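(* Let $\mathcal V$ be a closed, complete and cocomplete Cartesian monoidal category. For any based operad $\mathscr C$ in $\mathcal V$ and any $n\ge0$, there are isomorphisms of $\Lambda$-objects (contravariant functors on $\Lambda$) $$\overline{\mathscr C}(-,\mathbf n)\cong\mathscr C^{\boxtimes n},\qquad \widehat{\mathscr C}(-,\mathbf n)\cong\overline{\mathscr C}(-,\mathbf n)\boxtimes\mathscr{C}omm\cong\mathscr C^{\boxtimes n}\boxtimes\mathscr{C}omm.$$
   Context: Write $\mathcal I=*$ for the unit of $\mathcal V$. $\mathbf n=\{0,1,\dots,n\}$ is based at $0$; $\mathscr F$ is the category with objects $\mathbf n$ ($n\ge0$) and all based maps; $\mathscr F_{>0}\subset\mathscr F$ has the same objects and only the maps $\phi$ with $\phi^{-1}(0)=\{0\}$; $\Lambda\subset\mathscr F_{>0}$ has the based injections as morphisms. The Day convolution of functors $\mathscr D,\mathscr E:\Lambda^{op}\to\mathcal V$ is $(\mathscr D\boxtimes\mathscr E)(\mathbf n)=\int^{\mathbf j_1,\mathbf j_2\in\Lambda}\Lambda(\mathbf n,\mathbf{j_1+j_2})\otimes(\mathscr D(\mathbf j_1)\otimes\mathscr E(\mathbf j_2))$, where $S\otimes X=\coprod_SX$ for a set $S$; its underlying symmetric sequence is the usual Day convolution of symmetric sequences. A based operad is an operad $\mathscr C$ with a map $\eta:\mathcal I\to\mathscr C(0)$; it is a functor $\Lambda^{op}\to\mathcal V$ by inserting $\eta$. $\mathscr{C}omm$ is the commutativity operad, $\mathscr{C}omm(n)=\mathcal I$. The permutative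 envelope $\overline{\mathscr C}$ and the category of operators $\widehat{\mathscr C}$ are the $\mathcal V$-enriched categories with objects $\mathbf n$ and $$\overline{\mathscr C}(\mathbf m,\mathbf n)=\coprod_{\phi\in\mathscr F_{>0}(\mathbf m,\mathbf n)}\mathscr C(\phi^{-1}(1))\otimes\cdots\otimes\mathscr C(\phi^{-1}(n)),\qquad \widehat{\mathscr C}(\mathbf m,\mathbf n)=\coprod_{\phi\in\mathscr F(\mathbf m,\mathbf n)}\mathscr C(\phi^{-1}(1))\otimes\cdots\otimes\mathscr C(\phi^{-1}(n)),$$ where $\mathscr C(A)\cong\mathscr C(|A|)$ is the extension of $\mathscr C$ to finite sets and bijections. Identities are given by the operad unit $\mathcal I\to\mathscr C(1)$. Composition covers composition in $\mathscr F$ and is induced by the operad structure maps $\gamma$, together with, for $\widehat{\mathscr C}$, the projections $\mathscr C(\phi^{-1}(j))\to*$ for those $j$ sent to the base point by the second map. Via the canonical map of operads $\mathscr I_1\to\mathscr C$ (where $\mathscr I_1(0)=\mathscr I_1(1)=\mathcal I$, $\mathscr I_1(n)=\emptyset$ for $n\ge2$) and $\Lambda=\overline{\mathscr I_1}$, there is a functor $\Lambda\to\overline{\mathscr C}\subset\widehat{\mathscr C}$, by which $\overline{\mathscr C}(-,\mathbf n)$ and $\widehat{\mathscr C}(-,\mathbf n)$ are $\Lambda$-objects. (The paper defines $\overline{\mathscr C}(\mathbf m,\mathbf n)$ as $\mathscr C^{\boxtimes n}(\mathbf m)$, with the explicit form $\coprod_{\phi\in\mathscr F_{>0}(\mathbf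 m,\mathbf n)}\mathscr C(\phi^{-1}(1))\otimes\cdots\otimes\mathscr C(\phi^{-1}(n))$.) *)

theory Defs
  imports "HOL-Combinatorics.Permutations" "HOL-Library.FuncSet"
begin

section \<open>Categories, functors, limits\<close>

record ('o, 'a) cat =
  Obj :: "'o set"
  Arr :: "'a set"
  Dom :: "'a \<Rightarrow> 'o"
  Cod :: "'a \<Rightarrow> 'o"
  Id :: "'o \<Rightarrow> 'a"
  Comp :: "'a \<Rightarrow> 'a \<Rightarrow> 'a"  (infixr "\<cdot>\<index>" 70)

definition hom :: "('o, 'a, 'z) cat_scheme \<Rightarrow> 'o \<Rightarrow> 'o \<Rightarrow> 'a set" where
  "hom C a b = {f \<in> Arr C. Dom C f = a \<and> Cod C f = b}"

definition is_category :: "('o, 'a, 'z) cat_scheme \<Rightarrow> bool" where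
  "is_category C \<longleftrightarrow>
     (\<forall>f\<in>Arr C. Dom C f \<in> Obj C \<and> Cod C f \<in> Obj C) \<and>
     (\<forall>a\<in>Obj C. Id C a \<in> hom C a a) \<and>
     (\<forall>f\<in>Arr C. \<forall>g\<in>Arr C. Cod C f = Dom C g \<longrightarrow>
        g \<cdot>\<^bsub>C\<^esub> f \<in> hom C (Dom C f) (Cod C g)) \<and>
     (\<forall>f\<in>Arr C. f \<cdot>\<^bsub>C\<^esub> Id C (Dom C f) = f \<and> Id C (Cod C f) \<cdot>\<^bsub>C\<^esub> f = f) \<and>
     (\<forall>f\<in>Arr C. \<forall>g\<in>Arr C. \<forall>h\<in>Arr C. Cod C f = Dom C g \<longrightarrow> Cod C g = Dom C h \<longrightarrow>
        h \<cdot>\<^bsub>C\<^esub> (g \<cdot>\<^bsub>C\<^esub> f) = (h \<cdot>\<^bsub>C\<^esub> g) \<cdot>\<^bsub>C\<^esub> f)"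

definition op_cat :: "('o, 'a, 'z) cat_scheme \<Rightarrow> ('o, 'a) cat" where
  "op_cat C = \<lparr>Obj = Obj C, Arr = Arr C, Dom = Cod C, Cod = Dom C, Id = Id C,
     Comp = (\<lambda>g f. f \<cdot>\<^bsub>C\<^esub> g)\<rparr>"

definition prod_cat ::
  "('o, 'a, 'z) cat_scheme \<Rightarrow> ('p, 'b, 'y) cat_scheme \<Rightarrow> ('o \<times> 'p, 'a \<times> 'b) cat" where
  "prod_cat C D = \<lparr>Obj = Obj C \<times> Obj D, Arr = Arr C \<times> Arr D,
     Dom = map_prod (Dom C) (Dom D), Cod = map_prod (Cod C) (Cod D),
     Id = map_prod (Id C) (Id D),
     Comp = (\<lambda>g f. (fst g \<cdot>\<^bsub>C\<^esub> fst f, snd g \<cdot>\<^bsub>D\<^esub> snd f))\<rparr>"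

record ('o, 'a, 'p, 'b) functr =
  FO :: "'o \<Rightarrow> 'p"
  FA :: "'a \<Rightarrow> 'b"

definition is_functor ::
  "('o, 'a, 'z) cat_scheme \<Rightarrow> ('p, 'b, 'y) cat_scheme \<Rightarrow> ('o, 'a, 'p, 'b) functr \<Rightarrow> bool" where
  "is_functor A B F \<longleftrightarrow>
     (\<forall>a\<in>Obj A. FO F a \<in> Obj B) \<and>
     (\<forall>f\<in>Arr A. FA F f \<in> hom B (FO F (Dom A f)) (FO F (Cod A f))) \<and>
     (\<forall>a\<in>Obj A. FA F (Id A a) = Id B (FO F a)) \<and>
     (\<forall>f\<in>Arr A. \<forall>g\<in>Arr A. Cod A f = Dom A g \<longrightarrow> FA F (g \<cdot>\<^bsub>A\<^esub> f) = FA F g \<cdot>\<^bsub>B\<^esub> FA F f)"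

definition is_iso :: "('o, 'a, 'z) cat_scheme \<Rightarrow> 'a \<Rightarrow> bool" where
  "is_iso C f \<longleftrightarrow> f \<in> Arr C \<and> (\<exists>g \<in> hom C (Cod C f) (Dom C f).
     g \<cdot>\<^bsub>C\<^esub> f = Id C (Dom C f) \<and> f \<cdot>\<^bsub>C\<^esub> g = Id C (Cod C f))"

definition naturally_isomorphic ::
  "('o, 'a, 'z) cat_scheme \<Rightarrow> ('p, 'b, 'y) cat_scheme \<Rightarrow>
   ('o, 'a, 'p, 'b) functr \<Rightarrow> ('o, 'a, 'p, 'b) functr \<Rightarrow> bool" where
  "naturally_isomorphic A B F G \<longleftrightarrow> is_functor A B F \<and> is_functor A B G \<and>
     (\<exists>\<alpha>. (\<forall>a\<in>Obj A. \<alpha> a \<in> hom B (FO F a) (FO G a) \<and> is_iso B (\<alpha> a)) \<and>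
          (\<forall>f\<in>Arr A. FA G f \<cdot>\<^bsub>B\<^esub> \<alpha> (Dom A f) = \<alpha> (Cod A f) \<cdot>\<^bsub>B\<^esub> FA F f))"

definition is_cone ::
  "('i, 'j, 'y) cat_scheme \<Rightarrow> ('o, 'a, 'z) cat_scheme \<Rightarrow> ('i, 'j, 'o, 'a) functr \<Rightarrow>
   'o \<Rightarrow> ('i \<Rightarrow> 'a) \<Rightarrow> bool" where
  "is_cone J C D c w \<longleftrightarrow> c \<in> Obj C \<and> (\<forall>i\<in>Obj J. w i \<in> hom C c (FO D i)) \<and>
     (\<forall>u\<in>Arr J. FA D u \<cdot>\<^bsub>C\<^esub> w (Dom J u) = w (Cod J u))"

definition is_limit ::
  "('i, 'j, 'y) cat_scheme \<Rightarrow> ('o, 'a, 'z) cat_scheme \<Rightarrow> ('i, 'j, 'o, 'a) functr \<Rightarrow>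
   'o \<Rightarrow> ('i \<Rightarrow> 'a) \<Rightarrow> bool" where
  "is_limit J C D c w \<longleftrightarrow> is_cone J C D c w \<and>
     (\<forall>d v. is_cone J C D d v \<longrightarrow> (\<exists>!h. h \<in> hom C d c \<and> (\<forall>i\<in>Obj J. w i \<cdot>\<^bsub>C\<^esub> h = v i)))"

definition is_cocone ::
  "('i, 'j, 'y) cat_scheme \<Rightarrow> ('o, 'a, 'z) cat_scheme \<Rightarrow> ('i, 'j, 'o, 'a) functr \<Rightarrow>
   'o \<Rightarrow> ('i \<Rightarrow> 'a) \<Rightarrow> bool" where
  "is_cocone J C D c w \<longleftrightarrow> c \<in> Obj C \<and> (\<forall>i\<in>Obj J. w i \<in> hom C (FO D i) c) \<and>
     (\<forall>u\<in>Arr J. w (Cod J u) \<cdot>\<^bsub>C\<^esub> FA D u = w (Dom J u))"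

definition is_colimit ::
  "('i, 'j, 'y) cat_scheme \<Rightarrow> ('o, 'a, 'z) cat_scheme \<Rightarrow> ('i, 'j, 'o, 'a) functr \<Rightarrow>
   'o \<Rightarrow> ('i \<Rightarrow> 'a) \<Rightarrow> bool" where
  "is_colimit J C D c w \<longleftrightarrow> is_cocone J C D c w \<and>
     (\<forall>d v. is_cocone J C D d v \<longrightarrow> (\<exists>!h. h \<in> hom C c d \<and> (\<forall>i\<in>Obj J. h \<cdot>\<^bsub>C\<^esub> w i = v i)))"

text \<open>A type \<open>'s\<close> delimits smallness: a small category is one whose objects and arrows are
  elements of \<open>'s\<close>. It is a parameter because diagrams as large as the arrow type of
  \<open>C\<close> must not be allowed: only preorders have limits of that size.\<close>

definition complete_cat :: "'s itself \<Rightarrow> ('o, 'a, 'z) cat_scheme \<Rightarrow> bool" where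
  "complete_cat S C \<longleftrightarrow> (\<forall>(J :: ('s, 's) cat) D. is_category J \<and> is_functor J C D \<longrightarrow>
     (\<exists>c w. is_limit J C D c w))"

definition cocomplete_cat :: "'s itself \<Rightarrow> ('o, 'a, 'z) cat_scheme \<Rightarrow> bool" where
  "cocomplete_cat S C \<longleftrightarrow> (\<forall>(J :: ('s, 's) cat) D. is_category J \<and> is_functor J C D \<longrightarrow>
     (\<exists>c w. is_colimit J C D c w))"

definition is_coproduct ::
  "('o, 'a, 'z) cat_scheme \<Rightarrow> 'i set \<Rightarrow> ('i \<Rightarrow> 'o) \<Rightarrow> 'o \<Rightarrow> ('i \<Rightarrow> 'a) \<Rightarrow> bool" where
  "is_coproduct C I X c w \<longleftrightarrow> c \<in> Obj C \<and> (\<forall>i\<in>I. w i \<in> hom C (X i) c) \<and>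
     (\<forall>d\<in>Obj C. \<forall>v. (\<forall>i\<in>I. v i \<in> hom C (X i) d) \<longrightarrow>
        (\<exists>!h. h \<in> hom C c d \<and> (\<forall>i\<in>I. h \<cdot>\<^bsub>C\<^esub> w i = v i)))"

definition coprod_cocone ::
  "('o, 'a, 'z) cat_scheme \<Rightarrow> 'i set \<Rightarrow> ('i \<Rightarrow> 'o) \<Rightarrow> 'o \<times> ('i \<Rightarrow> 'a)" where
  "coprod_cocone C I X = (SOME p. is_coproduct C I X (fst p) (snd p))"

definition coprod :: "('o, 'a, 'z) cat_scheme \<Rightarrow> 'i set \<Rightarrow> ('i \<Rightarrow> 'o) \<Rightarrow> 'o" where
  "coprod C I X = fst (coprod_cocone C I X)"

definition inj_coprod :: "('o, 'a, 'z) cat_scheme \<Rightarrow> 'i set \<Rightarrow> ('i \<Rightarrow> 'o) \<Rightarrow> 'i \<Rightarrow> 'a" where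
  "inj_coprod C I X = snd (coprod_cocone C I X)"

text \<open>The copower \<open>S \<otimes> X\<close> and its action on a function \<open>u : S \<rightarrow> S'\<close> and an
  arrow \<open>x : X \<rightarrow> X'\<close>.\<close>

definition copower :: "('o, 'a, 'z) cat_scheme \<Rightarrow> 'i set \<Rightarrow> 'o \<Rightarrow> 'o" where
  "copower C S X = coprod C S (\<lambda>_. X)"

definition inj_copower :: "('o, 'a, 'z) cat_scheme \<Rightarrow> 'i set \<Rightarrow> 'o \<Rightarrow> 'i \<Rightarrow> 'a" where
  "inj_copower C S X = inj_coprod C S (\<lambda>_. X)"

definition copower_map ::
  "('o, 'a, 'z) cat_scheme \<Rightarrow> 'i set \<Rightarrow> 'i set \<Rightarrow> ('i \<Rightarrow> 'i) \<Rightarrow> 'a \<Rightarrow> 'a" where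
  "copower_map C S S' u x = (THE h.
     h \<in> hom C (copower C S (Dom C x)) (copower C S' (Cod C x)) \<and>
     (\<forall>s\<in>S. h \<cdot>\<^bsub>C\<^esub> inj_copower C S (Dom C x) s = inj_copower C S' (Cod C x) (u s) \<cdot>\<^bsub>C\<^esub> x))"

text \<open>Coends of functors \<open>P : J\<^sup>o\<^sup>p \<times> J \<rightarrow> C\<close>.\<close>

definition is_cowedge ::
  "('i, 'j, 'y) cat_scheme \<Rightarrow> ('o, 'a, 'z) cat_scheme \<Rightarrow> ('i \<times> 'i, 'j \<times> 'j, 'o, 'a) functr \<Rightarrow>
   'o \<Rightarrow> ('i \<Rightarrow> 'a) \<Rightarrow> bool" where
  "is_cowedge J C P c w \<longleftrightarrow> c \<in> Obj C \<and> (\<forall>i\<in>Obj J. w i \<in> hom C (FO P (i, i)) c) \<and>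
     (\<forall>u\<in>Arr J. w (Dom J u) \<cdot>\<^bsub>C\<^esub> FA P (u, Id J (Dom J u)) =
                w (Cod J u) \<cdot>\<^bsub>C\<^esub> FA P (Id J (Cod J u), u))"

definition is_coend ::
  "('i, 'j, 'y) cat_scheme \<Rightarrow> ('o, 'a, 'z) cat_scheme \<Rightarrow> ('i \<times> 'i, 'j \<times> 'j, 'o, 'a) functr \<Rightarrow>
   'o \<Rightarrow> ('i \<Rightarrow> 'a) \<Rightarrow> bool" where
  "is_coend J C P c w \<longleftrightarrow> is_cowedge J C P c w \<and>
     (\<forall>d v. is_cowedge J C P d v \<longrightarrow> (\<exists>!h. h \<in> hom C c d \<and> (\<forall>i\<in>Obj J. h \<cdot>\<^bsub>C\<^esub> w i = v i)))"

definition coend_cowedge ::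
  "('i, 'j, 'y) cat_scheme \<Rightarrow> ('o, 'a, 'z) cat_scheme \<Rightarrow> ('i \<times> 'i, 'j \<times> 'j, 'o, 'a) functr \<Rightarrow>
   'o \<times> ('i \<Rightarrow> 'a)" where
  "coend_cowedge J C P = (SOME p. is_coend J C P (fst p) (snd p))"

section \<open>Cartesian closed categories\<close>

record ('o, 'a) cmcat = "('o, 'a) cat" +
  One :: "'o"
  Prod :: "'o \<Rightarrow> 'o \<Rightarrow> 'o"  (infixr "\<otimes>\<index>" 75)
  Fst :: "'o \<Rightarrow> 'o \<Rightarrow> 'a"
  Snd :: "'o \<Rightarrow> 'o \<Rightarrow> 'a"

definition is_cartesian :: "('o, 'a, 'z) cmcat_scheme \<Rightarrow> bool" where
  "is_cartesian V \<longleftrightarrow> is_category V \<and>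
     One V \<in> Obj V \<and> (\<forall>a\<in>Obj V. \<exists>!f. f \<in> hom V a (One V)) \<and>
     (\<forall>a\<in>Obj V. \<forall>b\<in>Obj V. a \<otimes>\<^bsub>V\<^esub> b \<in> Obj V \<and>
        Fst V a b \<in> hom V (a \<otimes>\<^bsub>V\<^esub> b) a \<and> Snd V a b \<in> hom V (a \<otimes>\<^bsub>V\<^esub> b) b \<and>
        (\<forall>t\<in>Obj V. \<forall>f\<in>hom V t a. \<forall>g\<in>hom V t b.
           \<exists>!h. h \<in> hom V t (a \<otimes>\<^bsub>V\<^esub> b) \<and> Fst V a b \<cdot>\<^bsub>V\<^esub> h = f \<and> Snd V a b \<cdot>\<^bsub>V\<^esub> h = g))"

definition bang :: "('o, 'a, 'z) cmcat_scheme \<Rightarrow> 'o \<Rightarrow> 'a" where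
  "bang V a = (THE f. f \<in> hom V a (One V))"

definition pair :: "('o, 'a, 'z) cmcat_scheme \<Rightarrow> 'a \<Rightarrow> 'a \<Rightarrow> 'a" where
  "pair V f g = (THE h. h \<in> hom V (Dom V f) (Cod V f \<otimes>\<^bsub>V\<^esub> Cod V g) \<and>
     Fst V (Cod V f) (Cod V g) \<cdot>\<^bsub>V\<^esub> h = f \<and> Snd V (Cod V f) (Cod V g) \<cdot>\<^bsub>V\<^esub> h = g)"

definition prod_map :: "('o, 'a, 'z) cmcat_scheme \<Rightarrow> 'a \<Rightarrow> 'a \<Rightarrow> 'a" where
  "prod_map V f g = pair V (f \<cdot>\<^bsub>V\<^esub> Fst V (Dom V f) (Dom V g)) (g \<cdot>\<^bsub>V\<^esub> Snd V (Dom V f) (Dom V g))"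

definition is_cartesian_closed :: "('o, 'a, 'z) cmcat_scheme \<Rightarrow> bool" where
  "is_cartesian_closed V \<longleftrightarrow> is_cartesian V \<and>
     (\<forall>b\<in>Obj V. \<forall>c\<in>Obj V. \<exists>e\<in>Obj V. \<exists>ev \<in> hom V (e \<otimes>\<^bsub>V\<^esub> b) c.
        \<forall>a\<in>Obj V. \<forall>f \<in> hom V (a \<otimes>\<^bsub>V\<^esub> b) c.
          \<exists>!g. g \<in> hom V a e \<and> ev \<cdot>\<^bsub>V\<^esub> prod_map V g (Id V b) = f)"

text \<open>Iterated products, bracketed to the right and ending in the unit:
  \<open>lprod V [a, b] = a \<otimes> (b \<otimes> *)\<close>.\<close>

primrec lprod :: "('o, 'a, 'z) cmcat_scheme \<Rightarrow> 'o list \<Rightarrow> 'o" where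
  "lprod V [] = One V"
| "lprod V (x # xs) = x \<otimes>\<^bsub>V\<^esub> lprod V xs"

primrec proj :: "('o, 'a, 'z) cmcat_scheme \<Rightarrow> 'o list \<Rightarrow> nat \<Rightarrow> 'a" where
  "proj V [] i = undefined"
| "proj V (x # xs) i = (case i of 0 \<Rightarrow> Fst V x (lprod V xs)
     | Suc k \<Rightarrow> proj V xs k \<cdot>\<^bsub>V\<^esub> Snd V x (lprod V xs))"

primrec tuple :: "('o, 'a, 'z) cmcat_scheme \<Rightarrow> 'o \<Rightarrow> 'a list \<Rightarrow> 'a" where
  "tuple V t [] = bang V t"
| "tuple V t (f # fs) = pair V f (tuple V t fs)"

section \<open>Operads\<close>

text \<open>\<open>OpGam C [j\<^sub>1, \<dots>, j\<^sub>k] : C(k) \<otimes> (C(j\<^sub>1) \<otimes> \<dots> \<otimes> C(j\<^sub>k)) \<rightarrow> C(j\<^sub>1 + \<dots> + j\<^sub>k)\<close>;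
  \<open>OpAct C n \<sigma> : C(n) \<rightarrow> C(n)\<close> is the right action of \<open>\<sigma>\<close>, a permutation of
  \<open>{0, \<dots>, n - 1}\<close>.\<close>

record ('o, 'a) operad =
  OpOb :: "nat \<Rightarrow> 'o"
  OpAct :: "nat \<Rightarrow> (nat \<Rightarrow> nat) \<Rightarrow> 'a"
  OpGam :: "nat list \<Rightarrow> 'a"
  OpUnit :: "'a"

record ('o, 'a) based_operad = "('o, 'a) operad" +
  OpEta :: "'a"

definition offset :: "nat list \<Rightarrow> nat \<Rightarrow> nat" where
  "offset js i = sum_list (take i js)"

definition block_of :: "nat list \<Rightarrow> nat \<Rightarrow> nat" where
  "block_of js p = (LEAST i. p < offset js (Suc i))"

definition permute_list_by :: "(nat \<Rightarrow> nat) \<Rightarrow> 'x list \<Rightarrow> 'x list" where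
  "permute_list_by \<sigma> xs = map (\<lambda>i. xs ! inv \<sigma> i) [0..<length xs]"

text \<open>\<open>block_perm \<sigma> js\<close> is \<open>\<sigma>(j\<^sub>1, \<dots>, j\<^sub>k)\<close>, which moves the \<open>i\<close>-th block to the \<open>\<sigma> i\<close>-th
  place; \<open>perm_sum js \<tau>s\<close> is \<open>\<tau>\<^sub>1 \<oplus> \<dots> \<oplus> \<tau>\<^sub>k\<close>.\<close>

definition block_perm :: "(nat \<Rightarrow> nat) \<Rightarrow> nat list \<Rightarrow> nat \<Rightarrow> nat" where
  "block_perm \<sigma> js p = (if p < sum_list js
     then let i = block_of js p in offset (permute_list_by \<sigma> js) (\<sigma> i) + (p - offset js i)
     else p)"

definition perm_sum :: "nat list \<Rightarrow> (nat \<Rightarrow> nat \<Rightarrow> nat) \<Rightarrow> nat \<Rightarrow> nat" where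
  "perm_sum js \<tau> p = (if p < sum_list js
     then let i = block_of js p in offset js i + \<tau> i (p - offset js i)
     else p)"

definition operad_typed :: "('o, 'a, 'z) cmcat_scheme \<Rightarrow> ('o, 'a, 'y) operad_scheme \<Rightarrow> bool" where
  "operad_typed V C \<longleftrightarrow> (\<forall>n. OpOb C n \<in> Obj V) \<and>
     (\<forall>n \<sigma>. \<sigma> permutes {..<n} \<longrightarrow> OpAct C n \<sigma> \<in> hom V (OpOb C n) (OpOb C n)) \<and>
     (\<forall>js. OpGam C js \<in> hom V (OpOb C (length js) \<otimes>\<^bsub>V\<^esub> lprod V (map (OpOb C) js))
                            (OpOb C (sum_list js))) \<and>
     OpUnit C \<in> hom V (One V) (OpOb C 1)"

definition operad_action :: "('o, 'a, 'z) cmcat_scheme \<Rightarrow> ('o, 'a, 'y) operad_scheme \<Rightarrow> bool" where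
  "operad_action V C \<longleftrightarrow> (\<forall>n. OpAct C n id = Id V (OpOb C n)) \<and>
     (\<forall>n \<sigma> \<tau>. \<sigma> permutes {..<n} \<longrightarrow> \<tau> permutes {..<n} \<longrightarrow>
        OpAct C n (\<sigma> \<circ> \<tau>) = OpAct C n \<tau> \<cdot>\<^bsub>V\<^esub> OpAct C n \<sigma>)"

text \<open>Associativity, for \<open>c \<in> C(k)\<close>, \<open>d\<^sub>s \<in> C(j\<^sub>s)\<close> and \<open>e\<^sub>t \<in> C(i\<^sub>t)\<close>, where \<open>iss\<close> lists the
  numbers \<open>i\<^sub>t\<close> in \<open>k\<close> blocks of lengths \<open>j\<^sub>1, \<dots>, j\<^sub>k\<close>. Below, \<open>c\<close>, \<open>d s\<close> and \<open>e t\<close> are the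
  projections from the product of all these objects, with which the shuffle is written.\<close>

definition operad_assoc :: "('o, 'a, 'z) cmcat_scheme \<Rightarrow> ('o, 'a, 'y) operad_scheme \<Rightarrow> bool" where
  "operad_assoc V C \<longleftrightarrow> (\<forall>iss. let
       k = length iss; js = map length iss; is = concat iss;
       K = OpOb C k; Js = map (OpOb C) js; Is = map (OpOb C) is;
       X = (K \<otimes>\<^bsub>V\<^esub> lprod V Js) \<otimes>\<^bsub>V\<^esub> lprod V Is;
       c = Fst V K (lprod V Js) \<cdot>\<^bsub>V\<^esub> Fst V (K \<otimes>\<^bsub>V\<^esub> lprod V Js) (lprod V Is);
       d = (\<lambda>s. proj V Js s \<cdot>\<^bsub>V\<^esub> Snd V K (lprod V Js) \<cdot>\<^bsub>V\<^esub> Fst V (K \<otimes>\<^bsub>V\<^esub> lprod V Js) (lprod V Is));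
       e = (\<lambda>t. proj V Is t \<cdot>\<^bsub>V\<^esub> Snd V (K \<otimes>\<^bsub>V\<^esub> lprod V Js) (lprod V Is))
     in OpGam C is \<cdot>\<^bsub>V\<^esub> prod_map V (OpGam C js) (Id V (lprod V Is)) =
        OpGam C (map sum_list iss) \<cdot>\<^bsub>V\<^esub> pair V c (tuple V X
          (map (\<lambda>s. OpGam C (iss ! s) \<cdot>\<^bsub>V\<^esub>
                 pair V (d s) (tuple V X (map (\<lambda>t. e (offset js s + t)) [0..<js ! s])))
            [0..<k])))"

definition operad_unital :: "('o, 'a, 'z) cmcat_scheme \<Rightarrow> ('o, 'a, 'y) operad_scheme \<Rightarrow> bool" where
  "operad_unital V C \<longleftrightarrow>
     (\<forall>j. let X = OpOb C j in
        OpGam C [j] \<cdot>\<^bsub>V\<^esub> pair V (OpUnit C \<cdot>\<^bsub>V\<^esub> bang V X) (tuple V X [Id V X]) = Id V X) \<and>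
     (\<forall>k. let X = OpOb C k in
        OpGam C (replicate k 1) \<cdot>\<^bsub>V\<^esub>
          pair V (Id V X) (tuple V X (replicate k (OpUnit C \<cdot>\<^bsub>V\<^esub> bang V X))) = Id V X)"

text \<open>\<open>\<gamma>(c\<sigma>; d\<^sub>1, \<dots>, d\<^sub>k) = \<gamma>(c; d\<^bsub>\<sigma>\<^sup>-\<^sup>1(1)\<^esub>, \<dots>, d\<^bsub>\<sigma>\<^sup>-\<^sup>1(k)\<^esub>) \<sigma>(j\<^sub>1, \<dots>, j\<^sub>k)\<close> and
  \<open>\<gamma>(c; d\<^sub>1\<tau>\<^sub>1, \<dots>, d\<^sub>k\<tau>\<^sub>k) = \<gamma>(c; d\<^sub>1, \<dots>, d\<^sub>k) (\<tau>\<^sub>1 \<oplus> \<dots> \<oplus> \<tau>\<^sub>k)\<close>.\<close>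

definition operad_equivariant :: "('o, 'a, 'z) cmcat_scheme \<Rightarrow> ('o, 'a, 'y) operad_scheme \<Rightarrow> bool" where
  "operad_equivariant V C \<longleftrightarrow>
     (\<forall>js \<sigma>. \<sigma> permutes {..<length js} \<longrightarrow> (let
          k = length js; K = OpOb C k; Js = map (OpOb C) js; X = K \<otimes>\<^bsub>V\<^esub> lprod V Js;
          d = (\<lambda>s. proj V Js s \<cdot>\<^bsub>V\<^esub> Snd V K (lprod V Js))
        in OpGam C js \<cdot>\<^bsub>V\<^esub> prod_map V (OpAct C k \<sigma>) (Id V (lprod V Js)) =
           OpAct C (sum_list js) (block_perm \<sigma> js) \<cdot>\<^bsub>V\<^esub> OpGam C (permute_list_by \<sigma> js) \<cdot>\<^bsub>V\<^esub>
             pair V (Fst V K (lprod V Js)) (tuple V X (permute_list_by \<sigma> (map d [0..<k]))))) \<and>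
     (\<forall>js \<tau>. (\<forall>i<length js. \<tau> i permutes {..<js ! i}) \<longrightarrow> (let
          k = length js; K = OpOb C k; Js = map (OpOb C) js; X = K \<otimes>\<^bsub>V\<^esub> lprod V Js;
          d = (\<lambda>s. proj V Js s \<cdot>\<^bsub>V\<^esub> Snd V K (lprod V Js))
        in OpGam C js \<cdot>\<^bsub>V\<^esub> pair V (Fst V K (lprod V Js))
             (tuple V X (map (\<lambda>s. OpAct C (js ! s) (\<tau> s) \<cdot>\<^bsub>V\<^esub> d s) [0..<k])) =
           OpAct C (sum_list js) (perm_sum js \<tau>) \<cdot>\<^bsub>V\<^esub> OpGam C js))"

definition is_operad :: "('o, 'a, 'z) cmcat_scheme \<Rightarrow> ('o, 'a, 'y) operad_scheme \<Rightarrow> bool" where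
  "is_operad V C \<longleftrightarrow> operad_typed V C \<and> operad_action V C \<and> operad_assoc V C \<and>
     operad_unital V C \<and> operad_equivariant V C"

definition is_based_operad ::
  "('o, 'a, 'z) cmcat_scheme \<Rightarrow> ('o, 'a, 'y) based_operad_scheme \<Rightarrow> bool" where
  "is_based_operad V C \<longleftrightarrow> is_operad V C \<and> OpEta C \<in> hom V (One V) (OpOb C 0)"

definition Comm :: "('o, 'a, 'z) cmcat_scheme \<Rightarrow> ('o, 'a) based_operad" where
  "Comm V = \<lparr>OpOb = (\<lambda>n. One V), OpAct = (\<lambda>n \<sigma>. Id V (One V)),
     OpGam = (\<lambda>js. bang V (One V \<otimes>\<^bsub>V\<^esub> lprod V (map (\<lambda>_. One V) js))),
     OpUnit = Id V (One V), OpEta = Id V (One V)\<rparr>"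

text \<open>The extension of \<open>C\<close> to finite sets, for finite sets of natural numbers: \<open>C(A)\<close> is
  identified with \<open>C(|A|)\<close> by the increasing enumeration of \<open>A\<close>. The structure map of \<open>f : A \<rightarrow> B\<close>,
  from \<open>C(B) \<otimes> (\<Otimes>b\<in>B. C(f\<^sup>-\<^sup>1(b)))\<close> to \<open>C(A)\<close>, is \<open>\<gamma>\<close> followed by the permutation that passes
  from the order on \<open>A\<close> by blocks \<open>f\<^sup>-\<^sup>1(b)\<close> to the given order.\<close>

definition set_fib :: "nat set \<Rightarrow> (nat \<Rightarrow> nat) \<Rightarrow> nat \<Rightarrow> nat set" where
  "set_fib A f b = {a \<in> A. f a = b}"

definition block_rank :: "nat set \<Rightarrow> (nat \<Rightarrow> nat) \<Rightarrow> nat \<Rightarrow> nat" where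
  "block_rank A f a = card {x \<in> A. f x < f a \<or> f x = f a \<and> x < a}"

definition sort_perm :: "nat set \<Rightarrow> (nat \<Rightarrow> nat) \<Rightarrow> nat \<Rightarrow> nat" where
  "sort_perm A f r = (if r < card A then block_rank A f (sorted_list_of_set A ! r) else r)"

definition set_gam :: "('o, 'a, 'z) cmcat_scheme \<Rightarrow> ('o, 'a, 'y) operad_scheme \<Rightarrow>
    nat set \<Rightarrow> nat set \<Rightarrow> (nat \<Rightarrow> nat) \<Rightarrow> 'a" where
  "set_gam V C A B f = OpAct C (card A) (sort_perm A f) \<cdot>\<^bsub>V\<^esub>
     OpGam C (map (\<lambda>b. card (set_fib A f b)) (sorted_list_of_set B))"

section \<open>The categories \<open>\<F>\<close>, \<open>\<F>\<^sub>>\<^sub>0\<close> and \<open>\<Lambda>\<close>\<close>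

text \<open>A based map \<open>\<phi> : {0..m} \<rightarrow> {0..n}\<close> is \<open>(m, n, \<phi>)\<close> with \<open>\<phi>\<close> undefined outside \<open>{0..m}\<close>.\<close>

type_synonym bmap = "nat \<times> nat \<times> (nat \<Rightarrow> nat)"

definition src :: "bmap \<Rightarrow> nat" where "src \<phi> = fst \<phi>"
definition tgt :: "bmap \<Rightarrow> nat" where "tgt \<phi> = fst (snd \<phi>)"
definition fn :: "bmap \<Rightarrow> nat \<Rightarrow> nat" where "fn \<phi> = snd (snd \<phi>)"

definition F_arr :: "bmap set" where
  "F_arr = {\<phi>. fn \<phi> \<in> {0..src \<phi>} \<rightarrow>\<^sub>E {0..tgt \<phi>} \<and> fn \<phi> 0 = 0}"

definition F_cat :: "(nat, bmap) cat" where
  "F_cat = \<lparr>Obj = UNIV, Arr = F_arr, Dom = src, Cod = tgt,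
     Id = (\<lambda>n. (n, n, restrict id {0..n})),
     Comp = (\<lambda>\<psi> \<phi>. (src \<phi>, tgt \<psi>, restrict (fn \<psi> \<circ> fn \<phi>) {0..src \<phi>}))\<rparr>"

definition Fpos_cat :: "(nat, bmap) cat" where
  "Fpos_cat = F_cat\<lparr>Arr := {\<phi> \<in> F_arr. \<forall>i\<in>{0..src \<phi>}. fn \<phi> i = 0 \<longrightarrow> i = 0}\<rparr>"

definition Lambda_cat :: "(nat, bmap) cat" where
  "Lambda_cat = F_cat\<lparr>Arr := {\<phi> \<in> F_arr. inj_on (fn \<phi>) {0..src \<phi>}}\<rparr>"

definition fib :: "bmap \<Rightarrow> nat \<Rightarrow> nat set" where
  "fib \<phi> j = {i \<in> {0..src \<phi>}. fn \<phi> i = j}"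

text \<open>The wedge sum of based maps, for which \<open>\<j>\<^sub>1 + \<j>\<^sub>2\<close> has \<open>\<j>\<^sub>1\<close> first.\<close>

definition bmap_sum :: "bmap \<Rightarrow> bmap \<Rightarrow> bmap" where
  "bmap_sum \<phi> \<psi> = (src \<phi> + src \<psi>, tgt \<phi> + tgt \<psi>,
     restrict (\<lambda>i. if i \<le> src \<phi> then fn \<phi> i else tgt \<phi> + fn \<psi> (i - src \<phi>)) {0..src \<phi> + src \<psi>})"

section \<open>\<open>\<Lambda>\<close>-objects and Day convolution\<close>

type_synonym ('o, 'a) Lambda_obj = "(nat, bmap, 'o, 'a) functr"

definition day_integrand :: "('o, 'a, 'z) cmcat_scheme \<Rightarrow>
    ('o, 'a) Lambda_obj \<Rightarrow> ('o, 'a) Lambda_obj \<Rightarrow> nat \<Rightarrow>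
    ((nat \<times> nat) \<times> (nat \<times> nat), (bmap \<times> bmap) \<times> (bmap \<times> bmap), 'o, 'a) functr" where
  "day_integrand V D E n = \<lparr>
     FO = (\<lambda>((j1, j2), (k1, k2)).
       copower V (hom Lambda_cat n (k1 + k2)) (FO D j1 \<otimes>\<^bsub>V\<^esub> FO E j2)),
     FA = (\<lambda>((f1, f2), (g1, g2)).
       copower_map V (hom Lambda_cat n (src g1 + src g2)) (hom Lambda_cat n (tgt g1 + tgt g2))
         (\<lambda>k. bmap_sum g1 g2 \<cdot>\<^bsub>Lambda_cat\<^esub> k) (prod_map V (FA D f1) (FA E f2)))\<rparr>"

definition day_ob :: "('o, 'a, 'z) cmcat_scheme \<Rightarrow>
    ('o, 'a) Lambda_obj \<Rightarrow> ('o, 'a) Lambda_obj \<Rightarrow> nat \<Rightarrow> 'o" where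
  "day_ob V D E n =
     fst (coend_cowedge (prod_cat Lambda_cat Lambda_cat) V (day_integrand V D E n))"

definition day_in :: "('o, 'a, 'z) cmcat_scheme \<Rightarrow>
    ('o, 'a) Lambda_obj \<Rightarrow> ('o, 'a) Lambda_obj \<Rightarrow> nat \<Rightarrow> nat \<times> nat \<Rightarrow> 'a" where
  "day_in V D E n =
     snd (coend_cowedge (prod_cat Lambda_cat Lambda_cat) V (day_integrand V D E n))"

text \<open>An arrow \<open>\<lambda> : m \<rightarrow> n\<close> of \<open>\<Lambda>\<close> acts on the coend through \<open>\<Lambda>(\<lambda>, j\<^sub>1 + j\<^sub>2)\<close>.\<close>

definition day_arr :: "('o, 'a, 'z) cmcat_scheme \<Rightarrow>
    ('o, 'a) Lambda_obj \<Rightarrow> ('o, 'a) Lambda_obj \<Rightarrow> bmap \<Rightarrow> 'a" where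
  "day_arr V D E l = (THE h. h \<in> hom V (day_ob V D E (tgt l)) (day_ob V D E (src l)) \<and>
     (\<forall>j1 j2. h \<cdot>\<^bsub>V\<^esub> day_in V D E (tgt l) (j1, j2) =
        day_in V D E (src l) (j1, j2) \<cdot>\<^bsub>V\<^esub>
          copower_map V (hom Lambda_cat (tgt l) (j1 + j2)) (hom Lambda_cat (src l) (j1 + j2))
            (\<lambda>k. k \<cdot>\<^bsub>Lambda_cat\<^esub> l) (Id V (FO D j1 \<otimes>\<^bsub>V\<^esub> FO E j2))))"

definition day :: "('o, 'a, 'z) cmcat_scheme \<Rightarrow>
    ('o, 'a) Lambda_obj \<Rightarrow> ('o, 'a) Lambda_obj \<Rightarrow> ('o, 'a) Lambda_obj" where
  "day V D E = \<lparr>FO = day_ob V D E, FA = day_arr V D E\<rparr>"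

text \<open>The unit \<open>\<Lambda>(-, 0) \<otimes> *\<close> of the Day convolution.\<close>

definition day_unit :: "('o, 'a, 'z) cmcat_scheme \<Rightarrow> ('o, 'a) Lambda_obj" where
  "day_unit V = \<lparr>
     FO = (\<lambda>n. copower V (hom Lambda_cat n 0) (One V)),
     FA = (\<lambda>l. copower_map V (hom Lambda_cat (tgt l) 0) (hom Lambda_cat (src l) 0)
             (\<lambda>k. k \<cdot>\<^bsub>Lambda_cat\<^esub> l) (Id V (One V)))\<rparr>"

primrec day_power :: "('o, 'a, 'z) cmcat_scheme \<Rightarrow> ('o, 'a) Lambda_obj \<Rightarrow> nat \<Rightarrow> ('o, 'a) Lambda_obj"
  where
  "day_power V D 0 = day_unit V"
| "day_power V D (Suc n) = day V (day_power V D n) D"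

text \<open>For an injection \<open>l\<close>, the object \<open>C(l\<^sup>-\<^sup>1(j))\<close> is \<open>C(1)\<close> or \<open>C(0)\<close>; \<open>inj_point\<close> is its
  point given by the operad unit or by \<open>\<eta>\<close>, that is, by the map of operads \<open>I\<^sub>1 \<rightarrow> C\<close>.\<close>

definition inj_point :: "('o, 'a, 'y) based_operad_scheme \<Rightarrow> bmap \<Rightarrow> nat \<Rightarrow> 'a" where
  "inj_point C l j = (if fib l j = {} then OpEta C else OpUnit C)"

text \<open>The functor \<open>\<Lambda>\<^sup>o\<^sup>p \<rightarrow> V\<close> of a based operad sends \<open>l : m \<rightarrow> n\<close> to
  \<open>c \<mapsto> \<gamma>(c; \<epsilon>\<^sub>1, \<dots>, \<epsilon>\<^sub>n) \<sigma>\<close>, where \<open>\<epsilon>\<^sub>j\<close> is \<open>inj_point C l j\<close> and \<open>\<sigma>\<close> is the permutation of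
  \<open>{1..m}\<close> with the same relative order as \<open>l\<close>.\<close>

definition operad_Lambda ::
  "('o, 'a, 'z) cmcat_scheme \<Rightarrow> ('o, 'a, 'y) based_operad_scheme \<Rightarrow> ('o, 'a) Lambda_obj" where
  "operad_Lambda V C = \<lparr>
     FO = OpOb C,
     FA = (\<lambda>l. let X = OpOb C (tgt l) in
       set_gam V C {1..src l} {1..tgt l} (fn l) \<cdot>\<^bsub>V\<^esub>
         pair V (Id V X) (tuple V X (map (\<lambda>j. inj_point C l j \<cdot>\<^bsub>V\<^esub> bang V X) [1..<Suc (tgt l)])))\<rparr>"

section \<open>The permutative envelope and the category of operators\<close>

text \<open>The data of a \<open>V\<close>-enriched category with objects the natural numbers, with
  \<open>VComp E m n p : E(n, p) \<otimes> E(m, n) \<rightarrow> E(m, p)\<close> and \<open>VId E n : * \<rightarrow> E(n, n)\<close>.\<close>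

record ('o, 'a) vcat =
  VHom :: "nat \<Rightarrow> nat \<Rightarrow> 'o"
  VComp :: "nat \<Rightarrow> nat \<Rightarrow> nat \<Rightarrow> 'a"
  VId :: "nat \<Rightarrow> 'a"

definition fib_obs :: "('o, 'a, 'y) operad_scheme \<Rightarrow> bmap \<Rightarrow> 'o list" where
  "fib_obs C \<phi> = map (\<lambda>j. OpOb C (card (fib \<phi> j))) [1..<Suc (tgt \<phi>)]"

definition fib_prod :: "('o, 'a, 'z) cmcat_scheme \<Rightarrow> ('o, 'a, 'y) operad_scheme \<Rightarrow> bmap \<Rightarrow> 'o" where
  "fib_prod V C \<phi> = lprod V (fib_obs C \<phi>)"

text \<open>The component of composition at \<open>(\<psi>, \<phi>)\<close>: its \<open>k\<close>-th coordinate is the structure map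
  \<open>C(\<psi>\<^sup>-\<^sup>1(k)) \<otimes> (\<Otimes>j\<in>\<psi>\<^sup>-\<^sup>1(k). C(\<phi>\<^sup>-\<^sup>1(j))) \<rightarrow> C((\<psi>\<phi>)\<^sup>-\<^sup>1(k))\<close>. The factors \<open>C(\<phi>\<^sup>-\<^sup>1(j))\<close> with
  \<open>\<psi> j = 0\<close> occur in no coordinate, so they are projected to \<open>*\<close>.\<close>

definition fib_comp ::
  "('o, 'a, 'z) cmcat_scheme \<Rightarrow> ('o, 'a, 'y) operad_scheme \<Rightarrow> bmap \<Rightarrow> bmap \<Rightarrow> 'a" where
  "fib_comp V C \<psi> \<phi> = (let
       P = fib_prod V C \<psi>; Q = fib_prod V C \<phi>; X = P \<otimes>\<^bsub>V\<^esub> Q;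
       c = (\<lambda>k. proj V (fib_obs C \<psi>) (k - 1) \<cdot>\<^bsub>V\<^esub> Fst V P Q);
       d = (\<lambda>j. proj V (fib_obs C \<phi>) (j - 1) \<cdot>\<^bsub>V\<^esub> Snd V P Q)
     in tuple V X (map (\<lambda>k.
          set_gam V C (fib (\<psi> \<cdot>\<^bsub>F_cat\<^esub> \<phi>) k) (fib \<psi> k) (fn \<phi>) \<cdot>\<^bsub>V\<^esub>
            pair V (c k) (tuple V X (map d (sorted_list_of_set (fib \<psi> k)))))
        [1..<Suc (tgt \<psi>)]))"

text \<open>The \<open>V\<close>-category of operators over a subcategory \<open>F\<close> of \<open>\<F>\<close>. Composition is determined
  by its components since \<open>\<otimes>\<close> preserves coproducts, \<open>V\<close> being closed.\<close>

definition op_hom :: "('o, 'a, 'z) cmcat_scheme \<Rightarrow> (nat, bmap) cat \<Rightarrow> ('o, 'a, 'y) operad_scheme \<Rightarrow>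
    nat \<Rightarrow> nat \<Rightarrow> 'o" where
  "op_hom V F C m n = coprod V (hom F m n) (fib_prod V C)"

definition op_inj :: "('o, 'a, 'z) cmcat_scheme \<Rightarrow> (nat, bmap) cat \<Rightarrow> ('o, 'a, 'y) operad_scheme \<Rightarrow>
    bmap \<Rightarrow> 'a" where
  "op_inj V F C \<phi> = inj_coprod V (hom F (src \<phi>) (tgt \<phi>)) (fib_prod V C) \<phi>"

definition op_comp :: "('o, 'a, 'z) cmcat_scheme \<Rightarrow> (nat, bmap) cat \<Rightarrow> ('o, 'a, 'y) operad_scheme \<Rightarrow>
    nat \<Rightarrow> nat \<Rightarrow> nat \<Rightarrow> 'a" where
  "op_comp V F C m n p = (THE h.
     h \<in> hom V (op_hom V F C n p \<otimes>\<^bsub>V\<^esub> op_hom V F C m n) (op_hom V F C m p) \<and>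
     (\<forall>\<psi> \<in> hom F n p. \<forall>\<phi> \<in> hom F m n.
        h \<cdot>\<^bsub>V\<^esub> prod_map V (op_inj V F C \<psi>) (op_inj V F C \<phi>) =
        op_inj V F C (\<psi> \<cdot>\<^bsub>F\<^esub> \<phi>) \<cdot>\<^bsub>V\<^esub> fib_comp V C \<psi> \<phi>))"

text \<open>The point \<open>* \<rightarrow> E(src l, tgt l)\<close> that is the image of an arrow \<open>l\<close> of \<open>\<Lambda>\<close>; it is
  induced by the map of operads \<open>I\<^sub>1 \<rightarrow> C\<close>.\<close>

definition op_point :: "('o, 'a, 'z) cmcat_scheme \<Rightarrow> (nat, bmap) cat \<Rightarrow>
    ('o, 'a, 'y) based_operad_scheme \<Rightarrow> bmap \<Rightarrow> 'a" where
  "op_point V F C l =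
     op_inj V F C l \<cdot>\<^bsub>V\<^esub> tuple V (One V) (map (inj_point C l) [1..<Suc (tgt l)])"

definition op_vcat :: "('o, 'a, 'z) cmcat_scheme \<Rightarrow> (nat, bmap) cat \<Rightarrow>
    ('o, 'a, 'y) operad_scheme \<Rightarrow> ('o, 'a) vcat" where
  "op_vcat V F C = \<lparr>VHom = op_hom V F C, VComp = op_comp V F C,
     VId = (\<lambda>n. op_inj V F C (Id F n) \<cdot>\<^bsub>V\<^esub> tuple V (One V) (replicate n (OpUnit C)))\<rparr>"

definition perm_envelope ::
  "('o, 'a, 'z) cmcat_scheme \<Rightarrow> ('o, 'a, 'y) operad_scheme \<Rightarrow> ('o, 'a) vcat" where
  "perm_envelope V C = op_vcat V Fpos_cat C"

definition cat_of_operators ::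
  "('o, 'a, 'z) cmcat_scheme \<Rightarrow> ('o, 'a, 'y) operad_scheme \<Rightarrow> ('o, 'a) vcat" where
  "cat_of_operators V C = op_vcat V F_cat C"

text \<open>The \<open>\<Lambda>\<close>-object \<open>E(-, n)\<close> of a \<open>V\<close>-category \<open>E\<close> and a functor \<open>\<Lambda> \<rightarrow> E\<close>, given by
  \<open>pt l : * \<rightarrow> E(src l, tgt l)\<close>: precomposition with \<open>pt l\<close>.\<close>

definition Lambda_rep :: "('o, 'a, 'z) cmcat_scheme \<Rightarrow> ('o, 'a, 'y) vcat_scheme \<Rightarrow>
    (bmap \<Rightarrow> 'a) \<Rightarrow> nat \<Rightarrow> ('o, 'a) Lambda_obj" where
  "Lambda_rep V E pt n = \<lparr>
     FO = (\<lambda>m. VHom E m n),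
     FA = (\<lambda>l. let X = VHom E (tgt l) n in
       VComp E (src l) (tgt l) n \<cdot>\<^bsub>V\<^esub> pair V (Id V X) (pt l \<cdot>\<^bsub>V\<^esub> bang V X))\<rparr>"

definition perm_envelope_Lambda :: "('o, 'a, 'z) cmcat_scheme \<Rightarrow>
    ('o, 'a, 'y) based_operad_scheme \<Rightarrow> nat \<Rightarrow> ('o, 'a) Lambda_obj" where
  "perm_envelope_Lambda V C n = Lambda_rep V (perm_envelope V C) (op_point V Fpos_cat C) n"

definition cat_of_operators_Lambda :: "('o, 'a, 'z) cmcat_scheme \<Rightarrow>
    ('o, 'a, 'y) based_operad_scheme \<Rightarrow> nat \<Rightarrow> ('o, 'a) Lambda_obj" where
  "cat_of_operators_Lambda V C n = Lambda_rep V (cat_of_operators V C) (op_point V F_cat C) n"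

definition Lambda_iso :: "('o, 'a, 'z) cmcat_scheme \<Rightarrow>
    ('o, 'a) Lambda_obj \<Rightarrow> ('o, 'a) Lambda_obj \<Rightarrow> bool" where
  "Lambda_iso V D E \<longleftrightarrow> naturally_isomorphic (op_cat Lambda_cat) V D E"

end

theory Submission
  imports Defs
begin

text \<open>
  A morphism in a category of operators is a map of finite based sets with an operation on each fibre
  over a non-base point. The proof compares such fibrewise descriptions: each \<open>\<Lambda>\<close>-object in the
  proposition is, at \<open>m\<close>, a coproduct of products of objects \<open>C(k)\<close> indexed by a finite set, and an
  injection acts by maps between the index sets and by arrows between the summands (\<open>presents\<close>).
  Two \<open>\<Lambda>\<close>-objects with the same such presentation are isomorphic (\<open>presents_iso\<close>), and a
  presentation can be moved along isomorphisms of \<open>\<Lambda>\<close>-objects (\<open>presents_transport\<close>) and rewritten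
  along bijections of the index sets (\<open>presents_reindex\<close>).

  The Day convolution of \<open>D\<close> and \<open>E\<close> has such a presentation because an injection \<open>k : m \<rightarrow> j\<^sub>1 + j\<^sub>2\<close> splits \<open>m\<close> into
  the preimage \<open>S\<close> of the first summand and its complement, and factors through \<open>m \<rightarrow> |S| + |m - S|\<close>
  (\<open>split_injection\<close>). A cowedge is therefore determined by its values at these bijections, which can
  be arbitrary, and the coend is the coproduct of the objects \<open>D(|S|) \<otimes> E(|m - S|)\<close> over the subsets \<open>S\<close>
  of \<open>{1..m}\<close> (\<open>day_presents\<close>). Restricting an injection to \<open>S\<close> requires the functors to be extended from
  the objects of \<open>\<Lambda>\<close> to all finite sets of numbers, which is done by increasing enumeration
  (\<open>std\<close>, \<open>restr\<close>).

  For the envelope and the category of operators the presentation is their definition, once it is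
  known that precomposition with an injection acts on the factor \<open>C(\<phi>\<^sup>-\<^sup>1(j))\<close> by the functor of the
  operad on the restriction of the injection to the fibre (\<open>Lambda_rep_presents\<close>). This uses that
  products distribute over coproducts. That the operad is a functor on \<open>\<Lambda>\<close> in the first place
  follows from associativity, equivariance and the unit axioms (\<open>operad_Lambda_functor\<close>).

  Finally a based map \<open>\<phi> : m \<rightarrow> n\<close> amounts to the set of elements that it does not send to the base
  point and a map in \<open>\<F>\<^sub>>\<^sub>0\<close> from this set to \<open>n\<close>. Hence convolution of the envelope at \<open>n\<close> with \<open>E\<close> is
  presented by the based maps \<open>\<phi> : m \<rightarrow> n\<close>, with one more factor \<open>E\<close> for the fibre over the base point
  (\<open>day_env_presents\<close>). If \<open>E\<close> is the commutativity operad, this factor is trivial, and the result is the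
  category of operators. If \<open>E\<close> is \<open>C\<close>, sending that fibre to a new point gives the envelope at \<open>n + 1\<close>, so
  that the envelope at \<open>n\<close> is the \<open>n\<close>-fold convolution power of \<open>C\<close> by induction (\<open>perm_envelope_iso\<close>).
\<close>


section \<open>Arrows of a Cartesian category\<close>

locale cartesian =
  fixes V :: "('o, 'a, 'z) cmcat_scheme" (structure)
  assumes cartesian: "is_cartesian V"
begin

lemma category: "is_category V"
  using cartesian by (simp add: is_cartesian_def)

lemma hom_iff: "f \<in> hom V a b \<longleftrightarrow> f \<in> Arr V \<and> Dom V f = a \<and> Cod V f = b"
  by (auto simp: hom_def)

lemma Dom_Obj [simp]: "f \<in> Arr V \<Longrightarrow> Dom V f \<in> Obj V"
  and Cod_Obj [simp]: "f \<in> Arr V \<Longrightarrow> Cod V f \<in> Obj V"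
  using category by (auto simp: is_category_def)

lemma Id_simps [simp]:
  assumes "a \<in> Obj V"
  shows "Id V a \<in> Arr V" "Dom V (Id V a) = a" "Cod V (Id V a) = a"
  using category assms by (auto simp: is_category_def hom_def)

lemma comp_simps [simp]:
  assumes "f \<in> Arr V" "g \<in> Arr V" "Cod V f = Dom V g"
  shows "g \<cdot> f \<in> Arr V" "Dom V (g \<cdot> f) = Dom V f" "Cod V (g \<cdot> f) = Cod V g"
  using category assms by (auto simp: is_category_def hom_def)

lemma comp_Id [simp]: "f \<in> Arr V \<Longrightarrow> Dom V f = a \<Longrightarrow> f \<cdot> Id V a = f"
  and Id_comp [simp]: "f \<in> Arr V \<Longrightarrow> Cod V f = a \<Longrightarrow> Id V a \<cdot> f = f"
  using category by (auto simp: is_category_def)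

lemma comp_assoc [simp]:
  assumes "f \<in> Arr V" "g \<in> Arr V" "h \<in> Arr V" "Cod V f = Dom V g" "Cod V g = Dom V h"
  shows "(h \<cdot> g) \<cdot> f = h \<cdot> g \<cdot> f"
  using category assms unfolding is_category_def by metis

lemma One_Obj [simp]: "One V \<in> Obj V"
  using cartesian by (simp add: is_cartesian_def)

lemma One_ex1: "a \<in> Obj V \<Longrightarrow> \<exists>!f. f \<in> hom V a (One V)"
  using cartesian unfolding is_cartesian_def by blast

lemma bang_hom: "a \<in> Obj V \<Longrightarrow> bang V a \<in> hom V a (One V)"
  unfolding bang_def using One_ex1 by (rule theI')

lemma bang_simps [simp]:
  assumes "a \<in> Obj V"
  shows "bang V a \<in> Arr V" "Dom V (bang V a) = a" "Cod V (bang V a) = One V"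
  using bang_hom[OF assms] by (auto simp: hom_def)

lemma One_ext:
  assumes "f \<in> Arr V" "g \<in> Arr V" "Dom V f = Dom V g" "Cod V f = One V" "Cod V g = One V"
  shows "f = g"
proof -
  have "f \<in> hom V (Dom V g) (One V)" "g \<in> hom V (Dom V g) (One V)"
    using assms by (auto simp: hom_iff)
  with One_ex1[of "Dom V g"] assms(2) show ?thesis by auto
qed

lemma bang_comp [simp]:
  "f \<in> Arr V \<Longrightarrow> Cod V f = a \<Longrightarrow> bang V a \<cdot> f = bang V (Dom V f)"
  by (rule One_ext) auto

lemma bang_One [simp]: "bang V (One V) = Id V (One V)"
  by (rule One_ext) auto

lemma Prod_simps [simp]:
  assumes "a \<in> Obj V" "b \<in> Obj V"
  shows "a \<otimes> b \<in> Obj V"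
    "Fst V a b \<in> Arr V" "Dom V (Fst V a b) = a \<otimes> b" "Cod V (Fst V a b) = a"
    "Snd V a b \<in> Arr V" "Dom V (Snd V a b) = a \<otimes> b" "Cod V (Snd V a b) = b"
proof -
  have "a \<otimes> b \<in> Obj V \<and> Fst V a b \<in> hom V (a \<otimes> b) a \<and> Snd V a b \<in> hom V (a \<otimes> b) b"
    using cartesian assms unfolding is_cartesian_def by blast
  then show "a \<otimes> b \<in> Obj V"
    "Fst V a b \<in> Arr V" "Dom V (Fst V a b) = a \<otimes> b" "Cod V (Fst V a b) = a"
    "Snd V a b \<in> Arr V" "Dom V (Snd V a b) = a \<otimes> b" "Cod V (Snd V a b) = b"
    by (auto simp: hom_iff)
qed

lemma pair_ex1:
  assumes "f \<in> Arr V" "g \<in> Arr V" "Dom V f = Dom V g"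
  shows "\<exists>!h. h \<in> hom V (Dom V f) (Cod V f \<otimes> Cod V g) \<and>
     Fst V (Cod V f) (Cod V g) \<cdot> h = f \<and> Snd V (Cod V f) (Cod V g) \<cdot> h = g"
proof -
  have "\<forall>t\<in>Obj V. \<forall>u\<in>hom V t a. \<forall>v\<in>hom V t b.
           \<exists>!h. h \<in> hom V t (a \<otimes> b) \<and> Fst V a b \<cdot> h = u \<and> Snd V a b \<cdot> h = v"
    if "a \<in> Obj V" "b \<in> Obj V" for a b
    using cartesian that unfolding is_cartesian_def by blast
  from this[of "Cod V f" "Cod V g"] assms show ?thesis by (simp add: hom_iff)
qed

lemma pair_simps [simp]:
  assumes "f \<in> Arr V" "g \<in> Arr V" "Dom V f = Dom V g"
  shows "pair V f g \<in> Arr V" "Dom V (pair V f g) = Dom V f"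
    "Cod V (pair V f g) = Cod V f \<otimes> Cod V g"
  using theI'[OF pair_ex1[OF assms], folded pair_def] by (auto simp: hom_iff)

lemma Fst_pair [simp]:
  "f \<in> Arr V \<Longrightarrow> g \<in> Arr V \<Longrightarrow> Dom V f = Dom V g \<Longrightarrow> Cod V f = a \<Longrightarrow> Cod V g = b \<Longrightarrow>
    Fst V a b \<cdot> pair V f g = f"
  and Snd_pair [simp]:
  "f \<in> Arr V \<Longrightarrow> g \<in> Arr V \<Longrightarrow> Dom V f = Dom V g \<Longrightarrow> Cod V f = a \<Longrightarrow> Cod V g = b \<Longrightarrow>
    Snd V a b \<cdot> pair V f g = g"
  using theI'[OF pair_ex1, folded pair_def] by auto

lemma pair_ext:
  assumes "h \<in> Arr V" "k \<in> Arr V" "Dom V h = Dom V k" "Cod V h = a \<otimes> b" "Cod V k = a \<otimes> b"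
    and ab: "a \<in> Obj V" "b \<in> Obj V"
    and "Fst V a b \<cdot> h = Fst V a b \<cdot> k" "Snd V a b \<cdot> h = Snd V a b \<cdot> k"
  shows "h = k"
proof -
  have "Cod V (Fst V a b \<cdot> h) = a" "Cod V (Snd V a b \<cdot> h) = b"
    "Dom V (Fst V a b \<cdot> h) = Dom V k" "Dom V (Snd V a b \<cdot> h) = Dom V k"
    "Fst V a b \<cdot> h \<in> Arr V" "Snd V a b \<cdot> h \<in> Arr V"
    using assms(1-5) ab by auto
  with pair_ex1[of "Fst V a b \<cdot> h" "Snd V a b \<cdot> h"] show ?thesis
    using assms by (metis hom_iff)
qed

lemma pair_comp [simp]:
  assumes "f \<in> Arr V" "g \<in> Arr V" "Dom V f = Dom V g" "h \<in> Arr V" "Cod V h = Dom V g"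
  shows "pair V f g \<cdot> h = pair V (f \<cdot> h) (g \<cdot> h)"
proof (rule pair_ext)
  show "Fst V (Cod V f) (Cod V g) \<cdot> pair V f g \<cdot> h
      = Fst V (Cod V f) (Cod V g) \<cdot> pair V (f \<cdot> h) (g \<cdot> h)"
    using assms comp_assoc[of h "pair V f g" "Fst V (Cod V f) (Cod V g)"] by simp
  show "Snd V (Cod V f) (Cod V g) \<cdot> pair V f g \<cdot> h
      = Snd V (Cod V f) (Cod V g) \<cdot> pair V (f \<cdot> h) (g \<cdot> h)"
    using assms comp_assoc[of h "pair V f g" "Snd V (Cod V f) (Cod V g)"] by simp
qed (use assms in auto)

lemma pair_Fst_Snd [simp]:
  "a \<in> Obj V \<Longrightarrow> b \<in> Obj V \<Longrightarrow> pair V (Fst V a b) (Snd V a b) = Id V (a \<otimes> b)"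
  by (rule pair_ext[of _ _ a b]) auto

lemma prod_map_simps [simp]:
  assumes "f \<in> Arr V" "g \<in> Arr V"
  shows "prod_map V f g \<in> Arr V" "Dom V (prod_map V f g) = Dom V f \<otimes> Dom V g"
    "Cod V (prod_map V f g) = Cod V f \<otimes> Cod V g"
  using assms by (auto simp: prod_map_def)

lemma prod_map_pair [simp]:
  assumes "f \<in> Arr V" "g \<in> Arr V" "h \<in> Arr V" "k \<in> Arr V"
    "Cod V h = Dom V f" "Cod V k = Dom V g" "Dom V h = Dom V k"
  shows "prod_map V f g \<cdot> pair V h k = pair V (f \<cdot> h) (g \<cdot> k)"
  using assms by (simp add: prod_map_def)

lemma prod_map_comp [simp]:
  assumes "f \<in> Arr V" "g \<in> Arr V" "h \<in> Arr V" "k \<in> Arr V"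
    "Cod V h = Dom V f" "Cod V k = Dom V g"
  shows "prod_map V f g \<cdot> prod_map V h k = prod_map V (f \<cdot> h) (g \<cdot> k)"
  using assms by (simp add: prod_map_def[of V h k]) (simp add: prod_map_def)

lemma prod_map_Id [simp]:
  "a \<in> Obj V \<Longrightarrow> b \<in> Obj V \<Longrightarrow> prod_map V (Id V a) (Id V b) = Id V (a \<otimes> b)"
  by (simp add: prod_map_def)

lemma Fst_prod_map [simp]:
  "f \<in> Arr V \<Longrightarrow> g \<in> Arr V \<Longrightarrow> Cod V f = a \<Longrightarrow> Cod V g = b \<Longrightarrow>
    Fst V a b \<cdot> prod_map V f g = f \<cdot> Fst V (Dom V f) (Dom V g)"
  and Snd_prod_map [simp]:
  "f \<in> Arr V \<Longrightarrow> g \<in> Arr V \<Longrightarrow> Cod V f = a \<Longrightarrow> Cod V g = b \<Longrightarrow>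
    Snd V a b \<cdot> prod_map V f g = g \<cdot> Snd V (Dom V f) (Dom V g)"
  by (simp_all add: prod_map_def)

subsection \<open>Iterated products\<close>

lemma lprod_Obj [simp]: "set xs \<subseteq> Obj V \<Longrightarrow> lprod V xs \<in> Obj V"
  by (induction xs) auto

lemma proj_simps [simp]:
  assumes "set xs \<subseteq> Obj V" "i < length xs"
  shows "proj V xs i \<in> Arr V" "Dom V (proj V xs i) = lprod V xs" "Cod V (proj V xs i) = xs ! i"
  using assms
proof (induction xs arbitrary: i)
  case (Cons x xs)
  { case 1 then show ?case using Cons by (cases i) auto }
  { case 2 then show ?case using Cons by (cases i) auto }
  { case 3 then show ?case using Cons by (cases i) auto }
qed auto

lemma tuple_simps [simp]:
  assumes "t \<in> Obj V" "\<forall>f\<in>set fs. f \<in> Arr V \<and> Dom V f = t"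
  shows "tuple V t fs \<in> Arr V" "Dom V (tuple V t fs) = t"
    "Cod V (tuple V t fs) = lprod V (map (Cod V) fs)"
  using assms by (induction fs) auto

lemma proj_tuple [simp]:
  assumes "t \<in> Obj V" "\<forall>f\<in>set fs. f \<in> Arr V \<and> Dom V f = t" "map (Cod V) fs = xs" "i < length fs"
  shows "proj V xs i \<cdot> tuple V t fs = fs ! i"
  using assms
proof (induction fs arbitrary: i xs)
  case (Cons f fs)
  have "set (map (Cod V) fs) \<subseteq> Obj V" using Cons.prems by auto
  with Cons show ?case by (cases i) auto
qed auto

lemma tuple_comp [simp]:
  assumes "t \<in> Obj V" "\<forall>f\<in>set fs. f \<in> Arr V \<and> Dom V f = t" "h \<in> Arr V" "Cod V h = t"
  shows "tuple V t fs \<cdot> h = tuple V (Dom V h) (map (\<lambda>f. f \<cdot> h) fs)"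
  using assms by (induction fs) auto

lemma lprod_ext:
  assumes "h \<in> Arr V" "k \<in> Arr V" "Dom V h = Dom V k" "Cod V h = lprod V xs" "Cod V k = lprod V xs"
    "set xs \<subseteq> Obj V" "\<And>i. i < length xs \<Longrightarrow> proj V xs i \<cdot> h = proj V xs i \<cdot> k"
  shows "h = k"
  using assms
proof (induction xs arbitrary: h k)
  case Nil
  then show ?case by (intro One_ext) auto
next
  case (Cons x xs)
  show ?case
  proof (rule pair_ext)
    show "Fst V x (lprod V xs) \<cdot> h = Fst V x (lprod V xs) \<cdot> k"
      using Cons.prems(7)[of 0] by simp
    show "Snd V x (lprod V xs) \<cdot> h = Snd V x (lprod V xs) \<cdot> k"
    proof (rule Cons.IH)
      fix i assume "i < length xs"
      then show "proj V xs i \<cdot> Snd V x (lprod V xs) \<cdot> h = proj V xs i \<cdot> Snd V x (lprod V xs) \<cdot> k"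
        using Cons.prems(1-6) Cons.prems(7)[of "Suc i"] by simp
    qed (use Cons.prems in auto)
  qed (use Cons.prems in auto)
qed

text \<open>The product \<open>f\<^sub>1 \<otimes> \<dots> \<otimes> f\<^sub>k\<close> of arrows with domains \<open>xs\<close>.\<close>

definition lmap :: "'o list \<Rightarrow> 'a list \<Rightarrow> 'a" where
  "lmap xs fs = tuple V (lprod V xs) (map (\<lambda>i. fs ! i \<cdot> proj V xs i) [0..<length xs])"

lemma
  assumes "set xs \<subseteq> Obj V" "set fs \<subseteq> Arr V" "map (Dom V) fs = xs"
  shows lmap_simps [simp]: "lmap xs fs \<in> Arr V" "Dom V (lmap xs fs) = lprod V xs"
    "Cod V (lmap xs fs) = lprod V (map (Cod V) fs)"
  and proj_lmap: "map (Cod V) fs = ys \<Longrightarrow> i < length xs \<Longrightarrow>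
    proj V ys i \<cdot> lmap xs fs = fs ! i \<cdot> proj V xs i"
proof -
  let ?gs = "map (\<lambda>i. fs ! i \<cdot> proj V xs i) [0..<length xs]"
  have l: "length xs = length fs" using assms(3) by auto
  have f: "fs ! i \<in> Arr V \<and> Dom V (fs ! i) = xs ! i" if "i < length xs" for i
    using assms(2,3) that l by (metis nth_map nth_mem subsetD)
  have "map (Cod V) ?gs = map (\<lambda>i. Cod V (fs ! i)) [0..<length fs]"
    unfolding map_map l[symmetric] by (rule map_cong) (use assms(1) f in simp_all)
  also have "\<dots> = map (Cod V) (map ((!) fs) [0..<length fs])" by simp
  finally have c: "map (Cod V) ?gs = map (Cod V) fs" by (simp only: map_nth)
  have o: "lprod V xs \<in> Obj V" and a: "\<forall>g\<in>set ?gs. g \<in> Arr V \<and> Dom V g = lprod V xs"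
    using assms(1) f by auto
  show "lmap xs fs \<in> Arr V" "Dom V (lmap xs fs) = lprod V xs"
    "Cod V (lmap xs fs) = lprod V (map (Cod V) fs)"
    unfolding lmap_def using tuple_simps[OF o a] c by simp_all
  assume "map (Cod V) fs = ys" and i: "i < length xs"
  then show "proj V ys i \<cdot> lmap xs fs = fs ! i \<cdot> proj V xs i"
    unfolding lmap_def using proj_tuple[OF o a, of ys i] c by simp
qed

lemma Cod_projs:
  assumes "set xs \<subseteq> Obj V" "f \<in> Arr V" "Cod V f = lprod V xs"
  shows "map (\<lambda>i. Cod V (proj V xs i \<cdot> f)) [0..<length xs] = xs"
proof -
  have "map (\<lambda>i. Cod V (proj V xs i \<cdot> f)) [0..<length xs] = map ((!) xs) [0..<length xs]"
    using assms by (intro map_cong) auto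
  then show ?thesis by (simp add: map_nth)
qed

text \<open>The associativity isomorphism \<open>(x\<^sub>1 \<otimes> \<dots> \<otimes> x\<^sub>k) \<otimes> x \<rightarrow> x\<^sub>1 \<otimes> \<dots> \<otimes> x\<^sub>k \<otimes> x\<close> and its inverse. They are
  needed because iterated products are bracketed to the right while Day powers grow on the right.\<close>

definition snoc_arr :: "'o list \<Rightarrow> 'o \<Rightarrow> 'a" where
  "snoc_arr xs x = tuple V (lprod V xs \<otimes> x)
     (map (\<lambda>i. proj V xs i \<cdot> Fst V (lprod V xs) x) [0..<length xs] @ [Snd V (lprod V xs) x])"

definition unsnoc_arr :: "'o list \<Rightarrow> 'o \<Rightarrow> 'a" where
  "unsnoc_arr xs x = pair V
     (tuple V (lprod V (xs @ [x])) (map (proj V (xs @ [x])) [0..<length xs]))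
     (proj V (xs @ [x]) (length xs))"

context
  fixes xs x
  assumes xs: "set xs \<subseteq> Obj V" and x: "x \<in> Obj V"
begin

lemma snoc_arr_simps [simp]:
  "snoc_arr xs x \<in> Arr V" "Dom V (snoc_arr xs x) = lprod V xs \<otimes> x"
  "Cod V (snoc_arr xs x) = lprod V (xs @ [x])"
  and proj_snoc_arr:
  "i \<le> length xs \<Longrightarrow> proj V (xs @ [x]) i \<cdot> snoc_arr xs x =
    (if i < length xs then proj V xs i \<cdot> Fst V (lprod V xs) x else Snd V (lprod V xs) x)"
proof -
  let ?fs = "map (\<lambda>i. proj V xs i \<cdot> Fst V (lprod V xs) x) [0..<length xs] @ [Snd V (lprod V xs) x]"
  have c: "map (Cod V) ?fs = xs @ [x]"
    using Cod_projs[OF xs, of "Fst V (lprod V xs) x"] xs x by (simp add: comp_def)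
  have o: "lprod V xs \<otimes> x \<in> Obj V" and a: "\<forall>f\<in>set ?fs. f \<in> Arr V \<and> Dom V f = lprod V xs \<otimes> x"
    using xs x by auto
  show "snoc_arr xs x \<in> Arr V" "Dom V (snoc_arr xs x) = lprod V xs \<otimes> x"
    "Cod V (snoc_arr xs x) = lprod V (xs @ [x])"
    unfolding snoc_arr_def using tuple_simps[OF o a] c by simp_all
  assume i: "i \<le> length xs"
  have "proj V (xs @ [x]) i \<cdot> snoc_arr xs x = ?fs ! i"
    unfolding snoc_arr_def by (rule proj_tuple[OF o a c]) (use i in simp)
  then show "proj V (xs @ [x]) i \<cdot> snoc_arr xs x =
    (if i < length xs then proj V xs i \<cdot> Fst V (lprod V xs) x else Snd V (lprod V xs) x)"
    using i by (simp add: nth_append)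
qed

lemma unsnoc_arr_simps [simp]:
  "unsnoc_arr xs x \<in> Arr V" "Cod V (unsnoc_arr xs x) = lprod V xs \<otimes> x"
  "Dom V (unsnoc_arr xs x) = lprod V (xs @ [x])"
  and Snd_unsnoc_arr: "Snd V (lprod V xs) x \<cdot> unsnoc_arr xs x = proj V (xs @ [x]) (length xs)"
  and proj_unsnoc_arr: "i < length xs \<Longrightarrow>
    proj V xs i \<cdot> Fst V (lprod V xs) x \<cdot> unsnoc_arr xs x = proj V (xs @ [x]) i"
proof -
  let ?fs = "map (proj V (xs @ [x])) [0..<length xs]"
  have "map (Cod V) ?fs = map ((!) xs) [0..<length xs]"
    using xs x by (simp add: nth_append)
  then have c: "map (Cod V) ?fs = xs" by (simp add: map_nth)
  have o: "lprod V (xs @ [x]) \<in> Obj V"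
    and a: "\<forall>f\<in>set ?fs. f \<in> Arr V \<and> Dom V f = lprod V (xs @ [x])"
    using xs x by auto
  note t = tuple_simps[OF o a] c
  have l: "proj V (xs @ [x]) (length xs) \<in> Arr V"
     "Dom V (proj V (xs @ [x]) (length xs)) = lprod V (xs @ [x])"
     "Cod V (proj V (xs @ [x]) (length xs)) = x"
    using xs x by auto
  show "unsnoc_arr xs x \<in> Arr V" "Cod V (unsnoc_arr xs x) = lprod V xs \<otimes> x"
    "Dom V (unsnoc_arr xs x) = lprod V (xs @ [x])"
    and "Snd V (lprod V xs) x \<cdot> unsnoc_arr xs x = proj V (xs @ [x]) (length xs)"
    unfolding unsnoc_arr_def using t l by simp_all
  have f: "Fst V (lprod V xs) x \<cdot> unsnoc_arr xs x = tuple V (lprod V (xs @ [x])) ?fs"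
    unfolding unsnoc_arr_def using t l by simp
  assume i: "i < length xs"
  show "proj V xs i \<cdot> Fst V (lprod V xs) x \<cdot> unsnoc_arr xs x = proj V (xs @ [x]) i"
    unfolding f using proj_tuple[OF o a c] i by simp
qed

lemma snoc_unsnoc: "snoc_arr xs x \<cdot> unsnoc_arr xs x = Id V (lprod V (xs @ [x]))"
proof (rule lprod_ext[where xs = "xs @ [x]"])
  fix i assume i: "i < length (xs @ [x])"
  have "proj V (xs @ [x]) i \<cdot> snoc_arr xs x \<cdot> unsnoc_arr xs x
      = (proj V (xs @ [x]) i \<cdot> snoc_arr xs x) \<cdot> unsnoc_arr xs x"
    using xs x i by (subst comp_assoc) auto
  also have "\<dots> = proj V (xs @ [x]) i"
    using xs x i by (cases "i < length xs")
      (simp_all add: proj_snoc_arr proj_unsnoc_arr Snd_unsnoc_arr not_less less_Suc_eq_le)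
  finally show "proj V (xs @ [x]) i \<cdot> snoc_arr xs x \<cdot> unsnoc_arr xs x
      = proj V (xs @ [x]) i \<cdot> Id V (lprod V (xs @ [x]))"
    using xs x i by simp
qed (use xs x in auto)

lemma unsnoc_snoc: "unsnoc_arr xs x \<cdot> snoc_arr xs x = Id V (lprod V xs \<otimes> x)"
proof (rule pair_ext)
  have "Snd V (lprod V xs) x \<cdot> unsnoc_arr xs x \<cdot> snoc_arr xs x
    = (Snd V (lprod V xs) x \<cdot> unsnoc_arr xs x) \<cdot> snoc_arr xs x"
    using xs x by simp
  then show "Snd V (lprod V xs) x \<cdot> unsnoc_arr xs x \<cdot> snoc_arr xs x
      = Snd V (lprod V xs) x \<cdot> Id V (lprod V xs \<otimes> x)"
    unfolding Snd_unsnoc_arr using xs x by (simp add: proj_snoc_arr)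
  show "Fst V (lprod V xs) x \<cdot> unsnoc_arr xs x \<cdot> snoc_arr xs x
      = Fst V (lprod V xs) x \<cdot> Id V (lprod V xs \<otimes> x)"
  proof (rule lprod_ext[where xs = xs])
    fix i assume i: "i < length xs"
    have "proj V xs i \<cdot> Fst V (lprod V xs) x \<cdot> unsnoc_arr xs x \<cdot> snoc_arr xs x
      = (proj V xs i \<cdot> Fst V (lprod V xs) x \<cdot> unsnoc_arr xs x) \<cdot> snoc_arr xs x"
      using xs x i by simp
    then show "proj V xs i \<cdot> Fst V (lprod V xs) x \<cdot> unsnoc_arr xs x \<cdot> snoc_arr xs x
      = proj V xs i \<cdot> Fst V (lprod V xs) x \<cdot> Id V (lprod V xs \<otimes> x)"
      unfolding proj_unsnoc_arr[OF i] using xs x i by (simp add: proj_snoc_arr)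
  qed (use xs x in auto)
qed (use xs x in auto)

end

lemma snoc_arr_natural:
  assumes xs: "set xs \<subseteq> Obj V" and fs: "set fs \<subseteq> Arr V" "map (Dom V) fs = xs"
    and ys: "map (Cod V) fs = ys" and f: "f \<in> Arr V" "Dom V f = x" "Cod V f = y"
  shows "lmap (xs @ [x]) (fs @ [f]) \<cdot> snoc_arr xs x = snoc_arr ys y \<cdot> prod_map V (lmap xs fs) f"
proof -
  have ys': "set ys \<subseteq> Obj V" using fs(1) ys by (force simp: subset_iff)
  have x: "x \<in> Obj V" and y: "y \<in> Obj V" using f by auto
  have l: "length xs = length fs" "length ys = length fs" using fs(2) ys by auto
  have g: "(fs @ [f]) ! i \<in> Arr V \<and> Dom V ((fs @ [f]) ! i) = (xs @ [x]) ! i"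
    if "i \<le> length fs" for i
    using fs f(1,2) l(1) that
    by (cases "i < length fs") (auto simp: nth_append subset_iff dest: nth_mem)
  note L = lmap_simps[OF xs fs, unfolded ys] and pL = proj_lmap[OF xs fs ys]
  have xx: "set (xs @ [x]) \<subseteq> Obj V" and ff: "set (fs @ [f]) \<subseteq> Arr V" "map (Dom V) (fs @ [f]) = xs @ [x]"
    and yy: "map (Cod V) (fs @ [f]) = ys @ [y]"
    using xs x fs f ys by auto
  note LL = lmap_simps[OF xx ff, unfolded yy] and pLL = proj_lmap[OF xx ff yy]
  note S = snoc_arr_simps[OF xs x] snoc_arr_simps[OF ys' y]
  note pS = proj_snoc_arr[OF xs x] proj_snoc_arr[OF ys' y]
  show ?thesis
  proof (rule lprod_ext[where xs = "ys @ [y]"])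
    fix i assume "i < length (ys @ [y])"
    then have i: "i \<le> length fs" using l by simp
    have P: "proj V (ys @ [y]) i \<in> Arr V" "Dom V (proj V (ys @ [y]) i) = lprod V (ys @ [y])"
      "proj V (xs @ [x]) i \<in> Arr V" "Dom V (proj V (xs @ [x]) i) = lprod V (xs @ [x])"
      "Cod V (proj V (xs @ [x]) i) = (xs @ [x]) ! i"
      using i l xs ys' x y by auto
    have "proj V (ys @ [y]) i \<cdot> lmap (xs @ [x]) (fs @ [f]) \<cdot> snoc_arr xs x
      = (proj V (ys @ [y]) i \<cdot> lmap (xs @ [x]) (fs @ [f])) \<cdot> snoc_arr xs x"
      using P LL S by simp
    also have "\<dots> = (fs @ [f]) ! i \<cdot> (proj V (xs @ [x]) i \<cdot> snoc_arr xs x)"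
      using P S g[OF i] i l by (simp add: pLL)
    finally have 1: "proj V (ys @ [y]) i \<cdot> lmap (xs @ [x]) (fs @ [f]) \<cdot> snoc_arr xs x = \<dots>" .
    have "proj V (ys @ [y]) i \<cdot> snoc_arr ys y \<cdot> prod_map V (lmap xs fs) f
      = (proj V (ys @ [y]) i \<cdot> snoc_arr ys y) \<cdot> prod_map V (lmap xs fs) f"
      using P L S f by simp
    also have "\<dots> = (fs @ [f]) ! i \<cdot> (proj V (xs @ [x]) i \<cdot> snoc_arr xs x)"
    proof (cases "i < length fs")
      case True
      then have Q: "proj V ys i \<in> Arr V" "Dom V (proj V ys i) = lprod V ys"
        "proj V xs i \<in> Arr V" "Dom V (proj V xs i) = lprod V xs" "Cod V (proj V xs i) = xs ! i"
        using l xs ys' by auto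
      have "proj V ys i \<cdot> lmap xs fs \<cdot> Fst V (lprod V xs) x
        = (proj V ys i \<cdot> lmap xs fs) \<cdot> Fst V (lprod V xs) x"
        using Q L ys xs x by simp
      also have "\<dots> = fs ! i \<cdot> proj V xs i \<cdot> Fst V (lprod V xs) x"
        using True l g[of i] Q x xs by (simp add: pL nth_append)
      finally have 2: "proj V ys i \<cdot> lmap xs fs \<cdot> Fst V (lprod V xs) x = \<dots>" .
      have "(proj V (ys @ [y]) i \<cdot> snoc_arr ys y) \<cdot> prod_map V (lmap xs fs) f
        = proj V ys i \<cdot> (Fst V (lprod V ys) y \<cdot> prod_map V (lmap xs fs) f)"
        using True l Q L f ys ys' y by (simp add: pS)
      also have "Fst V (lprod V ys) y \<cdot> prod_map V (lmap xs fs) f = lmap xs fs \<cdot> Fst V (lprod V xs) x"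
        using L f ys by simp
      finally show ?thesis using True l by (simp add: 2 pS nth_append)
    next
      case False
      then show ?thesis using i l L f ys ys' y by (simp add: pS nth_append)
    qed
    finally show "proj V (ys @ [y]) i \<cdot> lmap (xs @ [x]) (fs @ [f]) \<cdot> snoc_arr xs x
      = proj V (ys @ [y]) i \<cdot> snoc_arr ys y \<cdot> prod_map V (lmap xs fs) f"
      using 1 by simp
  qed (use L LL S f ys xx yy in \<open>simp_all add: ys' y\<close>)
qed

end


context cartesian begin

section \<open>Isomorphisms and coproducts\<close>

lemma is_isoI:
  assumes "f \<in> Arr V" "g \<in> Arr V" "Dom V g = Cod V f" "Cod V g = Dom V f"
    "g \<cdot> f = Id V (Dom V f)" "f \<cdot> g = Id V (Cod V f)"
  shows "is_iso V f"
  using assms by (auto simp: is_iso_def hom_iff)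

lemma is_isoE:
  assumes "is_iso V f"
  obtains g where "f \<in> Arr V" "g \<in> Arr V" "Dom V g = Cod V f" "Cod V g = Dom V f"
    "g \<cdot> f = Id V (Dom V f)" "f \<cdot> g = Id V (Cod V f)"
  using assms by (auto simp: is_iso_def hom_iff)

lemma is_coproductI:
  assumes "c \<in> Obj V" "\<And>i. i \<in> I \<Longrightarrow> w i \<in> hom V (X i) c"
    and "\<And>d v. d \<in> Obj V \<Longrightarrow> \<forall>i\<in>I. v i \<in> hom V (X i) d \<Longrightarrow> \<exists>h\<in>hom V c d. \<forall>i\<in>I. h \<cdot> w i = v i"
    and "\<And>h k. h \<in> Arr V \<Longrightarrow> k \<in> Arr V \<Longrightarrow> Dom V h = c \<Longrightarrow> Dom V k = c \<Longrightarrow> Cod V h = Cod V k \<Longrightarrow>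
      \<forall>i\<in>I. h \<cdot> w i = k \<cdot> w i \<Longrightarrow> h = k"
  shows "is_coproduct V I X c w"
  unfolding is_coproduct_def
proof (intro conjI ballI allI impI)
  fix d v assume d: "d \<in> Obj V" and v: "\<forall>i\<in>I. v i \<in> hom V (X i) d"
  from assms(3)[OF this] obtain h where h: "h \<in> hom V c d" "\<forall>i\<in>I. h \<cdot> w i = v i" by auto
  show "\<exists>!h. h \<in> hom V c d \<and> (\<forall>i\<in>I. h \<cdot> w i = v i)"
  proof (rule ex1I)
    show "h \<in> hom V c d \<and> (\<forall>i\<in>I. h \<cdot> w i = v i)" using h by blast
    fix k assume "k \<in> hom V c d \<and> (\<forall>i\<in>I. k \<cdot> w i = v i)"
    with h show "k = h" by (intro assms(4)) (auto simp: hom_iff)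
  qed
qed (use assms(1,2) in auto)

context
  fixes I X c w
  assumes cp: "is_coproduct V I X c w"
begin

lemma coproduct_simps:
  "c \<in> Obj V" "i \<in> I \<Longrightarrow> w i \<in> Arr V" "i \<in> I \<Longrightarrow> Dom V (w i) = X i" "i \<in> I \<Longrightarrow> Cod V (w i) = c"
  using cp by (auto simp: is_coproduct_def hom_iff)

lemma coproduct_index_Obj: "i \<in> I \<Longrightarrow> X i \<in> Obj V"
  using Dom_Obj[of "w i"] coproduct_simps by simp

lemma coproduct_ex1:
  "d \<in> Obj V \<Longrightarrow> \<forall>i\<in>I. v i \<in> hom V (X i) d \<Longrightarrow>
    \<exists>!h. h \<in> hom V c d \<and> (\<forall>i\<in>I. h \<cdot> w i = v i)"
  using cp unfolding is_coproduct_def by blast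

lemma coproduct_desc:
  assumes "d \<in> Obj V" "\<forall>i\<in>I. v i \<in> hom V (X i) d"
  shows "\<exists>h. h \<in> Arr V \<and> Dom V h = c \<and> Cod V h = d \<and> (\<forall>i\<in>I. h \<cdot> w i = v i)"
  using ex1_implies_ex[OF coproduct_ex1[OF assms]] by (simp add: hom_iff)

lemma coproduct_ext:
  assumes "h \<in> Arr V" "k \<in> Arr V" "Dom V h = c" "Dom V k = c" "Cod V h = Cod V k"
    "\<And>i. i \<in> I \<Longrightarrow> h \<cdot> w i = k \<cdot> w i"
  shows "h = k"
proof -
  have v: "\<forall>i\<in>I. k \<cdot> w i \<in> hom V (X i) (Cod V k)"
    using coproduct_simps assms(2,4) by (auto simp: hom_iff)
  have "\<exists>!h. h \<in> hom V c (Cod V k) \<and> (\<forall>i\<in>I. h \<cdot> w i = k \<cdot> w i)"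
    by (rule coproduct_ex1[OF _ v]) (use assms(2) in simp)
  moreover have "h \<in> hom V c (Cod V k)" "k \<in> hom V c (Cod V k)"
    using assms(1-5) by (simp_all add: hom_iff)
  ultimately show ?thesis using assms(6) by blast
qed

lemma coproduct_iso:
  assumes t: "is_iso V t" "Dom V t = c"
  shows "is_coproduct V I X (Cod V t) (\<lambda>i. t \<cdot> w i)"
proof -
  from t obtain s where s: "t \<in> Arr V" "s \<in> Arr V" "Dom V s = Cod V t" "Cod V s = c"
    "s \<cdot> t = Id V c" "t \<cdot> s = Id V (Cod V t)" by (elim is_isoE) auto
  note cs = coproduct_simps
  show ?thesis
  proof (rule is_coproductI)
    fix d v assume d: "d \<in> Obj V" and v: "\<forall>i\<in>I. v i \<in> hom V (X i) d"
    obtain h where h: "h \<in> Arr V" "Dom V h = c" "Cod V h = d" "\<And>i. i \<in> I \<Longrightarrow> h \<cdot> w i = v i"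
      using coproduct_desc[OF d v] by blast
    have "(h \<cdot> s) \<cdot> t \<cdot> w i = v i" if "i \<in> I" for i
    proof -
      have "(h \<cdot> s) \<cdot> t \<cdot> w i = h \<cdot> (s \<cdot> t) \<cdot> w i" using h(1-3) s(1-4) t cs that by simp
      then show ?thesis using h s(5) cs that by simp
    qed
    then show "\<exists>h\<in>hom V (Cod V t) d. \<forall>i\<in>I. h \<cdot> t \<cdot> w i = v i"
      using h s by (intro bexI[of _ "h \<cdot> s"]) (auto simp: hom_iff)
  next
    fix h k assume a: "h \<in> Arr V" "k \<in> Arr V" "Dom V h = Cod V t" "Dom V k = Cod V t" "Cod V h = Cod V k"
      "\<forall>i\<in>I. h \<cdot> t \<cdot> w i = k \<cdot> t \<cdot> w i"
    have "h \<cdot> t = k \<cdot> t"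
      by (rule coproduct_ext) (use a s t cs in simp_all)
    then have "(h \<cdot> t) \<cdot> s = (k \<cdot> t) \<cdot> s" by simp
    then show "h = k" using a s t by simp
  qed (use s t cs in \<open>auto simp: hom_iff\<close>)
qed

lemma coproduct_reindex:
  assumes b: "bij_betw b I' I"
    and a: "\<And>i. i \<in> I' \<Longrightarrow> is_iso V (a i) \<and> Dom V (a i) = X' i \<and> Cod V (a i) = X (b i)"
  shows "is_coproduct V I' X' c (\<lambda>i. w (b i) \<cdot> a i)"
proof -
  have "\<forall>i\<in>I'. \<exists>s. a i \<in> Arr V \<and> s \<in> Arr V \<and> Dom V s = X (b i) \<and> Cod V s = X' i \<and>
    s \<cdot> a i = Id V (X' i) \<and> a i \<cdot> s = Id V (X (b i))"
  proof
    fix i assume "i \<in> I'"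
    with a have ai: "is_iso V (a i)" "Dom V (a i) = X' i" "Cod V (a i) = X (b i)" by auto
    show "\<exists>s. a i \<in> Arr V \<and> s \<in> Arr V \<and> Dom V s = X (b i) \<and> Cod V s = X' i \<and>
      s \<cdot> a i = Id V (X' i) \<and> a i \<cdot> s = Id V (X (b i))"
      by (rule is_isoE[OF ai(1)]) (use ai(2,3) in auto)
  qed
  then obtain s where s: "\<forall>i\<in>I'. a i \<in> Arr V \<and> s i \<in> Arr V \<and> Dom V (s i) = X (b i) \<and> Cod V (s i) = X' i \<and>
    s i \<cdot> a i = Id V (X' i) \<and> a i \<cdot> s i = Id V (X (b i))"
    by (elim bchoice[THEN exE])
  have bI: "b i \<in> I" if "i \<in> I'" for i using b that by (auto simp: bij_betw_def)
  note cs = coproduct_simps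
  show ?thesis
  proof (rule is_coproductI)
    fix d v assume d: "d \<in> Obj V" and v: "\<forall>i\<in>I'. v i \<in> hom V (X' i) d"
    let ?b = "inv_into I' b"
    have inv: "?b i \<in> I'" "b (?b i) = i" if "i \<in> I" for i
      using b that by (auto simp: bij_betw_def f_inv_into_f inv_into_into)
    have vs: "\<forall>i\<in>I. v (?b i) \<cdot> s (?b i) \<in> hom V (X i) d"
      using v s inv by (auto simp: hom_iff)
    obtain h where h: "h \<in> Arr V" "Dom V h = c" "Cod V h = d"
      "\<And>i. i \<in> I \<Longrightarrow> h \<cdot> w i = v (?b i) \<cdot> s (?b i)"
      using coproduct_desc[OF d vs] by blast
    have "h \<cdot> w (b i) \<cdot> a i = v i" if i: "i \<in> I'" for i
    proof -
      have b': "?b (b i) = i" using b i by (simp add: bij_betw_def)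
      have "h \<cdot> w (b i) \<cdot> a i = (h \<cdot> w (b i)) \<cdot> a i"
        using h(1-3) s a[OF i] cs bI[OF i] i by simp
      also have "\<dots> = v i \<cdot> (s i \<cdot> a i)"
        using v s h(4)[OF bI[OF i]] b' i a[OF i] by (simp add: hom_iff)
      also have "\<dots> = v i" using s v i by (simp add: hom_iff)
      finally show ?thesis .
    qed
    then show "\<exists>h\<in>hom V c d. \<forall>i\<in>I'. h \<cdot> w (b i) \<cdot> a i = v i"
      using h by (intro bexI[of _ h]) (auto simp: hom_iff)
  next
    fix h k assume e: "h \<in> Arr V" "k \<in> Arr V" "Dom V h = c" "Dom V k = c" "Cod V h = Cod V k"
      "\<forall>i\<in>I'. h \<cdot> w (b i) \<cdot> a i = k \<cdot> w (b i) \<cdot> a i"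
    show "h = k"
    proof (rule coproduct_ext)
      fix j assume "j \<in> I"
      then obtain i where i: "i \<in> I'" "j = b i" using b by (auto simp: bij_betw_def)
      have "(h \<cdot> w (b i) \<cdot> a i) \<cdot> s i = (k \<cdot> w (b i) \<cdot> a i) \<cdot> s i" using e(6) i by simp
      then show "h \<cdot> w j = k \<cdot> w j"
        using e(1-5) s a[OF i(1)] cs bI[OF i(1)] i by simp
    qed (use e in simp_all)
  next
    fix i assume "i \<in> I'"
    then show "w (b i) \<cdot> a i \<in> hom V (X' i) c" using s a bI cs by (simp add: hom_iff)
  qed (use cs in simp)
qed

end

text \<open>An arrow out of \<open>c\<close> is a family of arrows out of the \<open>X i\<close>, and each of these is a family of arrows
  out of the \<open>Y i j\<close>.\<close>

lemma coproduct_Sigma: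
  assumes cp: "is_coproduct V I X c w"
    and u: "\<And>i. i \<in> I \<Longrightarrow> is_coproduct V (J i) (Y i) (X i) (u i)"
  shows "is_coproduct V (Sigma I J) (\<lambda>(i, j). Y i j) c (\<lambda>(i, j). w i \<cdot> u i j)"
proof -
  note cs = coproduct_simps[OF cp]
  note us = coproduct_simps[OF u]
  show ?thesis
  proof (rule is_coproductI)
    show "(case i of (i, j) \<Rightarrow> w i \<cdot> u i j) \<in> hom V (case i of (i, j) \<Rightarrow> Y i j) c"
      if "i \<in> Sigma I J" for i
      using that us cs by (auto simp: hom_iff)
    fix d v assume d: "d \<in> Obj V" and v: "\<forall>i\<in>Sigma I J. v i \<in> hom V (case i of (i, j) \<Rightarrow> Y i j) d"
    have "\<exists>h\<in>hom V (X i) d. \<forall>j\<in>J i. h \<cdot> u i j = v (i, j)" if "i \<in> I" for i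
    proof -
      have "\<forall>j\<in>J i. v (i, j) \<in> hom V (Y i j) d" using v that by auto
      from coproduct_desc[OF u[OF that] d this] show ?thesis by (auto simp: hom_iff)
    qed
    then obtain g where g: "\<And>i. i \<in> I \<Longrightarrow> g i \<in> hom V (X i) d"
      "\<And>i j. i \<in> I \<Longrightarrow> j \<in> J i \<Longrightarrow> g i \<cdot> u i j = v (i, j)" by metis
    obtain h where h: "h \<in> Arr V" "Dom V h = c" "Cod V h = d" "\<And>i. i \<in> I \<Longrightarrow> h \<cdot> w i = g i"
      using coproduct_desc[OF cp d, of g] g(1) by blast
    have "h \<cdot> w i \<cdot> u i j = v (i, j)" if "i \<in> I" "j \<in> J i" for i j
    proof -
      have "h \<cdot> w i \<cdot> u i j = (h \<cdot> w i) \<cdot> u i j" using h(1-3) cs us that by simp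
      then show ?thesis using h(4) g(2) that by simp
    qed
    then show "\<exists>h\<in>hom V c d. \<forall>i\<in>Sigma I J. h \<cdot> (case i of (i, j) \<Rightarrow> w i \<cdot> u i j) = v i"
      using h(1-3) by (intro bexI[of _ h]) (auto simp: hom_iff)
  next
    fix h k assume e: "h \<in> Arr V" "k \<in> Arr V" "Dom V h = c" "Dom V k = c" "Cod V h = Cod V k"
      "\<forall>i\<in>Sigma I J. h \<cdot> (case i of (i, j) \<Rightarrow> w i \<cdot> u i j) = k \<cdot> (case i of (i, j) \<Rightarrow> w i \<cdot> u i j)"
    show "h = k"
    proof (rule coproduct_ext[OF cp e(1-5)])
      fix i assume i: "i \<in> I"
      have "(h \<cdot> w i) \<cdot> u i j = (k \<cdot> w i) \<cdot> u i j" if j: "j \<in> J i" for j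
        using bspec[OF e(6), of "(i, j)"] i j e(1-5) cs us[OF i] by simp
      then show "h \<cdot> w i = k \<cdot> w i"
        by (rule coproduct_ext[OF u[OF i], rotated 5]) (use e(1-5) cs i in simp_all)
    qed
  qed (use cs in simp)
qed

end

text \<open>A coproduct of objects indexed by a finite set is the colimit of a diagram on a discrete
  category, which embeds into every infinite type.\<close>

lemma finite_coproduct_exists:
  fixes V :: "('o, 'a, 'z) cmcat_scheme" and I :: "'i set"
  assumes V: "is_cartesian V" and inf: "infinite (UNIV :: 's set)"
    and coc: "cocomplete_cat TYPE('s) V" and I: "finite I" and X: "\<forall>i\<in>I. X i \<in> Obj V"
  shows "\<exists>c w. is_coproduct V I X c w"
proof -
  interpret cartesian V by standard (rule V)
  obtain T :: "'s set" where T: "finite T" "card T = card I"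
    using infinite_arbitrarily_large[OF inf] by blast
  then obtain e :: "'i \<Rightarrow> 's" where "bij_betw e I T"
    using finite_same_card_bij[OF I] by metis
  then have e: "inj_on e I" by (simp add: bij_betw_def)
  let ?J = "\<lparr>Obj = e ` I, Arr = e ` I, Dom = id, Cod = id, Id = id, Comp = (\<lambda>g f. f)\<rparr> :: ('s, 's) cat"
  let ?D = "\<lparr>FO = (\<lambda>s. X (inv_into I e s)), FA = (\<lambda>s. Id V (X (inv_into I e s)))\<rparr> :: ('s, 's, 'o, 'a) functr"
  have J: "is_category ?J" by (auto simp: is_category_def hom_def)
  have D: "is_functor ?J V ?D"
    using X e by (auto simp: is_functor_def hom_def)
  from coc J D obtain c w where cw: "is_colimit ?J V ?D c w"
    unfolding cocomplete_cat_def by blast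
  have cone: "is_cocone ?J V ?D d v \<longleftrightarrow> d \<in> Obj V \<and> (\<forall>i\<in>I. v (e i) \<in> hom V (X i) d)" for d v
    using e by (auto simp: is_cocone_def hom_iff)
  have "is_coproduct V I X c (\<lambda>i. w (e i))"
    unfolding is_coproduct_def
  proof (intro conjI ballI allI impI)
    have cw': "is_cocone ?J V ?D c w" using cw unfolding is_colimit_def by blast
    show "c \<in> Obj V" using cw' cone by blast
    show "w (e i) \<in> hom V (X i) c" if "i \<in> I" for i using cw' cone that by blast
    fix d v assume "d \<in> Obj V" "\<forall>i\<in>I. v i \<in> hom V (X i) d"
    then have "is_cocone ?J V ?D d (\<lambda>s. v (inv_into I e s))"
      using cone e by auto
    then have "\<exists>!h. h \<in> hom V c d \<and> (\<forall>s\<in>Obj ?J. h \<cdot>\<^bsub>V\<^esub> w s = v (inv_into I e s))"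
      using cw unfolding is_colimit_def by blast
    then show "\<exists>!h. h \<in> hom V c d \<and> (\<forall>i\<in>I. h \<cdot>\<^bsub>V\<^esub> w (e i) = v i)"
      using e by simp
  qed
  then show ?thesis by blast
qed

text \<open>Every coproduct and coend below reduces to a finite coproduct, and exponentials make products
  distribute over it. The coproducts are assumed for sets of natural numbers, since an assumption
  cannot range over all index types; any finite set is in bijection with such a set.\<close>

locale distributive = cartesian V for V :: "('o, 'a, 'z) cmcat_scheme" (structure) +
  assumes closed: "is_cartesian_closed V"
    and nat_coproducts: "finite (I :: nat set) \<Longrightarrow> \<forall>i\<in>I. X i \<in> Obj V \<Longrightarrow> \<exists>c w. is_coproduct V I X c w"
begin

lemma coproduct_exists:
  assumes "finite I" "\<forall>i\<in>I. X i \<in> Obj V"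
  shows "\<exists>c w. is_coproduct V I X c w"
proof -
  obtain e :: "_ \<Rightarrow> nat" and n where e: "bij_betw e I {..<n}"
    using assms(1) by (metis atLeast0LessThan ex_bij_betw_finite_nat)
  let ?Y = "\<lambda>s. X (inv_into I e s)"
  have "?Y s \<in> Obj V" if "s \<in> {..<n}" for s
    using assms(2) e that by (metis bij_betw_imp_surj_on inv_into_into)
  then have "\<forall>s\<in>{..<n}. ?Y s \<in> Obj V" by blast
  then obtain c w where "is_coproduct V {..<n} ?Y c w"
    using nat_coproducts[of "{..<n}" ?Y] by auto
  then have "is_coproduct V I X c (\<lambda>i. w (e i) \<cdot> Id V (X i))"
  proof (rule coproduct_reindex[OF _ e])
    fix i assume i: "i \<in> I"
    then have "is_iso V (Id V (X i))" using assms(2) by (intro is_isoI[where g = "Id V (X i)"]) simp_all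
    then show "is_iso V (Id V (X i)) \<and> Dom V (Id V (X i)) = X i \<and>
        Cod V (Id V (X i)) = X (inv_into I e (e i))"
      using assms(2) e i by (simp add: bij_betw_def)
  qed
  then show ?thesis by blast
qed

lemma coprod:
  assumes "finite I" "\<forall>i\<in>I. X i \<in> Obj V"
  shows "is_coproduct V I X (coprod V I X) (inj_coprod V I X)"
proof -
  have "\<exists>p. is_coproduct V I X (fst p) (snd p)" using coproduct_exists[OF assms] by auto
  from someI_ex[OF this] show ?thesis
    by (simp add: coprod_def inj_coprod_def coprod_cocone_def)
qed

lemma exponential:
  assumes "b \<in> Obj V" "d \<in> Obj V"
  shows "\<exists>e ev. e \<in> Obj V \<and> ev \<in> hom V (e \<otimes> b) d \<and> (\<forall>a\<in>Obj V. \<forall>f\<in>hom V (a \<otimes> b) d.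
    \<exists>!g. g \<in> hom V a e \<and> ev \<cdot> prod_map V g (Id V b) = f)"
  using closed assms unfolding is_cartesian_closed_def by blast

text \<open>The functor \<open>- \<otimes> b\<close> is a left adjoint, so it preserves coproducts.\<close>

lemma coproduct_prod_right:
  assumes cp: "is_coproduct V I X c w" and b: "b \<in> Obj V"
  shows "is_coproduct V I (\<lambda>i. X i \<otimes> b) (c \<otimes> b) (\<lambda>i. prod_map V (w i) (Id V b))"
proof (rule is_coproductI)
  note cs = coproduct_simps[OF cp]
  fix d v assume d: "d \<in> Obj V" and v: "\<forall>i\<in>I. v i \<in> hom V (X i \<otimes> b) d"
  from exponential[OF b d] obtain e ev where e: "e \<in> Obj V" "ev \<in> hom V (e \<otimes> b) d"
    and g: "\<forall>a\<in>Obj V. \<forall>f\<in>hom V (a \<otimes> b) d. \<exists>!g. g \<in> hom V a e \<and> ev \<cdot> prod_map V g (Id V b) = f"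
    by blast
  have "\<exists>g\<in>hom V (X i) e. ev \<cdot> prod_map V g (Id V b) = v i" if "i \<in> I" for i
    using g v coproduct_index_Obj[OF cp that] that by blast
  then obtain u where u: "\<And>i. i \<in> I \<Longrightarrow> u i \<in> hom V (X i) e"
    "\<And>i. i \<in> I \<Longrightarrow> ev \<cdot> prod_map V (u i) (Id V b) = v i" by metis
  obtain h where h: "h \<in> Arr V" "Dom V h = c" "Cod V h = e" "\<And>i. i \<in> I \<Longrightarrow> h \<cdot> w i = u i"
    using coproduct_desc[OF cp e(1), of u] u(1) by blast
  have "(ev \<cdot> prod_map V h (Id V b)) \<cdot> prod_map V (w i) (Id V b) = v i" if i: "i \<in> I" for i
  proof -
    have "(ev \<cdot> prod_map V h (Id V b)) \<cdot> prod_map V (w i) (Id V b)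
      = ev \<cdot> prod_map V (h \<cdot> w i) (Id V b)"
      using e h(1-3) cs b i by (simp add: hom_iff)
    then show ?thesis using h(4) u(2) i by simp
  qed
  then show "\<exists>h\<in>hom V (c \<otimes> b) d. \<forall>i\<in>I. h \<cdot> prod_map V (w i) (Id V b) = v i"
    using e h b by (intro bexI[of _ "ev \<cdot> prod_map V h (Id V b)"]) (auto simp: hom_iff)
next
  note cs = coproduct_simps[OF cp]
  fix h k assume a: "h \<in> Arr V" "k \<in> Arr V" "Dom V h = c \<otimes> b" "Dom V k = c \<otimes> b" "Cod V h = Cod V k"
    "\<forall>i\<in>I. h \<cdot> prod_map V (w i) (Id V b) = k \<cdot> prod_map V (w i) (Id V b)"
  have "Cod V k \<in> Obj V" using a by simp
  from exponential[OF b this] obtain e ev where e: "e \<in> Obj V" "ev \<in> hom V (e \<otimes> b) (Cod V k)"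
    and g: "\<forall>a\<in>Obj V. \<forall>f\<in>hom V (a \<otimes> b) (Cod V k).
      \<exists>!g. g \<in> hom V a e \<and> ev \<cdot> prod_map V g (Id V b) = f" by blast
  have hk: "h \<in> hom V (c \<otimes> b) (Cod V k)" "k \<in> hom V (c \<otimes> b) (Cod V k)"
    using a by (auto simp: hom_iff)
  obtain h' where h': "h' \<in> hom V c e" "ev \<cdot> prod_map V h' (Id V b) = h"
    using g cs(1) hk(1) by blast
  obtain k' where k': "k' \<in> hom V c e" "ev \<cdot> prod_map V k' (Id V b) = k"
    using g cs(1) hk(2) by blast
  have "h' = k'"
  proof (rule coproduct_ext[OF cp])
    fix i assume i: "i \<in> I"
    have "ev \<cdot> prod_map V (h' \<cdot> w i) (Id V b) = h \<cdot> prod_map V (w i) (Id V b)"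
      unfolding h'(2)[symmetric] using h'(1) e b cs i by (simp add: hom_iff)
    moreover have "ev \<cdot> prod_map V (k' \<cdot> w i) (Id V b) = k \<cdot> prod_map V (w i) (Id V b)"
      unfolding k'(2)[symmetric] using k'(1) e b cs i by (simp add: hom_iff)
    moreover have "h' \<cdot> w i \<in> hom V (X i) e" "k' \<cdot> w i \<in> hom V (X i) e"
      using h'(1) k'(1) cs i by (auto simp: hom_iff)
    moreover have "k \<cdot> prod_map V (w i) (Id V b) \<in> hom V (X i \<otimes> b) (Cod V k)"
      using a cs i b by (auto simp: hom_iff)
    then have "\<exists>!g. g \<in> hom V (X i) e \<and> ev \<cdot> prod_map V g (Id V b) = k \<cdot> prod_map V (w i) (Id V b)"
      using g coproduct_index_Obj[OF cp i] by blast
    moreover have "h \<cdot> prod_map V (w i) (Id V b) = k \<cdot> prod_map V (w i) (Id V b)" using a(6) i by blast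
    ultimately show "h' \<cdot> w i = k' \<cdot> w i" by (metis (no_types, lifting))
  qed (use h' k' in \<open>auto simp: hom_iff\<close>)
  with h' k' show "h = k" by simp
qed (use coproduct_simps[OF cp] b in \<open>auto simp: hom_iff\<close>)

lemma is_iso_swap:
  assumes "a \<in> Obj V" "b \<in> Obj V"
  shows "is_iso V (pair V (Snd V a b) (Fst V a b))"
  by (rule is_isoI[where g = "pair V (Snd V b a) (Fst V b a)"]) (use assms in auto)

text \<open>By symmetry \<open>b \<otimes> -\<close> preserves coproducts as well, so the double coproduct can be taken in two
  steps.\<close>

lemma coproduct_prod:
  assumes cp: "is_coproduct V I X c w" and cp': "is_coproduct V J Y d u"
  shows "is_coproduct V (I \<times> J) (\<lambda>(i, j). X i \<otimes> Y j) (c \<otimes> d) (\<lambda>(i, j). prod_map V (w i) (u j))"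
proof -
  note cs = coproduct_simps[OF cp] coproduct_simps[OF cp']
  have left: "is_coproduct V J (\<lambda>j. b \<otimes> Y j) (b \<otimes> d) (\<lambda>j. prod_map V (Id V b) (u j))"
    if b: "b \<in> Obj V" for b
  proof -
    have Y: "Y j \<in> Obj V" if "j \<in> J" for j using coproduct_index_Obj[OF cp' that] .
    from coproduct_iso[OF coproduct_prod_right[OF cp' b] is_iso_swap[of d b]] b cs
    have "is_coproduct V J (\<lambda>j. Y j \<otimes> b) (b \<otimes> d)
       (\<lambda>j. pair V (Snd V d b) (Fst V d b) \<cdot> prod_map V (u j) (Id V b))" by simp
    from coproduct_reindex[OF this bij_betw_id, of "\<lambda>j. pair V (Snd V b (Y j)) (Fst V b (Y j))" "\<lambda>j. b \<otimes> Y j"]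
    have "is_coproduct V J (\<lambda>j. b \<otimes> Y j) (b \<otimes> d)
       (\<lambda>j. (pair V (Snd V d b) (Fst V d b) \<cdot> prod_map V (u j) (Id V b)) \<cdot>
         pair V (Snd V b (Y j)) (Fst V b (Y j)))"
      using b Y is_iso_swap by simp
    moreover have "(pair V (Snd V d b) (Fst V d b) \<cdot> prod_map V (u j) (Id V b)) \<cdot>
         pair V (Snd V b (Y j)) (Fst V b (Y j)) = prod_map V (Id V b) (u j)" if "j \<in> J" for j
      using b Y cs that by (simp add: prod_map_def)
    ultimately show ?thesis by (auto simp: is_coproduct_def)
  qed
  have X: "X i \<in> Obj V" if "i \<in> I" for i using coproduct_index_Obj[OF cp that] .
  have "is_coproduct V (I \<times> J) (\<lambda>(i, j). X i \<otimes> Y j) (c \<otimes> d)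
     (\<lambda>(i, j). prod_map V (w i) (Id V d) \<cdot> prod_map V (Id V (X i)) (u j))"
    by (rule coproduct_Sigma[OF coproduct_prod_right[OF cp cs(5)]]) (rule left, rule X)
  moreover have "prod_map V (w i) (Id V d) \<cdot> prod_map V (Id V (X i)) (u j) = prod_map V (w i) (u j)"
    if "i \<in> I" "j \<in> J" for i j using cs X that by simp
  ultimately show ?thesis by (auto simp: is_coproduct_def)
qed

end

lemma distributiveI:
  fixes V :: "('o, 'a, 'z) cmcat_scheme"
  assumes "infinite (UNIV :: 's set)" "is_cartesian_closed V" "cocomplete_cat TYPE('s) V"
  shows "distributive V"
proof
  show V: "is_cartesian V" using assms(2) by (simp add: is_cartesian_closed_def)
  show "\<exists>c w. is_coproduct V I X c w" if "finite I" "\<forall>i\<in>I. X i \<in> Obj V" for I :: "nat set" and X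
    using finite_coproduct_exists[OF V assms(1,3) that] .
qed (rule assms(2))


section \<open>Based maps and order-preserving relabelling\<close>

text \<open>The rank of \<open>a\<close> in \<open>A\<close>, counted from \<open>1\<close>, because \<open>{1..n}\<close> is the complement of the base point in
  the object \<open>n\<close> of \<open>\<F>\<close>.\<close>

definition rank :: "nat set \<Rightarrow> nat \<Rightarrow> nat" where
  "rank A a = card {x \<in> A. x \<le> a}"

definition unrank :: "nat set \<Rightarrow> nat \<Rightarrow> nat" where
  "unrank A = inv_into A (rank A)"

lemma rank_less:
  assumes "finite A" "b \<in> A" "a < b"
  shows "rank A a < rank A b"
proof -
  have "b \<in> {x \<in> A. x \<le> b} - {x \<in> A. x \<le> a}" using assms by auto
  moreover have "{x \<in> A. x \<le> a} \<subseteq> {x \<in> A. x \<le> b}" using assms(3) by auto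
  ultimately have "{x \<in> A. x \<le> a} \<subset> {x \<in> A. x \<le> b}" by blast
  then show ?thesis unfolding rank_def using assms(1) by (intro psubset_card_mono) simp_all
qed

lemma rank_less_iff: "finite A \<Longrightarrow> a \<in> A \<Longrightarrow> b \<in> A \<Longrightarrow> rank A a < rank A b \<longleftrightarrow> a < b"
  using rank_less by (metis less_asym linorder_neqE_nat)

lemma strict_mono_on_rank: "finite A \<Longrightarrow> strict_mono_on A (rank A)"
  by (simp add: strict_mono_on_def rank_less)

lemma rank_bij: "finite A \<Longrightarrow> bij_betw (rank A) A {1..card A}"
proof -
  assume A: "finite A"
  have i: "inj_on (rank A) A"
    using rank_less_iff[OF A] by (metis inj_onI less_irrefl linorder_neqE_nat)
  have "rank A a \<in> {1..card A}" if "a \<in> A" for a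
  proof -
    have "{x \<in> A. x \<le> a} \<noteq> {}" "finite {x \<in> A. x \<le> a}" using that A by auto
    then have "rank A a \<noteq> 0" unfolding rank_def by (metis card_eq_0_iff)
    moreover have "rank A a \<le> card A" unfolding rank_def using A by (intro card_mono) auto
    ultimately show ?thesis by auto
  qed
  then have "rank A ` A = {1..card A}"
    using A i by (intro card_subset_eq) (auto simp: card_image)
  with i show ?thesis by (simp add: bij_betw_def)
qed

lemma rank_range: "finite A \<Longrightarrow> a \<in> A \<Longrightarrow> 1 \<le> rank A a \<and> rank A a \<le> card A"
  using rank_bij by (fastforce simp: bij_betw_def)

lemma rank_inj: "finite A \<Longrightarrow> a \<in> A \<Longrightarrow> b \<in> A \<Longrightarrow> rank A a = rank A b \<longleftrightarrow> a = b"
  using rank_bij by (fastforce simp: bij_betw_def inj_on_def)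

lemma rank_image: "finite A \<Longrightarrow> rank A ` A = {1..card A}"
  using rank_bij by (auto simp: bij_betw_def)

lemma unrank_rank [simp]: "finite A \<Longrightarrow> a \<in> A \<Longrightarrow> unrank A (rank A a) = a"
  unfolding unrank_def using rank_bij by (simp add: bij_betw_def)

lemma
  assumes "finite A" "1 \<le> r" "r \<le> card A"
  shows unrank_mem [simp]: "unrank A r \<in> A" and rank_unrank [simp]: "rank A (unrank A r) = r"
proof -
  have "r \<in> rank A ` A" using rank_image assms by auto
  then show "unrank A r \<in> A" "rank A (unrank A r) = r"
    unfolding unrank_def by (auto simp: inv_into_into f_inv_into_f)
qed

lemma rank_strict_mono_image:
  assumes "strict_mono_on A p" "a \<in> A"
  shows "rank (p ` A) (p a) = rank A a"
proof -
  have le: "p x \<le> p a \<longleftrightarrow> x \<le> a" if "x \<in> A" for x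
    using strict_mono_onD[OF assms(1) that assms(2)] strict_mono_onD[OF assms(1) assms(2) that]
    by (cases x a rule: linorder_cases) auto
  have "{x \<in> p ` A. x \<le> p a} = p ` {x \<in> A. x \<le> a}"
    using le by auto
  moreover have "inj_on p {x \<in> A. x \<le> a}"
    using strict_mono_on_imp_inj_on[OF assms(1)] by (rule inj_on_subset) auto
  ultimately show ?thesis by (simp add: rank_def card_image)
qed

lemma rank_interval: "j < i \<Longrightarrow> i \<le> j + n \<Longrightarrow> rank {Suc j..j + n} i = i - j"
proof -
  assume "j < i" "i \<le> j + n"
  then have "{x \<in> {Suc j..j + n}. x \<le> i} = {Suc j..i}" by auto
  then show ?thesis by (simp add: rank_def)
qed

lemma rank_initial [simp]: "i \<le> n \<Longrightarrow> rank {Suc 0..n} i = i"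
  using rank_interval[of 0 i n] by (cases "i = 0") (auto simp: rank_def)

lemma sorted_list_of_set_eq_unrank: "finite A \<Longrightarrow> sorted_list_of_set A = map (unrank A) [1..<Suc (card A)]"
proof -
  assume A: "finite A"
  have "sorted_wrt (<) (map (unrank A) [1..<Suc (card A)])"
    unfolding sorted_wrt_map
  proof (rule sorted_wrt_mono_rel[rotated])
    show "sorted_wrt (<) [1..<Suc (card A)]" by (rule sorted_wrt_upt)
    fix x y assume "x \<in> set [1..<Suc (card A)]" "y \<in> set [1..<Suc (card A)]" "x < y"
    then show "unrank A x < unrank A y" using A rank_less_iff[OF A unrank_mem unrank_mem, of x y] by auto
  qed
  moreover have "set (map (unrank A) [1..<Suc (card A)]) = A"
  proof -
    have "unrank A ` {1..card A} = A" unfolding rank_image[OF A, symmetric] image_image using A by simp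
    then show ?thesis by (simp add: atLeastLessThanSuc_atLeastAtMost del: upt_Suc)
  qed
  ultimately show ?thesis
    using A by (metis sorted_list_of_set.sorted_key_list_of_set_unique strict_sorted_equal
        sorted_list_of_set.set_sorted_key_list_of_set sorted_list_of_set.strict_sorted_key_list_of_set)
qed

subsection \<open>The categories of based maps\<close>

definition based_map :: "nat \<Rightarrow> nat \<Rightarrow> (nat \<Rightarrow> nat) \<Rightarrow> bmap" where
  "based_map m n f = (m, n, restrict (\<lambda>i. if i = 0 then 0 else f i) {0..m})"

lemma based_map_simps [simp]:
  "src (based_map m n f) = m" "tgt (based_map m n f) = n" "fn (based_map m n f) 0 = 0"
  "1 \<le> i \<Longrightarrow> i \<le> m \<Longrightarrow> fn (based_map m n f) i = f i"
  by (auto simp: based_map_def src_def tgt_def fn_def)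

lemma based_map_F_arr: "(\<And>i. 1 \<le> i \<Longrightarrow> i \<le> m \<Longrightarrow> f i \<le> n) \<Longrightarrow> based_map m n f \<in> F_arr"
  by (auto simp: F_arr_def based_map_def src_def tgt_def fn_def PiE_iff)

lemma F_arr_0 [simp]: "\<phi> \<in> F_arr \<Longrightarrow> fn \<phi> 0 = 0"
  by (auto simp: F_arr_def)

lemma F_arr_le [simp]:
  assumes "\<phi> \<in> F_arr" "i \<le> src \<phi>"
  shows "fn \<phi> i \<le> tgt \<phi>"
proof -
  have "fn \<phi> \<in> {0..src \<phi>} \<rightarrow>\<^sub>E {0..tgt \<phi>}" using assms(1) unfolding F_arr_def by blast
  from PiE_mem[OF this, of i] assms(2) show ?thesis by simp
qed

lemma F_arr_undefined:
  assumes "\<phi> \<in> F_arr" "\<not> i \<le> src \<phi>"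
  shows "fn \<phi> i = undefined"
proof -
  have "fn \<phi> \<in> {0..src \<phi>} \<rightarrow>\<^sub>E {0..tgt \<phi>}" using assms(1) unfolding F_arr_def by blast
  from PiE_arb[OF this, of i] assms(2) show ?thesis by simp
qed

lemma F_arrI:
  assumes "fn \<phi> 0 = 0" "\<And>i. i \<le> src \<phi> \<Longrightarrow> fn \<phi> i \<le> tgt \<phi>"
    "\<And>i. \<not> i \<le> src \<phi> \<Longrightarrow> fn \<phi> i = undefined"
  shows "\<phi> \<in> F_arr"
  unfolding F_arr_def using assms by (simp add: PiE_iff extensional_def)

text \<open>The value at the base point is forced, and outside the domain all values are undefined.\<close>

lemma bmap_eqI:
  assumes "\<phi> \<in> F_arr" "\<psi> \<in> F_arr" "src \<phi> = src \<psi>" "tgt \<phi> = tgt \<psi>"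
    "\<And>i. 1 \<le> i \<Longrightarrow> i \<le> src \<psi> \<Longrightarrow> fn \<phi> i = fn \<psi> i"
  shows "\<phi> = \<psi>"
proof -
  have "fn \<phi> i = fn \<psi> i" for i
  proof (cases "i \<le> src \<psi>")
    case True
    then show ?thesis using assms by (cases "i = 0") auto
  next
    case False
    then show ?thesis using assms(1-3) by (simp add: F_arr_undefined)
  qed
  then show ?thesis using assms(3,4) by (auto simp: src_def tgt_def fn_def prod_eq_iff)
qed

lemma cat_simps [simp]:
  "Obj F_cat = UNIV" "Arr F_cat = F_arr" "Dom F_cat = src" "Cod F_cat = tgt"
  "Obj Fpos_cat = UNIV" "Dom Fpos_cat = src" "Cod Fpos_cat = tgt"
  "Id Fpos_cat = Id F_cat" "Comp Fpos_cat = Comp F_cat"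
  "Obj Lambda_cat = UNIV" "Dom Lambda_cat = src" "Cod Lambda_cat = tgt"
  "Id Lambda_cat = Id F_cat" "Comp Lambda_cat = Comp F_cat"
  by (auto simp: F_cat_def Fpos_cat_def Lambda_cat_def)

abbreviation F_compose :: "bmap \<Rightarrow> bmap \<Rightarrow> bmap" (infixr "\<odot>" 70) where
  "\<psi> \<odot> \<phi> \<equiv> \<psi> \<cdot>\<^bsub>F_cat\<^esub> \<phi>"

lemma F_comp_simps [simp]:
  "src (\<psi> \<odot> \<phi>) = src \<phi>" "tgt (\<psi> \<odot> \<phi>) = tgt \<psi>"
  "i \<le> src \<phi> \<Longrightarrow> fn (\<psi> \<odot> \<phi>) i = fn \<psi> (fn \<phi> i)"
  by (auto simp: F_cat_def src_def tgt_def fn_def)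

lemma F_Id_simps [simp]:
  "src (Id F_cat n) = n" "tgt (Id F_cat n) = n" "i \<le> n \<Longrightarrow> fn (Id F_cat n) i = i"
  by (auto simp: F_cat_def src_def tgt_def fn_def)

lemma F_Id [simp]: "Id F_cat n \<in> F_arr"
  by (intro F_arrI) (auto simp: F_cat_def src_def tgt_def fn_def)

lemma F_comp [simp]:
  assumes "\<phi> \<in> F_arr" "\<psi> \<in> F_arr" "tgt \<phi> = src \<psi>"
  shows "\<psi> \<odot> \<phi> \<in> F_arr"
proof -
  have "fn \<phi> i \<le> src \<psi>" if "i \<le> src \<phi>" for i using F_arr_le[OF assms(1) that] assms(3) by simp
  moreover have "fn \<phi> 0 = 0" "fn \<psi> 0 = 0" using assms by auto
  moreover have "fn \<psi> i \<le> tgt \<psi>" if "i \<le> src \<psi>" for i using assms(2) that by simp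
  ultimately show ?thesis
    using assms by (intro F_arrI) (auto simp: F_cat_def src_def tgt_def fn_def)
qed

lemma F_assoc:
  assumes "\<phi> \<in> F_arr" "\<psi> \<in> F_arr" "\<chi> \<in> F_arr" "tgt \<phi> = src \<psi>" "tgt \<psi> = src \<chi>"
  shows "(\<chi> \<odot> \<psi>) \<odot> \<phi> = \<chi> \<odot> \<psi> \<odot> \<phi>"
  using assms F_arr_le[OF assms(1)] by (intro bmap_eqI) auto

lemma F_Id_comp [simp]: "\<phi> \<in> F_arr \<Longrightarrow> tgt \<phi> = n \<Longrightarrow> Id F_cat n \<odot> \<phi> = \<phi>"
  using F_arr_le[of \<phi>] by (intro bmap_eqI) auto

lemma F_comp_Id [simp]: "\<phi> \<in> F_arr \<Longrightarrow> src \<phi> = n \<Longrightarrow> \<phi> \<odot> Id F_cat n = \<phi>"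
  by (intro bmap_eqI) auto

lemma Lambda_arr_iff: "l \<in> Arr Lambda_cat \<longleftrightarrow> l \<in> F_arr \<and> inj_on (fn l) {0..src l}"
  by (auto simp: Lambda_cat_def)

lemma Fpos_arr_iff: "\<phi> \<in> Arr Fpos_cat \<longleftrightarrow> \<phi> \<in> F_arr \<and> (\<forall>i. 1 \<le> i \<longrightarrow> i \<le> src \<phi> \<longrightarrow> 1 \<le> fn \<phi> i)"
  by (auto simp: Fpos_cat_def Suc_le_eq)

lemma hom_F_iff: "\<phi> \<in> hom F_cat m n \<longleftrightarrow> \<phi> \<in> F_arr \<and> src \<phi> = m \<and> tgt \<phi> = n"
  and hom_Fpos_iff: "\<phi> \<in> hom Fpos_cat m n \<longleftrightarrow> \<phi> \<in> Arr Fpos_cat \<and> src \<phi> = m \<and> tgt \<phi> = n"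
  and hom_Lambda_iff: "\<phi> \<in> hom Lambda_cat m n \<longleftrightarrow> \<phi> \<in> Arr Lambda_cat \<and> src \<phi> = m \<and> tgt \<phi> = n"
  by (auto simp: hom_def)

lemma Lambda_F [simp]: "l \<in> Arr Lambda_cat \<Longrightarrow> l \<in> F_arr"
  unfolding Lambda_arr_iff by blast

lemma Fpos_F [simp]: "l \<in> Arr Fpos_cat \<Longrightarrow> l \<in> F_arr"
  unfolding Fpos_arr_iff by blast

lemma LambdaI:
  "l \<in> F_arr \<Longrightarrow> (\<And>i j. i \<le> src l \<Longrightarrow> j \<le> src l \<Longrightarrow> fn l i = fn l j \<Longrightarrow> i = j) \<Longrightarrow> l \<in> Arr Lambda_cat"
  unfolding Lambda_arr_iff inj_on_def by auto

lemma FposI: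
  "\<phi> \<in> F_arr \<Longrightarrow> (\<And>i. 1 \<le> i \<Longrightarrow> i \<le> src \<phi> \<Longrightarrow> 1 \<le> fn \<phi> i) \<Longrightarrow> \<phi> \<in> Arr Fpos_cat"
  unfolding Fpos_arr_iff by blast

lemma Fpos_pos [simp]: "\<phi> \<in> Arr Fpos_cat \<Longrightarrow> 1 \<le> i \<Longrightarrow> i \<le> src \<phi> \<Longrightarrow> Suc 0 \<le> fn \<phi> i"
  unfolding Fpos_arr_iff by simp

lemma Lambda_inj:
  "l \<in> Arr Lambda_cat \<Longrightarrow> i \<le> src l \<Longrightarrow> j \<le> src l \<Longrightarrow> fn l i = fn l j \<longleftrightarrow> i = j"
  unfolding Lambda_arr_iff inj_on_def by auto

lemma Lambda_pos [simp]: "l \<in> Arr Lambda_cat \<Longrightarrow> 1 \<le> i \<Longrightarrow> i \<le> src l \<Longrightarrow> Suc 0 \<le> fn l i"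
  using Lambda_inj[of l i 0] by (cases "fn l i") auto

lemma Lambda_Fpos: "l \<in> Arr Lambda_cat \<Longrightarrow> l \<in> Arr Fpos_cat"
  by (rule FposI) simp_all

lemma Lambda_Id [simp]: "Id F_cat n \<in> Arr Lambda_cat"
  by (rule LambdaI) simp_all

lemma Lambda_comp [simp]:
  assumes "k \<in> Arr Lambda_cat" "l \<in> Arr Lambda_cat" "tgt k = src l"
  shows "l \<odot> k \<in> Arr Lambda_cat"
proof -
  have "fn k i \<le> src l" if "i \<le> src k" for i
    using F_arr_le[OF Lambda_F[OF assms(1)] that] assms(3) by simp
  with assms show ?thesis by (intro LambdaI) (simp_all add: Lambda_inj)
qed

lemma Fpos_comp [simp]:
  assumes "k \<in> Arr Fpos_cat" "l \<in> Arr Fpos_cat" "tgt k = src l"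
  shows "l \<odot> k \<in> Arr Fpos_cat"
proof -
  have "fn k i \<le> src l" if "i \<le> src k" for i
    using F_arr_le[OF Fpos_F[OF assms(1)] that] assms(3) by simp
  with assms show ?thesis by (intro FposI) simp_all
qed

lemma based_map_Lambda:
  assumes "inj_on f {1..m}" "\<And>i. 1 \<le> i \<Longrightarrow> i \<le> m \<Longrightarrow> 1 \<le> f i \<and> f i \<le> n"
  shows "based_map m n f \<in> Arr Lambda_cat"
proof -
  have "fn (based_map m n f) i = fn (based_map m n f) j \<longleftrightarrow> i = j" if "i \<le> m" "j \<le> m" for i j
    using assms(2)[of i] assms(2)[of j] that inj_onD[OF assms(1), of i j]
    by (cases "i = 0"; cases "j = 0") auto
  then show ?thesis using assms(2) by (intro LambdaI based_map_F_arr) simp_all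
qed

lemma finite_hom_F [simp]: "finite (hom F_cat m n)"
proof (rule finite_subset)
  show "hom F_cat m n \<subseteq> (\<lambda>f. (m, n, f)) ` ({0..m} \<rightarrow>\<^sub>E {0..n})"
  proof
    fix \<phi> assume "\<phi> \<in> hom F_cat m n"
    then have \<phi>: "\<phi> \<in> F_arr" "src \<phi> = m" "tgt \<phi> = n" by (simp_all add: hom_F_iff)
    have "\<phi> = (m, n, fn \<phi>)" using \<phi>(2,3) by (auto simp: src_def tgt_def fn_def)
    moreover have "fn \<phi> \<in> {0..m} \<rightarrow>\<^sub>E {0..n}" using \<phi> unfolding F_arr_def by blast
    ultimately show "\<phi> \<in> (\<lambda>f. (m, n, f)) ` ({0..m} \<rightarrow>\<^sub>E {0..n})" by blast
  qed
qed (auto intro: finite_PiE)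

lemma finite_hom_Lambda [simp]: "finite (hom Lambda_cat m n)"
  by (rule finite_subset[OF _ finite_hom_F[of m n]]) (auto simp: hom_F_iff hom_Lambda_iff)

subsection \<open>Standardisation of injections between finite sets\<close>

text \<open>An injection \<open>f : A \<rightarrow> B\<close> of finite sets, read as an arrow \<open>|A| \<rightarrow> |B|\<close> of \<open>\<Lambda>\<close> through the increasing
  enumerations. In this way a functor on \<open>\<Lambda>\<close> extends to finite sets of numbers and injections.\<close>

definition std :: "nat set \<Rightarrow> nat set \<Rightarrow> (nat \<Rightarrow> nat) \<Rightarrow> bmap" where
  "std A B f = based_map (card A) (card B) (\<lambda>r. rank B (f (unrank A r)))"

lemma std_simps [simp]: "src (std A B f) = card A" "tgt (std A B f) = card B"
  by (simp_all add: std_def)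

lemma fn_std:
  assumes "finite A" "a \<in> A"
  shows "fn (std A B f) (rank A a) = rank B (f a)"
  unfolding std_def using assms rank_range[OF assms] by simp

lemma std_Lambda:
  assumes "finite A" "finite B" "inj_on f A" "f ` A \<subseteq> B"
  shows "std A B f \<in> Arr Lambda_cat"
  unfolding std_def
proof (rule based_map_Lambda)
  have "f (unrank A r) \<in> B" if "1 \<le> r" "r \<le> card A" for r using assms that by auto
  then show "1 \<le> rank B (f (unrank A i)) \<and> rank B (f (unrank A i)) \<le> card B" if "1 \<le> i" "i \<le> card A" for i
    using rank_range[OF assms(2)] that by simp
  show "inj_on (\<lambda>r. rank B (f (unrank A r))) {1..card A}"
  proof (rule inj_onI)
    fix r s assume rs: "r \<in> {1..card A}" "s \<in> {1..card A}" "rank B (f (unrank A r)) = rank B (f (unrank A s))"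
    then have e: "unrank A r \<in> A" "unrank A s \<in> A" using assms(1) by auto
    then have "f (unrank A r) = f (unrank A s)" using rs(3) assms rank_inj[OF assms(2)] by blast
    then have "unrank A r = unrank A s" using e assms(3) by (auto dest: inj_onD)
    then have "rank A (unrank A r) = rank A (unrank A s)" by simp
    then show "r = s" using rs assms(1) by simp
  qed
qed

lemma std_eqI:
  assumes "finite A" "finite B" "f ` A \<subseteq> B" "g \<in> F_arr" "src g = card A" "tgt g = card B"
    "\<And>a. a \<in> A \<Longrightarrow> fn g (rank A a) = rank B (f a)"
  shows "std A B f = g"
proof (rule bmap_eqI)
  have "f (unrank A r) \<in> B" if "1 \<le> r" "r \<le> card A" for r using assms that by auto
  then show "std A B f \<in> F_arr" unfolding std_def
    using rank_range[OF assms(2)] by (intro based_map_F_arr) simp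
  fix i assume i: "1 \<le> i" "i \<le> src g"
  then have "unrank A i \<in> A" "rank A (unrank A i) = i" using assms by auto
  then show "fn (std A B f) i = fn g i"
    using fn_std[OF assms(1), of "unrank A i" B f] assms(7)[of "unrank A i"] by simp
qed (use assms in auto)

text \<open>Ranks are not changed by order-preserving relabellings \<open>p\<close> and \<open>q\<close>, so neither is the standardisation.\<close>

lemma std_relabel:
  assumes "finite A" "finite B" "f ` A \<subseteq> B" "inj_on f A"
    and "strict_mono_on A p" "strict_mono_on B q" "\<And>a. a \<in> A \<Longrightarrow> f' (p a) = q (f a)"
  shows "std (p ` A) (q ` B) f' = std A B f"
proof (rule std_eqI)
  show "src (std A B f) = card (p ` A)" "tgt (std A B f) = card (q ` B)"
    using assms(5,6) by (simp_all add: card_image strict_mono_on_imp_inj_on)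
  show "std A B f \<in> F_arr" using std_Lambda[OF assms(1,2,4,3)] by simp
  fix a assume "a \<in> p ` A"
  then obtain b where b: "b \<in> A" "a = p b" by auto
  then have "f b \<in> B" using assms(3) by auto
  then show "fn (std A B f) (rank (p ` A) a) = rank (q ` B) (f' a)"
    using b assms by (simp add: rank_strict_mono_image fn_std)
qed (use assms in auto)

lemma std_comp:
  assumes "finite A" "finite B" "finite C" "f ` A \<subseteq> B" "inj_on f A" "g ` B \<subseteq> C" "inj_on g B"
    and "\<And>a. a \<in> A \<Longrightarrow> h a = g (f a)"
  shows "std A C h = std B C g \<odot> std A B f"
proof (rule std_eqI)
  have "std A B f \<in> F_arr" "std B C g \<in> F_arr"
    using assms std_Lambda by simp_all
  then show "std B C g \<odot> std A B f \<in> F_arr" by simp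
  fix a assume a: "a \<in> A"
  then have "f a \<in> B" using assms(4) by auto
  then show "fn (std B C g \<odot> std A B f) (rank A a) = rank C (h a)"
    using a assms rank_range[OF assms(1) a] by (simp add: fn_std)
qed (use assms in auto)

text \<open>The preimage of \<open>S\<close> without the base point, and the restriction \<open>l\<^sup>-\<^sup>1(S) \<rightarrow> S\<close> of \<open>l\<close> as an arrow of \<open>\<Lambda>\<close>.\<close>

definition preim :: "bmap \<Rightarrow> nat set \<Rightarrow> nat set" where
  "preim l S = {i \<in> {1..src l}. fn l i \<in> S}"

definition restr :: "bmap \<Rightarrow> nat set \<Rightarrow> bmap" where
  "restr l S = std (preim l S) S (fn l)"

lemma finite_pre [simp]: "finite (preim l S)"
  by (simp add: preim_def)

lemma preim_subset: "preim l S \<subseteq> {1..src l}"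
  by (auto simp: preim_def)

lemma restr_simps [simp]: "src (restr l S) = card (preim l S)" "tgt (restr l S) = card S"
  by (simp_all add: restr_def)

lemma preim_inj: "l \<in> Arr Lambda_cat \<Longrightarrow> inj_on (fn l) (preim l S)"
  by (rule inj_onI) (simp add: preim_def Lambda_inj)

lemma preim_image: "fn l ` preim l S \<subseteq> S"
  by (auto simp: preim_def)

lemma restr_Lambda [simp]: "l \<in> Arr Lambda_cat \<Longrightarrow> finite S \<Longrightarrow> restr l S \<in> Arr Lambda_cat"
  unfolding restr_def by (intro std_Lambda finite_pre preim_inj preim_image)

lemma preim_comp:
  assumes "k \<in> Arr Lambda_cat" "tgt k = src l"
  shows "preim (l \<odot> k) S = preim k (preim l S)"
proof -
  have "fn k i \<le> src l" if "i \<le> src k" for i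
    using F_arr_le[OF Lambda_F[OF assms(1)] that] assms(2) by simp
  moreover have "Suc 0 \<le> fn k i" if "Suc 0 \<le> i" "i \<le> src k" for i
    using assms(1) that by simp
  ultimately show ?thesis by (auto simp: preim_def)
qed

lemma restr_comp:
  assumes "k \<in> Arr Lambda_cat" "l \<in> Arr Lambda_cat" "tgt k = src l" "finite S"
  shows "restr (l \<odot> k) S = restr l S \<odot> restr k (preim l S)"
  unfolding restr_def preim_comp[OF assms(1,3)]
proof (rule std_comp)
  show "fn k ` preim k (preim l S) \<subseteq> preim l S" "fn l ` preim l S \<subseteq> S"
    by (rule preim_image)+
  show "inj_on (fn k) (preim k (preim l S))" "inj_on (fn l) (preim l S)"
    using assms by (simp_all add: preim_inj)
  show "fn (l \<odot> k) a = fn l (fn k a)" if "a \<in> preim k (preim l S)" for a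
    using that by (simp add: preim_def)
qed (use assms in simp_all)

lemma preim_Id [simp]: "S \<subseteq> {1..n} \<Longrightarrow> preim (Id F_cat n) S = S"
  by (auto simp: preim_def)

lemma restr_Id [simp]: "S \<subseteq> {1..n} \<Longrightarrow> restr (Id F_cat n) S = Id F_cat (card S)"
  unfolding restr_def
proof (rule std_eqI)
  assume S: "S \<subseteq> {1..n}"
  then have fS: "finite S" by (auto intro: finite_subset)
  then show "finite S" "finite (preim (Id F_cat n) S)" by auto
  fix a assume "a \<in> preim (Id F_cat n) S"
  then show "fn (Id F_cat (card S)) (rank (preim (Id F_cat n) S) a) = rank S (fn (Id F_cat n) a)"
    using S rank_range[OF fS, of a] by (auto simp: subset_iff)
qed (use preim_image in auto)

lemma preim_compl:
  assumes "l \<in> Arr Lambda_cat"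
  shows "preim l ({1..tgt l} - S) = {1..src l} - preim l S"
proof -
  have "fn l i \<le> tgt l" "Suc 0 \<le> fn l i" if "Suc 0 \<le> i" "i \<le> src l" for i
    using assms that by simp_all
  then show ?thesis by (auto simp: preim_def)
qed

text \<open>The restriction of \<open>l\<close> to the preimage of \<open>B\<close> may be formed inside the standardised
  restriction to a larger set \<open>S\<close>.\<close>

lemma preim_restr:
  assumes "l \<in> Arr Lambda_cat" "finite S" "B \<subseteq> S"
  shows "preim (restr l S) (rank S ` B) = rank (preim l S) ` preim l B"
proof -
  have B: "rank S (fn l a) \<in> rank S ` B \<longleftrightarrow> fn l a \<in> B" if "a \<in> preim l S" for a
    using that assms rank_inj[OF assms(2)] preim_image[of l S] by (auto simp: image_iff subset_iff)
  have f: "fn (restr l S) (rank (preim l S) a) = rank S (fn l a)" if "a \<in> preim l S" for a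
    unfolding restr_def using that by (simp add: fn_std)
  have BF: "fn (restr l S) (rank (preim l S) a) \<in> rank S ` B \<longleftrightarrow> fn l a \<in> B" if "a \<in> preim l S" for a
    unfolding f[OF that] by (rule B[OF that])
  have "preim (restr l S) (rank S ` B) = {r \<in> rank (preim l S) ` preim l S. fn (restr l S) r \<in> rank S ` B}"
    by (simp add: preim_def[of "restr l S"] rank_image)
  also have "\<dots> = rank (preim l S) ` {a \<in> preim l S. fn (restr l S) (rank (preim l S) a) \<in> rank S ` B}"
    by blast
  also have "\<dots> = rank (preim l S) ` {a \<in> preim l S. fn l a \<in> B}"
    using BF by blast
  also have "{a \<in> preim l S. fn l a \<in> B} = preim l B"
    using assms(3) by (auto simp: preim_def)
  finally show ?thesis .
qed

lemma restr_restr: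
  assumes "l \<in> Arr Lambda_cat" "finite S" "B \<subseteq> S"
  shows "restr (restr l S) (rank S ` B) = restr l B"
  unfolding restr_def[of "restr l S"] preim_restr[OF assms] unfolding restr_def[of l B]
proof (rule std_relabel)
  have sub: "preim l B \<subseteq> preim l S" using assms(3) by (auto simp: preim_def)
  show "strict_mono_on (preim l B) (rank (preim l S))" "strict_mono_on B (rank S)"
    using monotone_on_subset[OF strict_mono_on_rank sub] monotone_on_subset[OF strict_mono_on_rank assms(3)]
      assms(2) by simp_all
  fix a assume "a \<in> preim l B"
  then show "fn (restr l S) (rank (preim l S) a) = rank S (fn l a)"
    unfolding restr_def using sub by (auto simp: fn_std)
next
  show "inj_on (fn l) (preim l B)" "finite B"
    using assms by (simp_all add: preim_inj finite_subset)
qed (simp_all add: preim_image)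

subsection \<open>Splitting an injection into a sum\<close>

lemma bmap_sum_simps [simp]:
  "src (bmap_sum f g) = src f + src g" "tgt (bmap_sum f g) = tgt f + tgt g"
  "i \<le> src f \<Longrightarrow> fn (bmap_sum f g) i = fn f i"
  "src f < i \<Longrightarrow> i \<le> src f + src g \<Longrightarrow> fn (bmap_sum f g) i = tgt f + fn g (i - src f)"
  by (auto simp: bmap_sum_def src_def tgt_def fn_def)

lemma bmap_sum_F:
  assumes "f \<in> F_arr" "g \<in> F_arr"
  shows "bmap_sum f g \<in> F_arr"
proof -
  have "fn (bmap_sum f g) i \<le> tgt f + tgt g" if "i \<le> src f + src g" for i
    using that F_arr_le[OF assms(1), of i] F_arr_le[OF assms(2), of "i - src f"]
    by (cases "i \<le> src f") auto
  moreover have "fn (bmap_sum f g) i = undefined" if "\<not> i \<le> src f + src g" for i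
    using that by (auto simp: bmap_sum_def src_def tgt_def fn_def)
  ultimately show ?thesis using assms by (intro F_arrI) auto
qed

lemma bmap_sum_Lambda [simp]:
  assumes "f \<in> Arr Lambda_cat" "g \<in> Arr Lambda_cat"
  shows "bmap_sum f g \<in> Arr Lambda_cat"
proof -
  have "i = j" if i: "i \<le> src f + src g" and j: "j \<le> src f + src g"
    and e: "fn (bmap_sum f g) i = fn (bmap_sum f g) j" for i j
  proof -
    have *: "fn f i \<le> tgt f" if "i \<le> src f" for i using assms that by simp
    have **: "1 \<le> fn g (i - src f)" if "src f < i" "i \<le> src f + src g" for i
      using Lambda_pos[OF assms(2), of "i - src f"] that by simp
    show ?thesis
    proof (cases "i \<le> src f"; cases "j \<le> src f")
      assume "i \<le> src f" "j \<le> src f"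
      then show ?thesis using e Lambda_inj[OF assms(1)] by simp
    next
      assume "\<not> i \<le> src f" "\<not> j \<le> src f"
      then show ?thesis using e i j Lambda_inj[OF assms(2), of "i - src f" "j - src f"] by simp
    next
      assume "i \<le> src f" "\<not> j \<le> src f"
      then show ?thesis using e *[of i] **[of j] j by simp
    next
      assume "\<not> i \<le> src f" "j \<le> src f"
      then show ?thesis using e *[of j] **[of i] i by simp
    qed
  qed
  then show ?thesis using assms by (intro LambdaI bmap_sum_F) simp_all
qed

lemma bmap_sum_Id [simp]: "bmap_sum (Id F_cat m) (Id F_cat n) = Id F_cat (m + n)"
proof (rule bmap_eqI)
  fix i assume "1 \<le> i" "i \<le> src (Id F_cat (m + n))"
  then show "fn (bmap_sum (Id F_cat m) (Id F_cat n)) i = fn (Id F_cat (m + n)) i"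
    by (cases "i \<le> m") auto
qed (auto intro: bmap_sum_F)

lemma
  assumes "f \<in> Arr Lambda_cat" "g \<in> Arr Lambda_cat"
  shows preim_bmap_sum1: "preim (bmap_sum f g) {1..tgt f} = {1..src f}"
    and restr_bmap_sum1: "restr (bmap_sum f g) {1..tgt f} = f"
    and preim_bmap_sum2: "preim (bmap_sum f g) {Suc (tgt f)..tgt f + tgt g} = {Suc (src f)..src f + src g}"
    and restr_bmap_sum2: "restr (bmap_sum f g) {Suc (tgt f)..tgt f + tgt g} = g"
proof -
  have f: "fn f i \<le> tgt f" if "i \<le> src f" for i using assms that by simp
  have f': "Suc 0 \<le> fn f i" if "Suc 0 \<le> i" "i \<le> src f" for i using assms that by simp
  have g: "Suc 0 \<le> fn g (i - src f)" "fn g (i - src f) \<le> tgt g" if "src f < i" "i \<le> src f + src g" for i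
    using Lambda_pos[OF assms(2), of "i - src f"] that assms by simp_all
  show p1: "preim (bmap_sum f g) {1..tgt f} = {1..src f}"
  proof (intro set_eqI)
    fix i
    show "i \<in> preim (bmap_sum f g) {1..tgt f} \<longleftrightarrow> i \<in> {1..src f}"
      using f[of i] f'[of i] g[of i] by (cases "i \<le> src f") (auto simp: preim_def)
  qed
  show p2: "preim (bmap_sum f g) {Suc (tgt f)..tgt f + tgt g} = {Suc (src f)..src f + src g}"
  proof (intro set_eqI)
    fix i
    show "i \<in> preim (bmap_sum f g) {Suc (tgt f)..tgt f + tgt g} \<longleftrightarrow> i \<in> {Suc (src f)..src f + src g}"
      using f[of i] f'[of i] g[of i] by (cases "i \<le> src f") (auto simp: preim_def)
  qed
  show "restr (bmap_sum f g) {1..tgt f} = f"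
    unfolding restr_def p1
    by (rule std_eqI) (use assms f f' in auto)
  show "restr (bmap_sum f g) {Suc (tgt f)..tgt f + tgt g} = g"
    unfolding restr_def p2
  proof (rule std_eqI)
    fix a assume "a \<in> {Suc (src f)..src f + src g}"
    then show "fn g (rank {Suc (src f)..src f + src g} a)
        = rank {Suc (tgt f)..tgt f + tgt g} (fn (bmap_sum f g) a)"
      using g[of a] by (simp add: rank_interval)
  qed (use assms g in auto)
qed

text \<open>The permutation \<open>n \<rightarrow> |S| + |n - S|\<close> that puts \<open>S\<close> first and keeps the order on \<open>S\<close> and on its
  complement.\<close>

definition kappa :: "nat \<Rightarrow> nat set \<Rightarrow> bmap" where
  "kappa n S = based_map n (card S + card ({1..n} - S))
     (\<lambda>i. if i \<in> S then rank S i else card S + rank ({1..n} - S) i)"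

lemma kappa_simps [simp]:
  "src (kappa n S) = n" "tgt (kappa n S) = card S + card ({1..n} - S)"
  by (simp_all add: kappa_def)

context
  fixes n :: nat and S :: "nat set"
  assumes S: "S \<subseteq> {1..n}"
begin

lemma finite_split: "finite S" "finite ({1..n} - S)"
  using S by (auto intro: finite_subset)

lemma fn_kappa:
  "i \<in> S \<Longrightarrow> fn (kappa n S) i = rank S i"
  "i \<in> {1..n} - S \<Longrightarrow> fn (kappa n S) i = card S + rank ({1..n} - S) i"
  using S by (auto simp: kappa_def subset_iff)

lemma kappa_Lambda [simp]: "kappa n S \<in> Arr Lambda_cat"
  unfolding kappa_def
proof (rule based_map_Lambda)
  let ?f = "\<lambda>i. if i \<in> S then rank S i else card S + rank ({1..n} - S) i"
  note r = rank_range[OF finite_split(1)] rank_range[OF finite_split(2)]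
  show "1 \<le> ?f i \<and> ?f i \<le> card S + card ({1..n} - S)" if "1 \<le> i" "i \<le> n" for i
    using r[of i] that by auto
  show "inj_on ?f {1..n}"
  proof (rule inj_onI)
    fix i j assume "i \<in> {1..n}" "j \<in> {1..n}" "?f i = ?f j"
    then show "i = j"
      using r[of i] r[of j] rank_inj[OF finite_split(1), of i j] rank_inj[OF finite_split(2), of i j]
      by (cases "i \<in> S"; cases "j \<in> S") auto
  qed
qed

lemma preim_kappa1: "preim (kappa n S) {1..card S} = S"
  and preim_kappa2: "preim (kappa n S) {Suc (card S)..card S + card ({1..n} - S)} = {1..n} - S"
proof -
  note r = rank_range[OF finite_split(1)] rank_range[OF finite_split(2)]
  have "i \<in> preim (kappa n S) {1..card S} \<longleftrightarrow> i \<in> S"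
    "i \<in> preim (kappa n S) {Suc (card S)..card S + card ({1..n} - S)} \<longleftrightarrow> i \<in> {1..n} - S" for i
    using r[of i] S fn_kappa[of i] by (cases "i \<in> {1..n}"; cases "i \<in> S"; auto simp: preim_def)+
  then show "preim (kappa n S) {1..card S} = S"
    "preim (kappa n S) {Suc (card S)..card S + card ({1..n} - S)} = {1..n} - S" by blast+
qed

lemma restr_kappa1: "restr (kappa n S) {1..card S} = Id F_cat (card S)"
  unfolding restr_def preim_kappa1
  by (rule std_eqI) (use finite_split rank_range[OF finite_split(1)] in \<open>auto simp: fn_kappa\<close>)

lemma restr_kappa2: "restr (kappa n S) {Suc (card S)..card S + card ({1..n} - S)} = Id F_cat (card ({1..n} - S))"
  unfolding restr_def preim_kappa2
proof (rule std_eqI)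
  fix a assume a: "a \<in> {1..n} - S"
  then show "fn (Id F_cat (card ({1..n} - S))) (rank ({1..n} - S) a) =
      rank {Suc (card S)..card S + card ({1..n} - S)} (fn (kappa n S) a)"
    using rank_range[OF finite_split(2) a] unfolding fn_kappa(2)[OF a] by (simp add: rank_interval)
next
  show "fn (kappa n S) ` ({1..n} - S) \<subseteq> {Suc (card S)..card S + card ({1..n} - S)}"
  proof (intro image_subsetI)
    fix a assume a: "a \<in> {1..n} - S"
    show "fn (kappa n S) a \<in> {Suc (card S)..card S + card ({1..n} - S)}"
      using rank_range[OF finite_split(2) a] unfolding fn_kappa(2)[OF a] by simp
  qed
qed (use finite_split in auto)

end

lemma preim_upper:
  assumes "k \<in> hom Lambda_cat n (i + j)"
  shows "preim k {Suc i..i + j} = {1..n} - preim k {1..i}"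
proof -
  have "{1..i + j} - {1..i} = {Suc i..i + j}" by auto
  then show ?thesis using assms preim_compl[of k "{1..i}"] by (auto simp: hom_Lambda_iff)
qed

text \<open>An injection \<open>k\<close> into \<open>i + j\<close> is \<open>kappa n S\<close> for \<open>S = k\<^sup>-\<^sup>1{1..i}\<close> followed by a sum of two injections. This is
  why the coend that defines the Day convolution reduces to a coproduct over subsets.\<close>

lemma split_injection:
  assumes k: "k \<in> hom Lambda_cat n (i + j)"
  shows "bmap_sum (restr k {1..i}) (restr k {Suc i..i + j}) \<odot> kappa n (preim k {1..i}) = k"
proof (rule bmap_eqI)
  let ?S = "preim k {1..i}"
  have k': "k \<in> Arr Lambda_cat" "src k = n" "tgt k = i + j" using k by (auto simp: hom_Lambda_iff)
  have S: "?S \<subseteq> {1..n}" using k' preim_subset by metis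
  note T = preim_upper[OF k]
  note fs = finite_split[OF S]
  have L: "bmap_sum (restr k {1..i}) (restr k {Suc i..i + j}) \<in> Arr Lambda_cat"
    using k' by simp
  then show "bmap_sum (restr k {1..i}) (restr k {Suc i..i + j}) \<odot> kappa n ?S \<in> F_arr"
    using kappa_Lambda[OF S] T by (intro F_comp) auto
  fix a assume "1 \<le> a" "a \<le> src k"
  then have a: "a \<in> {1..n}" using k' by auto
  show "fn (bmap_sum (restr k {1..i}) (restr k {Suc i..i + j}) \<odot> kappa n ?S) a = fn k a"
  proof (cases "a \<in> ?S")
    case True
    then have "fn k a \<in> {1..i}" by (simp add: preim_def)
    moreover have "fn (restr k {1..i}) (rank ?S a) = rank {1..i} (fn k a)"
      unfolding restr_def using True by (simp add: fn_std)
    ultimately show ?thesis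
      using a rank_range[OF fs(1) True] fn_kappa(1)[OF S True] by simp
  next
    case False
    then have aT: "a \<in> {1..n} - ?S" using a by auto
    then have "fn k a \<in> {Suc i..i + j}" unfolding T[symmetric] by (simp add: preim_def)
    moreover have "fn (restr k {Suc i..i + j}) (rank ({1..n} - ?S) a) = rank {Suc i..i + j} (fn k a)"
      unfolding restr_def T using aT by (simp add: fn_std)
    ultimately show ?thesis
      using a rank_range[OF fs(2) aT] T fn_kappa(2)[OF S aT] by (simp add: rank_interval)
  qed
qed (use k preim_upper[OF k] in \<open>auto simp: hom_Lambda_iff\<close>)


subsection \<open>Splitting off the elements sent to the base point\<close>

text \<open>The elements that a based map does not send to the base point, those that it does, and the map
  on the former, which is an arrow of \<open>\<F>\<^sub>>\<^sub>0\<close> after standardisation; \<open>glue\<close> recovers the based map.\<close>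

definition support :: "bmap \<Rightarrow> nat set" where
  "support \<phi> = {i \<in> {1..src \<phi>}. fn \<phi> i \<noteq> 0}"

definition zero_fib :: "bmap \<Rightarrow> nat set" where
  "zero_fib \<phi> = {i \<in> {1..src \<phi>}. fn \<phi> i = 0}"

definition nonzero_part :: "bmap \<Rightarrow> bmap" where
  "nonzero_part \<phi> = based_map (card (support \<phi>)) (tgt \<phi>) (\<lambda>r. fn \<phi> (unrank (support \<phi>) r))"

definition glue :: "nat \<Rightarrow> nat set \<Rightarrow> bmap \<Rightarrow> bmap" where
  "glue m S \<psi> = based_map m (tgt \<psi>) (\<lambda>i. if i \<in> S then fn \<psi> (rank S i) else 0)"

lemma finite_supp [simp]: "finite (support \<phi>)" and finite_zfib [simp]: "finite (zero_fib \<phi>)"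
  by (simp_all add: support_def zero_fib_def)

lemma zero_fib_eq: "zero_fib \<phi> = {1..src \<phi>} - support \<phi>"
  by (auto simp: zero_fib_def support_def)

lemma finite_fib [simp]: "finite (fib \<phi> j)"
  by (simp add: fib_def)

lemma fib_pos: "\<phi> \<in> F_arr \<Longrightarrow> 1 \<le> j \<Longrightarrow> fib \<phi> j = {i \<in> {1..src \<phi>}. fn \<phi> i = j}"
proof -
  assume p: "\<phi> \<in> F_arr" "1 \<le> j"
  have "1 \<le> i" if "fn \<phi> i = j" for i using p that by (cases "i = 0") auto
  then show ?thesis by (auto simp: fib_def)
qed

lemma fib_subset_supp: "\<phi> \<in> F_arr \<Longrightarrow> 1 \<le> j \<Longrightarrow> fib \<phi> j \<subseteq> support \<phi>"
  by (auto simp: fib_pos support_def)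

lemma fib_comp:
  assumes "\<phi> \<in> F_arr" "l \<in> Arr Lambda_cat" "tgt l = src \<phi>" "1 \<le> j"
  shows "fib (\<phi> \<odot> l) j = preim l (fib \<phi> j)"
proof -
  have "fn l i \<le> src \<phi>" if "i \<le> src l" for i
    using F_arr_le[OF Lambda_F[OF assms(2)] that] assms(3) by simp
  then show ?thesis using assms by (auto simp: fib_pos preim_def)
qed

lemma support_comp:
  assumes "\<phi> \<in> F_arr" "l \<in> Arr Lambda_cat" "tgt l = src \<phi>"
  shows "support (\<phi> \<odot> l) = preim l (support \<phi>)"
proof -
  have "fn l i \<le> src \<phi>" if "i \<le> src l" for i
    using F_arr_le[OF Lambda_F[OF assms(2)] that] assms(3) by simp
  then show ?thesis using assms by (auto simp: support_def preim_def)
qed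

lemma zero_fib_comp:
  assumes "\<phi> \<in> F_arr" "l \<in> Arr Lambda_cat" "tgt l = src \<phi>"
  shows "zero_fib (\<phi> \<odot> l) = preim l (zero_fib \<phi>)"
  using preim_compl[OF assms(2), of "support \<phi>"] assms by (simp add: zero_fib_eq support_comp)

lemma nonzero_part_simps [simp]: "src (nonzero_part \<phi>) = card (support \<phi>)" "tgt (nonzero_part \<phi>) = tgt \<phi>"
  by (simp_all add: nonzero_part_def)

lemma fn_nonzero_part: "i \<in> support \<phi> \<Longrightarrow> fn (nonzero_part \<phi>) (rank (support \<phi>) i) = fn \<phi> i"
  using rank_range[OF finite_supp, of i \<phi>] by (simp add: nonzero_part_def)

lemma nonzero_part_Fpos:
  assumes "\<phi> \<in> F_arr"
  shows "nonzero_part \<phi> \<in> Arr Fpos_cat"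
proof -
  have "unrank (support \<phi>) r \<in> support \<phi>" if "1 \<le> r" "r \<le> card (support \<phi>)" for r using that by simp
  then have *: "fn \<phi> (unrank (support \<phi>) r) \<noteq> 0 \<and> fn \<phi> (unrank (support \<phi>) r) \<le> tgt \<phi>"
    if "1 \<le> r" "r \<le> card (support \<phi>)" for r
    using that assms unfolding support_def by (metis (mono_tags, lifting) F_arr_le atLeastAtMost_iff mem_Collect_eq)
  have "nonzero_part \<phi> \<in> F_arr" unfolding nonzero_part_def by (rule based_map_F_arr) (use * in auto)
  then show ?thesis by (rule FposI) (use * in \<open>simp add: nonzero_part_def Suc_le_eq\<close>)
qed

lemma fib_nonzero_part:
  assumes "\<phi> \<in> F_arr" "1 \<le> j"
  shows "fib (nonzero_part \<phi>) j = rank (support \<phi>) ` fib \<phi> j"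
proof -
  have "fib (nonzero_part \<phi>) j = {r \<in> rank (support \<phi>) ` support \<phi>. fn (nonzero_part \<phi>) r = j}"
    using nonzero_part_Fpos[OF assms(1)] assms(2) by (simp add: fib_pos rank_image)
  also have "\<dots> = rank (support \<phi>) ` {i \<in> support \<phi>. fn (nonzero_part \<phi>) (rank (support \<phi>) i) = j}"
    by blast
  also have "{i \<in> support \<phi>. fn (nonzero_part \<phi>) (rank (support \<phi>) i) = j} = {i \<in> support \<phi>. fn \<phi> i = j}"
    by (rule Collect_cong) (use fn_nonzero_part[of _ \<phi>] in auto)
  also have "{i \<in> support \<phi>. fn \<phi> i = j} = fib \<phi> j"
    using fib_subset_supp[OF assms] by (auto simp: fib_def support_def)
  finally show ?thesis .
qed

lemma card_fib_nonzero_part: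
  assumes "\<phi> \<in> F_arr" "1 \<le> j"
  shows "card (fib (nonzero_part \<phi>) j) = card (fib \<phi> j)"
  unfolding fib_nonzero_part[OF assms]
  using rank_bij[OF finite_supp, of \<phi>] fib_subset_supp[OF assms]
  by (intro card_image) (auto simp: bij_betw_def intro: inj_on_subset)

lemma nonzero_part_comp:
  assumes "\<phi> \<in> F_arr" "l \<in> Arr Lambda_cat" "tgt l = src \<phi>"
  shows "nonzero_part (\<phi> \<odot> l) = nonzero_part \<phi> \<odot> restr l (support \<phi>)"
proof (rule bmap_eqI)
  have restr: "restr l (support \<phi>) \<in> Arr Lambda_cat" using assms by simp
  have p: "nonzero_part \<phi> \<in> F_arr" using nonzero_part_Fpos assms by simp
  show "nonzero_part (\<phi> \<odot> l) \<in> F_arr" using assms by (simp add: Fpos_F[OF nonzero_part_Fpos])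
  show "nonzero_part \<phi> \<odot> restr l (support \<phi>) \<in> F_arr" using restr p by simp
  fix r assume "1 \<le> r" "r \<le> src (nonzero_part \<phi> \<odot> restr l (support \<phi>))"
  then have "r \<in> rank (preim l (support \<phi>)) ` preim l (support \<phi>)" by (simp add: rank_image)
  then obtain i where i: "i \<in> preim l (support \<phi>)" "r = rank (preim l (support \<phi>)) i" by auto
  have "fn (nonzero_part (\<phi> \<odot> l)) r = fn \<phi> (fn l i)"
    using fn_nonzero_part[of i "\<phi> \<odot> l"] i assms by (simp add: support_comp) (simp add: preim_def)
  moreover have "fn (restr l (support \<phi>)) r = rank (support \<phi>) (fn l i)"
    unfolding restr_def using i by (simp add: fn_std)
  moreover have "fn l i \<in> support \<phi>" using i by (simp add: preim_def)
  ultimately show "fn (nonzero_part (\<phi> \<odot> l)) r = fn (nonzero_part \<phi> \<odot> restr l (support \<phi>)) r"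
    using i rank_range[OF finite_pre i(1)] by (simp add: fn_nonzero_part)
qed (use assms in \<open>simp_all add: support_comp\<close>)

lemma restr_fib_nonzero_part:
  assumes "\<phi> \<in> F_arr" "l \<in> Arr Lambda_cat" "1 \<le> j"
  shows "restr (restr l (support \<phi>)) (fib (nonzero_part \<phi>) j) = restr l (fib \<phi> j)"
  unfolding fib_nonzero_part[OF assms(1,3)]
  by (rule restr_restr[OF assms(2) finite_supp fib_subset_supp[OF assms(1,3)]])

lemma bij_support_nonzero_part:
  "bij_betw (\<lambda>\<phi>. (support \<phi>, nonzero_part \<phi>)) (hom F_cat m n)
     (SIGMA S:Pow {1..m}. hom Fpos_cat (card S) n)"
proof (rule bij_betw_byWitness[where f' = "\<lambda>(S, \<psi>). glue m S \<psi>"])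
  have sub: "support \<phi> \<subseteq> {1..src \<phi>}" for \<phi> by (auto simp: support_def)
  show "\<forall>\<phi>\<in>hom F_cat m n. (case (support \<phi>, nonzero_part \<phi>) of (S, \<psi>) \<Rightarrow> glue m S \<psi>) = \<phi>"
  proof
    fix \<phi> assume "\<phi> \<in> hom F_cat m n"
    then have p: "\<phi> \<in> F_arr" "src \<phi> = m" "tgt \<phi> = n" by (auto simp: hom_F_iff)
    have *: "(if i \<in> support \<phi> then fn (nonzero_part \<phi>) (rank (support \<phi>) i) else 0) = fn \<phi> i"
      if "1 \<le> i" "i \<le> m" for i
      using that p fn_nonzero_part[of i \<phi>] by (auto simp: support_def)
    have "glue m (support \<phi>) (nonzero_part \<phi>) = \<phi>"
      unfolding glue_def
    proof (rule bmap_eqI)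
      show "based_map m (tgt (nonzero_part \<phi>)) (\<lambda>i. if i \<in> support \<phi> then fn (nonzero_part \<phi>) (rank (support \<phi>) i) else 0) \<in> F_arr"
        by (rule based_map_F_arr) (use * p in auto)
    qed (use * p in auto)
    then show "(case (support \<phi>, nonzero_part \<phi>) of (S, \<psi>) \<Rightarrow> glue m S \<psi>) = \<phi>" by simp
  qed
  show "(\<lambda>\<phi>. (support \<phi>, nonzero_part \<phi>)) ` hom F_cat m n \<subseteq> (SIGMA S:Pow {1..m}. hom Fpos_cat (card S) n)"
  proof (rule image_subsetI)
    fix \<phi> assume "\<phi> \<in> hom F_cat m n"
    then have p: "\<phi> \<in> F_arr" "src \<phi> = m" "tgt \<phi> = n" by (auto simp: hom_F_iff)
    then show "(support \<phi>, nonzero_part \<phi>) \<in> (SIGMA S:Pow {1..m}. hom Fpos_cat (card S) n)"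
      using sub[of \<phi>] nonzero_part_Fpos[OF p(1)] by (simp add: hom_Fpos_iff)
  qed
  have glue: "glue m S \<psi> \<in> F_arr \<and> support (glue m S \<psi>) = S \<and> nonzero_part (glue m S \<psi>) = \<psi>"
    if S: "S \<subseteq> {1..m}" and \<psi>: "\<psi> \<in> hom Fpos_cat (card S) n" for S \<psi>
  proof -
    have fS: "finite S" using S finite_subset by auto
    have \<psi>': "\<psi> \<in> F_arr" "src \<psi> = card S" "tgt \<psi> = n" "\<And>i. 1 \<le> i \<Longrightarrow> i \<le> card S \<Longrightarrow> 1 \<le> fn \<psi> i"
      using \<psi> by (simp_all add: hom_Fpos_iff)
    have r: "1 \<le> rank S i" "rank S i \<le> card S" if "i \<in> S" for i using rank_range[OF fS that] by auto
    have g: "glue m S \<psi> \<in> F_arr" unfolding glue_def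
    proof (rule based_map_F_arr)
      fix i show "(if i \<in> S then fn \<psi> (rank S i) else 0) \<le> tgt \<psi>"
        using F_arr_le[OF \<psi>'(1), of "rank S i"] r[of i] \<psi>'(2) by auto
    qed
    have f: "fn (glue m S \<psi>) i = (if i \<in> S then fn \<psi> (rank S i) else 0)" if "i \<in> {1..m}" for i
      using that by (simp add: glue_def)
    have "fn \<psi> (rank S i) \<noteq> 0" if "i \<in> S" for i using \<psi>'(4)[of "rank S i"] r[OF that] by simp
    then have s: "support (glue m S \<psi>) = S"
      using f S by (auto simp: support_def glue_def split: if_splits)
    moreover have "nonzero_part (glue m S \<psi>) = \<psi>"
    proof (rule bmap_eqI)
      show "nonzero_part (glue m S \<psi>) \<in> F_arr" using nonzero_part_Fpos[OF g] by simp
      fix i assume "1 \<le> i" "i \<le> src \<psi>"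
      then have "i \<in> rank S ` S" using \<psi>'(2) rank_image[OF fS] by simp
      then obtain a where a: "a \<in> S" "i = rank S a" by auto
      then show "fn (nonzero_part (glue m S \<psi>)) i = fn \<psi> i"
        using fn_nonzero_part[of a "glue m S \<psi>"] f[of a] S s by auto
    qed (use \<psi>' s in \<open>auto simp: glue_def\<close>)
    ultimately show ?thesis using g by blast
  qed
  show "\<forall>p\<in>(SIGMA S:Pow {1..m}. hom Fpos_cat (card S) n).
      (support (case p of (S, \<psi>) \<Rightarrow> glue m S \<psi>), nonzero_part (case p of (S, \<psi>) \<Rightarrow> glue m S \<psi>)) = p"
    using glue by auto
  show "(\<lambda>(S, \<psi>). glue m S \<psi>) ` (SIGMA S:Pow {1..m}. hom Fpos_cat (card S) n) \<subseteq> hom F_cat m n"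
    using glue by (auto simp: hom_F_iff hom_Fpos_iff glue_def)
qed

text \<open>The elements of \<open>{1..m}\<close> over the base point are sent to a new largest element instead; this identifies
  \<open>\<F>(m, n)\<close> with \<open>\<F>\<^sub>>\<^sub>0(m, n + 1)\<close>.\<close>

definition top_map :: "bmap \<Rightarrow> bmap" where
  "top_map \<phi> = based_map (src \<phi>) (Suc (tgt \<phi>)) (\<lambda>i. if fn \<phi> i = 0 then Suc (tgt \<phi>) else fn \<phi> i)"

lemma top_map_simps [simp]: "src (top_map \<phi>) = src \<phi>" "tgt (top_map \<phi>) = Suc (tgt \<phi>)"
  "1 \<le> i \<Longrightarrow> i \<le> src \<phi> \<Longrightarrow> fn (top_map \<phi>) i = (if fn \<phi> i = 0 then Suc (tgt \<phi>) else fn \<phi> i)"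
  by (simp_all add: top_map_def)

lemma top_map_Fpos:
  assumes "\<phi> \<in> F_arr"
  shows "top_map \<phi> \<in> Arr Fpos_cat"
proof -
  have "top_map \<phi> \<in> F_arr" unfolding top_map_def
    by (rule based_map_F_arr) (use F_arr_le[OF assms] in \<open>auto simp: le_Suc_eq\<close>)
  then show ?thesis by (rule FposI) simp
qed

lemma fib_top_map:
  assumes "\<phi> \<in> F_arr" "1 \<le> j" "j \<le> tgt \<phi>"
  shows "fib (top_map \<phi>) j = fib \<phi> j"
proof -
  have "fib (top_map \<phi>) j = {i \<in> {1..src \<phi>}. fn (top_map \<phi>) i = j}"
    using fib_pos[OF Fpos_F[OF top_map_Fpos[OF assms(1)]] assms(2)] by simp
  also have "\<dots> = {i \<in> {1..src \<phi>}. fn \<phi> i = j}"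
    by (rule Collect_cong) (use assms(2,3) in \<open>auto split: if_splits\<close>)
  finally show ?thesis using fib_pos[OF assms(1,2)] by simp
qed

lemma fib_top_map_top:
  assumes "\<phi> \<in> F_arr"
  shows "fib (top_map \<phi>) (Suc (tgt \<phi>)) = zero_fib \<phi>"
proof -
  have *: "fn \<phi> i \<noteq> Suc (tgt \<phi>)" if "i \<le> src \<phi>" for i
    using F_arr_le[OF assms that] by auto
  have "fib (top_map \<phi>) (Suc (tgt \<phi>)) = {i \<in> {1..src \<phi>}. fn (top_map \<phi>) i = Suc (tgt \<phi>)}"
    using fib_pos[OF Fpos_F[OF top_map_Fpos[OF assms]], of "Suc (tgt \<phi>)"] by simp
  also have "\<dots> = zero_fib \<phi>" unfolding zero_fib_def
    by (rule Collect_cong) (use * in \<open>auto split: if_splits\<close>)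
  finally show ?thesis .
qed

lemma top_map_comp:
  assumes "\<phi> \<in> F_arr" "l \<in> Arr Lambda_cat" "tgt l = src \<phi>"
  shows "top_map (\<phi> \<odot> l) = top_map \<phi> \<odot> l"
proof (rule bmap_eqI)
  show "top_map (\<phi> \<odot> l) \<in> F_arr" "top_map \<phi> \<odot> l \<in> F_arr"
    using assms by (simp_all add: top_map_Fpos)
  fix i assume i: "1 \<le> i" "i \<le> src (top_map \<phi> \<odot> l)"
  then have "fn l i \<le> src \<phi>" "Suc 0 \<le> fn l i"
    using F_arr_le[OF Lambda_F[OF assms(2)], of i] assms by simp_all
  then show "fn (top_map (\<phi> \<odot> l)) i = fn (top_map \<phi> \<odot> l) i"
    using i by simp
qed auto

lemma bij_top_map: "bij_betw top_map (hom F_cat m n) (hom Fpos_cat m (Suc n))"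
proof (rule bij_betw_byWitness[where
      f' = "\<lambda>\<psi>. based_map m n (\<lambda>i. if fn \<psi> i = Suc n then 0 else fn \<psi> i)"])
  show "top_map ` hom F_cat m n \<subseteq> hom Fpos_cat m (Suc n)"
    by (rule image_subsetI) (simp add: hom_F_iff hom_Fpos_iff top_map_Fpos)
  show "\<forall>\<phi>\<in>hom F_cat m n. based_map m n (\<lambda>i. if fn (top_map \<phi>) i = Suc n then 0 else fn (top_map \<phi>) i) = \<phi>"
  proof
    fix \<phi> assume "\<phi> \<in> hom F_cat m n"
    then have p: "\<phi> \<in> F_arr" "src \<phi> = m" "tgt \<phi> = n" by (auto simp: hom_F_iff)
    have *: "(if fn (top_map \<phi>) i = Suc n then 0 else fn (top_map \<phi>) i) = fn \<phi> i"
      if "1 \<le> i" "i \<le> m" for i using that p F_arr_le[OF p(1), of i] by auto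
    show "based_map m n (\<lambda>i. if fn (top_map \<phi>) i = Suc n then 0 else fn (top_map \<phi>) i) = \<phi>"
    proof (rule bmap_eqI)
      show "based_map m n (\<lambda>i. if fn (top_map \<phi>) i = Suc n then 0 else fn (top_map \<phi>) i) \<in> F_arr"
        by (rule based_map_F_arr) (use * p in auto)
    qed (use * p in auto)
  qed
  have inv: "based_map m n (\<lambda>i. if fn \<psi> i = Suc n then 0 else fn \<psi> i) \<in> F_arr"
    if "\<psi> \<in> hom Fpos_cat m (Suc n)" for \<psi>
  proof (rule based_map_F_arr)
    fix i assume "1 \<le> i" "i \<le> m"
    then have "fn \<psi> i \<le> Suc n" using that F_arr_le[of \<psi> i] by (simp add: hom_Fpos_iff)
    then show "(if fn \<psi> i = Suc n then 0 else fn \<psi> i) \<le> n" by auto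
  qed
  then show "(\<lambda>\<psi>. based_map m n (\<lambda>i. if fn \<psi> i = Suc n then 0 else fn \<psi> i)) ` hom Fpos_cat m (Suc n) \<subseteq> hom F_cat m n"
    by (intro image_subsetI) (simp add: hom_F_iff)
  show "\<forall>\<psi>\<in>hom Fpos_cat m (Suc n). top_map (based_map m n (\<lambda>i. if fn \<psi> i = Suc n then 0 else fn \<psi> i)) = \<psi>"
  proof
    fix \<psi> assume \<psi>: "\<psi> \<in> hom Fpos_cat m (Suc n)"
    show "top_map (based_map m n (\<lambda>i. if fn \<psi> i = Suc n then 0 else fn \<psi> i)) = \<psi>"
    proof (rule bmap_eqI)
      show "top_map (based_map m n (\<lambda>i. if fn \<psi> i = Suc n then 0 else fn \<psi> i)) \<in> F_arr"
        using top_map_Fpos[OF inv[OF \<psi>]] by simp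
    next
      fix i assume i: "1 \<le> i" "i \<le> src \<psi>"
      moreover have "\<psi> \<in> Arr Fpos_cat" "src \<psi> = m" using \<psi> by (simp_all add: hom_Fpos_iff)
      ultimately have "Suc 0 \<le> fn \<psi> i" using i by (intro Fpos_pos) simp_all
      then have "fn \<psi> i \<noteq> 0" by simp
      then show "fn (top_map (based_map m n (\<lambda>i. if fn \<psi> i = Suc n then 0 else fn \<psi> i))) i = fn \<psi> i"
        using i \<open>src \<psi> = m\<close> by simp
    qed (use \<psi> in \<open>simp_all add: hom_Fpos_iff\<close>)
  qed
qed


context cartesian begin

section \<open>Presentations of \<open>\<Lambda>\<close>-objects by coproducts\<close>

abbreviation Lambda_functor :: "('o, 'a) Lambda_obj \<Rightarrow> bool" where
  "Lambda_functor Z \<equiv> is_functor (op_cat Lambda_cat) V Z"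

lemma Lambda_functorI:
  assumes "\<And>n. FO Z n \<in> Obj V"
    "\<And>l. l \<in> Arr Lambda_cat \<Longrightarrow> FA Z l \<in> hom V (FO Z (tgt l)) (FO Z (src l))"
    "\<And>n. FA Z (Id F_cat n) = Id V (FO Z n)"
    "\<And>k l. k \<in> Arr Lambda_cat \<Longrightarrow> l \<in> Arr Lambda_cat \<Longrightarrow> tgt k = src l \<Longrightarrow>
      FA Z (l \<odot> k) = FA Z k \<cdot> FA Z l"
  shows "Lambda_functor Z"
  unfolding is_functor_def op_cat_def using assms by simp

context
  fixes Z
  assumes Z: "Lambda_functor Z"
begin

lemma Lambda_functor_Obj: "FO Z n \<in> Obj V"
  using Z by (simp add: is_functor_def op_cat_def)

lemma Lambda_functor_simps:
  assumes "l \<in> Arr Lambda_cat"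
  shows "FA Z l \<in> Arr V" "Dom V (FA Z l) = FO Z (tgt l)" "Cod V (FA Z l) = FO Z (src l)"
  using Z assms by (simp_all add: is_functor_def op_cat_def hom_iff)

lemma Lambda_functor_Id: "FA Z (Id F_cat n) = Id V (FO Z n)"
  using Z by (simp add: is_functor_def op_cat_def)

lemma Lambda_functor_comp:
  "k \<in> Arr Lambda_cat \<Longrightarrow> l \<in> Arr Lambda_cat \<Longrightarrow> tgt k = src l \<Longrightarrow>
      FA Z (l \<odot> k) = FA Z k \<cdot> FA Z l"
  using Z by (simp add: is_functor_def op_cat_def)

end

lemma Lambda_iso_iff:
  "Lambda_iso V Z Z' \<longleftrightarrow> Lambda_functor Z \<and> Lambda_functor Z' \<and>
     (\<exists>\<alpha>. (\<forall>n. \<alpha> n \<in> hom V (FO Z n) (FO Z' n) \<and> is_iso V (\<alpha> n)) \<and>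
          (\<forall>l\<in>Arr Lambda_cat. FA Z' l \<cdot> \<alpha> (tgt l) = \<alpha> (src l) \<cdot> FA Z l))"
  unfolding Lambda_iso_def naturally_isomorphic_def by (simp add: op_cat_def)

text \<open>Functoriality passes along an objectwise isomorphism that commutes with the arrow maps, because the
  components \<open>\<alpha> n\<close> can be cancelled.\<close>

lemma functor_transport:
  assumes Z: "Lambda_functor Z"
    and \<alpha>: "\<And>n. \<alpha> n \<in> hom V (FO Z n) (FO Z' n) \<and> is_iso V (\<alpha> n)"
    and nat: "\<And>l. l \<in> Arr Lambda_cat \<Longrightarrow> FA Z' l \<cdot> \<alpha> (tgt l) = \<alpha> (src l) \<cdot> FA Z l"
    and Z': "\<And>l. l \<in> Arr Lambda_cat \<Longrightarrow> FA Z' l \<in> hom V (FO Z' (tgt l)) (FO Z' (src l))"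
  shows "Lambda_functor Z'"
proof (rule Lambda_functorI)
  have a: "\<alpha> n \<in> Arr V" "Dom V (\<alpha> n) = FO Z n" "Cod V (\<alpha> n) = FO Z' n" for n
    using \<alpha>[of n] by (auto simp: hom_iff)
  show Ob: "FO Z' n \<in> Obj V" for n using a(1,3)[of n] Cod_Obj by metis
  have epi: "f = g" if fg: "f \<in> Arr V" "g \<in> Arr V" "Dom V f = FO Z' n" "Dom V g = FO Z' n"
      "f \<cdot> \<alpha> n = g \<cdot> \<alpha> n" for f g n
  proof -
    obtain b where b: "b \<in> Arr V" "Dom V b = FO Z' n" "Cod V b = FO Z n" "\<alpha> n \<cdot> b = Id V (FO Z' n)"
      using \<alpha>[of n] a[of n] by (elim conjE is_isoE) auto
    have "(f \<cdot> \<alpha> n) \<cdot> b = (g \<cdot> \<alpha> n) \<cdot> b" using fg(5) by simp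
    then show ?thesis using fg(1-4) b a by simp
  qed
  note z = Lambda_functor_simps[OF Z] Lambda_functor_Obj[OF Z]
  have z': "FA Z' l \<in> Arr V" "Dom V (FA Z' l) = FO Z' (tgt l)" "Cod V (FA Z' l) = FO Z' (src l)"
    if "l \<in> Arr Lambda_cat" for l using Z'[OF that] by (auto simp: hom_iff)
  show "FA Z' (Id F_cat n) = Id V (FO Z' n)" for n
  proof (rule epi)
    show "FA Z' (Id F_cat n) \<cdot> \<alpha> n = Id V (FO Z' n) \<cdot> \<alpha> n"
      using nat[of "Id F_cat n"] a by (simp add: Lambda_functor_Id[OF Z])
  qed (use z'[of "Id F_cat n"] Ob in simp_all)
  fix k l assume kl: "k \<in> Arr Lambda_cat" "l \<in> Arr Lambda_cat" "tgt k = src l"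
  show "FA Z' (l \<odot> k) = FA Z' k \<cdot> FA Z' l"
  proof (rule epi)
    have "(FA Z' k \<cdot> FA Z' l) \<cdot> \<alpha> (tgt l) = FA Z' k \<cdot> \<alpha> (src l) \<cdot> FA Z l"
      using kl a z' nat[of l] by simp
    also have "\<dots> = (FA Z' k \<cdot> \<alpha> (tgt k)) \<cdot> FA Z l" using kl a z z' by simp
    also have "\<dots> = \<alpha> (src k) \<cdot> FA Z k \<cdot> FA Z l" using kl a z z' nat[of k] by simp
    also have "\<dots> = FA Z' (l \<odot> k) \<cdot> \<alpha> (tgt l)"
      using kl nat[of "l \<odot> k"] Lambda_functor_comp[OF Z kl] by simp
    finally show "FA Z' (l \<odot> k) \<cdot> \<alpha> (tgt l) = (FA Z' k \<cdot> FA Z' l) \<cdot> \<alpha> (tgt l)" by simp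
  qed (use kl z' z'[of "l \<odot> k"] in simp_all)
qed (rule Z')

text \<open>\<open>Z m\<close> is the coproduct of the objects \<open>X m i\<close> for \<open>i \<in> I m\<close>, and an arrow \<open>l\<close> carries the summand \<open>i\<close>
  into the summand \<open>act l i\<close> by \<open>x l i\<close>. The data \<open>I\<close>, \<open>X\<close>, \<open>act\<close>, \<open>x\<close> determine \<open>Z\<close> up to isomorphism, so
  that an isomorphism of \<open>\<Lambda>\<close>-objects is obtained by bringing presentations to the same data.\<close>

definition presents :: "('o, 'a) Lambda_obj \<Rightarrow> (nat \<Rightarrow> 'i set) \<Rightarrow> (nat \<Rightarrow> 'i \<Rightarrow> 'o) \<Rightarrow>
    (bmap \<Rightarrow> 'i \<Rightarrow> 'i) \<Rightarrow> (bmap \<Rightarrow> 'i \<Rightarrow> 'a) \<Rightarrow> (nat \<Rightarrow> 'i \<Rightarrow> 'a) \<Rightarrow> bool" where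
  "presents Z I X act x \<iota> \<longleftrightarrow>
     (\<forall>m. is_coproduct V (I m) (X m) (FO Z m) (\<iota> m)) \<and>
     (\<forall>l\<in>Arr Lambda_cat. FA Z l \<in> hom V (FO Z (tgt l)) (FO Z (src l)) \<and>
        (\<forall>i\<in>I (tgt l). act l i \<in> I (src l) \<and> x l i \<in> hom V (X (tgt l) i) (X (src l) (act l i)) \<and>
           FA Z l \<cdot> \<iota> (tgt l) i = \<iota> (src l) (act l i) \<cdot> x l i))"

context
  fixes Z I X act x \<iota>
  assumes P: "presents Z I X act x \<iota>"
begin

lemma presents_coproduct: "is_coproduct V (I m) (X m) (FO Z m) (\<iota> m)"
  using P unfolding presents_def by blast

lemma presents_arr:
  assumes "l \<in> Arr Lambda_cat"
  shows "FA Z l \<in> hom V (FO Z (tgt l)) (FO Z (src l))"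
    "FA Z l \<in> Arr V" "Dom V (FA Z l) = FO Z (tgt l)" "Cod V (FA Z l) = FO Z (src l)"
proof -
  show *: "FA Z l \<in> hom V (FO Z (tgt l)) (FO Z (src l))"
    using P assms unfolding presents_def by blast
  then show "FA Z l \<in> Arr V" "Dom V (FA Z l) = FO Z (tgt l)" "Cod V (FA Z l) = FO Z (src l)"
    by (auto simp: hom_iff)
qed

lemma presents_act:
  assumes "l \<in> Arr Lambda_cat" "i \<in> I (tgt l)"
  shows "act l i \<in> I (src l)"
    "x l i \<in> Arr V" "Dom V (x l i) = X (tgt l) i" "Cod V (x l i) = X (src l) (act l i)"
    "FA Z l \<cdot> \<iota> (tgt l) i = \<iota> (src l) (act l i) \<cdot> x l i"
proof -
  have "act l i \<in> I (src l) \<and> x l i \<in> hom V (X (tgt l) i) (X (src l) (act l i)) \<and>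
           FA Z l \<cdot> \<iota> (tgt l) i = \<iota> (src l) (act l i) \<cdot> x l i"
    using P assms unfolding presents_def by blast
  then show "act l i \<in> I (src l)"
    "x l i \<in> Arr V" "Dom V (x l i) = X (tgt l) i" "Cod V (x l i) = X (src l) (act l i)"
    "FA Z l \<cdot> \<iota> (tgt l) i = \<iota> (src l) (act l i) \<cdot> x l i"
    by (auto simp: hom_iff)
qed

lemma presents_in:
  assumes "i \<in> I m"
  shows "\<iota> m i \<in> Arr V" "Dom V (\<iota> m i) = X m i" "Cod V (\<iota> m i) = FO Z m"
  using coproduct_simps(2-4)[OF presents_coproduct assms] by auto

text \<open>An arrow out of a coproduct is determined on the summands, where functoriality is assumed.\<close>

lemma presents_functor:
  assumes actId: "\<And>m i. i \<in> I m \<Longrightarrow> act (Id F_cat m) i = i \<and> x (Id F_cat m) i = Id V (X m i)"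
    and actcomp: "\<And>k l i. k \<in> Arr Lambda_cat \<Longrightarrow> l \<in> Arr Lambda_cat \<Longrightarrow> tgt k = src l \<Longrightarrow> i \<in> I (tgt l) \<Longrightarrow>
      act (l \<odot> k) i = act k (act l i) \<and> x (l \<odot> k) i = x k (act l i) \<cdot> x l i"
  shows "Lambda_functor Z"
proof (rule Lambda_functorI)
  note cp = presents_coproduct
  show Ob: "FO Z n \<in> Obj V" for n using coproduct_simps(1)[OF cp] .
  show "FA Z (Id F_cat n) = Id V (FO Z n)" for n
  proof (rule coproduct_ext[OF cp[of n]])
    fix i assume "i \<in> I n"
    then show "FA Z (Id F_cat n) \<cdot> \<iota> n i = Id V (FO Z n) \<cdot> \<iota> n i"
      using presents_act(5)[of "Id F_cat n" i] actId[of i n] presents_in[of i n] by simp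
  qed (use presents_arr[of "Id F_cat n"] Ob in simp_all)
  fix k l assume kl: "k \<in> Arr Lambda_cat" "l \<in> Arr Lambda_cat" "tgt k = src l"
  note kl' = Lambda_comp[OF kl]
  show "FA Z (l \<odot> k) = FA Z k \<cdot> FA Z l"
  proof (rule coproduct_ext[OF cp[of "tgt l"]])
    fix i assume i: "i \<in> I (tgt l)"
    note ai = presents_act[OF kl(2) i]
    have ai': "act l i \<in> I (tgt k)" using ai kl by simp
    note aai = presents_act[OF kl(1) ai']
    have "(FA Z k \<cdot> FA Z l) \<cdot> \<iota> (tgt l) i = FA Z k \<cdot> FA Z l \<cdot> \<iota> (tgt l) i"
      using presents_arr kl presents_in[OF i] by simp
    also have "\<dots> = FA Z k \<cdot> \<iota> (tgt k) (act l i) \<cdot> x l i" using ai kl by simp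
    also have "\<dots> = (FA Z k \<cdot> \<iota> (tgt k) (act l i)) \<cdot> x l i"
      using presents_arr(2-4)[OF kl(1)] presents_in[OF ai'] ai(2-4) kl(3) by simp
    also have "\<dots> = \<iota> (src k) (act k (act l i)) \<cdot> x k (act l i) \<cdot> x l i"
      unfolding aai(5) using aai(2-4) ai(2-4) presents_in[OF aai(1)] kl(3) by simp
    also have "\<dots> = FA Z (l \<odot> k) \<cdot> \<iota> (tgt l) i"
      using presents_act(5)[OF kl', of i] actcomp[OF kl i] i by simp
    finally show "FA Z (l \<odot> k) \<cdot> \<iota> (tgt l) i = (FA Z k \<cdot> FA Z l) \<cdot> \<iota> (tgt l) i" by simp
  qed (use presents_arr kl presents_arr[OF kl'] in simp_all)
qed (rule presents_arr(1))

text \<open>The comparison maps between two coproducts of the same objects are mutually inverse, and natural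
  because both actions are given by the same \<open>act\<close> and \<open>x\<close>.\<close>

lemma presents_iso:
  assumes P': "presents Z' I X act x \<iota>'" and Z: "Lambda_functor Z"
  shows "Lambda_iso V Z Z'"
proof -
  note cp = presents_coproduct
  note cp' = cartesian.presents_coproduct[OF cartesian_axioms P']
  note in' = cartesian.presents_in[OF cartesian_axioms P']
  note arr' = cartesian.presents_arr[OF cartesian_axioms P']
  note act' = cartesian.presents_act[OF cartesian_axioms P']
  have "\<exists>h. h \<in> Arr V \<and> Dom V h = FO Z n \<and> Cod V h = FO Z' n \<and> (\<forall>i\<in>I n. h \<cdot> \<iota> n i = \<iota>' n i)" for n
    by (rule coproduct_desc[OF cp coproduct_simps(1)[OF cp']]) (simp add: in' hom_iff)
  then obtain \<alpha> where \<alpha>: "\<And>n. \<alpha> n \<in> Arr V" "\<And>n. Dom V (\<alpha> n) = FO Z n" "\<And>n. Cod V (\<alpha> n) = FO Z' n"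
      "\<And>n i. i \<in> I n \<Longrightarrow> \<alpha> n \<cdot> \<iota> n i = \<iota>' n i" by metis
  have "\<exists>h. h \<in> Arr V \<and> Dom V h = FO Z' n \<and> Cod V h = FO Z n \<and> (\<forall>i\<in>I n. h \<cdot> \<iota>' n i = \<iota> n i)" for n
    by (rule coproduct_desc[OF cp' coproduct_simps(1)[OF cp]]) (simp add: presents_in hom_iff)
  then obtain \<beta> where \<beta>: "\<And>n. \<beta> n \<in> Arr V" "\<And>n. Dom V (\<beta> n) = FO Z' n" "\<And>n. Cod V (\<beta> n) = FO Z n"
      "\<And>n i. i \<in> I n \<Longrightarrow> \<beta> n \<cdot> \<iota>' n i = \<iota> n i" by metis
  have iso: "is_iso V (\<alpha> n)" for n
  proof (rule is_isoI[where g = "\<beta> n"])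
    have "\<beta> n \<cdot> \<alpha> n = Id V (FO Z n)"
    proof (rule coproduct_ext[OF cp])
      show "(\<beta> n \<cdot> \<alpha> n) \<cdot> \<iota> n i = Id V (FO Z n) \<cdot> \<iota> n i" if i: "i \<in> I n" for i
        using \<alpha>(1-3)[of n] \<beta>(1-3)[of n] \<alpha>(4)[OF i] \<beta>(4)[OF i] presents_in[OF i] by simp
    qed (use \<alpha> \<beta> coproduct_simps(1)[OF cp] in simp_all)
    then show "\<beta> n \<cdot> \<alpha> n = Id V (Dom V (\<alpha> n))" using \<alpha> by simp
    have "\<alpha> n \<cdot> \<beta> n = Id V (FO Z' n)"
    proof (rule coproduct_ext[OF cp'])
      show "(\<alpha> n \<cdot> \<beta> n) \<cdot> \<iota>' n i = Id V (FO Z' n) \<cdot> \<iota>' n i" if i: "i \<in> I n" for i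
        using \<alpha>(1-3)[of n] \<beta>(1-3)[of n] \<alpha>(4)[OF i] \<beta>(4)[OF i] in'[OF i] by simp
    qed (use \<alpha> \<beta> coproduct_simps(1)[OF cp'] in simp_all)
    then show "\<alpha> n \<cdot> \<beta> n = Id V (Cod V (\<alpha> n))" using \<alpha> by simp
  qed (use \<alpha> \<beta> in simp_all)
  have nat: "FA Z' l \<cdot> \<alpha> (tgt l) = \<alpha> (src l) \<cdot> FA Z l" if l: "l \<in> Arr Lambda_cat" for l
  proof (rule coproduct_ext[OF cp[of "tgt l"]])
    fix i assume i: "i \<in> I (tgt l)"
    note ai = presents_act[OF l i]
    have "(\<alpha> (src l) \<cdot> FA Z l) \<cdot> \<iota> (tgt l) i = \<alpha> (src l) \<cdot> \<iota> (src l) (act l i) \<cdot> x l i"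
      using \<alpha>(1-3) presents_arr[OF l] presents_in[OF i] ai(5) by simp
    also have "\<dots> = (\<alpha> (src l) \<cdot> \<iota> (src l) (act l i)) \<cdot> x l i"
      using \<alpha>(1-3) ai(2-4) presents_in[OF ai(1)] by simp
    also have "\<dots> = FA Z' l \<cdot> \<iota>' (tgt l) i" using \<alpha>(4) ai(1) act'(5)[OF l i] by simp
    also have "\<dots> = (FA Z' l \<cdot> \<alpha> (tgt l)) \<cdot> \<iota> (tgt l) i"
      using \<alpha> arr'[OF l] presents_in[OF i] i by simp
    finally show "(FA Z' l \<cdot> \<alpha> (tgt l)) \<cdot> \<iota> (tgt l) i = (\<alpha> (src l) \<cdot> FA Z l) \<cdot> \<iota> (tgt l) i" by simp
  qed (use \<alpha> presents_arr[OF l] arr'[OF l] in simp_all)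
  have "\<alpha> n \<in> hom V (FO Z n) (FO Z' n) \<and> is_iso V (\<alpha> n)" for n
    using \<alpha> iso by (simp add: hom_iff)
  moreover from functor_transport[OF Z this nat arr'(1)] have "Lambda_functor Z'" .
  ultimately show ?thesis unfolding Lambda_iso_iff using Z nat by blast
qed

lemma presents_transport:
  assumes "Lambda_iso V Z Z'"
  shows "\<exists>\<iota>'. presents Z' I X act x \<iota>'"
proof -
  from assms obtain \<alpha> where Z': "Lambda_functor Z'"
    and \<alpha>': "\<forall>n. \<alpha> n \<in> hom V (FO Z n) (FO Z' n) \<and> is_iso V (\<alpha> n)"
    and nat: "\<forall>l\<in>Arr Lambda_cat. FA Z' l \<cdot> \<alpha> (tgt l) = \<alpha> (src l) \<cdot> FA Z l"
    unfolding Lambda_iso_iff by blast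
  have \<alpha>: "\<alpha> n \<in> Arr V" "Dom V (\<alpha> n) = FO Z n" "Cod V (\<alpha> n) = FO Z' n" "is_iso V (\<alpha> n)" for n
    using \<alpha>' by (simp_all add: hom_iff)
  note z' = Lambda_functor_simps[OF Z']
  have "presents Z' I X act x (\<lambda>m i. \<alpha> m \<cdot> \<iota> m i)"
    unfolding presents_def
  proof (intro conjI allI ballI)
    show "is_coproduct V (I m) (X m) (FO Z' m) (\<lambda>i. \<alpha> m \<cdot> \<iota> m i)" for m
      using coproduct_iso[OF presents_coproduct \<alpha>(4,2)] \<alpha>(3) by simp
    fix l assume l: "l \<in> Arr Lambda_cat"
    show "FA Z' l \<in> hom V (FO Z' (tgt l)) (FO Z' (src l))" using z'[OF l] by (simp add: hom_iff)
    fix i assume i: "i \<in> I (tgt l)"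
    note ai = presents_act[OF l i]
    show "act l i \<in> I (src l)" "x l i \<in> hom V (X (tgt l) i) (X (src l) (act l i))"
      using ai by (simp_all add: hom_iff)
    have "FA Z' l \<cdot> \<alpha> (tgt l) \<cdot> \<iota> (tgt l) i = (FA Z' l \<cdot> \<alpha> (tgt l)) \<cdot> \<iota> (tgt l) i"
      using \<alpha> z'[OF l] presents_in[OF i] by simp
    also have "\<dots> = (\<alpha> (src l) \<cdot> FA Z l) \<cdot> \<iota> (tgt l) i" using nat l by simp
    also have "\<dots> = \<alpha> (src l) \<cdot> \<iota> (src l) (act l i) \<cdot> x l i"
      using \<alpha> presents_arr[OF l] presents_in[OF i] ai(5) by simp
    also have "\<dots> = (\<alpha> (src l) \<cdot> \<iota> (src l) (act l i)) \<cdot> x l i"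
      using \<alpha> presents_in[OF ai(1)] ai(2-4) by simp
    finally show "FA Z' l \<cdot> \<alpha> (tgt l) \<cdot> \<iota> (tgt l) i = (\<alpha> (src l) \<cdot> \<iota> (src l) (act l i)) \<cdot> x l i" .
  qed
  then show ?thesis by blast
qed

lemma presents_reindex:
  assumes b: "\<And>m. bij_betw (b m) (I' m) (I m)"
    and a: "\<And>m i. i \<in> I' m \<Longrightarrow> is_iso V (a m i) \<and> Dom V (a m i) = X' m i \<and> Cod V (a m i) = X m (b m i)"
    and act': "\<And>l i. l \<in> Arr Lambda_cat \<Longrightarrow> i \<in> I' (tgt l) \<Longrightarrow>
      act' l i \<in> I' (src l) \<and> b (src l) (act' l i) = act l (b (tgt l) i) \<and>
      x' l i \<in> hom V (X' (tgt l) i) (X' (src l) (act' l i)) \<and>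
      a (src l) (act' l i) \<cdot> x' l i = x l (b (tgt l) i) \<cdot> a (tgt l) i"
  shows "presents Z I' X' act' x' (\<lambda>m i. \<iota> m (b m i) \<cdot> a m i)"
  unfolding presents_def
proof (intro conjI allI ballI)
  show "is_coproduct V (I' m) (X' m) (FO Z m) (\<lambda>i. \<iota> m (b m i) \<cdot> a m i)" for m
    by (rule coproduct_reindex[OF presents_coproduct b a])
  have aa: "a m i \<in> Arr V \<and> Dom V (a m i) = X' m i \<and> Cod V (a m i) = X m (b m i)" if "i \<in> I' m" for m i
    using a[OF that] by (simp add: is_iso_def)
  have bI: "b m i \<in> I m" if "i \<in> I' m" for m i using b[of m] that by (auto simp: bij_betw_def)
  fix l assume l: "l \<in> Arr Lambda_cat"
  show "FA Z l \<in> hom V (FO Z (tgt l)) (FO Z (src l))" using presents_arr(1)[OF l] .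
  fix i assume i: "i \<in> I' (tgt l)"
  note A = act'[OF l i]
  show "act' l i \<in> I' (src l)" "x' l i \<in> hom V (X' (tgt l) i) (X' (src l) (act' l i))"
    using A by blast+
  have j: "act' l i \<in> I' (src l)"
    and xj: "x' l i \<in> Arr V" "Cod V (x' l i) = X' (src l) (act' l i)"
    using A by (simp_all add: hom_iff)
  note ai = presents_act[OF l bI[OF i]]
  have "FA Z l \<cdot> \<iota> (tgt l) (b (tgt l) i) \<cdot> a (tgt l) i = (FA Z l \<cdot> \<iota> (tgt l) (b (tgt l) i)) \<cdot> a (tgt l) i"
    using presents_arr[OF l] presents_in[OF bI[OF i]] aa[OF i] by simp
  also have "\<dots> = \<iota> (src l) (act l (b (tgt l) i)) \<cdot> x l (b (tgt l) i) \<cdot> a (tgt l) i"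
    using ai presents_in[OF ai(1)] aa[OF i] by simp
  also have "\<dots> = \<iota> (src l) (b (src l) (act' l i)) \<cdot> a (src l) (act' l i) \<cdot> x' l i"
    using A by simp
  also have "\<dots> = (\<iota> (src l) (b (src l) (act' l i)) \<cdot> a (src l) (act' l i)) \<cdot> x' l i"
    using presents_in[OF bI[OF j]] aa[OF j] xj by simp
  finally show "FA Z l \<cdot> \<iota> (tgt l) (b (tgt l) i) \<cdot> a (tgt l) i
     = (\<iota> (src l) (b (src l) (act' l i)) \<cdot> a (src l) (act' l i)) \<cdot> x' l i" .
qed

end

end

section \<open>Day convolution as a coproduct over subsets\<close>

context distributive begin

lemma copower:
  assumes "finite S" "X \<in> Obj V"
  shows "is_coproduct V S (\<lambda>_. X) (copower V S X) (inj_copower V S X)"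
  unfolding copower_def inj_copower_def using assms by (intro coprod) auto

lemma
  assumes S: "finite S" "finite S'" and x: "x \<in> Arr V" "Dom V x = X" "Cod V x = X'"
    and u: "\<And>s. s \<in> S \<Longrightarrow> u s \<in> S'"
  shows copower_map_simps: "copower_map V S S' u x \<in> Arr V"
      "Dom V (copower_map V S S' u x) = copower V S X" "Cod V (copower_map V S S' u x) = copower V S' X'"
    and copower_map_inj: "s \<in> S \<Longrightarrow>
      copower_map V S S' u x \<cdot> inj_copower V S X s = inj_copower V S' X' (u s) \<cdot> x"
proof -
  have X: "X \<in> Obj V" "X' \<in> Obj V" using x by auto
  note cp = copower[OF S(1) X(1)] and cp' = copower[OF S(2) X(2)]
  have "\<exists>!h. h \<in> hom V (copower V S X) (copower V S' X') \<and>
     (\<forall>s\<in>S. h \<cdot> inj_copower V S X s = inj_copower V S' X' (u s) \<cdot> x)"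
    by (rule coproduct_ex1[OF cp]) (use coproduct_simps[OF cp'] u x in \<open>auto simp: hom_iff\<close>)
  from theI'[OF this] have *: "copower_map V S S' u x \<in> hom V (copower V S X) (copower V S' X')"
    "\<forall>s\<in>S. copower_map V S S' u x \<cdot> inj_copower V S X s = inj_copower V S' X' (u s) \<cdot> x"
    unfolding copower_map_def x by blast+
  then show "copower_map V S S' u x \<in> Arr V"
      "Dom V (copower_map V S S' u x) = copower V S X" "Cod V (copower_map V S S' u x) = copower V S' X'"
    by (simp_all add: hom_iff)
  show "s \<in> S \<Longrightarrow> copower_map V S S' u x \<cdot> inj_copower V S X s = inj_copower V S' X' (u s) \<cdot> x"
    using * by blast
qed

context
  fixes D E :: "('o, 'a) Lambda_obj"
  assumes D: "Lambda_functor D" and E: "Lambda_functor E"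
begin

lemmas D_simps = Lambda_functor_simps[OF D] and E_simps = Lambda_functor_simps[OF E]
lemmas DE_Obj = Lambda_functor_Obj[OF D] Lambda_functor_Obj[OF E]

abbreviation "summand n j1 j2 k \<equiv> inj_copower V (hom Lambda_cat n (j1 + j2)) (FO D j1 \<otimes> FO E j2) k"
abbreviation "summands n j1 j2 \<equiv> copower V (hom Lambda_cat n (j1 + j2)) (FO D j1 \<otimes> FO E j2)"
abbreviation "day_cowedge n \<equiv> is_cowedge (prod_cat Lambda_cat Lambda_cat) V (day_integrand V D E n)"
abbreviation "DE f g \<equiv> prod_map V (FA D f) (FA E g)"

lemma copower_pw: "is_coproduct V (hom Lambda_cat n (j1 + j2)) (\<lambda>_. FO D j1 \<otimes> FO E j2)
    (summands n j1 j2) (summand n j1 j2)"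
  by (rule copower) (simp_all add: DE_Obj)

lemmas pw_simps = coproduct_simps[OF copower_pw]

text \<open>A cowedge, written on the summands of the copowers: at \<open>k : n \<rightarrow> j\<^sub>1 + j\<^sub>2\<close> and arrows \<open>g\<^sub>1\<close>, \<open>g\<^sub>2\<close> of \<open>\<Lambda>\<close>, acting
  on \<open>D \<otimes> E\<close> by \<open>g\<^sub>1\<close> and \<open>g\<^sub>2\<close> is the same as composing \<open>k\<close> with \<open>g\<^sub>1 + g\<^sub>2\<close>.\<close>

lemma day_cowedge_iff:
  "day_cowedge n c w \<longleftrightarrow>
    c \<in> Obj V \<and> (\<forall>j1 j2. w (j1, j2) \<in> hom V (summands n j1 j2) c) \<and>
    (\<forall>g1\<in>Arr Lambda_cat. \<forall>g2\<in>Arr Lambda_cat. \<forall>k\<in>hom Lambda_cat n (src g1 + src g2).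
      w (src g1, src g2) \<cdot> summand n (src g1) (src g2) k \<cdot> DE g1 g2 =
      w (tgt g1, tgt g2) \<cdot> summand n (tgt g1) (tgt g2) (bmap_sum g1 g2 \<odot> k))"
  (is "?L \<longleftrightarrow> ?c \<and> ?t \<and> ?n")
proof -
  let ?P = "day_integrand V D E n"
  have L: "?L \<longleftrightarrow> ?c \<and> ?t \<and> (\<forall>g1\<in>Arr Lambda_cat. \<forall>g2\<in>Arr Lambda_cat.
      w (src g1, src g2) \<cdot> FA ?P ((g1, g2), (Id F_cat (src g1), Id F_cat (src g2))) =
      w (tgt g1, tgt g2) \<cdot> FA ?P ((Id F_cat (tgt g1), Id F_cat (tgt g2)), (g1, g2)))"
    unfolding is_cowedge_def prod_cat_def by (simp add: day_integrand_def)
  have "w (src g1, src g2) \<cdot> FA ?P ((g1, g2), (Id F_cat (src g1), Id F_cat (src g2))) =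
      w (tgt g1, tgt g2) \<cdot> FA ?P ((Id F_cat (tgt g1), Id F_cat (tgt g2)), (g1, g2)) \<longleftrightarrow>
      (\<forall>k\<in>hom Lambda_cat n (src g1 + src g2).
      w (src g1, src g2) \<cdot> summand n (src g1) (src g2) k \<cdot> DE g1 g2 =
      w (tgt g1, tgt g2) \<cdot> summand n (tgt g1) (tgt g2) (bmap_sum g1 g2 \<odot> k))"
    (is "?l = ?r \<longleftrightarrow> _")
    if w: "?t" and g: "g1 \<in> Arr Lambda_cat" "g2 \<in> Arr Lambda_cat" for g1 g2
  proof -
    let ?S = "hom Lambda_cat n (src g1 + src g2)" and ?T = "hom Lambda_cat n (tgt g1 + tgt g2)"
    let ?X = "FO D (tgt g1) \<otimes> FO E (tgt g2)"
    let ?i = "inj_copower V ?S ?X"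
    have w': "w (j1, j2) \<in> Arr V" "Dom V (w (j1, j2)) = summands n j1 j2" "Cod V (w (j1, j2)) = c" for j1 j2
      using w by (auto simp: hom_iff)
    have DE: "DE g1 g2 \<in> Arr V" "Dom V (DE g1 g2) = ?X" "Cod V (DE g1 g2) = FO D (src g1) \<otimes> FO E (src g2)"
      using D_simps E_simps g by auto
    have XO: "?X \<in> Obj V" by (simp add: DE_Obj)
    have comp: "bmap_sum g1 g2 \<odot> k \<in> ?T" if "k \<in> ?S" for k
      using that g by (simp add: hom_Lambda_iff)
    have id: "Id F_cat (src g1 + src g2) \<odot> k = k" if "k \<in> ?S" for k
      using that by (simp add: hom_Lambda_iff)
    let ?m1 = "copower_map V ?S ?S (\<lambda>k. Id F_cat (src g1 + src g2) \<odot> k) (DE g1 g2)"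
    let ?m2 = "copower_map V ?S ?T (\<lambda>k. bmap_sum g1 g2 \<odot> k) (Id V ?X)"
    have F: "FA ?P ((g1, g2), (Id F_cat (src g1), Id F_cat (src g2))) = ?m1"
      "FA ?P ((Id F_cat (tgt g1), Id F_cat (tgt g2)), (g1, g2)) = ?m2"
      by (simp_all add: day_integrand_def Lambda_functor_Id[OF D] Lambda_functor_Id[OF E] DE_Obj)
    have m1: "?m1 \<in> Arr V" "Dom V ?m1 = copower V ?S ?X" "Cod V ?m1 = summands n (src g1) (src g2)"
      "\<And>k. k \<in> ?S \<Longrightarrow> ?m1 \<cdot> ?i k = summand n (src g1) (src g2) k \<cdot> DE g1 g2"
      using copower_map_simps[of ?S ?S "DE g1 g2" ?X _ "\<lambda>k. Id F_cat (src g1 + src g2) \<odot> k", OF _ _ DE]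
        copower_map_inj[of ?S ?S "DE g1 g2" ?X _ "\<lambda>k. Id F_cat (src g1 + src g2) \<odot> k", OF _ _ DE] id
      by simp_all
    have m2: "?m2 \<in> Arr V" "Dom V ?m2 = copower V ?S ?X" "Cod V ?m2 = summands n (tgt g1) (tgt g2)"
      "\<And>k. k \<in> ?S \<Longrightarrow> ?m2 \<cdot> ?i k = summand n (tgt g1) (tgt g2) (bmap_sum g1 g2 \<odot> k) \<cdot> Id V ?X"
      using copower_map_simps[of ?S ?T "Id V ?X" ?X ?X "\<lambda>k. bmap_sum g1 g2 \<odot> k"]
        copower_map_inj[of ?S ?T "Id V ?X" ?X ?X "\<lambda>k. bmap_sum g1 g2 \<odot> k"] comp XO
      by simp_all
    note cS = copower[OF finite_hom_Lambda XO, of n "src g1 + src g2"]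
    note iS = coproduct_simps[OF cS]
    have l: "?l \<cdot> ?i k = w (src g1, src g2) \<cdot> summand n (src g1) (src g2) k \<cdot> DE g1 g2" if "k \<in> ?S" for k
      unfolding F using m1 w' iS that by simp
    have r: "?r \<cdot> ?i k = w (tgt g1, tgt g2) \<cdot> summand n (tgt g1) (tgt g2) (bmap_sum g1 g2 \<odot> k)"
      if "k \<in> ?S" for k
      unfolding F using m2 w' iS that pw_simps(2-4)[OF comp[OF that]] by simp
    have "?l = ?r \<longleftrightarrow> (\<forall>k\<in>?S. ?l \<cdot> ?i k = ?r \<cdot> ?i k)"
    proof
      assume a: "\<forall>k\<in>?S. ?l \<cdot> ?i k = ?r \<cdot> ?i k"
      show "?l = ?r"
      proof (rule coproduct_ext[OF cS])
        show "?l \<cdot> ?i k = ?r \<cdot> ?i k" if "k \<in> ?S" for k using a that by blast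
      qed (use m1(1-3) m2(1-3) w' in \<open>simp_all add: F\<close>)
    qed simp
    then show ?thesis using l r by simp
  qed
  then have "?t \<Longrightarrow> (\<forall>g1\<in>Arr Lambda_cat. \<forall>g2\<in>Arr Lambda_cat.
      w (src g1, src g2) \<cdot> FA ?P ((g1, g2), (Id F_cat (src g1), Id F_cat (src g2))) =
      w (tgt g1, tgt g2) \<cdot> FA ?P ((Id F_cat (tgt g1), Id F_cat (tgt g2)), (g1, g2))) \<longleftrightarrow> ?n"
    by simp
  then show ?thesis unfolding L by blast
qed

abbreviation "day_part n S \<equiv> FO D (card S) \<otimes> FO E (card ({1..n} - S))"

text \<open>The value of a cowedge at \<open>kappa n S\<close>. By the factorisation of injections into sums these values
  determine the cowedge, and they can be chosen arbitrarily. So the coend classifies families of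
  arrows out of \<open>D(|S|) \<otimes> E(|n - S|)\<close>, for all \<open>S\<close>, and is their coproduct.\<close>

definition cowedge_at :: "nat \<Rightarrow> (nat \<times> nat \<Rightarrow> 'a) \<Rightarrow> nat set \<Rightarrow> 'a" where
  "cowedge_at n w S = w (card S, card ({1..n} - S)) \<cdot> summand n (card S) (card ({1..n} - S)) (kappa n S)"

abbreviation "restr_pair j1 j2 k \<equiv> DE (restr k {1..j1}) (restr k {Suc j1..j1 + j2})"

lemma kappa_hom: "S \<subseteq> {1..n} \<Longrightarrow> kappa n S \<in> hom Lambda_cat n (card S + card ({1..n} - S))"
  by (simp add: hom_Lambda_iff)

lemma restr_pair_simps:
  assumes "k \<in> hom Lambda_cat n (j1 + j2)"
  shows "restr_pair j1 j2 k \<in> Arr V" "Dom V (restr_pair j1 j2 k) = FO D j1 \<otimes> FO E j2"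
    "Cod V (restr_pair j1 j2 k) = day_part n (preim k {1..j1})" "preim k {1..j1} \<subseteq> {1..n}"
proof -
  have k: "k \<in> Arr Lambda_cat" "src k = n" using assms by (auto simp: hom_Lambda_iff)
  show "preim k {1..j1} \<subseteq> {1..n}" using preim_subset[of k] k by simp
  show "restr_pair j1 j2 k \<in> Arr V" "Dom V (restr_pair j1 j2 k) = FO D j1 \<otimes> FO E j2"
    "Cod V (restr_pair j1 j2 k) = day_part n (preim k {1..j1})"
    using D_simps[of "restr k {1..j1}"] E_simps[of "restr k {Suc j1..j1 + j2}"] k preim_upper[OF assms]
    by simp_all
qed

context
  fixes n c w
  assumes cw: "day_cowedge n c w"
begin

lemma cowedge_simps:
  "c \<in> Obj V" "w (j1, j2) \<in> Arr V" "Dom V (w (j1, j2)) = summands n j1 j2" "Cod V (w (j1, j2)) = c"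
proof -
  have "w (j1, j2) \<in> hom V (summands n j1 j2) c" using cw unfolding day_cowedge_iff by blast
  then show "w (j1, j2) \<in> Arr V" "Dom V (w (j1, j2)) = summands n j1 j2" "Cod V (w (j1, j2)) = c"
    by (simp_all add: hom_iff)
  show "c \<in> Obj V" using cw unfolding day_cowedge_iff by blast
qed

lemma cowedge_factor:
  assumes k: "k \<in> hom Lambda_cat n (j1 + j2)"
  shows "w (j1, j2) \<cdot> summand n j1 j2 k = cowedge_at n w (preim k {1..j1}) \<cdot> restr_pair j1 j2 k"
proof -
  let ?S = "preim k {1..j1}" and ?f = "restr k {1..j1}" and ?g = "restr k {Suc j1..j1 + j2}"
  have kL: "k \<in> Arr Lambda_cat" using k by (simp add: hom_Lambda_iff)
  note r = restr_pair_simps[OF k]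
  have fg: "?f \<in> Arr Lambda_cat" "?g \<in> Arr Lambda_cat"
    "src ?f = card ?S" "src ?g = card ({1..n} - ?S)" "tgt ?f = j1" "tgt ?g = j2"
    using kL preim_upper[OF k] by simp_all
  note kp = kappa_hom[OF r(4)]
  \<comment> \<open>Naturality at the two restrictions of \<open>k\<close>, which compose with \<open>kappa n S\<close> to \<open>k\<close>.\<close>
  have "w (src ?f, src ?g) \<cdot> summand n (src ?f) (src ?g) (kappa n ?S) \<cdot> restr_pair j1 j2 k
      = w (tgt ?f, tgt ?g) \<cdot> summand n (tgt ?f) (tgt ?g) (bmap_sum ?f ?g \<odot> kappa n ?S)"
    using cw fg(1,2) kp unfolding day_cowedge_iff fg(3,4)[symmetric] by blast
  then have "w (card ?S, card ({1..n} - ?S)) \<cdot> summand n (card ?S) (card ({1..n} - ?S)) (kappa n ?S) \<cdot> restr_pair j1 j2 k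
      = w (j1, j2) \<cdot> summand n j1 j2 k"
    unfolding fg(3-6) split_injection[OF k] .
  then show ?thesis
    unfolding cowedge_at_def using r(1-3) cowedge_simps pw_simps(2-4)[OF kp] by simp
qed

lemma cowedge_at_simps:
  assumes "S \<subseteq> {1..n}"
  shows "cowedge_at n w S \<in> Arr V" "Dom V (cowedge_at n w S) = day_part n S" "Cod V (cowedge_at n w S) = c"
  unfolding cowedge_at_def using cowedge_simps pw_simps(2-4)[OF kappa_hom[OF assms]] by simp_all

lemma cowedge_comp:
  assumes "h \<in> Arr V" "Dom V h = c"
  shows "day_cowedge n (Cod V h) (\<lambda>i. h \<cdot> w i)"
  unfolding day_cowedge_iff
proof (intro conjI allI ballI)
  show "Cod V h \<in> Obj V" "\<And>j1 j2. h \<cdot> w (j1, j2) \<in> hom V (summands n j1 j2) (Cod V h)"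
    using assms cowedge_simps by (simp_all add: hom_iff)
  fix g1 g2 k assume g: "g1 \<in> Arr Lambda_cat" "g2 \<in> Arr Lambda_cat"
    and k: "k \<in> hom Lambda_cat n (src g1 + src g2)"
  have k': "bmap_sum g1 g2 \<odot> k \<in> hom Lambda_cat n (tgt g1 + tgt g2)"
    using k g by (simp add: hom_Lambda_iff)
  have "w (src g1, src g2) \<cdot> summand n (src g1) (src g2) k \<cdot> DE g1 g2 =
      w (tgt g1, tgt g2) \<cdot> summand n (tgt g1) (tgt g2) (bmap_sum g1 g2 \<odot> k)"
    using cw g k unfolding day_cowedge_iff by blast
  then show "(h \<cdot> w (src g1, src g2)) \<cdot> summand n (src g1) (src g2) k \<cdot> DE g1 g2 =
      (h \<cdot> w (tgt g1, tgt g2)) \<cdot> summand n (tgt g1) (tgt g2) (bmap_sum g1 g2 \<odot> k)"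
    using assms cowedge_simps pw_simps(2-4)[OF k] pw_simps(2-4)[OF k'] D_simps E_simps g by simp
qed

lemma cowedge_at_comp:
  assumes "h \<in> Arr V" "Dom V h = c" "S \<subseteq> {1..n}"
  shows "cowedge_at n (\<lambda>i. h \<cdot> w i) S = h \<cdot> cowedge_at n w S"
  unfolding cowedge_at_def using assms cowedge_simps pw_simps(2-4)[OF kappa_hom[OF assms(3)]] by simp

lemma cowedge_eqI:
  assumes cv: "day_cowedge n c v"
    and eq: "\<And>S. S \<subseteq> {1..n} \<Longrightarrow> cowedge_at n w S = cowedge_at n v S"
  shows "w (j1, j2) = v (j1, j2)"
proof (rule coproduct_ext[OF copower_pw])
  fix k assume k: "k \<in> hom Lambda_cat n (j1 + j2)"
  show "w (j1, j2) \<cdot> summand n j1 j2 k = v (j1, j2) \<cdot> summand n j1 j2 k"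
    using cowedge_factor[OF k] distributive.cowedge_factor[OF distributive_axioms D E cv k]
      eq[OF restr_pair_simps(4)[OF k]] by simp
qed (use cowedge_simps distributive.cowedge_simps[OF distributive_axioms D E cv] in simp_all)

end

text \<open>The cowedge of a family \<open>v\<close> is \<open>v S\<close> after the two restrictions of \<open>k\<close>, where \<open>S = k\<^sup>-\<^sup>1{1..j\<^sub>1}\<close>; composing \<open>k\<close>
  with \<open>g\<^sub>1 + g\<^sub>2\<close> keeps \<open>S\<close> and composes the restrictions with \<open>g\<^sub>1\<close> and \<open>g\<^sub>2\<close>.\<close>

lemma cowedge_of_family:
  assumes d: "d \<in> Obj V" and v: "\<And>S. S \<subseteq> {1..n} \<Longrightarrow> v S \<in> hom V (day_part n S) d"
  shows "\<exists>w. day_cowedge n d w \<and>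
     (\<forall>S\<subseteq>{1..n}. cowedge_at n w S = v S)"
proof -
  have v': "v S \<in> Arr V" "Dom V (v S) = day_part n S" "Cod V (v S) = d" if "S \<subseteq> {1..n}" for S
    using v[OF that] by (auto simp: hom_iff)
  have "\<exists>h. h \<in> Arr V \<and> Dom V h = summands n j1 j2 \<and> Cod V h = d \<and>
     (\<forall>k\<in>hom Lambda_cat n (j1 + j2). h \<cdot> summand n j1 j2 k = v (preim k {1..j1}) \<cdot> restr_pair j1 j2 k)" for j1 j2
  proof (rule coproduct_desc[OF copower_pw d], rule ballI)
    fix k assume k: "k \<in> hom Lambda_cat n (j1 + j2)"
    show "v (preim k {1..j1}) \<cdot> restr_pair j1 j2 k \<in> hom V (FO D j1 \<otimes> FO E j2) d"
      using v'[OF restr_pair_simps(4)[OF k]] restr_pair_simps(1-3)[OF k] by (simp add: hom_iff)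
  qed
  then obtain w' where w': "\<And>j1 j2. w' j1 j2 \<in> Arr V" "\<And>j1 j2. Dom V (w' j1 j2) = summands n j1 j2"
    "\<And>j1 j2. Cod V (w' j1 j2) = d" and wk: "\<And>j1 j2 k. k \<in> hom Lambda_cat n (j1 + j2) \<Longrightarrow>
      w' j1 j2 \<cdot> summand n j1 j2 k = v (preim k {1..j1}) \<cdot> restr_pair j1 j2 k"
    by metis
  define w where "w = (\<lambda>(j1, j2). w' j1 j2)"
  have "day_cowedge n d w"
    unfolding day_cowedge_iff
  proof (intro conjI allI ballI)
    show "w (j1, j2) \<in> hom V (summands n j1 j2) d" for j1 j2 using w' by (simp add: w_def hom_iff)
    fix g1 g2 k assume g: "g1 \<in> Arr Lambda_cat" "g2 \<in> Arr Lambda_cat"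
      and k: "k \<in> hom Lambda_cat n (src g1 + src g2)"
    let ?b = "bmap_sum g1 g2"
    have b: "?b \<in> Arr Lambda_cat" using g by simp
    have kL: "k \<in> Arr Lambda_cat" "tgt k = src ?b" using k by (simp_all add: hom_Lambda_iff)
    have k': "?b \<odot> k \<in> hom Lambda_cat n (tgt g1 + tgt g2)"
      using k b by (simp add: hom_Lambda_iff)
    have p: "preim (?b \<odot> k) {1..tgt g1} = preim k {1..src g1}"
      unfolding preim_comp[OF kL] preim_bmap_sum1[OF g] ..
    have r1: "restr (?b \<odot> k) {1..tgt g1} = g1 \<odot> restr k {1..src g1}"
      unfolding restr_comp[OF kL(1) b kL(2) finite_atLeastAtMost] preim_bmap_sum1[OF g] restr_bmap_sum1[OF g] ..
    have r2: "restr (?b \<odot> k) {Suc (tgt g1)..tgt g1 + tgt g2}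
       = g2 \<odot> restr k {Suc (src g1)..src g1 + src g2}"
      unfolding restr_comp[OF kL(1) b kL(2) finite_atLeastAtMost] preim_bmap_sum2[OF g] restr_bmap_sum2[OF g] ..
    have R: "restr_pair (tgt g1) (tgt g2) (?b \<odot> k) = restr_pair (src g1) (src g2) k \<cdot> DE g1 g2"
      unfolding r1 r2 using g kL D_simps E_simps
      by (simp add: Lambda_functor_comp[OF D] Lambda_functor_comp[OF E])
    note vr = v'[OF restr_pair_simps(4)[OF k]] restr_pair_simps(1-3)[OF k]
    have DEg: "DE g1 g2 \<in> Arr V" "Cod V (DE g1 g2) = FO D (src g1) \<otimes> FO E (src g2)"
      using D_simps E_simps g by simp_all
    have "w (tgt g1, tgt g2) \<cdot> summand n (tgt g1) (tgt g2) (?b \<odot> k)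
       = v (preim k {1..src g1}) \<cdot> restr_pair (src g1) (src g2) k \<cdot> DE g1 g2"
      unfolding w_def prod.case wk[OF k'] p R ..
    also have "\<dots> = (v (preim k {1..src g1}) \<cdot> restr_pair (src g1) (src g2) k) \<cdot> DE g1 g2"
      using vr DEg by simp
    also have "\<dots> = (w (src g1, src g2) \<cdot> summand n (src g1) (src g2) k) \<cdot> DE g1 g2"
      by (simp add: w_def wk[OF k])
    also have "\<dots> = w (src g1, src g2) \<cdot> summand n (src g1) (src g2) k \<cdot> DE g1 g2"
      using w' pw_simps(2-4)[OF k] DEg by (simp add: w_def)
    finally show "w (src g1, src g2) \<cdot> summand n (src g1) (src g2) k \<cdot> DE g1 g2 =
      w (tgt g1, tgt g2) \<cdot> summand n (tgt g1) (tgt g2) (?b \<odot> k)" by simp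
  qed (rule d)
  moreover have "cowedge_at n w S = v S" if S: "S \<subseteq> {1..n}" for S
    unfolding cowedge_at_def w_def prod.case wk[OF kappa_hom[OF S]] preim_kappa1[OF S] restr_kappa1[OF S] restr_kappa2[OF S]
    using v'[OF S] by (simp add: Lambda_functor_Id[OF D] Lambda_functor_Id[OF E] DE_Obj)
  ultimately show ?thesis by blast
qed

text \<open>Cowedges correspond to families, so the coproduct of the objects \<open>D(|S|) \<otimes> E(|n - S|)\<close> is a
  coend.\<close>

lemma coend_exists:
  "\<exists>c w. is_coend (prod_cat Lambda_cat Lambda_cat) V (day_integrand V D E n) c w"
proof -
  let ?c = "coprod V (Pow {1..n}) (day_part n)" and ?i = "inj_coprod V (Pow {1..n}) (day_part n)"
  have cp: "is_coproduct V (Pow {1..n}) (day_part n) ?c ?i"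
    by (rule coprod) (simp_all add: DE_Obj)
  note cs = coproduct_simps[OF cp]
  obtain w where w: "day_cowedge n ?c w"
    and fw: "\<forall>S\<subseteq>{1..n}. cowedge_at n w S = ?i S"
    using cowedge_of_family[OF cs(1), of n ?i] cs by (auto simp: hom_iff)
  have "is_coend (prod_cat Lambda_cat Lambda_cat) V (day_integrand V D E n) ?c w"
    unfolding is_coend_def
  proof (intro conjI allI impI w)
    fix d v assume v: "day_cowedge n d v"
    have "\<forall>S\<in>Pow {1..n}. cowedge_at n v S \<in> hom V (day_part n S) d"
      using cowedge_at_simps[OF v] by (auto simp: hom_iff)
    from coproduct_desc[OF cp cowedge_simps(1)[OF v] this]
    obtain h where h: "h \<in> Arr V" "Dom V h = ?c" "Cod V h = d" "\<forall>S\<in>Pow {1..n}. h \<cdot> ?i S = cowedge_at n v S"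
      by blast
    show "\<exists>!h. h \<in> hom V ?c d \<and> (\<forall>i\<in>Obj (prod_cat Lambda_cat Lambda_cat). h \<cdot> w i = v i)"
    proof (rule ex1I)
      have "h \<cdot> w (j1, j2) = v (j1, j2)" for j1 j2
        by (rule cowedge_eqI[OF cowedge_comp[OF w h(1,2), unfolded h(3)] v])
          (use h fw in \<open>auto simp: cowedge_at_comp[OF w]\<close>)
      then show "h \<in> hom V ?c d \<and> (\<forall>i\<in>Obj (prod_cat Lambda_cat Lambda_cat). h \<cdot> w i = v i)"
        using h by (auto simp: hom_iff)
      fix g assume "g \<in> hom V ?c d \<and> (\<forall>i\<in>Obj (prod_cat Lambda_cat Lambda_cat). g \<cdot> w i = v i)"
      then have g: "g \<in> Arr V" "Dom V g = ?c" "Cod V g = d" "\<And>j1 j2. g \<cdot> w (j1, j2) = v (j1, j2)"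
        by (simp_all add: hom_iff prod_cat_def)
      show "g = h"
      proof (rule coproduct_ext[OF cp])
        fix S assume S: "S \<in> Pow {1..n}"
        have "cowedge_at n (\<lambda>i. g \<cdot> w i) S = cowedge_at n v S" unfolding cowedge_at_def g(4) ..
        then show "g \<cdot> ?i S = h \<cdot> ?i S"
          using S h fw g by (simp add: cowedge_at_comp[OF w])
      qed (use g h in simp_all)
    qed
  qed
  then show ?thesis by blast
qed

lemma day_coend: "is_coend (prod_cat Lambda_cat Lambda_cat) V (day_integrand V D E n)
    (day_ob V D E n) (day_in V D E n)"
proof -
  have "\<exists>p. is_coend (prod_cat Lambda_cat Lambda_cat) V (day_integrand V D E n) (fst p) (snd p)"
    using coend_exists by simp
  from someI_ex[OF this] show ?thesis
    by (simp add: day_ob_def day_in_def coend_cowedge_def)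
qed

lemma day_in_cowedge: "day_cowedge n (day_ob V D E n) (day_in V D E n)"
  using day_coend unfolding is_coend_def by blast

lemma day_ex1:
  assumes "day_cowedge n d v"
  shows "\<exists>!h. h \<in> hom V (day_ob V D E n) d \<and> (\<forall>j1 j2. h \<cdot> day_in V D E n (j1, j2) = v (j1, j2))"
proof -
  have "\<exists>!h. h \<in> hom V (day_ob V D E n) d \<and>
      (\<forall>i\<in>Obj (prod_cat Lambda_cat Lambda_cat). h \<cdot> day_in V D E n i = v i)"
    using day_coend[of n] assms unfolding is_coend_def by blast
  then show ?thesis by (simp add: prod_cat_def)
qed

lemma day_ob_coproduct:
  "is_coproduct V (Pow {1..n}) (day_part n) (day_ob V D E n) (cowedge_at n (day_in V D E n))"
proof (rule is_coproductI)
  note cw = day_in_cowedge[of n]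
  show "day_ob V D E n \<in> Obj V" by (rule cowedge_simps(1)[OF cw])
  show "cowedge_at n (day_in V D E n) S \<in> hom V (day_part n S) (day_ob V D E n)" if "S \<in> Pow {1..n}" for S
    using cowedge_at_simps[OF cw, of S] that by (simp add: hom_iff)
  fix d v assume d: "d \<in> Obj V" and v: "\<forall>S\<in>Pow {1..n}. v S \<in> hom V (day_part n S) d"
  obtain w where w: "day_cowedge n d w"
    "\<forall>S\<subseteq>{1..n}. cowedge_at n w S = v S"
    using cowedge_of_family[OF d, of n v] v by auto
  obtain h where h: "h \<in> hom V (day_ob V D E n) d" "\<forall>j1 j2. h \<cdot> day_in V D E n (j1, j2) = w (j1, j2)"
    using ex1_implies_ex[OF day_ex1[OF w(1)]] by blast
  have "h \<cdot> cowedge_at n (day_in V D E n) S = v S" if S: "S \<subseteq> {1..n}" for S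
  proof -
    have "h \<cdot> cowedge_at n (day_in V D E n) S = cowedge_at n (\<lambda>i. h \<cdot> day_in V D E n i) S"
      using cowedge_at_comp[OF cw _ _ S, of h] h(1) by (simp add: hom_iff)
    also have "\<dots> = cowedge_at n w S" unfolding cowedge_at_def using h(2) by simp
    finally show ?thesis using w(2) S by simp
  qed
  then show "\<exists>h\<in>hom V (day_ob V D E n) d. \<forall>S\<in>Pow {1..n}. h \<cdot> cowedge_at n (day_in V D E n) S = v S"
    using h(1) by blast
next
  note cw = day_in_cowedge[of n]
  fix h k assume a: "h \<in> Arr V" "k \<in> Arr V" "Dom V h = day_ob V D E n" "Dom V k = day_ob V D E n"
    "Cod V h = Cod V k" "\<forall>S\<in>Pow {1..n}. h \<cdot> cowedge_at n (day_in V D E n) S = k \<cdot> cowedge_at n (day_in V D E n) S"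
  note ck = cowedge_comp[OF cw a(2,4)] and ch = cowedge_comp[OF cw a(1,3), unfolded a(5)]
  have "h \<cdot> day_in V D E n (j1, j2) = k \<cdot> day_in V D E n (j1, j2)" for j1 j2
    by (rule cowedge_eqI[OF ch ck]) (use a in \<open>simp add: cowedge_at_comp[OF cw]\<close>)
  moreover have "h \<in> hom V (day_ob V D E n) (Cod V k)" "k \<in> hom V (day_ob V D E n) (Cod V k)"
    using a(1-5) by (simp_all add: hom_iff)
  ultimately show "h = k" using day_ex1[OF ck] by blast
qed

lemma
  assumes l: "l \<in> Arr Lambda_cat"
  shows day_arr_hom: "day_arr V D E l \<in> hom V (day_ob V D E (tgt l)) (day_ob V D E (src l))"
    and day_arr_pt: "k \<in> hom Lambda_cat (tgt l) (j1 + j2) \<Longrightarrow>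
      day_arr V D E l \<cdot> day_in V D E (tgt l) (j1, j2) \<cdot> summand (tgt l) j1 j2 k =
      day_in V D E (src l) (j1, j2) \<cdot> summand (src l) j1 j2 (k \<odot> l)"
proof -
  let ?m = "src l" and ?n = "tgt l"
  let ?cm = "\<lambda>j1 j2. copower_map V (hom Lambda_cat ?n (j1 + j2)) (hom Lambda_cat ?m (j1 + j2))
            (\<lambda>k. k \<odot> l) (Id V (FO D j1 \<otimes> FO E j2))"
  let ?w = "\<lambda>(j1, j2). day_in V D E ?m (j1, j2) \<cdot> ?cm j1 j2"
  have kl: "k \<odot> l \<in> hom Lambda_cat ?m j" if "k \<in> hom Lambda_cat ?n j" for k j
    using that l by (simp add: hom_Lambda_iff)
  have X: "FO D j1 \<otimes> FO E j2 \<in> Obj V" for j1 j2 by (simp add: DE_Obj)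
  note cm = copower_map_simps[of "hom Lambda_cat ?n j" "hom Lambda_cat ?m j" "Id V X" X X "\<lambda>k. k \<odot> l" for j X]
    and cmi = copower_map_inj[of "hom Lambda_cat ?n j" "hom Lambda_cat ?m j" "Id V X" X X "\<lambda>k. k \<odot> l" for j X]
  have cm': "?cm j1 j2 \<in> Arr V" "Dom V (?cm j1 j2) = summands ?n j1 j2" "Cod V (?cm j1 j2) = summands ?m j1 j2" for j1 j2
    using cm[of "j1 + j2" "FO D j1 \<otimes> FO E j2"] X kl by simp_all
  have cmi': "?cm j1 j2 \<cdot> summand ?n j1 j2 k = summand ?m j1 j2 (k \<odot> l)"
    if "k \<in> hom Lambda_cat ?n (j1 + j2)" for k j1 j2
    using cmi[of "j1 + j2" "FO D j1 \<otimes> FO E j2" k] X kl that pw_simps(2-4)[OF kl[OF that]] by simp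
  note di = cowedge_simps[OF day_in_cowedge[of ?m]]
  have wk: "?w (j1, j2) \<cdot> summand ?n j1 j2 k = day_in V D E ?m (j1, j2) \<cdot> summand ?m j1 j2 (k \<odot> l)"
    if "k \<in> hom Lambda_cat ?n (j1 + j2)" for k j1 j2
    using di cm'[of j1 j2] pw_simps(2-4)[OF that] cmi'[OF that] by simp
  have w: "day_cowedge ?n (day_ob V D E ?m) ?w"
    unfolding day_cowedge_iff
  proof (intro conjI allI ballI)
    show "day_ob V D E ?m \<in> Obj V" by (rule di)
    show wt: "?w (j1, j2) \<in> hom V (summands ?n j1 j2) (day_ob V D E ?m)" for j1 j2
      using di cm' by (simp add: hom_iff)
    fix g1 g2 k assume g: "g1 \<in> Arr Lambda_cat" "g2 \<in> Arr Lambda_cat"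
      and k: "k \<in> hom Lambda_cat ?n (src g1 + src g2)"
    have k': "bmap_sum g1 g2 \<odot> k \<in> hom Lambda_cat ?n (tgt g1 + tgt g2)"
      using k g by (simp add: hom_Lambda_iff)
    have as: "(bmap_sum g1 g2 \<odot> k) \<odot> l = bmap_sum g1 g2 \<odot> (k \<odot> l)"
      using k g l by (intro F_assoc) (simp_all add: hom_Lambda_iff)
    have DEg: "DE g1 g2 \<in> Arr V" "Cod V (DE g1 g2) = FO D (src g1) \<otimes> FO E (src g2)"
      using D_simps E_simps g by simp_all
    have "?w (src g1, src g2) \<cdot> summand ?n (src g1) (src g2) k \<cdot> DE g1 g2
      = (?w (src g1, src g2) \<cdot> summand ?n (src g1) (src g2) k) \<cdot> DE g1 g2"
      using DEg pw_simps(2-4)[OF k] wt[of "src g1" "src g2"] by (simp add: hom_iff)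
    also have "\<dots> = (day_in V D E ?m (src g1, src g2) \<cdot> summand ?m (src g1) (src g2) (k \<odot> l)) \<cdot> DE g1 g2"
      unfolding wk[OF k] ..
    also have "\<dots> = day_in V D E ?m (src g1, src g2) \<cdot> summand ?m (src g1) (src g2) (k \<odot> l) \<cdot> DE g1 g2"
      using DEg pw_simps(2-4)[OF kl[OF k]] di by simp
    also have "\<dots> = day_in V D E ?m (tgt g1, tgt g2) \<cdot>
        summand ?m (tgt g1) (tgt g2) (bmap_sum g1 g2 \<odot> (k \<odot> l))"
      using day_in_cowedge[of ?m] g kl[OF k] unfolding day_cowedge_iff by blast
    finally show "?w (src g1, src g2) \<cdot> summand ?n (src g1) (src g2) k \<cdot> DE g1 g2 =
        ?w (tgt g1, tgt g2) \<cdot> summand ?n (tgt g1) (tgt g2) (bmap_sum g1 g2 \<odot> k)"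
      unfolding wk[OF k'] as .
  qed
  have da: "day_arr V D E l = (THE h. h \<in> hom V (day_ob V D E ?n) (day_ob V D E ?m) \<and>
      (\<forall>j1 j2. h \<cdot> day_in V D E ?n (j1, j2) = ?w (j1, j2)))"
    unfolding day_arr_def by simp
  have "day_arr V D E l \<in> hom V (day_ob V D E ?n) (day_ob V D E ?m) \<and>
      (\<forall>j1 j2. day_arr V D E l \<cdot> day_in V D E ?n (j1, j2) = ?w (j1, j2))"
    unfolding da by (rule theI'[OF day_ex1[OF w]])
  then have h: "day_arr V D E l \<in> hom V (day_ob V D E ?n) (day_ob V D E ?m)"
    "day_arr V D E l \<cdot> day_in V D E ?n (j1, j2) = ?w (j1, j2)" by blast+
  show "day_arr V D E l \<in> hom V (day_ob V D E ?n) (day_ob V D E ?m)" by (rule h(1))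
  assume k: "k \<in> hom Lambda_cat ?n (j1 + j2)"
  have "day_arr V D E l \<cdot> day_in V D E ?n (j1, j2) \<cdot> summand ?n j1 j2 k
     = (day_arr V D E l \<cdot> day_in V D E ?n (j1, j2)) \<cdot> summand ?n j1 j2 k"
    using h(1) cowedge_simps[OF day_in_cowedge[of ?n]] pw_simps(2-4)[OF k] by (simp add: hom_iff)
  then show "day_arr V D E l \<cdot> day_in V D E ?n (j1, j2) \<cdot> summand ?n j1 j2 k =
      day_in V D E ?m (j1, j2) \<cdot> summand ?m j1 j2 (k \<odot> l)"
    unfolding h(2) wk[OF k] .
qed

text \<open>The action of \<open>l\<close> composes \<open>kappa n S\<close> with \<open>l\<close>. The composite splits at \<open>l\<^sup>-\<^sup>1(S)\<close> into the restrictions of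
  \<open>l\<close> to \<open>l\<^sup>-\<^sup>1(S)\<close> and to its complement.\<close>

lemma day_presents:
  "presents (day V D E) (\<lambda>m. Pow {1..m}) (\<lambda>m S. FO D (card S) \<otimes> FO E (card ({1..m} - S))) preim
     (\<lambda>l S. prod_map V (FA D (restr l S)) (FA E (restr l ({1..tgt l} - S))))
     (\<lambda>m. cowedge_at m (day_in V D E m))"
  unfolding presents_def
proof (intro conjI allI ballI)
  show "is_coproduct V (Pow {1..m}) (day_part m) (FO (day V D E) m) (cowedge_at m (day_in V D E m))" for m
    using day_ob_coproduct by (simp add: day_def)
  fix l assume l: "l \<in> Arr Lambda_cat"
  show "FA (day V D E) l \<in> hom V (FO (day V D E) (tgt l)) (FO (day V D E) (src l))"
    using day_arr_hom[OF l] by (simp add: day_def)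
  fix S assume "S \<in> Pow {1..tgt l}"
  then have S: "S \<subseteq> {1..tgt l}" by simp
  then have fS: "finite S" "finite ({1..tgt l} - S)" by (auto intro: finite_subset)
  let ?k = "kappa (tgt l) S" and ?a = "card S" and ?b = "card ({1..tgt l} - S)"
  show "preim l S \<in> Pow {1..src l}" using preim_subset by simp
  show "DE (restr l S) (restr l ({1..tgt l} - S)) \<in> hom V (day_part (tgt l) S) (day_part (src l) (preim l S))"
    using D_simps[of "restr l S"] E_simps[of "restr l ({1..tgt l} - S)"] l fS preim_compl[OF l, of S]
    by (simp add: hom_iff)
  note kh = kappa_hom[OF S]
  have kL: "?k \<in> Arr Lambda_cat" "tgt l = src ?k" using S by simp_all
  have kl: "?k \<odot> l \<in> hom Lambda_cat (src l) (?a + ?b)"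
    using l kL by (simp add: hom_Lambda_iff)
  have p: "preim (?k \<odot> l) {1..?a} = preim l S"
    unfolding preim_comp[OF l kL(2)] preim_kappa1[OF S] ..
  have r1: "restr (?k \<odot> l) {1..?a} = restr l S"
    unfolding restr_comp[OF l kL(1,2) finite_atLeastAtMost] preim_kappa1[OF S] restr_kappa1[OF S]
    using l fS by simp
  have r2: "restr (?k \<odot> l) {Suc ?a..?a + ?b} = restr l ({1..tgt l} - S)"
    unfolding restr_comp[OF l kL(1,2) finite_atLeastAtMost] preim_kappa2[OF S] restr_kappa2[OF S]
    using l fS by simp
  have "FA (day V D E) l \<cdot> cowedge_at (tgt l) (day_in V D E (tgt l)) S
    = day_in V D E (src l) (?a, ?b) \<cdot> summand (src l) ?a ?b (?k \<odot> l)"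
    using day_arr_pt[OF l kh] by (simp add: day_def cowedge_at_def)
  also have "\<dots> = cowedge_at (src l) (day_in V D E (src l)) (preim l S) \<cdot> DE (restr l S) (restr l ({1..tgt l} - S))"
    unfolding cowedge_factor[OF day_in_cowedge kl] p r1 r2 ..
  finally show "FA (day V D E) l \<cdot> cowedge_at (tgt l) (day_in V D E (tgt l)) S
    = cowedge_at (src l) (day_in V D E (src l)) (preim l S) \<cdot> DE (restr l S) (restr l ({1..tgt l} - S))" .
qed

lemma day_functor: "Lambda_functor (day V D E)"
proof (rule presents_functor[OF day_presents])
  fix m :: nat and S :: "nat set" assume "S \<in> Pow {1..m}"
  then have "S \<subseteq> {1..m}" "{1..m} - S \<subseteq> {1..m}" by auto
  then show "preim (Id F_cat m) S = S \<and>
      DE (restr (Id F_cat m) S) (restr (Id F_cat m) ({1..tgt (Id F_cat m)} - S)) = Id V (day_part m S)"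
    by (simp add: Lambda_functor_Id[OF D] Lambda_functor_Id[OF E] DE_Obj)
next
  fix k l S assume kl: "k \<in> Arr Lambda_cat" "l \<in> Arr Lambda_cat" "tgt k = src l" and S: "S \<in> Pow {1..tgt l}"
  then have fS: "finite S" "finite ({1..tgt l} - S)" by (auto intro: finite_subset)
  have c: "preim l ({1..tgt l} - S) = {1..tgt k} - preim l S" using preim_compl[OF kl(2)] kl(3) by simp
  have 1: "restr (l \<odot> k) S = restr l S \<odot> restr k (preim l S)"
    by (rule restr_comp[OF kl fS(1)])
  have 2: "restr (l \<odot> k) ({1..tgt l} - S) =
      restr l ({1..tgt l} - S) \<odot> restr k ({1..tgt k} - preim l S)"
    unfolding c[symmetric] by (rule restr_comp[OF kl fS(2)])
  have d: "card (preim l ({1..tgt l} - S)) = card ({1..tgt k} - preim l S)" unfolding c ..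
  show "preim (l \<odot> k) S = preim k (preim l S) \<and>
      DE (restr (l \<odot> k) S) (restr (l \<odot> k) ({1..tgt (l \<odot> k)} - S)) =
      DE (restr k (preim l S)) (restr k ({1..tgt k} - preim l S)) \<cdot> DE (restr l S) (restr l ({1..tgt l} - S))"
    using kl fS d 1 2 D_simps E_simps
    by (simp add: preim_comp Lambda_functor_comp[OF D] Lambda_functor_comp[OF E])
qed

end

end


section \<open>Structure maps of an operad over finite sets\<close>

lemma block_rank_less:
  assumes "finite A" "b \<in> A" "f b < f a \<or> f b = f a \<and> b < a"
  shows "block_rank A f b < block_rank A f a"
proof -
  have "b \<in> {x \<in> A. f x < f a \<or> f x = f a \<and> x < a} - {x \<in> A. f x < f b \<or> f x = f b \<and> x < b}"
    using assms by auto
  moreover have "{x \<in> A. f x < f b \<or> f x = f b \<and> x < b} \<subseteq> {x \<in> A. f x < f a \<or> f x = f a \<and> x < a}"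
    using assms(3) by auto
  ultimately have "{x \<in> A. f x < f b \<or> f x = f b \<and> x < b} \<subset> {x \<in> A. f x < f a \<or> f x = f a \<and> x < a}"
    by blast
  then show ?thesis unfolding block_rank_def using assms(1) by (intro psubset_card_mono) simp_all
qed

lemma sorted_nth_unrank: "finite A \<Longrightarrow> r < card A \<Longrightarrow> sorted_list_of_set A ! r = unrank A (Suc r)"
  by (simp add: sorted_list_of_set_eq_unrank del: upt_Suc)

lemma sort_perm_permutes:
  assumes A: "finite A"
  shows "sort_perm A f permutes {..<card A}"
proof (rule bij_imp_permutes)
  let ?g = "\<lambda>r. block_rank A f (unrank A (Suc r))"
  have e: "unrank A (Suc r) \<in> A" if "r < card A" for r using A that by simp
  have g: "sort_perm A f r = ?g r" if "r < card A" for r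
    using that A by (simp add: sort_perm_def sorted_nth_unrank)
  have lt: "?g r < card A" if "r < card A" for r
    unfolding block_rank_def using e[OF that] A by (intro psubset_card_mono) auto
  have inj: "inj_on ?g {..<card A}"
  proof (rule inj_onI)
    fix r s assume rs: "r \<in> {..<card A}" "s \<in> {..<card A}" "?g r = ?g s"
    let ?a = "unrank A (Suc r)" and ?b = "unrank A (Suc s)"
    have ab: "?a \<in> A" "?b \<in> A" using e rs by simp_all
    have "?a = ?b"
    proof (rule ccontr)
      assume "?a \<noteq> ?b"
      then have "(f ?a < f ?b \<or> f ?a = f ?b \<and> ?a < ?b) \<or> (f ?b < f ?a \<or> f ?b = f ?a \<and> ?b < ?a)"
        by linarith
      then show False using block_rank_less[OF A ab(1), of f ?b] block_rank_less[OF A ab(2), of f ?a] rs(3)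
        by auto
    qed
    then have "rank A ?a = rank A ?b" by simp
    then show "r = s" using rs A by simp
  qed
  have "?g ` {..<card A} = {..<card A}"
    using inj lt by (intro card_subset_eq) (auto simp: card_image)
  then have "bij_betw ?g {..<card A} {..<card A}" using inj by (simp add: bij_betw_def)
  then show "bij_betw (sort_perm A f) {..<card A} {..<card A}"
    using g by (subst bij_betw_cong[where g = ?g]) auto
qed (simp add: sort_perm_def)

lemma sorted_list_of_interval: "sorted_list_of_set {1..n} = [1..<Suc n]"
  by (metis atLeastLessThanSuc_atLeastAtMost sorted_list_of_set_range)

lemma sum_list_card_fibres:
  assumes "finite A" "finite B" "f ` A \<subseteq> B"
  shows "sum_list (map (\<lambda>b. card (set_fib A f b)) (sorted_list_of_set B)) = card A"
proof -
  have "sum_list (map (\<lambda>b. card (set_fib A f b)) (sorted_list_of_set B)) = (\<Sum>b\<in>B. card (set_fib A f b))"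
    using assms(2) by (simp add: sum_list_distinct_conv_sum_set)
  also have "\<dots> = (\<Sum>b\<in>B. \<Sum>a\<in>{a \<in> A. f a = b}. 1)" by (simp add: set_fib_def)
  also have "\<dots> = (\<Sum>a\<in>A. 1)" by (rule sum.group[OF assms])
  finally show ?thesis by simp
qed

lemma image_Collect_restrict: "{y \<in> g ` A. Q y} = g ` {x \<in> A. Q (g x)}"
  by blast

text \<open>The structure map of \<open>f : A \<rightarrow> B\<close> only depends on the relative order of the elements.\<close>

lemma set_fib_std:
  assumes "finite A" "finite B" "f ` A \<subseteq> B" "b \<in> B"
  shows "set_fib {1..card A} (fn (std A B f)) (rank B b) = rank A ` set_fib A f b"
proof -
  have "set_fib {1..card A} (fn (std A B f)) (rank B b) = {r \<in> rank A ` A. fn (std A B f) r = rank B b}"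
    unfolding set_fib_def rank_image[OF assms(1)] ..
  also have "\<dots> = rank A ` {a \<in> A. fn (std A B f) (rank A a) = rank B b}" by blast
  also have "{a \<in> A. fn (std A B f) (rank A a) = rank B b} = {a \<in> A. f a = b}"
    by (rule Collect_cong) (use assms in \<open>auto simp: fn_std rank_inj subset_iff\<close>)
  finally show ?thesis by (simp add: set_fib_def)
qed

lemma card_set_fib_std:
  assumes "finite A" "finite B" "f ` A \<subseteq> B" "b \<in> B"
  shows "card (set_fib {1..card A} (fn (std A B f)) (rank B b)) = card (set_fib A f b)"
proof -
  have "inj_on (rank A) (set_fib A f b)"
    using rank_bij[OF assms(1)] by (auto simp: bij_betw_def set_fib_def intro: inj_on_subset)
  then show ?thesis unfolding set_fib_std[OF assms] by (rule card_image)
qed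

lemma sort_perm_std:
  assumes "finite A" "finite B" "f ` A \<subseteq> B"
  shows "sort_perm {1..card A} (fn (std A B f)) = sort_perm A f"
proof
  fix r
  let ?f = "fn (std A B f)"
  show "sort_perm {1..card A} ?f r = sort_perm A f r"
  proof (cases "r < card A")
    case True
    obtain a where a: "a \<in> A" "rank A a = Suc r" and ea: "unrank A (Suc r) = a"
      using assms(1) True by (intro that[of "unrank A (Suc r)"]) simp_all
    have f: "?f (rank A x) = rank B (f x)" if "x \<in> A" for x using fn_std[OF assms(1) that] .
    have c: "f x \<in> B" if "x \<in> A" for x using assms(3) that by auto
    have e: "(?f (rank A x) < ?f (Suc r) \<or> ?f (rank A x) = ?f (Suc r) \<and> rank A x < Suc r) \<longleftrightarrow>
       (f x < f a \<or> f x = f a \<and> x < a)" if "x \<in> A" for x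
      unfolding a(2)[symmetric] f[OF that] f[OF a(1)]
      using rank_less_iff[OF assms(2) c[OF that] c[OF a(1)]] rank_inj[OF assms(2) c[OF that] c[OF a(1)]]
        rank_less_iff[OF assms(1) that a(1)] by simp
    have "{x \<in> {1..card A}. ?f x < ?f (Suc r) \<or> ?f x = ?f (Suc r) \<and> x < Suc r}
       = rank A ` {x \<in> A. ?f (rank A x) < ?f (Suc r) \<or> ?f (rank A x) = ?f (Suc r) \<and> rank A x < Suc r}"
      unfolding rank_image[OF assms(1), symmetric] by (rule image_Collect_restrict)
    also have "\<dots> = rank A ` {x \<in> A. f x < f a \<or> f x = f a \<and> x < a}"
      by (rule arg_cong[where f = "(`) (rank A)"], rule Collect_cong) (use e in blast)
    finally have "block_rank {1..card A} ?f (Suc r) = card (rank A ` {x \<in> A. f x < f a \<or> f x = f a \<and> x < a})"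
      by (simp add: block_rank_def)
    also have "\<dots> = block_rank A f a"
      unfolding block_rank_def using rank_bij[OF assms(1)]
      by (intro card_image) (auto simp: bij_betw_def intro: inj_on_subset)
    finally have *: "block_rank {1..card A} ?f (Suc r) = block_rank A f a" .
    have "sorted_list_of_set {1..card A} ! r = Suc r"
      unfolding sorted_list_of_interval using True by (simp del: upt_Suc)
    then show ?thesis using True * assms(1) by (simp add: sort_perm_def sorted_nth_unrank ea)
  qed (simp add: sort_perm_def)
qed

text \<open>The functor of a based operad on an injection \<open>f : A \<rightarrow> B\<close> of finite sets is \<open>set_act\<close>; its inputs at
  the elements of \<open>B\<close> are the points \<open>set_point\<close>.\<close>

definition set_point :: "('o, 'a, 'y) based_operad_scheme \<Rightarrow> nat set \<Rightarrow> (nat \<Rightarrow> nat) \<Rightarrow> nat \<Rightarrow> 'a" where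
  "set_point C A f b = (if set_fib A f b = {} then OpEta C else OpUnit C)"

text \<open>The factors \<open>C(\<phi>\<^sup>-\<^sup>1(1)), \<dots>, C(\<phi>\<^sup>-\<^sup>1(n))\<close>. The length \<open>n\<close> is an argument so that the list has the same
  form for all maps to \<open>n\<close>.\<close>

definition env_obs :: "('o, 'a, 'y) operad_scheme \<Rightarrow> nat \<Rightarrow> bmap \<Rightarrow> 'o list" where
  "env_obs C n \<phi> = map (\<lambda>j. OpOb C (card (fib \<phi> j))) [1..<Suc n]"

lemma (in cartesian) comp_pair_comp:
  assumes "g \<in> Arr V" "c \<in> Arr V" "t \<in> Arr V" "h \<in> Arr V"
    "Dom V g = Cod V c \<otimes> Cod V t" "Dom V c = Dom V t" "Cod V h = Dom V t"
  shows "(g \<cdot> pair V c t) \<cdot> h = g \<cdot> pair V (c \<cdot> h) (t \<cdot> h)"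
  using assms by simp

context distributive begin

context
  fixes C :: "('o, 'a) based_operad"
  assumes C: "is_based_operad V C"
begin

lemma OpOb_Obj [simp]: "OpOb C n \<in> Obj V"
  using C by (simp add: is_based_operad_def is_operad_def operad_typed_def)

lemma OpAct_simps [simp]:
  assumes "\<sigma> permutes {..<n}"
  shows "OpAct C n \<sigma> \<in> Arr V" "Dom V (OpAct C n \<sigma>) = OpOb C n" "Cod V (OpAct C n \<sigma>) = OpOb C n"
  using C assms by (simp_all add: is_based_operad_def is_operad_def operad_typed_def hom_iff)

lemma OpGam_simps [simp]:
  "OpGam C js \<in> Arr V" "Dom V (OpGam C js) = OpOb C (length js) \<otimes> lprod V (map (OpOb C) js)"
  "Cod V (OpGam C js) = OpOb C (sum_list js)"
  using C by (simp_all add: is_based_operad_def is_operad_def operad_typed_def hom_iff)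

lemma OpPoint_simps [simp]:
  "OpUnit C \<in> Arr V" "Dom V (OpUnit C) = One V" "Cod V (OpUnit C) = OpOb C (Suc 0)"
  "OpEta C \<in> Arr V" "Dom V (OpEta C) = One V" "Cod V (OpEta C) = OpOb C 0"
  using C by (simp_all add: is_based_operad_def is_operad_def operad_typed_def hom_iff)

lemma set_gam_simps:
  assumes "finite A" "finite B" "f ` A \<subseteq> B"
  shows "set_gam V C A B f \<in> Arr V"
    "Dom V (set_gam V C A B f) =
      OpOb C (card B) \<otimes> lprod V (map (\<lambda>b. OpOb C (card (set_fib A f b))) (sorted_list_of_set B))"
    "Cod V (set_gam V C A B f) = OpOb C (card A)"
  unfolding set_gam_def
  using sort_perm_permutes[OF assms(1), of f] sum_list_card_fibres[OF assms] assms(2)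
  by (simp_all add: comp_def)

definition set_act :: "nat set \<Rightarrow> nat set \<Rightarrow> (nat \<Rightarrow> nat) \<Rightarrow> 'a" where
  "set_act A B f = (let X = OpOb C (card B) in
     set_gam V C A B f \<cdot> pair V (Id V X)
       (tuple V X (map (\<lambda>b. set_point C A f b \<cdot> bang V X) (sorted_list_of_set B))))"

lemma set_point_simps:
  assumes "finite A" "inj_on f A"
  shows "set_point C A f b \<in> Arr V" "Dom V (set_point C A f b) = One V"
    "Cod V (set_point C A f b) = OpOb C (card (set_fib A f b))"
proof -
  have "card (set_fib A f b) = Suc 0" if "set_fib A f b \<noteq> {}"
  proof -
    from that obtain a where a: "a \<in> A" "f a = b" by (auto simp: set_fib_def)
    then have "set_fib A f b = {a}" using assms(2) by (auto simp: set_fib_def dest: inj_onD)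
    then show ?thesis by simp
  qed
  then show "set_point C A f b \<in> Arr V" "Dom V (set_point C A f b) = One V"
    "Cod V (set_point C A f b) = OpOb C (card (set_fib A f b))"
    by (auto simp: set_point_def)
qed

lemma set_points_tuple:
  assumes "finite A" "inj_on f A" "X \<in> Obj V"
  shows "tuple V X (map (\<lambda>b. set_point C A f b \<cdot> bang V X) bs) \<in> Arr V"
    "Dom V (tuple V X (map (\<lambda>b. set_point C A f b \<cdot> bang V X) bs)) = X"
    "Cod V (tuple V X (map (\<lambda>b. set_point C A f b \<cdot> bang V X) bs)) =
      lprod V (map (\<lambda>b. OpOb C (card (set_fib A f b))) bs)"
  using set_point_simps[OF assms(1,2)] assms(3) by (simp_all add: comp_def)

lemma set_points_comp:
  assumes "finite A" "inj_on f A" "X \<in> Obj V" "h \<in> Arr V" "Cod V h = X"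
  shows "tuple V X (map (\<lambda>b. set_point C A f b \<cdot> bang V X) bs) \<cdot> h =
    tuple V (Dom V h) (map (\<lambda>b. set_point C A f b \<cdot> bang V (Dom V h)) bs)"
  using set_point_simps[OF assms(1,2)] assms(3-5) by (simp add: comp_def)

lemma set_act_simps:
  assumes "finite A" "finite B" "f ` A \<subseteq> B" "inj_on f A"
  shows "set_act A B f \<in> Arr V" "Dom V (set_act A B f) = OpOb C (card B)"
    "Cod V (set_act A B f) = OpOb C (card A)"
  unfolding set_act_def Let_def
  using set_gam_simps[OF assms(1-3)] set_points_tuple[OF assms(1,4)] by simp_all

lemma set_act_comp:
  assumes "finite A" "finite B" "f ` A \<subseteq> B" "inj_on f A" "h \<in> Arr V" "Cod V h = OpOb C (card B)"
  shows "set_act A B f \<cdot> h = set_gam V C A B f \<cdot> pair V h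
     (tuple V (Dom V h) (map (\<lambda>b. set_point C A f b \<cdot> bang V (Dom V h)) (sorted_list_of_set B)))"
  unfolding set_act_def Let_def
  using set_gam_simps[OF assms(1-3)] set_points_tuple[OF assms(1,4)] assms(5,6)
    set_points_comp[OF assms(1,4) OpOb_Obj assms(5,6)] by simp

lemma operad_Lambda_FO [simp]: "FO (operad_Lambda V C) = OpOb C"
  by (simp add: operad_Lambda_def)

lemma operad_Lambda_FA:
  assumes "l \<in> Arr Lambda_cat"
  shows "FA (operad_Lambda V C) l = set_act {1..src l} {1..tgt l} (fn l)"
proof -
  have "fib l j = set_fib {1..src l} (fn l) j" if "1 \<le> j" for j
    using assms that by (simp add: fib_pos set_fib_def)
  then have 1: "map (\<lambda>j. inj_point C l j \<cdot> bang V X) [1..<Suc (tgt l)] =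
      map (\<lambda>b. set_point C {1..src l} (fn l) b \<cdot> bang V X) [1..<Suc (tgt l)]" for X
    by (intro map_cong[OF refl]) (auto simp: inj_point_def set_point_def simp del: upt_Suc)
  have "card {1..tgt l} = tgt l" by simp
  then show ?thesis
    unfolding operad_Lambda_def set_act_def Let_def functr.simps sorted_list_of_interval 1 by (simp only:)
qed

text \<open>Fibre cardinalities, block permutation and points only depend on the relative order of elements, so
  they do not change under standardisation.\<close>

lemma set_act_eq:
  assumes "finite A" "finite B" "f ` A \<subseteq> B" "inj_on f A"
  shows "FA (operad_Lambda V C) (std A B f) = set_act A B f"
proof -
  let ?A = "{1..card A}" and ?B = "{1..card B}" and ?f = "fn (std A B f)"
  have B: "sorted_list_of_set B = map (unrank B) [1..<Suc (card B)]"
    by (rule sorted_list_of_set_eq_unrank[OF assms(2)])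
  note B' = sorted_list_of_interval[of "card B"]
  have e: "unrank B j \<in> B \<and> rank B (unrank B j) = j" if "j \<in> set [1..<Suc (card B)]" for j
    using that assms(2) by (auto simp del: upt_Suc)
  have c: "card (set_fib ?A ?f j) = card (set_fib A f (unrank B j))"
    "set_fib ?A ?f j = {} \<longleftrightarrow> set_fib A f (unrank B j) = {}" if "j \<in> set [1..<Suc (card B)]" for j
    using card_set_fib_std[OF assms(1-3), of "unrank B j"] set_fib_std[OF assms(1-3), of "unrank B j"] e[OF that]
    by auto
  have 1: "map (\<lambda>b. card (set_fib ?A ?f b)) (sorted_list_of_set ?B)
      = map (\<lambda>b. card (set_fib A f b)) (sorted_list_of_set B)"
    unfolding B B' map_map comp_def by (rule map_cong) (use c in simp_all)
  have 2: "map (\<lambda>b. set_point C ?A ?f b \<cdot> bang V X) (sorted_list_of_set ?B) =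
      map (\<lambda>b. set_point C A f b \<cdot> bang V X) (sorted_list_of_set B)" for X
    unfolding B B' map_map comp_def set_point_def by (rule map_cong) (use c in simp_all)
  have 3: "set_gam V C ?A ?B ?f = set_gam V C A B f"
    unfolding set_gam_def 1 sort_perm_std[OF assms(1-3)] by simp
  have "card ?B = card B" by simp
  then have "set_act ?A ?B ?f = set_act A B f"
    unfolding set_act_def Let_def 2 3 by (simp only:)
  then show ?thesis
    unfolding operad_Lambda_FA[OF std_Lambda[OF assms(1,2,4,3)]] std_simps .
qed

lemma operad_Lambda_simps:
  assumes "l \<in> Arr Lambda_cat"
  shows "FA (operad_Lambda V C) l \<in> Arr V" "Dom V (FA (operad_Lambda V C) l) = OpOb C (tgt l)"
    "Cod V (FA (operad_Lambda V C) l) = OpOb C (src l)"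
proof -
  have "fn l i \<le> tgt l" "Suc 0 \<le> fn l i" if "Suc 0 \<le> i" "i \<le> src l" for i
    using assms that by simp_all
  then have "fn l ` {1..src l} \<subseteq> {1..tgt l}" "inj_on (fn l) {1..src l}"
    using Lambda_inj[OF assms] by (auto simp: inj_on_def)
  then show "FA (operad_Lambda V C) l \<in> Arr V" "Dom V (FA (operad_Lambda V C) l) = OpOb C (tgt l)"
    "Cod V (FA (operad_Lambda V C) l) = OpOb C (src l)"
    unfolding operad_Lambda_FA[OF assms] using set_act_simps[of "{1..src l}" "{1..tgt l}" "fn l"] by simp_all
qed

section \<open>The permutative envelope and the category of operators as \<open>\<Lambda>\<close>-objects\<close>

abbreviation "D \<equiv> operad_Lambda V C"

text \<open>The action of \<open>l\<close> on the summand \<open>\<phi>\<close>: the functor of the operad on each restriction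
  \<open>(\<phi> l)\<^sup>-\<^sup>1(j) \<rightarrow> \<phi>\<^sup>-\<^sup>1(j)\<close>.\<close>

definition env_arr :: "nat \<Rightarrow> bmap \<Rightarrow> bmap \<Rightarrow> 'a" where
  "env_arr n l \<phi> = lmap (env_obs C n \<phi>) (map (\<lambda>j. FA D (restr l (fib \<phi> j))) [1..<Suc n])"

lemma env_obs_Obj: "set (env_obs C n \<phi>) \<subseteq> Obj V"
  by (auto simp: env_obs_def)

lemma fib_obs_eq: "fib_obs C \<phi> = env_obs C (tgt \<phi>) \<phi>"
  by (simp add: fib_obs_def env_obs_def)

lemma fib_prod_eq: "tgt \<phi> = n \<Longrightarrow> fib_prod V C \<phi> = lprod V (env_obs C n \<phi>)"
  by (auto simp: fib_prod_def fib_obs_eq)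

lemma fib_prod_Obj: "fib_prod V C \<phi> \<in> Obj V"
  by (simp add: fib_prod_eq[OF refl] env_obs_Obj)

lemma env_arr_lists:
  assumes "\<phi> \<in> F_arr" "l \<in> Arr Lambda_cat" "tgt l = src \<phi>"
  shows "set (map (\<lambda>j. FA D (restr l (fib \<phi> j))) [1..<Suc n]) \<subseteq> Arr V"
    "map (Dom V) (map (\<lambda>j. FA D (restr l (fib \<phi> j))) [1..<Suc n]) = env_obs C n \<phi>"
    "map (Cod V) (map (\<lambda>j. FA D (restr l (fib \<phi> j))) [1..<Suc n]) = env_obs C n (\<phi> \<odot> l)"
  using operad_Lambda_simps[OF restr_Lambda[OF assms(2) finite_fib[of \<phi>]]] fib_comp[OF assms]
  by (auto simp: env_obs_def simp del: upt_Suc)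

lemma env_arr_simps:
  assumes "\<phi> \<in> F_arr" "l \<in> Arr Lambda_cat" "tgt l = src \<phi>"
  shows "env_arr n l \<phi> \<in> Arr V" "Dom V (env_arr n l \<phi>) = lprod V (env_obs C n \<phi>)"
    "Cod V (env_arr n l \<phi>) = lprod V (env_obs C n (\<phi> \<odot> l))"
  unfolding env_arr_def using lmap_simps[OF env_obs_Obj env_arr_lists(1,2)[OF assms]]
    env_arr_lists(3)[OF assms] by simp_all

lemma fib_comp_eq:
  assumes "\<phi> \<in> F_arr" "\<psi> \<in> F_arr" "tgt \<phi> = src \<psi>" "1 \<le> k"
  shows "fn \<phi> ` fib (\<psi> \<odot> \<phi>) k \<subseteq> fib \<psi> k"
    and "j \<in> fib \<psi> k \<Longrightarrow> 1 \<le> j \<and> j \<le> tgt \<phi> \<and> set_fib (fib (\<psi> \<odot> \<phi>) k) (fn \<phi>) j = fib \<phi> j"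
proof -
  have f: "fn \<phi> i \<le> src \<psi>" if "i \<le> src \<phi>" for i using F_arr_le[OF assms(1) that] assms(3) by simp
  then show "fn \<phi> ` fib (\<psi> \<odot> \<phi>) k \<subseteq> fib \<psi> k"
    by (auto simp: fib_def)
  assume j: "j \<in> fib \<psi> k"
  then have "fn \<psi> j = k" "j \<le> src \<psi>" by (auto simp: fib_def)
  \<comment> \<open>\<open>\<psi>\<close> sends \<open>0\<close> to \<open>0\<close>, so \<open>0\<close> lies in no fibre over \<open>k \<ge> 1\<close>.\<close>
  then have "1 \<le> j" using assms(2,4) by (cases "j = 0") auto
  then show "1 \<le> j \<and> j \<le> tgt \<phi> \<and> set_fib (fib (\<psi> \<odot> \<phi>) k) (fn \<phi>) j = fib \<phi> j"
    using \<open>fn \<psi> j = k\<close> \<open>j \<le> src \<psi>\<close> assms(3) by (auto simp: set_fib_def fib_def)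
qed

lemma env_proj_simps:
  assumes "1 \<le> k" "k \<le> n"
  shows "proj V (env_obs C n \<phi>) (k - 1) \<in> Arr V"
    "Dom V (proj V (env_obs C n \<phi>) (k - 1)) = lprod V (env_obs C n \<phi>)"
    "Cod V (proj V (env_obs C n \<phi>) (k - 1)) = OpOb C (card (fib \<phi> k))"
proof -
  have "k - 1 < length (env_obs C n \<phi>)" "env_obs C n \<phi> ! (k - 1) = OpOb C (card (fib \<phi> k))"
    using assms by (auto simp: env_obs_def simp del: upt_Suc)
  then show "proj V (env_obs C n \<phi>) (k - 1) \<in> Arr V"
    "Dom V (proj V (env_obs C n \<phi>) (k - 1)) = lprod V (env_obs C n \<phi>)"
    "Cod V (proj V (env_obs C n \<phi>) (k - 1)) = OpOb C (card (fib \<phi> k))"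
    using env_obs_Obj[of n \<phi>] by simp_all
qed

text \<open>Composition is a tuple of structure maps applied to tuples of projections, so an arrow \<open>h\<close> on the
  right can be moved in front of each projection.\<close>

lemma fib_comp_precomp:
  assumes \<phi>: "\<phi> \<in> F_arr" and \<psi>: "\<psi> \<in> F_arr" and st: "tgt \<phi> = src \<psi>" and n: "tgt \<psi> = n"
    and h: "h \<in> Arr V" "Cod V h = fib_prod V C \<psi> \<otimes> fib_prod V C \<phi>"
  shows "fib_comp V C \<psi> \<phi> \<in> hom V (fib_prod V C \<psi> \<otimes> fib_prod V C \<phi>) (fib_prod V C (\<psi> \<odot> \<phi>))"
    and "fib_comp V C \<psi> \<phi> \<cdot> h = tuple V (Dom V h) (map (\<lambda>k.
          set_gam V C (fib (\<psi> \<odot> \<phi>) k) (fib \<psi> k) (fn \<phi>) \<cdot>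
            pair V (proj V (env_obs C n \<psi>) (k - 1) \<cdot> Fst V (fib_prod V C \<psi>) (fib_prod V C \<phi>) \<cdot> h)
              (tuple V (Dom V h) (map (\<lambda>j. proj V (env_obs C (src \<psi>) \<phi>) (j - 1) \<cdot>
                 Snd V (fib_prod V C \<psi>) (fib_prod V C \<phi>) \<cdot> h) (sorted_list_of_set (fib \<psi> k)))))
        [1..<Suc n])"
proof -
  let ?P = "fib_prod V C \<psi>" and ?Q = "fib_prod V C \<phi>"
  let ?X = "?P \<otimes> ?Q"
  let ?c = "\<lambda>k. proj V (env_obs C n \<psi>) (k - 1) \<cdot> Fst V ?P ?Q"
  let ?d = "\<lambda>j. proj V (env_obs C (src \<psi>) \<phi>) (j - 1) \<cdot> Snd V ?P ?Q"
  let ?g = "\<lambda>k. set_gam V C (fib (\<psi> \<odot> \<phi>) k) (fib \<psi> k) (fn \<phi>)"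
  let ?T = "\<lambda>k. tuple V ?X (map ?d (sorted_list_of_set (fib \<psi> k)))"
  have PQ: "?P \<in> Obj V" "?Q \<in> Obj V" "?P = lprod V (env_obs C n \<psi>)" "?Q = lprod V (env_obs C (src \<psi>) \<phi>)"
    using n st by (simp_all add: fib_prod_eq env_obs_Obj)
  have c: "?c k \<in> Arr V" "Dom V (?c k) = ?X" "Cod V (?c k) = OpOb C (card (fib \<psi> k))"
    if "1 \<le> k" "k \<le> n" for k using env_proj_simps[OF that, of \<psi>] PQ by simp_all
  have d: "?d j \<in> Arr V" "Dom V (?d j) = ?X" "Cod V (?d j) = OpOb C (card (fib \<phi> j))"
    if "1 \<le> j" "j \<le> src \<psi>" for j using env_proj_simps[OF that, of \<phi>] PQ by simp_all
  have jb: "1 \<le> j \<and> j \<le> src \<psi>" if "j \<in> fib \<psi> k" "1 \<le> k" for j k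
    using fib_comp_eq(2)[OF \<phi> \<psi> st that(2,1)] st by simp
  have T: "?T k \<in> Arr V" "Dom V (?T k) = ?X"
    "Cod V (?T k) = lprod V (map (\<lambda>j. OpOb C (card (set_fib (fib (\<psi> \<odot> \<phi>) k) (fn \<phi>) j))) (sorted_list_of_set (fib \<psi> k)))"
    if k: "1 \<le> k" "k \<le> n" for k
  proof -
    have a: "\<forall>f\<in>set (map ?d (sorted_list_of_set (fib \<psi> k))). f \<in> Arr V \<and> Dom V f = ?X"
      using d jb[OF _ k(1)] by auto
    have cc: "map (Cod V) (map ?d (sorted_list_of_set (fib \<psi> k))) =
      map (\<lambda>j. OpOb C (card (set_fib (fib (\<psi> \<odot> \<phi>) k) (fn \<phi>) j))) (sorted_list_of_set (fib \<psi> k))"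
      unfolding map_map
      by (rule map_cong) (use d jb[OF _ k(1)] fib_comp_eq(2)[OF \<phi> \<psi> st k(1)] in simp_all)
    have X: "?X \<in> Obj V" using PQ by simp
    show "?T k \<in> Arr V" "Dom V (?T k) = ?X"
    "Cod V (?T k) = lprod V (map (\<lambda>j. OpOb C (card (set_fib (fib (\<psi> \<odot> \<phi>) k) (fn \<phi>) j))) (sorted_list_of_set (fib \<psi> k)))"
      using tuple_simps[OF X a] unfolding cc .
  qed
  have g: "?g k \<in> Arr V" "Dom V (?g k) = OpOb C (card (fib \<psi> k)) \<otimes>
      lprod V (map (\<lambda>j. OpOb C (card (set_fib (fib (\<psi> \<odot> \<phi>) k) (fn \<phi>) j))) (sorted_list_of_set (fib \<psi> k)))"
     "Cod V (?g k) = OpOb C (card (fib (\<psi> \<odot> \<phi>) k))" if "1 \<le> k" for k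
    using set_gam_simps[OF finite_fib finite_fib fib_comp_eq(1)[OF \<phi> \<psi> st that]] by simp_all
  let ?G = "\<lambda>k. ?g k \<cdot> pair V (?c k) (?T k)"
  have G: "?G k \<in> Arr V" "Dom V (?G k) = ?X" "Cod V (?G k) = OpOb C (card (fib (\<psi> \<odot> \<phi>) k))"
    if "1 \<le> k" "k \<le> n" for k using g[OF that(1)] c[OF that] T[OF that] by simp_all
  have fc: "fib_comp V C \<psi> \<phi> = tuple V ?X (map ?G [1..<Suc n])"
    using n st by (simp add: fib_comp_def Let_def fib_obs_eq del: upt_Suc)
  have a: "\<forall>f\<in>set (map ?G [1..<Suc n]). f \<in> Arr V \<and> Dom V f = ?X"
    using G by (auto simp del: upt_Suc)
  have "map (Cod V) (map ?G [1..<Suc n]) = env_obs C n (\<psi> \<odot> \<phi>)"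
    unfolding map_map env_obs_def[of C n "\<psi> \<odot> \<phi>"] by (rule map_cong) (use G in \<open>auto simp del: upt_Suc\<close>)
  then show "fib_comp V C \<psi> \<phi> \<in> hom V ?X (fib_prod V C (\<psi> \<odot> \<phi>))"
    unfolding fc using tuple_simps[OF _ a] PQ n by (simp add: hom_iff fib_prod_eq del: upt_Suc)
  have Gh: "?G k \<cdot> h = ?g k \<cdot> pair V (proj V (env_obs C n \<psi>) (k - 1) \<cdot> Fst V ?P ?Q \<cdot> h)
     (tuple V (Dom V h) (map (\<lambda>j. proj V (env_obs C (src \<psi>) \<phi>) (j - 1) \<cdot> Snd V ?P ?Q \<cdot> h)
        (sorted_list_of_set (fib \<psi> k))))"
    if k: "1 \<le> k" "k \<le> n" for k
  proof -
    have a: "\<forall>f\<in>set (map ?d (sorted_list_of_set (fib \<psi> k))). f \<in> Arr V \<and> Dom V f = ?X"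
      using d jb[OF _ k(1)] by auto
    have mm: "map (\<lambda>f. f \<cdot> h) (map ?d (sorted_list_of_set (fib \<psi> k))) =
      map (\<lambda>j. proj V (env_obs C (src \<psi>) \<phi>) (j - 1) \<cdot> Snd V ?P ?Q \<cdot> h) (sorted_list_of_set (fib \<psi> k))"
      unfolding map_map
      by (rule map_cong) (use env_proj_simps jb[OF _ k(1)] PQ h in simp_all)
    have X: "?X \<in> Obj V" using PQ by simp
    have "?T k \<cdot> h = tuple V (Dom V h) (map (\<lambda>j. proj V (env_obs C (src \<psi>) \<phi>) (j - 1) \<cdot>
        Snd V ?P ?Q \<cdot> h) (sorted_list_of_set (fib \<psi> k)))"
      unfolding tuple_comp[OF X a h] mm ..
    moreover have "?c k \<cdot> h = proj V (env_obs C n \<psi>) (k - 1) \<cdot> Fst V ?P ?Q \<cdot> h"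
      using env_proj_simps[OF k, of \<psi>] PQ h by simp
    moreover have "?G k \<cdot> h = ?g k \<cdot> pair V (?c k \<cdot> h) (?T k \<cdot> h)"
      by (rule comp_pair_comp) (simp_all only: g[OF k(1)] c[OF k] T[OF k] h)
    ultimately show ?thesis by simp
  qed
  have "fib_comp V C \<psi> \<phi> \<cdot> h = tuple V (Dom V h) (map (\<lambda>f. f \<cdot> h) (map ?G [1..<Suc n]))"
    unfolding fc by (rule tuple_comp[OF _ a h]) (use PQ in simp)
  also have "map (\<lambda>f. f \<cdot> h) (map ?G [1..<Suc n]) = map (\<lambda>k. ?g k \<cdot>
      pair V (proj V (env_obs C n \<psi>) (k - 1) \<cdot> Fst V ?P ?Q \<cdot> h)
     (tuple V (Dom V h) (map (\<lambda>j. proj V (env_obs C (src \<psi>) \<phi>) (j - 1) \<cdot> Snd V ?P ?Q \<cdot> h)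
        (sorted_list_of_set (fib \<psi> k))))) [1..<Suc n]"
    unfolding map_map comp_def by (rule map_cong[OF refl]) (use Gh in \<open>auto simp del: upt_Suc\<close>)
  finally show "fib_comp V C \<psi> \<phi> \<cdot> h = tuple V (Dom V h) (map (\<lambda>k.
          set_gam V C (fib (\<psi> \<odot> \<phi>) k) (fib \<psi> k) (fn \<phi>) \<cdot>
            pair V (proj V (env_obs C n \<psi>) (k - 1) \<cdot> Fst V (fib_prod V C \<psi>) (fib_prod V C \<phi>) \<cdot> h)
              (tuple V (Dom V h) (map (\<lambda>j. proj V (env_obs C (src \<psi>) \<phi>) (j - 1) \<cdot>
                 Snd V (fib_prod V C \<psi>) (fib_prod V C \<phi>) \<cdot> h) (sorted_list_of_set (fib \<psi> k)))))
        [1..<Suc n])" .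
qed

lemma points_obs:
  assumes "l \<in> Arr Lambda_cat"
  shows "\<forall>f\<in>set (map (inj_point C l) [1..<Suc (tgt l)]). f \<in> Arr V \<and> Dom V f = One V"
    "map (Cod V) (map (inj_point C l) [1..<Suc (tgt l)]) = env_obs C (tgt l) l"
proof -
  have i: "inj_on (fn l) {1..src l}" using Lambda_inj[OF assms] by (auto simp: inj_on_def)
  have "fib l j = set_fib {1..src l} (fn l) j" if "1 \<le> j" for j
    using assms that by (simp add: fib_pos set_fib_def)
  then have p: "inj_point C l j = set_point C {1..src l} (fn l) j \<and> fib l j = set_fib {1..src l} (fn l) j"
    if "1 \<le> j" for j using that by (simp add: inj_point_def set_point_def)
  note s = set_point_simps[OF finite_atLeastAtMost i]
  show "\<forall>f\<in>set (map (inj_point C l) [1..<Suc (tgt l)]). f \<in> Arr V \<and> Dom V f = One V"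
    using p s by (auto simp del: upt_Suc)
  show "map (Cod V) (map (inj_point C l) [1..<Suc (tgt l)]) = env_obs C (tgt l) l"
    unfolding env_obs_def map_map by (rule map_cong) (use p s in \<open>auto simp del: upt_Suc\<close>)
qed

text \<open>Precomposing with the points \<open>\<epsilon>\<close> of an injection acts on each factor by the functor of the
  operad.\<close>

lemma fib_comp_points:
  assumes \<phi>: "\<phi> \<in> F_arr" and l: "l \<in> Arr Lambda_cat" and st: "tgt l = src \<phi>" and n: "tgt \<phi> = n"
  shows "fib_comp V C \<phi> l \<cdot> pair V (Id V (fib_prod V C \<phi>))
      (tuple V (One V) (map (inj_point C l) [1..<Suc (tgt l)]) \<cdot> bang V (fib_prod V C \<phi>)) = env_arr n l \<phi>"
proof -
  let ?P = "fib_prod V C \<phi>" and ?Q = "fib_prod V C l"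
  let ?T = "tuple V (One V) (map (inj_point C l) [1..<Suc (tgt l)])"
  let ?h = "pair V (Id V ?P) (?T \<cdot> bang V ?P)"
  have PQ: "?P \<in> Obj V" "?Q \<in> Obj V" "?P = lprod V (env_obs C n \<phi>)" "?Q = lprod V (env_obs C (tgt l) l)"
    using n by (simp_all add: fib_prod_eq env_obs_Obj)
  note po = points_obs[OF l]
  have T: "?T \<in> Arr V" "Dom V ?T = One V" "Cod V ?T = ?Q"
    using tuple_simps[OF One_Obj po(1)] po(2) PQ by simp_all
  have h: "?h \<in> Arr V" "Dom V ?h = ?P" "Cod V ?h = ?P \<otimes> ?Q" using T PQ(1,2) by simp_all
  have F: "Fst V ?P ?Q \<cdot> ?h = Id V ?P" and S: "Snd V ?P ?Q \<cdot> ?h = ?T \<cdot> bang V ?P"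
    using T PQ(1,2) by simp_all
  have pj: "proj V (env_obs C (tgt l) l) (j - 1) \<cdot> ?T \<cdot> bang V ?P = inj_point C l j \<cdot> bang V ?P"
    if j: "1 \<le> j" "j \<le> tgt l" for j
  proof -
    have "proj V (env_obs C (tgt l) l) (j - 1) \<cdot> ?T = map (inj_point C l) [1..<Suc (tgt l)] ! (j - 1)"
      by (rule proj_tuple[OF One_Obj po(1,2)]) (use j in \<open>simp del: upt_Suc\<close>)
    also have "\<dots> = inj_point C l j" using j by (simp del: upt_Suc)
    finally show ?thesis
      using comp_assoc[of "bang V ?P" ?T "proj V (env_obs C (tgt l) l) (j - 1)"] T PQ
        env_proj_simps[OF j, of l] by simp
  qed
  have "fib_comp V C \<phi> l \<cdot> ?h = tuple V ?P (map (\<lambda>k.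
          set_gam V C (fib (\<phi> \<odot> l) k) (fib \<phi> k) (fn l) \<cdot>
            pair V (proj V (env_obs C n \<phi>) (k - 1) \<cdot> Id V ?P)
              (tuple V ?P (map (\<lambda>j. proj V (env_obs C (tgt l) l) (j - 1) \<cdot>
                 ?T \<cdot> bang V ?P) (sorted_list_of_set (fib \<phi> k))))) [1..<Suc n])"
    using fib_comp_precomp(2)[OF Lambda_F[OF l] \<phi> st n h(1,3), folded st] unfolding h(2) F S .
  also have "map (\<lambda>k.
          set_gam V C (fib (\<phi> \<odot> l) k) (fib \<phi> k) (fn l) \<cdot>
            pair V (proj V (env_obs C n \<phi>) (k - 1) \<cdot> Id V ?P)
              (tuple V ?P (map (\<lambda>j. proj V (env_obs C (tgt l) l) (j - 1) \<cdot>
                 ?T \<cdot> bang V ?P) (sorted_list_of_set (fib \<phi> k))))) [1..<Suc n]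
     = map (\<lambda>k. FA D (restr l (fib \<phi> k)) \<cdot> proj V (env_obs C n \<phi>) (k - 1)) [1..<Suc n]"
  proof (rule map_cong[OF refl])
    fix k assume "k \<in> set [1..<Suc n]"
    then have k: "1 \<le> k" "k \<le> n" by (auto simp del: upt_Suc)
    let ?A = "fib (\<phi> \<odot> l) k" and ?B = "fib \<phi> k" and ?p = "proj V (env_obs C n \<phi>) (k - 1)"
    have A: "?A = preim l ?B" by (rule fib_comp[OF \<phi> l st k(1)])
    note f = fib_comp_eq[OF Lambda_F[OF l] \<phi> st k(1)]
    have i: "inj_on (fn l) ?A" unfolding A by (rule preim_inj[OF l])
    have p: "?p \<in> Arr V" "Dom V ?p = ?P" "Cod V ?p = OpOb C (card ?B)"
      using env_proj_simps[OF k, of \<phi>] PQ by simp_all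
    have mm: "map (\<lambda>j. proj V (env_obs C (tgt l) l) (j - 1) \<cdot> ?T \<cdot> bang V ?P) (sorted_list_of_set ?B)
      = map (\<lambda>b. set_point C ?A (fn l) b \<cdot> bang V ?P) (sorted_list_of_set ?B)"
    proof (rule map_cong[OF refl])
      fix j assume "j \<in> set (sorted_list_of_set ?B)"
      then have "j \<in> ?B" by simp
      note j = f(2)[OF this]
      then have "inj_point C l j = set_point C ?A (fn l) j" by (simp add: inj_point_def set_point_def)
      then show "proj V (env_obs C (tgt l) l) (j - 1) \<cdot> ?T \<cdot> bang V ?P = set_point C ?A (fn l) j \<cdot> bang V ?P"
        using pj[of j] j by simp
    qed
    show "set_gam V C ?A ?B (fn l) \<cdot> pair V (?p \<cdot> Id V ?P) (tuple V ?P
          (map (\<lambda>j. proj V (env_obs C (tgt l) l) (j - 1) \<cdot> ?T \<cdot> bang V ?P) (sorted_list_of_set ?B)))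
        = FA D (restr l ?B) \<cdot> ?p"
      unfolding mm restr_def A[symmetric] set_act_eq[OF finite_fib finite_fib f(1) i]
      using set_act_comp[OF finite_fib finite_fib f(1) i p(1,3)] p by simp
  qed
  also have "\<dots> = map (\<lambda>i. map (\<lambda>j. FA D (restr l (fib \<phi> j))) [1..<Suc n] ! i \<cdot> proj V (env_obs C n \<phi>) i)
      [0..<length (env_obs C n \<phi>)]"
    by (rule nth_equalityI) (simp_all add: env_obs_def del: upt_Suc)
  finally show ?thesis unfolding env_arr_def lmap_def PQ(3) .
qed

text \<open>\<open>F\<close> stands for \<open>\<F>\<close> or \<open>\<F>\<^sub>>\<^sub>0\<close>, which are treated in the same way.\<close>

context
  fixes F :: "(nat, bmap) cat"
  assumes F: "Comp F = Comp F_cat" "\<And>m n. hom F m n \<subseteq> hom F_cat m n"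
    "\<And>l m n p \<phi> \<psi>. \<phi> \<in> hom F m n \<Longrightarrow> \<psi> \<in> hom F n p \<Longrightarrow> \<psi> \<odot> \<phi> \<in> hom F m p"
    "\<And>l. l \<in> Arr Lambda_cat \<Longrightarrow> l \<in> hom F (src l) (tgt l)"
begin

lemma hom_F: "\<phi> \<in> hom F m n \<Longrightarrow> \<phi> \<in> F_arr \<and> src \<phi> = m \<and> tgt \<phi> = n"
  using F(2)[of m n] by (auto simp: hom_F_iff)

lemma op_hom_coproduct:
  "is_coproduct V (hom F m n) (fib_prod V C) (op_hom V F C m n) (op_inj V F C)"
proof -
  have fin: "finite (hom F m n)" using F(2) finite_hom_F by (rule finite_subset)
  have "is_coproduct V (hom F m n) (fib_prod V C) (op_hom V F C m n) (inj_coprod V (hom F m n) (fib_prod V C))"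
    unfolding op_hom_def by (rule coprod[OF fin]) (simp add: fib_prod_Obj)
  moreover have "op_inj V F C \<phi> = inj_coprod V (hom F m n) (fib_prod V C) \<phi>" if "\<phi> \<in> hom F m n" for \<phi>
    using hom_F[OF that] by (simp add: op_inj_def)
  ultimately show ?thesis by (simp add: is_coproduct_def)
qed

lemmas op_hom_simps = coproduct_simps[OF op_hom_coproduct]

lemma
  shows op_comp_simps: "op_comp V F C m n p \<in> Arr V"
    "Dom V (op_comp V F C m n p) = op_hom V F C n p \<otimes> op_hom V F C m n"
    "Cod V (op_comp V F C m n p) = op_hom V F C m p"
    and op_comp_inj: "\<psi> \<in> hom F n p \<Longrightarrow> \<phi> \<in> hom F m n \<Longrightarrow>
      op_comp V F C m n p \<cdot> prod_map V (op_inj V F C \<psi>) (op_inj V F C \<phi>) =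
      op_inj V F C (\<psi> \<odot> \<phi>) \<cdot> fib_comp V C \<psi> \<phi>"
proof -
  note cp = coproduct_prod[OF op_hom_coproduct[of n p] op_hom_coproduct[of m n]]
  have t: "op_inj V F C (\<psi> \<odot> \<phi>) \<cdot> fib_comp V C \<psi> \<phi> \<in>
      hom V (fib_prod V C \<psi> \<otimes> fib_prod V C \<phi>) (op_hom V F C m p)"
    if "\<psi> \<in> hom F n p" "\<phi> \<in> hom F m n" for \<psi> \<phi>
  proof -
    have "fib_comp V C \<psi> \<phi> \<in> hom V (fib_prod V C \<psi> \<otimes> fib_prod V C \<phi>) (fib_prod V C (\<psi> \<odot> \<phi>))"
      using fib_comp_precomp(1)[of \<phi> \<psi> p "Id V (fib_prod V C \<psi> \<otimes> fib_prod V C \<phi>)"]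
        hom_F[OF that(1)] hom_F[OF that(2)] fib_prod_Obj by simp
    then show ?thesis using op_hom_simps(2-4)[OF F(3)[OF that(2,1)]] by (simp add: hom_iff)
  qed
  have "\<exists>!h. h \<in> hom V (op_hom V F C n p \<otimes> op_hom V F C m n) (op_hom V F C m p) \<and>
     (\<forall>q\<in>hom F n p \<times> hom F m n. h \<cdot> (case q of (\<psi>, \<phi>) \<Rightarrow> prod_map V (op_inj V F C \<psi>) (op_inj V F C \<phi>)) =
        (case q of (\<psi>, \<phi>) \<Rightarrow> op_inj V F C (\<psi> \<odot> \<phi>) \<cdot> fib_comp V C \<psi> \<phi>))"
    by (rule coproduct_ex1[OF cp op_hom_simps(1)]) (use t in auto)
  then have "\<exists>!h. h \<in> hom V (op_hom V F C n p \<otimes> op_hom V F C m n) (op_hom V F C m p) \<and>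
     (\<forall>\<psi> \<in> hom F n p. \<forall>\<phi> \<in> hom F m n. h \<cdot> prod_map V (op_inj V F C \<psi>) (op_inj V F C \<phi>) =
        op_inj V F C (\<psi> \<cdot>\<^bsub>F\<^esub> \<phi>) \<cdot> fib_comp V C \<psi> \<phi>)"
    by (simp add: F(1))
  from theI'[OF this, folded op_comp_def] F(1)
  have *: "op_comp V F C m n p \<in> hom V (op_hom V F C n p \<otimes> op_hom V F C m n) (op_hom V F C m p)"
    "\<forall>\<psi> \<in> hom F n p. \<forall>\<phi> \<in> hom F m n. op_comp V F C m n p \<cdot> prod_map V (op_inj V F C \<psi>) (op_inj V F C \<phi>) =
        op_inj V F C (\<psi> \<odot> \<phi>) \<cdot> fib_comp V C \<psi> \<phi>" by simp_all
  then show "op_comp V F C m n p \<in> Arr V"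
    "Dom V (op_comp V F C m n p) = op_hom V F C n p \<otimes> op_hom V F C m n"
    "Cod V (op_comp V F C m n p) = op_hom V F C m p" by (simp_all add: hom_iff)
  show "\<psi> \<in> hom F n p \<Longrightarrow> \<phi> \<in> hom F m n \<Longrightarrow>
      op_comp V F C m n p \<cdot> prod_map V (op_inj V F C \<psi>) (op_inj V F C \<phi>) =
      op_inj V F C (\<psi> \<odot> \<phi>) \<cdot> fib_comp V C \<psi> \<phi>" using *(2) by blast
qed

text \<open>Composition preserves coproducts in both variables, so precomposition with the point of \<open>l\<close> sends the
  summand \<open>\<phi>\<close> to the summand \<open>\<phi> l\<close>.\<close>

lemma Lambda_rep_presents:
  "presents (Lambda_rep V (op_vcat V F C) (op_point V F C) n) (\<lambda>m. hom F m n)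
     (\<lambda>m \<phi>. lprod V (env_obs C n \<phi>)) (\<lambda>l \<phi>. \<phi> \<odot> l) (env_arr n) (\<lambda>m. op_inj V F C)"
  unfolding presents_def
proof (intro conjI allI ballI)
  let ?Z = "Lambda_rep V (op_vcat V F C) (op_point V F C) n"
  have FO: "FO ?Z m = op_hom V F C m n" for m by (simp add: Lambda_rep_def op_vcat_def)
  show "is_coproduct V (hom F m n) (\<lambda>\<phi>. lprod V (env_obs C n \<phi>)) (FO ?Z m) (op_inj V F C)" for m
  proof -
    have "fib_prod V C \<phi> = lprod V (env_obs C n \<phi>)" if "\<phi> \<in> hom F m n" for \<phi>
      using hom_F[OF that] by (simp add: fib_prod_eq)
    then show ?thesis using op_hom_coproduct[of m n] unfolding FO is_coproduct_def by simp
  qed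
  fix l assume l: "l \<in> Arr Lambda_cat"
  let ?X = "op_hom V F C (tgt l) n"
  define T where "T = tuple V (One V) (map (inj_point C l) [1..<Suc (tgt l)])"
  have X: "?X \<in> Obj V" by (rule op_hom_simps)
  note il = op_hom_simps(2-4)[OF F(4)[OF l]]
  note po = points_obs[OF l]
  have T: "T \<in> Arr V" "Dom V T = One V" "Cod V T = fib_prod V C l"
    unfolding T_def using tuple_simps[OF One_Obj po(1)] po(2) by (simp_all add: fib_prod_eq[OF refl])
  have pt: "op_point V F C l = op_inj V F C l \<cdot> T" by (simp add: op_point_def T_def)
  have FA: "FA ?Z l = op_comp V F C (src l) (tgt l) n \<cdot> pair V (Id V ?X) ((op_inj V F C l \<cdot> T) \<cdot> bang V ?X)"
    unfolding pt[symmetric] by (simp add: Lambda_rep_def op_vcat_def Let_def)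
  show "FA ?Z l \<in> hom V (FO ?Z (tgt l)) (FO ?Z (src l))"
    unfolding FO FA using op_comp_simps X il T by (simp add: hom_iff)
  fix \<phi> assume \<phi>: "\<phi> \<in> hom F (tgt l) n"
  note h\<phi> = hom_F[OF \<phi>]
  have \<phi>': "\<phi> \<in> F_arr" "tgt l = src \<phi>" "tgt \<phi> = n" using h\<phi> by simp_all
  show c: "\<phi> \<odot> l \<in> hom F (src l) n" by (rule F(3)[OF F(4)[OF l] \<phi>])
  show "env_arr n l \<phi> \<in> hom V (lprod V (env_obs C n \<phi>)) (lprod V (env_obs C n (\<phi> \<odot> l)))"
    using env_arr_simps[OF \<phi>'(1) l \<phi>'(2)] by (simp add: hom_iff)
  let ?P = "fib_prod V C \<phi>"
  note i\<phi> = op_hom_simps(2-4)[OF \<phi>] and ic = op_hom_simps(2-4)[OF c]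
  have P: "?P \<in> Obj V" by (rule fib_prod_Obj)
  have fc: "fib_comp V C \<phi> l \<in> Arr V" "Dom V (fib_comp V C \<phi> l) = ?P \<otimes> fib_prod V C l"
    "Cod V (fib_comp V C \<phi> l) = fib_prod V C (\<phi> \<odot> l)"
    using fib_comp_precomp(1)[OF Lambda_F[OF l] \<phi>', of "Id V (?P \<otimes> fib_prod V C l)"] P fib_prod_Obj
    by (simp_all add: hom_iff)
  let ?h = "pair V (Id V ?P) (T \<cdot> bang V ?P)"
  have h: "?h \<in> Arr V" "Dom V ?h = ?P" "Cod V ?h = ?P \<otimes> fib_prod V C l" using T P by simp_all
  let ?p = "pair V (Id V ?X) ((op_inj V F C l \<cdot> T) \<cdot> bang V ?X)"
  have p: "?p \<in> Arr V" "Dom V ?p = ?X" "Cod V ?p = ?X \<otimes> op_hom V F C (src l) (tgt l)"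
    using il X T by simp_all
  have "?p \<cdot> op_inj V F C \<phi>
    = prod_map V (op_inj V F C \<phi>) (op_inj V F C l) \<cdot> ?h"
    using X il T P i\<phi> by simp
  then have "FA ?Z l \<cdot> op_inj V F C \<phi> =
      op_comp V F C (src l) (tgt l) n \<cdot> prod_map V (op_inj V F C \<phi>) (op_inj V F C l) \<cdot> ?h"
    unfolding FA using comp_assoc[OF i\<phi>(1) p(1) op_comp_simps(1)] i\<phi> p op_comp_simps by simp
  also have "\<dots> = (op_comp V F C (src l) (tgt l) n \<cdot> prod_map V (op_inj V F C \<phi>) (op_inj V F C l)) \<cdot> ?h"
    using comp_assoc[OF h(1) _ op_comp_simps(1), of "prod_map V (op_inj V F C \<phi>) (op_inj V F C l)"]
      op_comp_simps il i\<phi> h by simp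
  also have "\<dots> = (op_inj V F C (\<phi> \<odot> l) \<cdot> fib_comp V C \<phi> l) \<cdot> ?h"
    unfolding op_comp_inj[OF \<phi> F(4)[OF l]] ..
  also have "\<dots> = op_inj V F C (\<phi> \<odot> l) \<cdot> fib_comp V C \<phi> l \<cdot> ?h"
    using comp_assoc[OF h(1) fc(1), of "op_inj V F C (\<phi> \<odot> l)"] ic h fc by simp
  also have "fib_comp V C \<phi> l \<cdot> ?h = env_arr n l \<phi>"
    by (rule fib_comp_points[OF \<phi>'(1) l \<phi>'(2,3), folded T_def])
  finally show "FA ?Z l \<cdot> op_inj V F C \<phi> = op_inj V F C (\<phi> \<odot> l) \<cdot> env_arr n l \<phi>" .
qed

end

end

end


section \<open>Functoriality of the \<open>\<Lambda>\<close>-object of a based operad\<close>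

lemma card_fibres:
  assumes "finite A" "finite B"
  shows "(\<Sum>b\<in>B. card (set_fib A f b)) = card {a \<in> A. f a \<in> B}"
proof -
  let ?A = "{a \<in> A. f a \<in> B}"
  have "(\<Sum>b\<in>B. card (set_fib A f b)) = (\<Sum>b\<in>B. \<Sum>a\<in>{a \<in> ?A. f a = b}. 1)"
  proof (rule sum.cong[OF refl])
    fix b assume "b \<in> B"
    then have "set_fib A f b = {a \<in> ?A. f a = b}" by (auto simp: set_fib_def)
    then show "card (set_fib A f b) = (\<Sum>a\<in>{a \<in> ?A. f a = b}. 1)" by simp
  qed
  also have "\<dots> = (\<Sum>a\<in>?A. 1)" by (rule sum.group) (use assms in auto)
  finally show ?thesis by simp
qed

text \<open>Blocks of an injection have at most one element, so only the values matter.\<close>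

lemma sort_perm_inj:
  assumes "inj_on f {1..m}" "b \<in> {1..m}"
  shows "sort_perm {1..m} f (b - 1) = card {x \<in> {1..m}. f x < f b}"
proof -
  have "sorted_list_of_set {1..m} ! (b - 1) = b"
    unfolding sorted_list_of_interval using assms(2) by (simp del: upt_Suc)
  moreover have "b - 1 < card {1..m}" using assms(2) by auto
  moreover have "{x \<in> {1..m}. f x < f b \<or> f x = f b \<and> x < b} = {x \<in> {1..m}. f x < f b}"
    using inj_onD[OF assms(1) _ _ assms(2)] by blast
  ultimately show ?thesis unfolding sort_perm_def block_rank_def by simp
qed

text \<open>The elements of \<open>A\<close> listed in the order of their values under an injection \<open>f\<close>, that is, by
  the fibres of \<open>f\<close>.\<close>

definition by_value :: "nat set \<Rightarrow> (nat \<Rightarrow> nat) \<Rightarrow> nat list \<Rightarrow> nat list" where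
  "by_value A f js = concat (map (\<lambda>j. sorted_list_of_set (set_fib A f j)) js)"

lemma inj_set_fib:
  assumes "inj_on f A"
  obtains "set_fib A f j = {}" | a where "a \<in> A" "f a = j" "set_fib A f j = {a}"
proof (cases "set_fib A f j = {}")
  case False
  then obtain a where a: "a \<in> A" "f a = j" by (auto simp: set_fib_def)
  then have "set_fib A f j = {a}" using assms by (auto simp: set_fib_def dest: inj_onD)
  with a that show ?thesis by blast
qed

lemma set_by_value:
  assumes "finite A"
  shows "set (by_value A f js) = {a \<in> A. f a \<in> set js}"
proof -
  have "finite (set_fib A f j)" for j using assms by (simp add: set_fib_def)
  then show ?thesis by (auto simp: by_value_def set_fib_def)
qed

lemma sorted_by_value:
  assumes "finite A" "inj_on f A" "sorted_wrt (<) js"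
  shows "sorted_wrt (\<lambda>a b. f a < f b) (by_value A f js)"
  using assms(3)
proof (induction js)
  case (Cons j js)
  have "sorted_wrt (\<lambda>a b. f a < f b) (sorted_list_of_set (set_fib A f j))"
    using assms(2) by (rule inj_set_fib[of _ _ j]) simp_all
  moreover have "f a = j" if "a \<in> set (sorted_list_of_set (set_fib A f j))" for a
    using that assms(1) by (simp add: set_fib_def)
  moreover have "f b \<in> set js" if "b \<in> set (by_value A f js)" for b
    using that assms(1) by (simp add: set_by_value)
  ultimately show ?case using Cons by (auto simp: by_value_def sorted_wrt_append)
qed (simp add: by_value_def)

lemma
  assumes f: "inj_on f {1..m}" "f ` {1..m} \<subseteq> {1..n}"
  defines "ws \<equiv> by_value {1..m} f [1..<Suc n]"
  shows length_by_value: "length ws = m"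
    and distinct_by_value: "distinct ws"
    and set_take_by_value: "q < m \<Longrightarrow> set (take q ws) = {x \<in> {1..m}. f x < f (ws ! q)}"
    and nth_by_value: "q < m \<Longrightarrow> ws ! q \<in> {1..m}"
    and sort_perm_by_value: "q < m \<Longrightarrow> sort_perm {1..m} f (ws ! q - 1) = q"
proof -
  have s: "sorted_wrt (\<lambda>a b. f a < f b) ws"
    unfolding ws_def by (rule sorted_by_value[OF _ f(1)]) (simp_all del: upt_Suc)
  have set: "set ws = {1..m}"
    unfolding ws_def using f(2) by (auto simp: set_by_value simp del: upt_Suc)
  show d: "distinct ws"
    unfolding distinct_conv_nth using sorted_wrt_nth_less[OF s]
    by (metis less_irrefl linorder_neqE_nat)
  show l: "length ws = m" using distinct_card[OF d] set by simp
  show nth: "ws ! q \<in> {1..m}" if "q < m" for q using that l set nth_mem by metis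
  show t: "set (take q ws) = {x \<in> {1..m}. f x < f (ws ! q)}" if q: "q < m" for q
  proof (intro set_eqI iffI)
    fix x assume "x \<in> set (take q ws)"
    then obtain i where "i < q" "x = ws ! i" using q l by (auto simp: in_set_conv_nth)
    then show "x \<in> {x \<in> {1..m}. f x < f (ws ! q)}"
      using sorted_wrt_nth_less[OF s, of i q] nth[of i] q l by simp
  next
    fix x assume x: "x \<in> {x \<in> {1..m}. f x < f (ws ! q)}"
    then have "x \<in> set ws" using set by simp
    then obtain i where i: "i < length ws" "x = ws ! i" by (auto simp: in_set_conv_nth)
    have "i < q"
    proof (rule ccontr)
      assume "\<not> i < q"
      then have "q = i \<or> q < i" by auto
      then show False using sorted_wrt_nth_less[OF s, of q i] i x by auto
    qed
    then show "x \<in> set (take q ws)" using i q l by (auto simp: in_set_conv_nth)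
  qed
  show "sort_perm {1..m} f (ws ! q - 1) = q" if q: "q < m"
  proof -
    have "card (set (take q ws)) = q" using distinct_card[OF distinct_take[OF d, of q]] q l by simp
    then show ?thesis unfolding sort_perm_inj[OF f(1) nth[OF q]] t[OF q] .
  qed
qed

text \<open>Listing \<open>{1..m}\<close> by increasing values of \<open>f\<close> inverts the permutation that sorts by values.\<close>

lemma permute_by_value:
  assumes f: "inj_on f {1..m}" "f ` {1..m} \<subseteq> {1..n}" and xs: "length xs = m"
  shows "permute_list_by (sort_perm {1..m} f) xs =
    map (\<lambda>i. xs ! (i - 1)) (by_value {1..m} f [1..<Suc n])"
proof (rule nth_equalityI)
  let ?ws = "by_value {1..m} f [1..<Suc n]"
  have p: "sort_perm {1..m} f permutes {..<m}"
    using sort_perm_permutes[of "{1..m}" f] by simp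
  show "length (permute_list_by (sort_perm {1..m} f) xs) = length (map (\<lambda>i. xs ! (i - 1)) ?ws)"
    unfolding length_map length_by_value[OF f] using xs by (simp add: permute_list_by_def)
  fix q assume "q < length (permute_list_by (sort_perm {1..m} f) xs)"
  then have q: "q < m" using xs by (simp add: permute_list_by_def)
  have "inv (sort_perm {1..m} f) q = ?ws ! q - 1"
    using sort_perm_by_value[OF f q] p by (metis permutes_inverses(2))
  then show "permute_list_by (sort_perm {1..m} f) xs ! q = map (\<lambda>i. xs ! (i - 1)) ?ws ! q"
    using q xs length_by_value[OF f] by (simp add: permute_list_by_def del: upt_Suc)
qed

lemma offset_Cons [simp]: "offset (a # as) (Suc i) = a + offset as i"
  by (simp add: offset_def)

lemma concat_nth_offset:
  "s < length xss \<Longrightarrow> t < length (xss ! s) \<Longrightarrow>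
    concat xss ! (offset (map length xss) s + t) = xss ! s ! t"
proof (induction xss arbitrary: s)
  case (Cons xs xss)
  then show ?case
  proof (cases s)
    case 0
    then show ?thesis using Cons.prems by (simp add: offset_def nth_append)
  next
    case (Suc i)
    then show ?thesis using Cons by (simp add: nth_append)
  qed
qed simp

abbreviation fib_cards :: "nat \<Rightarrow> nat \<Rightarrow> (nat \<Rightarrow> nat) \<Rightarrow> nat list" where
  "fib_cards m n f \<equiv> map (\<lambda>j. card (set_fib {1..m} f j)) [1..<Suc n]"

lemma offset_fib_cards:
  assumes "i \<le> m" "g ` {1..p} \<subseteq> {1..m}"
  shows "offset (fib_cards p m g) i = card {x \<in> {1..p}. g x \<le> i}"
proof -
  have "take i [1..<Suc m] = [1..<Suc i]" using assms(1) by (simp add: take_upt del: upt_Suc)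
  then have "offset (fib_cards p m g) i = (\<Sum>j\<in>{1..i}. card (set_fib {1..p} g j))"
    by (simp add: offset_def take_map sum_list_distinct_conv_sum_set atLeastLessThanSuc_atLeastAtMost del: upt_Suc)
  also have "\<dots> = card {x \<in> {1..p}. g x \<in> {1..i}}" by (rule card_fibres) simp_all
  also have "{x \<in> {1..p}. g x \<in> {1..i}} = {x \<in> {1..p}. g x \<le> i}"
  proof (rule Collect_cong)
    fix x
    have "g x \<in> {1..m}" if "x \<in> {1..p}" using assms(2) that by blast
    then show "x \<in> {1..p} \<and> g x \<in> {1..i} \<longleftrightarrow> x \<in> {1..p} \<and> g x \<le> i" by auto
  qed
  finally show ?thesis .
qed

text \<open>The permutation of a composite injection: in the block order of \<open>g\<close>, block \<open>g a\<close> consists of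
  the single element \<open>a\<close>, and \<open>f\<close> then moves whole blocks.\<close>

lemma block_perm_sort_perm:
  assumes g: "inj_on g {1..p}" "g ` {1..p} \<subseteq> {1..m}" and f: "inj_on f {1..m}" "f ` {1..m} \<subseteq> {1..n}"
    and h: "\<And>x. x \<in> {1..p} \<Longrightarrow> h x = f (g x)"
  shows "block_perm (sort_perm {1..m} f) (fib_cards p m g) \<circ> sort_perm {1..p} g = sort_perm {1..p} h"
proof
  fix r
  let ?s = "sort_perm {1..m} f" and ?e = "fib_cards p m g"
  let ?ws = "by_value {1..m} f [1..<Suc n]"
  have sum: "sum_list ?e = p"
    using sum_list_card_fibres[of "{1..p}" "{1..m}" g] g(2) unfolding sorted_list_of_interval by simp
  show "(block_perm ?s ?e \<circ> sort_perm {1..p} g) r = sort_perm {1..p} h r"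
  proof (cases "r < p")
    case True
    define a where "a = Suc r"
    have a: "a \<in> {1..p}" "a - 1 = r" using True by (auto simp: a_def)
    let ?b = "g a"
    have gm: "g x \<in> {1..m}" if "x \<in> {1..p}" for x using g(2) that by blast
    have b: "?b \<in> {1..m}" using gm[OF a(1)] .
    \<comment> \<open>The position of \<open>a\<close> in the block order, where the block \<open>g a\<close> begins.\<close>
    define q where "q = card {x \<in> {1..p}. g x < ?b}"
    have sq: "sort_perm {1..p} g r = q" using sort_perm_inj[OF g(1) a(1)] a(2) by (simp add: q_def)
    have qp: "q < p"
    proof -
      have "{x \<in> {1..p}. g x < ?b} \<subset> {1..p}" using a(1) by blast
      then have "q < card {1..p}" unfolding q_def by (intro psubset_card_mono) simp_all
      then show ?thesis by simp
    qed
    have blk: "block_of ?e q = ?b - 1"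
      unfolding block_of_def
    proof (rule Least_equality)
      have "a \<in> {x \<in> {1..p}. g x \<le> ?b} - {x \<in> {1..p}. g x < ?b}" using a(1) by simp
      then have "{x \<in> {1..p}. g x < ?b} \<subset> {x \<in> {1..p}. g x \<le> ?b}" by auto
      then have "q < card {x \<in> {1..p}. g x \<le> ?b}" unfolding q_def by (intro psubset_card_mono) simp_all
      then show "q < offset ?e (Suc (?b - 1))" using offset_fib_cards[OF _ g(2), of ?b] b by simp
      fix i assume i: "q < offset ?e (Suc i)"
      show "?b - 1 \<le> i"
      proof (rule ccontr)
        assume "\<not> ?b - 1 \<le> i"
        then have ib: "Suc i < ?b" by simp
        then have "offset ?e (Suc i) = card {x \<in> {1..p}. g x \<le> Suc i}"
          using offset_fib_cards[OF _ g(2), of "Suc i"] b by simp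
        also have "\<dots> \<le> q" unfolding q_def by (rule card_mono) (use ib in auto)
        finally show False using i by simp
      qed
    qed
    have lt: "{x \<in> {1..p}. g x \<le> ?b - 1} = {x \<in> {1..p}. g x < ?b}" using b by auto
    have bm: "?b - 1 \<le> m" using b by auto
    have off: "offset ?e (?b - 1) = q"
      unfolding offset_fib_cards[OF bm g(2)] lt q_def ..
    \<comment> \<open>The place to which the permutation of \<open>f\<close> moves the block \<open>g a\<close>.\<close>
    define Q where "Q = ?s (?b - 1)"
    have "?b - 1 \<in> {..<m}" using b by auto
    then have Qm: "Q < m"
      unfolding Q_def using sort_perm_permutes[of "{1..m}" f] permutes_in_image by fastforce
    have wQ: "?ws ! Q = ?b"
    proof -
      have "?s (?ws ! Q - 1) = ?s (?b - 1)" using sort_perm_by_value[OF f Qm] by (simp add: Q_def)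
      moreover have "inj ?s" using sort_perm_permutes[of "{1..m}" f] permutes_inj by blast
      ultimately have "?ws ! Q - 1 = ?b - 1" by (simp add: inj_eq)
      moreover have "1 \<le> ?ws ! Q" "1 \<le> ?b"
        using nth_by_value[OF f Qm] b unfolding atLeastAtMost_iff by blast+
      ultimately show ?thesis by linarith
    qed
    have le: "length ?e = m" by simp
    have "offset (permute_list_by ?s ?e) Q = sum_list (map (\<lambda>i. ?e ! (i - 1)) (take Q ?ws))"
      unfolding permute_by_value[OF f le] offset_def by (simp add: take_map)
    also have "\<dots> = (\<Sum>i\<in>set (take Q ?ws). ?e ! (i - 1))"
      by (rule sum_list_distinct_conv_sum_set) (rule distinct_take[OF distinct_by_value[OF f]])
    also have "\<dots> = (\<Sum>i\<in>{x \<in> {1..m}. f x < f ?b}. ?e ! (i - 1))"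
      unfolding set_take_by_value[OF f Qm] wQ ..
    also have "\<dots> = (\<Sum>i\<in>{x \<in> {1..m}. f x < f ?b}. card (set_fib {1..p} g i))"
      by (rule sum.cong[OF refl]) (auto simp del: upt_Suc)
    also have "\<dots> = card {x \<in> {1..p}. g x \<in> {x \<in> {1..m}. f x < f ?b}}"
      by (rule card_fibres) simp_all
    also have "{x \<in> {1..p}. g x \<in> {x \<in> {1..m}. f x < f ?b}} = {x \<in> {1..p}. h x < h a}"
      using gm h a(1) by auto
    also have "card {x \<in> {1..p}. h x < h a} = sort_perm {1..p} h r"
    proof -
      have "inj_on h {1..p}"
      proof (rule inj_onI)
        fix x y assume xy: "x \<in> {1..p}" "y \<in> {1..p}" "h x = h y"
        then have "g x \<in> {1..m}" "g y \<in> {1..m}" using gm by blast+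
        then have "g x = g y" using xy h f(1) by (auto dest: inj_onD)
        then show "x = y" using xy g(1) by (auto dest: inj_onD)
      qed
      from sort_perm_inj[OF this a(1)] a(2) show ?thesis by simp
    qed
    finally have "offset (permute_list_by ?s ?e) Q = sort_perm {1..p} h r" .
    then show ?thesis
      unfolding comp_apply sq block_perm_def Let_def sum blk off Q_def[symmetric] using qp by simp
  next
    case False
    then have "sort_perm {1..p} g r = r" "sort_perm {1..p} h r = r" by (simp_all add: sort_perm_def)
    then show ?thesis using False sum by (simp add: block_perm_def del: upt_Suc)
  qed
qed

context distributive begin

context
  fixes C :: "('o, 'a) based_operad"
  assumes C: "is_based_operad V C"
begin

lemmas ob [simp] = OpOb_Obj[OF C] OpAct_simps[OF C] OpGam_simps[OF C] OpPoint_simps[OF C]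

definition pts :: "nat \<Rightarrow> nat \<Rightarrow> (nat \<Rightarrow> nat) \<Rightarrow> 'o \<Rightarrow> 'a list" where
  "pts m n f X = map (\<lambda>j. set_point C {1..m} f j \<cdot> bang V X) [1..<Suc n]"

lemma length_pts [simp]: "length (pts m n f X) = n"
  by (simp add: pts_def)

lemma pts_nth: "1 \<le> j \<Longrightarrow> j \<le> n \<Longrightarrow> pts m n f X ! (j - 1) = set_point C {1..m} f j \<cdot> bang V X"
  by (cases j) (simp_all add: pts_def del: upt_Suc)

lemma pts_simps:
  assumes "inj_on f {1..m}" "X \<in> Obj V"
  shows "\<forall>y\<in>set (pts m n f X). y \<in> Arr V \<and> Dom V y = X"
    "map (Cod V) (pts m n f X) = map (OpOb C) (fib_cards m n f)"
  using set_point_simps[OF C finite_atLeastAtMost assms(1)] assms(2)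
  by (simp_all add: pts_def del: upt_Suc)

lemma operad_Lambda_FA_comp:
  assumes l: "l \<in> Arr Lambda_cat" "src l = m" "tgt l = n" and h: "h \<in> Arr V" "Cod V h = OpOb C n"
  shows "FA (operad_Lambda V C) l \<cdot> h = OpAct C m (sort_perm {1..m} (fn l)) \<cdot>
    OpGam C (fib_cards m n (fn l)) \<cdot> pair V h (tuple V (Dom V h) (pts m n (fn l) (Dom V h)))"
proof -
  have f: "inj_on (fn l) {1..m}" "fn l ` {1..m} \<subseteq> {1..n}"
  proof -
    have "fn l i \<le> n" "Suc 0 \<le> fn l i" if "Suc 0 \<le> i" "i \<le> m" for i
      using l that F_arr_le[of l i] Lambda_pos[of l i] by simp_all
    then show "inj_on (fn l) {1..m}" "fn l ` {1..m} \<subseteq> {1..n}"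
      using Lambda_inj[OF l(1)] l(2) by (auto simp: inj_on_def)
  qed
  have D: "Dom V h \<in> Obj V" using h by simp
  have s: "sort_perm {1..m} (fn l) permutes {..<m}"
    using sort_perm_permutes[of "{1..m}" "fn l"] by simp
  have sum: "sum_list (fib_cards m n (fn l)) = m"
    using sum_list_card_fibres[of "{1..m}" "{1..n}" "fn l"] f(2) unfolding sorted_list_of_interval by simp
  note t = tuple_simps[OF D pts_simps(1)[OF f(1) D], of n, unfolded pts_simps(2)[OF f(1) D]]
  have "FA (operad_Lambda V C) l \<cdot> h = set_gam V C {1..m} {1..n} (fn l) \<cdot>
      pair V h (tuple V (Dom V h) (pts m n (fn l) (Dom V h)))"
    using set_act_comp[OF C finite_atLeastAtMost finite_atLeastAtMost f(2,1) h(1), of]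
      operad_Lambda_FA[OF C l(1)] h(2) l(2,3)
    unfolding pts_def sorted_list_of_interval by (simp del: upt_Suc)
  also have "\<dots> = (OpAct C m (sort_perm {1..m} (fn l)) \<cdot> OpGam C (fib_cards m n (fn l))) \<cdot>
      pair V h (tuple V (Dom V h) (pts m n (fn l) (Dom V h)))"
    unfolding set_gam_def sorted_list_of_interval by simp
  also have "\<dots> = OpAct C m (sort_perm {1..m} (fn l)) \<cdot> OpGam C (fib_cards m n (fn l)) \<cdot>
      pair V h (tuple V (Dom V h) (pts m n (fn l) (Dom V h)))"
    using t s sum h by (intro comp_assoc) (simp_all del: upt_Suc)
  finally show ?thesis .
qed

text \<open>The equivariance, associativity and unit axioms for generalised elements: the arguments of \<open>\<gamma>\<close> are
  arrows out of a common object \<open>X\<close>, which replaces the projections in the axioms.\<close>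

lemma operad_equivariance:
  assumes \<sigma>: "\<sigma> permutes {..<length js}" and q: "q \<in> Arr V" "Dom V q = X" "Cod V q = OpOb C (length js)"
    and ys: "\<forall>y\<in>set ys. y \<in> Arr V \<and> Dom V y = X" "map (Cod V) ys = map (OpOb C) js"
    and sum: "block_perm \<sigma> js permutes {..<sum_list js}" "sum_list (permute_list_by \<sigma> js) = sum_list js"
  shows "OpGam C js \<cdot> pair V (OpAct C (length js) \<sigma> \<cdot> q) (tuple V X ys) =
    OpAct C (sum_list js) (block_perm \<sigma> js) \<cdot> OpGam C (permute_list_by \<sigma> js) \<cdot>
      pair V q (tuple V X (permute_list_by \<sigma> ys))"
proof -
  let ?K = "OpOb C (length js)" and ?Js = "map (OpOb C) js"
  let ?Y = "?K \<otimes> lprod V ?Js"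
  let ?d = "\<lambda>s. proj V ?Js s \<cdot> Snd V ?K (lprod V ?Js)"
  let ?h = "pair V q (tuple V X ys)"
  have X: "X \<in> Obj V" using q by auto
  have "set ?Js \<subseteq> Obj V" by auto
  then have Js: "set ?Js \<subseteq> Obj V" "?K \<in> Obj V" "lprod V ?Js \<in> Obj V" "?Y \<in> Obj V"
    using lprod_Obj[of ?Js] by simp_all
  note t = tuple_simps[OF X ys(1), unfolded ys(2)]
  have h: "?h \<in> Arr V" "Dom V ?h = X" "Cod V ?h = ?Y" using q t by simp_all
  have ly: "length ys = length js" using ys(2) by (metis length_map)
  have inv: "inv \<sigma> i < length js" if "i < length js" for i
    using permutes_in_image[OF permutes_inv[OF \<sigma>], of i] that by simp
  have ax: "OpGam C js \<cdot> prod_map V (OpAct C (length js) \<sigma>) (Id V (lprod V ?Js)) =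
      OpAct C (sum_list js) (block_perm \<sigma> js) \<cdot> OpGam C (permute_list_by \<sigma> js) \<cdot>
        pair V (Fst V ?K (lprod V ?Js)) (tuple V ?Y (permute_list_by \<sigma> (map ?d [0..<length js])))"
    using C \<sigma> unfolding is_based_operad_def is_operad_def operad_equivariant_def Let_def by blast
  have d: "?d s \<in> Arr V" "Dom V (?d s) = ?Y" "Cod V (?d s) = ?Js ! s" "?d s \<cdot> ?h = ys ! s"
    if s: "s < length js" for s
  proof -
    show "?d s \<in> Arr V" "Dom V (?d s) = ?Y" "Cod V (?d s) = ?Js ! s"
      using Js s by simp_all
    have "Snd V ?K (lprod V ?Js) \<cdot> ?h = tuple V X ys" using q t by simp
    then show "?d s \<cdot> ?h = ys ! s"
      using comp_assoc[OF h(1), of "Snd V ?K (lprod V ?Js)" "proj V ?Js s"] h Js s ly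
        proj_tuple[OF X ys, of s] by simp
  qed
  let ?ds = "permute_list_by \<sigma> (map ?d [0..<length js])"
  have ds: "?ds = map (\<lambda>i. ?d (inv \<sigma> i)) [0..<length js]"
    unfolding permute_list_by_def length_map length_upt
    by (rule map_cong) (use inv in auto)
  have da: "\<forall>f\<in>set ?ds. f \<in> Arr V \<and> Dom V f = ?Y" unfolding ds using d(1,2) inv by auto
  have "map (Cod V) ?ds = map (\<lambda>i. ?Js ! inv \<sigma> i) [0..<length js]"
    unfolding ds map_map by (rule map_cong) (use d(3) inv in auto)
  also have "\<dots> = map (OpOb C) (permute_list_by \<sigma> js)"
    unfolding permute_list_by_def map_map by (rule map_cong) (use inv in auto)
  finally have dc: "map (Cod V) ?ds = map (OpOb C) (permute_list_by \<sigma> js)" .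
  have dh: "map (\<lambda>f. f \<cdot> ?h) ?ds = permute_list_by \<sigma> ys"
    unfolding ds permute_list_by_def map_map ly by (rule map_cong) (use d(4) inv in auto)
  note T = tuple_simps[OF Js(4) da, unfolded dc]
  let ?p = "pair V (Fst V ?K (lprod V ?Js)) (tuple V ?Y ?ds)"
  have Fh: "Fst V ?K (lprod V ?Js) \<cdot> ?h = q" using q t by simp
  have ph: "?p \<cdot> ?h = pair V q (tuple V X (permute_list_by \<sigma> ys))"
    using pair_comp[of "Fst V ?K (lprod V ?Js)" "tuple V ?Y ?ds" ?h] T h Js Fh
      tuple_comp[OF Js(4) da h(1,3)] dh by simp
  have lp: "length (permute_list_by \<sigma> js) = length js" by (simp add: permute_list_by_def)
  have p: "?p \<in> Arr V" "Dom V ?p = ?Y" "Cod V ?p = OpOb C (length js) \<otimes> lprod V (map (OpOb C) (permute_list_by \<sigma> js))"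
    using T Js by simp_all
  have "OpGam C js \<cdot> pair V (OpAct C (length js) \<sigma> \<cdot> q) (tuple V X ys)
     = OpGam C js \<cdot> prod_map V (OpAct C (length js) \<sigma>) (Id V (lprod V ?Js)) \<cdot> ?h"
    using \<sigma> q t Js by simp
  also have "\<dots> = (OpGam C js \<cdot> prod_map V (OpAct C (length js) \<sigma>) (Id V (lprod V ?Js))) \<cdot> ?h"
    by (rule comp_assoc[symmetric]) (use \<sigma> h Js in simp_all)
  also have "\<dots> = (OpAct C (sum_list js) (block_perm \<sigma> js) \<cdot> OpGam C (permute_list_by \<sigma> js) \<cdot> ?p) \<cdot> ?h"
    unfolding ax ..
  also have "\<dots> = OpAct C (sum_list js) (block_perm \<sigma> js) \<cdot> OpGam C (permute_list_by \<sigma> js) \<cdot> ?p \<cdot> ?h"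
    using h p lp sum by (simp del: pair_comp)
  finally show ?thesis unfolding ph .
qed

lemma operad_associativity:
  assumes q: "q \<in> Arr V" "Dom V q = X" "Cod V q = OpOb C (length iss)"
    and ys: "\<forall>y\<in>set ys. y \<in> Arr V \<and> Dom V y = X" "map (Cod V) ys = map (OpOb C) (map length iss)"
    and zss: "\<forall>z\<in>set (concat zss). z \<in> Arr V \<and> Dom V z = X" "map (map (Cod V)) zss = map (map (OpOb C)) iss"
  shows "OpGam C (concat iss) \<cdot> pair V (OpGam C (map length iss) \<cdot> pair V q (tuple V X ys)) (tuple V X (concat zss)) =
    OpGam C (map sum_list iss) \<cdot> pair V q (tuple V X
      (map (\<lambda>s. OpGam C (iss ! s) \<cdot> pair V (ys ! s) (tuple V X (zss ! s))) [0..<length iss]))"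
proof -
  let ?k = "length iss" and ?js = "map length iss" and ?is = "concat iss"
  let ?K = "OpOb C ?k" and ?Js = "map (OpOb C) ?js" and ?Is = "map (OpOb C) ?is"
  let ?KJ = "?K \<otimes> lprod V ?Js"
  let ?Y = "?KJ \<otimes> lprod V ?Is"
  let ?F = "Fst V ?KJ (lprod V ?Is)" and ?S = "Snd V ?KJ (lprod V ?Is)"
  let ?c = "Fst V ?K (lprod V ?Js) \<cdot> ?F"
  let ?d = "\<lambda>s. proj V ?Js s \<cdot> Snd V ?K (lprod V ?Js) \<cdot> ?F"
  let ?e = "\<lambda>t. proj V ?Is t \<cdot> ?S"
  let ?h1 = "pair V q (tuple V X ys)"
  let ?h = "pair V ?h1 (tuple V X (concat zss))"
  have X: "X \<in> Obj V" using q by auto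
  have "set ?Js \<subseteq> Obj V" "set ?Is \<subseteq> Obj V" by auto
  then have O: "set ?Js \<subseteq> Obj V" "set ?Is \<subseteq> Obj V" "lprod V ?Js \<in> Obj V" "lprod V ?Is \<in> Obj V"
    "?K \<in> Obj V" "?KJ \<in> Obj V" "?Y \<in> Obj V"
    using lprod_Obj[of ?Js] lprod_Obj[of ?Is] by simp_all
  have zc: "map (Cod V) (concat zss) = ?Is" unfolding map_concat zss(2) ..
  note t = tuple_simps[OF X ys(1), unfolded ys(2)] and t' = tuple_simps[OF X zss(1), unfolded zc]
  have h1: "?h1 \<in> Arr V" "Dom V ?h1 = X" "Cod V ?h1 = ?KJ" using q t by simp_all
  have h: "?h \<in> Arr V" "Dom V ?h = X" "Cod V ?h = ?Y" using h1 t' by simp_all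
  have Fh: "?F \<cdot> ?h = ?h1" and Sh: "?S \<cdot> ?h = tuple V X (concat zss)" using h1 t' by simp_all
  have ly: "length ys = ?k" using ys(2) by (metis length_map)
  have lz: "length zss = ?k" using zss(2) by (metis length_map)
  have lzs: "length (zss ! s) = length (iss ! s)" if "s < ?k" for s
    using arg_cong[OF zss(2), of "\<lambda>xss. length (xss ! s)"] that lz by simp
  then have lens: "map length zss = ?js" using lz by (intro nth_equalityI) simp_all
  have lconc: "length (concat zss) = length ?is" using arg_cong[OF zc, of length] by simp
  let ?G = "\<lambda>s. OpGam C (iss ! s) \<cdot> pair V (?d s) (tuple V ?Y (map (\<lambda>t. ?e (offset ?js s + t)) [0..<?js ! s]))"
  have ax: "OpGam C ?is \<cdot> prod_map V (OpGam C ?js) (Id V (lprod V ?Is)) =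
        OpGam C (map sum_list iss) \<cdot> pair V ?c (tuple V ?Y (map ?G [0..<?k]))"
    using C unfolding is_based_operad_def is_operad_def operad_assoc_def Let_def by blast
  have c: "?c \<in> Arr V" "Dom V ?c = ?Y" "Cod V ?c = ?K" using O by simp_all
  have ch: "?c \<cdot> ?h = q"
    using comp_assoc[of ?h ?F "Fst V ?K (lprod V ?Js)"] Fh h O q t by simp
  have d: "?d s \<in> Arr V" "Dom V (?d s) = ?Y" "Cod V (?d s) = OpOb C (length (iss ! s))" "?d s \<cdot> ?h = ys ! s"
    if s: "s < ?k" for s
  proof -
    show "?d s \<in> Arr V" "Dom V (?d s) = ?Y" "Cod V (?d s) = OpOb C (length (iss ! s))"
      using O s by simp_all
    have "?d s \<cdot> ?h = proj V ?Js s \<cdot> Snd V ?K (lprod V ?Js) \<cdot> ?F \<cdot> ?h"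
      using O s h(1,3) by (simp del: pair_comp Fst_pair)
    also have "\<dots> = proj V ?Js s \<cdot> tuple V X ys" unfolding Fh using q t by simp
    also have "\<dots> = ys ! s" by (rule proj_tuple[OF X ys]) (use s ly in simp)
    finally show "?d s \<cdot> ?h = ys ! s" .
  qed
  have off: "offset ?js s + t < length ?is" if "s < ?k" "t < length (iss ! s)" for s t
  proof -
    have "offset ?js s + length (iss ! s) = offset ?js (Suc s)"
      using that(1) by (simp add: offset_def take_Suc_conv_app_nth)
    also have "\<dots> \<le> sum_list ?js"
      unfolding offset_def using sum_list_append[of "take (Suc s) ?js" "drop (Suc s) ?js"] by simp
    finally show ?thesis using that(2) by (simp add: length_concat)
  qed
  have e: "?e (offset ?js s + t) \<in> Arr V" "Dom V (?e (offset ?js s + t)) = ?Y"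
    "Cod V (?e (offset ?js s + t)) = OpOb C (iss ! s ! t)" "?e (offset ?js s + t) \<cdot> ?h = zss ! s ! t"
    if s: "s < ?k" and tt: "t < length (iss ! s)" for s t
  proof -
    note o = off[OF s tt]
    have "?is ! (offset ?js s + t) = iss ! s ! t" by (rule concat_nth_offset[OF s tt])
    then show "?e (offset ?js s + t) \<in> Arr V" "Dom V (?e (offset ?js s + t)) = ?Y"
      "Cod V (?e (offset ?js s + t)) = OpOb C (iss ! s ! t)"
      using O o by simp_all
    have "?e (offset ?js s + t) \<cdot> ?h = proj V ?Is (offset ?js s + t) \<cdot> tuple V X (concat zss)"
      using O o h(1,3) Sh by (simp del: pair_comp Snd_pair)
    also have "\<dots> = concat zss ! (offset ?js s + t)"
      by (rule proj_tuple[OF X zss(1) zc]) (use o lconc in simp)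
    also have "\<dots> = zss ! s ! t"
      using concat_nth_offset[of s zss t] s tt lz lzs[OF s] lens by simp
    finally show "?e (offset ?js s + t) \<cdot> ?h = zss ! s ! t" .
  qed
  let ?T = "\<lambda>s. tuple V ?Y (map (\<lambda>t. ?e (offset ?js s + t)) [0..<?js ! s])"
  have T: "?T s \<in> Arr V" "Dom V (?T s) = ?Y" "Cod V (?T s) = lprod V (map (OpOb C) (iss ! s))"
    "?T s \<cdot> ?h = tuple V X (zss ! s)" if s: "s < ?k" for s
  proof -
    let ?l = "map (\<lambda>t. ?e (offset ?js s + t)) [0..<?js ! s]"
    have js: "?js ! s = length (iss ! s)" using s by simp
    have a: "\<forall>f\<in>set ?l. f \<in> Arr V \<and> Dom V f = ?Y" using e(1,2)[OF s] js by auto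
    have "map (Cod V) ?l = map (\<lambda>t. OpOb C (iss ! s ! t)) [0..<length (iss ! s)]"
      unfolding map_map js by (rule map_cong) (use e(3)[OF s] in auto)
    also have "\<dots> = map (OpOb C) (iss ! s)" by (rule nth_equalityI) simp_all
    finally have cc: "map (Cod V) ?l = map (OpOb C) (iss ! s)" .
    have "map (\<lambda>f. f \<cdot> ?h) ?l = map (\<lambda>t. zss ! s ! t) [0..<length (iss ! s)]"
      unfolding map_map js by (rule map_cong) (use e(4)[OF s] in auto)
    also have "\<dots> = zss ! s" using lzs[OF s] by (intro nth_equalityI) simp_all
    finally have hh: "map (\<lambda>f. f \<cdot> ?h) ?l = zss ! s" .
    show "?T s \<in> Arr V" "Dom V (?T s) = ?Y" "Cod V (?T s) = lprod V (map (OpOb C) (iss ! s))"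
      using tuple_simps[OF O(7) a] unfolding cc .
    show "?T s \<cdot> ?h = tuple V X (zss ! s)"
      unfolding tuple_comp[OF O(7) a h(1,3)] hh h(2) ..
  qed
  have G: "?G s \<in> Arr V" "Dom V (?G s) = ?Y" "Cod V (?G s) = OpOb C (sum_list (iss ! s))"
    "?G s \<cdot> ?h = OpGam C (iss ! s) \<cdot> pair V (ys ! s) (tuple V X (zss ! s))" if s: "s < ?k" for s
  proof -
    show "?G s \<in> Arr V" "Dom V (?G s) = ?Y" "Cod V (?G s) = OpOb C (sum_list (iss ! s))"
      using T(1-3)[OF s] d(1-3)[OF s] by simp_all
    have "?G s \<cdot> ?h = OpGam C (iss ! s) \<cdot> pair V (?d s \<cdot> ?h) (?T s \<cdot> ?h)"
      by (rule comp_pair_comp)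
        (simp_all only: T(1-3)[OF s] d(1-3)[OF s] h OpGam_simps[OF C])
    then show "?G s \<cdot> ?h = OpGam C (iss ! s) \<cdot> pair V (ys ! s) (tuple V X (zss ! s))"
      unfolding d(4)[OF s] T(4)[OF s] .
  qed
  let ?Gs = "map ?G [0..<?k]"
  have Ga: "\<forall>f\<in>set ?Gs. f \<in> Arr V \<and> Dom V f = ?Y" using G(1,2) by auto
  have "map (Cod V) ?Gs = map (\<lambda>s. OpOb C (sum_list (iss ! s))) [0..<?k]"
    unfolding map_map by (rule map_cong) (use G(3) in auto)
  also have "\<dots> = map (OpOb C) (map sum_list iss)" by (rule nth_equalityI) simp_all
  finally have Gc: "map (Cod V) ?Gs = map (OpOb C) (map sum_list iss)" .
  have Gh: "map (\<lambda>f. f \<cdot> ?h) ?Gs =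
      map (\<lambda>s. OpGam C (iss ! s) \<cdot> pair V (ys ! s) (tuple V X (zss ! s))) [0..<?k]"
    unfolding map_map by (rule map_cong) (use G(4) in auto)
  note GT = tuple_simps[OF O(7) Ga, unfolded Gc]
  have "OpGam C ?is \<cdot> pair V (OpGam C ?js \<cdot> ?h1) (tuple V X (concat zss)) =
      OpGam C ?is \<cdot> prod_map V (OpGam C ?js) (Id V (lprod V ?Is)) \<cdot> ?h"
    using h1 t' O by (simp del: pair_comp)
  also have "\<dots> = (OpGam C ?is \<cdot> prod_map V (OpGam C ?js) (Id V (lprod V ?Is))) \<cdot> ?h"
    by (rule comp_assoc[symmetric]) (use h O in \<open>simp_all add: length_concat\<close>)
  also have "\<dots> = (OpGam C (map sum_list iss) \<cdot> pair V ?c (tuple V ?Y ?Gs)) \<cdot> ?h"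
    unfolding ax ..
  also have "\<dots> = OpGam C (map sum_list iss) \<cdot> pair V (?c \<cdot> ?h) (tuple V ?Y ?Gs \<cdot> ?h)"
    by (rule comp_pair_comp) (simp_all only: GT c h OpGam_simps[OF C] length_map)
  finally show ?thesis unfolding ch tuple_comp[OF O(7) Ga h(1,3)] Gh h(2) .
qed

lemma operad_unit_left:
  assumes "y \<in> Arr V" "Cod V y = OpOb C j" "Dom V y = X"
  shows "OpGam C [j] \<cdot> pair V (OpUnit C \<cdot> bang V X) (tuple V X [y]) = y"
proof -
  let ?J = "OpOb C j"
  have X: "X \<in> Obj V" using assms by auto
  have "OpGam C [j] \<cdot> pair V (OpUnit C \<cdot> bang V ?J) (tuple V ?J [Id V ?J]) = Id V ?J"
    using C unfolding is_based_operad_def is_operad_def operad_unital_def Let_def by blast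
  then have "(OpGam C [j] \<cdot> pair V (OpUnit C \<cdot> bang V ?J) (tuple V ?J [Id V ?J])) \<cdot> y = y"
    using assms by simp
  then show ?thesis using assms X by simp
qed

lemma operad_unit_right:
  assumes "y \<in> Arr V" "Cod V y = OpOb C k" "Dom V y = X"
  shows "OpGam C (replicate k 1) \<cdot> pair V y (tuple V X (replicate k (OpUnit C \<cdot> bang V X))) = y"
proof -
  let ?K = "OpOb C k"
  let ?us = "replicate k (OpUnit C \<cdot> bang V ?K)"
  have X: "X \<in> Obj V" using assms by auto
  have a: "\<forall>f\<in>set ?us. f \<in> Arr V \<and> Dom V f = ?K" by auto
  have m: "map (Cod V) ?us = map (OpOb C) (replicate k 1)" by (simp add: map_replicate_const)
  note t = tuple_simps[OF OpOb_Obj[OF C] a, unfolded m]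
  have ty: "tuple V ?K ?us \<cdot> y = tuple V X (replicate k (OpUnit C \<cdot> bang V X))"
    unfolding tuple_comp[OF OpOb_Obj[OF C] a assms(1,2)] using assms X by (simp add: map_replicate_const)
  have "OpGam C (replicate k 1) \<cdot> pair V (Id V ?K) (tuple V ?K ?us) = Id V ?K"
    using C unfolding is_based_operad_def is_operad_def operad_unital_def Let_def by blast
  then have "(OpGam C (replicate k 1) \<cdot> pair V (Id V ?K) (tuple V ?K ?us)) \<cdot> y = y"
    using assms by simp
  moreover have "(OpGam C (replicate k 1) \<cdot> pair V (Id V ?K) (tuple V ?K ?us)) \<cdot> y =
      OpGam C (replicate k 1) \<cdot> pair V (Id V ?K \<cdot> y) (tuple V ?K ?us \<cdot> y)"
    by (rule comp_pair_comp) (use t assms in simp_all)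
  ultimately show ?thesis unfolding ty using assms by simp
qed

lemma Lambda_on_interval:
  assumes "l \<in> Arr Lambda_cat"
  shows "inj_on (fn l) {1..src l}" "fn l ` {1..src l} \<subseteq> {1..tgt l}"
proof -
  have "fn l i \<le> tgt l" "Suc 0 \<le> fn l i" if "Suc 0 \<le> i" "i \<le> src l" for i
    using assms that by simp_all
  then show "inj_on (fn l) {1..src l}" "fn l ` {1..src l} \<subseteq> {1..tgt l}"
    using Lambda_inj[OF assms] by (auto simp: inj_on_def)
qed

text \<open>Equivariance moves the permutation of \<open>l\<close> past the points of \<open>k\<close>, associativity combines these points
  with those of \<open>l\<close> in the fibres of \<open>l\<close>, and the unit axioms evaluate the blocks to the points of \<open>l k\<close>. The
  remaining permutations compose to that of \<open>l k\<close>.\<close>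

lemma operad_Lambda_comp:
  assumes k: "k \<in> Arr Lambda_cat" and l: "l \<in> Arr Lambda_cat" and kl: "tgt k = src l"
  shows "FA (operad_Lambda V C) (l \<odot> k) = FA (operad_Lambda V C) k \<cdot> FA (operad_Lambda V C) l"
proof -
  let ?D = "operad_Lambda V C"
  define p m n where "p = src k" and "m = src l" and "n = tgt l"
  define f g h where "f = fn l" and "g = fn k" and "h = fn (l \<odot> k)"
  let ?X = "OpOb C n"
  have kp: "src k = p" "tgt k = m" "src l = m" "tgt l = n" using kl by (simp_all add: p_def m_def n_def)
  have g: "inj_on g {1..p}" "g ` {1..p} \<subseteq> {1..m}"
    using Lambda_on_interval[OF k] kp by (simp_all add: g_def)
  have f: "inj_on f {1..m}" "f ` {1..m} \<subseteq> {1..n}"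
    using Lambda_on_interval[OF l] kp by (simp_all add: f_def)
  have h: "h x = f (g x)" if "x \<in> {1..p}" for x using that kp by (simp add: f_def g_def h_def)
  have hi: "inj_on h {1..p}" "h ` {1..p} \<subseteq> {1..n}"
    using Lambda_on_interval[OF Lambda_comp[OF k l kl]] kp by (simp_all add: h_def)
  let ?sk = "sort_perm {1..p} g" and ?sl = "sort_perm {1..m} f" and ?sh = "sort_perm {1..p} h"
  let ?ek = "fib_cards p m g" and ?el = "fib_cards m n f" and ?eh = "fib_cards p n h"
  let ?pk = "pts p m g ?X" and ?pl = "pts m n f ?X" and ?ph = "pts p n h ?X"
  have perm: "?sk permutes {..<p}" "?sl permutes {..<m}" "?sh permutes {..<p}"
    using sort_perm_permutes[of "{1..p}" g] sort_perm_permutes[of "{1..m}" f]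
      sort_perm_permutes[of "{1..p}" h] by simp_all
  let ?B = "block_perm ?sl ?ek"
  have comp: "?B \<circ> ?sk = ?sh" by (rule block_perm_sort_perm[OF g f h])
  have Bp: "?B permutes {..<p}"
  proof -
    have "?B = (?B \<circ> ?sk) \<circ> inv ?sk" using permutes_inv_o(1)[OF perm(1)] by (simp add: o_assoc[symmetric])
    then have "?B = ?sh \<circ> inv ?sk" unfolding comp .
    then show ?thesis using permutes_compose[OF permutes_inv[OF perm(1)] perm(3)] by simp
  qed
  have sumk: "sum_list ?ek = p"
    using sum_list_card_fibres[of "{1..p}" "{1..m}" g] g(2) unfolding sorted_list_of_interval by simp
  have suml: "sum_list ?el = m"
    using sum_list_card_fibres[of "{1..m}" "{1..n}" f] f(2) unfolding sorted_list_of_interval by simp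
  have X: "?X \<in> Obj V" by simp
  note pk = pts_simps[OF g(1) X, of m] and pl = pts_simps[OF f(1) X, of n]
  note tk = tuple_simps[OF X pk(1), unfolded pk(2)] and tl = tuple_simps[OF X pl(1), unfolded pl(2)]
  let ?q = "OpGam C ?el \<cdot> pair V (Id V ?X) (tuple V ?X ?pl)"
  have q: "?q \<in> Arr V" "Dom V ?q = ?X" "Cod V ?q = OpOb C m"
    using tl suml by (simp_all del: upt_Suc)
  have Dl: "FA ?D l = OpAct C m ?sl \<cdot> ?q"
    using operad_Lambda_FA_comp[OF l kp(3,4), of "Id V ?X"] operad_Lambda_simps[OF C l] kp
    by (simp add: f_def del: upt_Suc)
  let ?F = "\<lambda>j. sorted_list_of_set (set_fib {1..m} f j)"
  \<comment> \<open>The arities of the points of \<open>k\<close>, and the points themselves, grouped by the fibres of \<open>l\<close>.\<close>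
  let ?iss = "map (\<lambda>j. map (\<lambda>i. ?ek ! (i - 1)) (?F j)) [1..<Suc n]"
  let ?zss = "map (\<lambda>j. map (\<lambda>i. ?pk ! (i - 1)) (?F j)) [1..<Suc n]"
  have le: "length ?ek = m" by simp
  have ei: "permute_list_by ?sl ?ek = concat ?iss"
    unfolding permute_by_value[OF f le] by_value_def map_concat map_map comp_def ..
  have zi: "permute_list_by ?sl ?pk = concat ?zss"
    unfolding permute_by_value[OF f length_pts] by_value_def map_concat map_map comp_def ..
  have lens: "map length ?iss = ?el" by (simp del: upt_Suc)
  have sume: "sum_list (concat ?iss) = p"
  proof -
    have "mset (permute_list_by ?sl ?ek) = mset ?ek"
    proof -
      have "permute_list_by ?sl ?ek = permute_list (inv ?sl) ?ek"
        by (simp add: permute_list_by_def permute_list_def)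
      then show ?thesis using mset_permute_list[of "inv ?sl" ?ek] permutes_inv[OF perm(2)] by simp
    qed
    then have "sum_list (permute_list_by ?sl ?ek) = sum_list ?ek" by (metis sum_mset_sum_list)
    then show ?thesis unfolding ei sumk .
  qed
  have fm: "i \<in> {1..m}" if "i \<in> set (?F j)" for i j
  proof -
    have "finite (set_fib {1..m} f j)" by (simp add: set_fib_def)
    then show ?thesis using that by (simp add: set_fib_def)
  qed
  have pki: "?pk ! (i - 1) = set_point C {1..p} g i \<cdot> bang V ?X" "?ek ! (i - 1) = card (set_fib {1..p} g i)"
    if "i \<in> {1..m}" for i
    subgoal by (rule pts_nth) (use that in simp_all)
    subgoal using that by (cases i) (simp_all del: upt_Suc)
    done
  note sp = set_point_simps[OF C finite_atLeastAtMost g(1)]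
  have z1: "\<forall>z\<in>set (concat ?zss). z \<in> Arr V \<and> Dom V z = ?X"
  proof
    fix z assume "z \<in> set (concat ?zss)"
    then obtain j i where "i \<in> set (?F j)" and z: "z = ?pk ! (i - 1)"
      unfolding set_concat set_map image_image UN_iff image_iff[of z] by blast
    then have "i \<in> {1..m}" by (blast intro: fm)
    from pki(1)[OF this] show "z \<in> Arr V \<and> Dom V z = ?X" unfolding z using sp by simp
  qed
  have z2: "map (map (Cod V)) ?zss = map (map (OpOb C)) ?iss"
    unfolding map_map comp_def
  proof (rule map_cong[OF refl], rule map_cong[OF refl])
    fix j i assume "i \<in> set (?F j)"
    from pki[OF fm[OF this]] show "Cod V (?pk ! (i - 1)) = OpOb C (?ek ! (i - 1))"
      using sp[of i] by simp
  qed
  \<comment> \<open>A fibre of \<open>l\<close> is empty or has one element \<open>a\<close>, so its block is \<open>\<gamma>(\<eta>)\<close> or \<open>\<gamma>(1; \<epsilon>\<^sub>a)\<close>.\<close>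
  have J': "OpGam C (map (\<lambda>i. ?ek ! (i - 1)) (?F j)) \<cdot>
        pair V (set_point C {1..m} f j \<cdot> bang V ?X) (tuple V ?X (map (\<lambda>i. ?pk ! (i - 1)) (?F j)))
      = set_point C {1..p} h j \<cdot> bang V ?X \<and>
    sum_list (map (\<lambda>i. ?ek ! (i - 1)) (?F j)) = card (set_fib {1..p} h j)" for j
  proof -
    have gm: "g x \<in> {1..m}" if "x \<in> {1..p}" for x using g(2) that by blast
      consider "set_fib {1..m} f j = {}" | a where "a \<in> {1..m}" "f a = j" "set_fib {1..m} f j = {a}"
        by (rule inj_set_fib[OF f(1), of j])
      then show ?thesis
      proof cases
        case 1
        then have "set_fib {1..p} h j = {}" using gm h by (auto simp: set_fib_def)
        then show ?thesis
          using 1 operad_unit_right[of "OpEta C \<cdot> bang V ?X" 0 ?X] X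
          by (simp add: set_point_def del: upt_Suc)
      next
        case (2 a)
        have "h x = j \<longleftrightarrow> g x = a" if "x \<in> {1..p}" for x
          using 2(1,2) h[OF that] inj_onD[OF f(1) _ gm[OF that] 2(1)] by auto
        then have hg: "set_fib {1..p} h j = set_fib {1..p} g a" by (auto simp: set_fib_def)
        have u: "set_point C {1..m} f j = OpUnit C" unfolding set_point_def 2(3) by simp
        have v: "set_point C {1..p} h j = set_point C {1..p} g a" unfolding set_point_def hg ..
        show ?thesis
          unfolding u v using hg 2(3) pki[OF 2(1)] operad_unit_left[of "set_point C {1..p} g a \<cdot> bang V ?X" "card (set_fib {1..p} g a)" ?X]
            sp[of a] X by (simp del: upt_Suc)
      qed
  qed
  note J = conjunct1[OF J'] conjunct2[OF J']
  have "FA ?D k \<cdot> FA ?D l = OpAct C p ?sk \<cdot> OpGam C ?ek \<cdot> pair V (OpAct C m ?sl \<cdot> ?q) (tuple V ?X ?pk)"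
    using operad_Lambda_FA_comp[OF k kp(1,2), of "FA ?D l"] operad_Lambda_simps[OF C l] kp Dl
    by (simp add: g_def del: upt_Suc)
  also have "OpGam C ?ek \<cdot> pair V (OpAct C m ?sl \<cdot> ?q) (tuple V ?X ?pk)
    = OpAct C p ?B \<cdot> OpGam C (concat ?iss) \<cdot> pair V ?q (tuple V ?X (concat ?zss))"
    using operad_equivariance[of ?sl ?ek ?q ?X ?pk, unfolded le sumk ei zi, OF perm(2) q pk Bp sume] .
  also have "OpGam C (concat ?iss) \<cdot> pair V ?q (tuple V ?X (concat ?zss)) =
    OpGam C (map sum_list ?iss) \<cdot> pair V (Id V ?X) (tuple V ?X
      (map (\<lambda>s. OpGam C (?iss ! s) \<cdot> pair V (?pl ! s) (tuple V ?X (?zss ! s))) [0..<length ?iss]))"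
  proof -
    have "length ?iss = n" by simp
    then show ?thesis
      using operad_associativity[of "Id V ?X" ?X ?iss ?pl ?zss, unfolded lens, OF _ _ _ pl z1 z2] X
      by (simp del: upt_Suc)
  qed
  also have "map (\<lambda>s. OpGam C (?iss ! s) \<cdot> pair V (?pl ! s) (tuple V ?X (?zss ! s))) [0..<length ?iss] = ?ph"
  proof (rule nth_equalityI)
    fix s assume "s < length (map (\<lambda>s. OpGam C (?iss ! s) \<cdot> pair V (?pl ! s) (tuple V ?X (?zss ! s))) [0..<length ?iss])"
    then have s: "s < n" by (simp del: upt_Suc)
    have "?ph ! s = set_point C {1..p} h (Suc s) \<cdot> bang V ?X" "?pl ! s = set_point C {1..m} f (Suc s) \<cdot> bang V ?X"
      using s pts_nth[of "Suc s" n] by simp_all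
    then show "map (\<lambda>s. OpGam C (?iss ! s) \<cdot> pair V (?pl ! s) (tuple V ?X (?zss ! s))) [0..<length ?iss] ! s = ?ph ! s"
      using s J(1)[of "Suc s"] by (simp del: upt_Suc)
  qed simp
  also have "map sum_list ?iss = ?eh"
    unfolding map_map comp_def by (rule map_cong[OF refl]) (rule J(2))
  also have "OpAct C p ?sk \<cdot> OpAct C p ?B \<cdot> OpGam C ?eh \<cdot> pair V (Id V ?X) (tuple V ?X ?ph)
    = (OpAct C p ?sk \<cdot> OpAct C p ?B) \<cdot> OpGam C ?eh \<cdot> pair V (Id V ?X) (tuple V ?X ?ph)"
  proof (rule comp_assoc[symmetric])
    have sumh: "sum_list ?eh = p"
      using sum_list_card_fibres[of "{1..p}" "{1..n}" h] hi(2) unfolding sorted_list_of_interval by simp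
    note ph = pts_simps[OF hi(1) X, of n]
    note th = tuple_simps[OF X ph(1), unfolded ph(2)]
    show "OpGam C ?eh \<cdot> pair V (Id V ?X) (tuple V ?X ?ph) \<in> Arr V"
      "Cod V (OpGam C ?eh \<cdot> pair V (Id V ?X) (tuple V ?X ?ph)) = Dom V (OpAct C p ?B)"
      using th sumh Bp by (simp_all del: upt_Suc)
  qed (use perm Bp in simp_all)
  also have "OpAct C p ?sk \<cdot> OpAct C p ?B = OpAct C p ?sh"
    using C Bp perm(1) unfolding is_based_operad_def is_operad_def operad_action_def comp[symmetric]
    by simp
  also have "OpAct C p ?sh \<cdot> OpGam C ?eh \<cdot> pair V (Id V ?X) (tuple V ?X ?ph) = FA ?D (l \<odot> k)"
    using operad_Lambda_FA_comp[OF Lambda_comp[OF k l kl], of p n "Id V ?X"]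
      operad_Lambda_simps[OF C Lambda_comp[OF k l kl]] kp by (simp add: h_def del: upt_Suc)
  finally show ?thesis by simp
qed

lemma operad_Lambda_functor: "Lambda_functor (operad_Lambda V C)"
proof (rule Lambda_functorI)
  show "FO (operad_Lambda V C) n \<in> Obj V" for n using C by simp
  show "FA (operad_Lambda V C) l \<in> hom V (FO (operad_Lambda V C) (tgt l)) (FO (operad_Lambda V C) (src l))"
    if "l \<in> Arr Lambda_cat" for l
    using operad_Lambda_simps[OF C that] C by (simp add: hom_iff)
  show "FA (operad_Lambda V C) (Id F_cat n) = Id V (FO (operad_Lambda V C) n)" for n
  proof -
    let ?X = "OpOb C n" and ?f = "fn (Id F_cat n)"
    have f: "inj_on ?f {1..n}" by (simp add: inj_on_def)
    have "sort_perm {1..n} ?f r = r" for r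
    proof (cases "r < n")
      case True
      have "{x \<in> {1..n}. ?f x < ?f (Suc r)} = {1..r}" using True by auto
      then show ?thesis using sort_perm_inj[OF f, of "Suc r"] True by simp
    qed (simp add: sort_perm_def)
    then have s: "sort_perm {1..n} ?f = id" by auto
    have sf: "set_fib {1..n} ?f j = {j}" if "j \<in> {1..n}" for j using that by (auto simp: set_fib_def)
    have e: "fib_cards n n ?f = replicate n 1"
      using sf by (intro replicate_eqI) (auto simp del: upt_Suc)
    have p: "pts n n ?f ?X = replicate n (OpUnit C \<cdot> bang V ?X)"
      using sf by (intro replicate_eqI) (auto simp: pts_def set_point_def simp del: upt_Suc)
    have a: "OpAct C n id = Id V ?X"
      using C unfolding is_based_operad_def is_operad_def operad_action_def by blast
    have "FA (operad_Lambda V C) (Id F_cat n) \<cdot> Id V ?X =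
        OpAct C n id \<cdot> OpGam C (replicate n 1) \<cdot> pair V (Id V ?X) (tuple V ?X (replicate n (OpUnit C \<cdot> bang V ?X)))"
      using operad_Lambda_FA_comp[OF Lambda_Id, of n n n "Id V ?X"] unfolding Id_simps(2)[OF OpOb_Obj[OF C]] s e p
      by simp
    also have "\<dots> = Id V ?X"
      using operad_unit_right[of "Id V ?X" n ?X] unfolding a by simp
    finally show ?thesis using operad_Lambda_simps[OF C Lambda_Id[of n]] C by simp
  qed
qed (rule operad_Lambda_comp)

end

end


section \<open>Day convolution with an envelope\<close>

context distributive begin

context
  fixes C :: "('o, 'a) based_operad"
  assumes C: "is_based_operad V C"
begin

text \<open>The two presentations that are compared: \<open>is_env\<close> by maps in \<open>\<F>\<^sub>>\<^sub>0\<close> to \<open>n\<close>, with a factor for each fibre,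
  and \<open>is_split\<close> by based maps to \<open>n\<close>, with an additional factor \<open>E\<close> for the fibre of the base point.\<close>

abbreviation "env_ob \<equiv> env_obs C"
abbreviation "env_ar \<equiv> env_arr C"
abbreviation "is_split n E Z \<iota> \<equiv> presents Z (\<lambda>m. hom F_cat m n)
     (\<lambda>m \<phi>. lprod V (env_ob n \<phi>) \<otimes> FO E (card (zero_fib \<phi>))) (\<lambda>l \<phi>. \<phi> \<odot> l)
     (\<lambda>l \<phi>. prod_map V (env_ar n l \<phi>) (FA E (restr l (zero_fib \<phi>)))) \<iota>"
abbreviation "is_env n Z \<iota> \<equiv> presents Z (\<lambda>m. hom Fpos_cat m n) (\<lambda>m \<phi>. lprod V (env_ob n \<phi>))
     (\<lambda>l \<phi>. \<phi> \<odot> l) (env_ar n) \<iota>"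

text \<open>A based map \<open>\<phi>\<close> amounts to the set \<open>S\<close> of elements not sent to the base point together with
  an arrow \<open>|S| \<rightarrow> n\<close> of \<open>\<F>\<^sub>>\<^sub>0\<close>.\<close>

lemma day_env_presents:
  assumes Z: "Lambda_functor Z" and E: "Lambda_functor E" and P: "is_env n Z \<iota>"
  shows "\<exists>\<iota>'. is_split n E (day V Z E) \<iota>'"
proof -
  let ?D = "day V Z E"
  note DP = day_presents[OF Z E]
  define \<kappa> where "\<kappa> m = cowedge_at Z E m (day_in V Z E m)" for m
  note DP' = DP[folded \<kappa>_def]
  note e = Lambda_functor_simps[OF E] Lambda_functor_Obj[OF E]
  note z = Lambda_functor_simps[OF Z] Lambda_functor_Obj[OF Z]
  have EO: "lprod V (env_ob n \<phi>) \<in> Obj V" for \<phi> using env_obs_Obj[OF C] by simp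
  have posh: "nonzero_part \<phi> \<in> hom Fpos_cat (card (support \<phi>)) n" if "\<phi> \<in> hom F_cat m n" for \<phi> m
    using that nonzero_part_Fpos[of \<phi>] by (simp add: hom_Fpos_iff hom_F_iff)
  have posob: "env_ob n (nonzero_part \<phi>) = env_ob n \<phi>" if "\<phi> \<in> hom F_cat m n" for \<phi> m
    using that by (auto simp: env_obs_def hom_F_iff card_fib_nonzero_part simp del: upt_Suc)
  \<comment> \<open>The summand \<open>\<phi>\<close> is the summand \<open>nonzero_part \<phi>\<close> of \<open>Z\<close> inside the summand \<open>support \<phi>\<close> of the convolution.\<close>
  define \<iota>' where "\<iota>' m \<phi> = \<kappa> m (support \<phi>) \<cdot>
      prod_map V (\<iota> (card (support \<phi>)) (nonzero_part \<phi>)) (Id V (FO E (card (zero_fib \<phi>))))" for m \<phi>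
  have cp: "is_coproduct V (hom F_cat m n) (\<lambda>\<phi>. lprod V (env_ob n \<phi>) \<otimes> FO E (card (zero_fib \<phi>)))
      (FO ?D m) (\<iota>' m)" for m
  proof -
    let ?X = "\<lambda>(S, \<psi>). lprod V (env_ob n \<psi>) \<otimes> FO E (card ({1..m} - S))"
    have "is_coproduct V (hom Fpos_cat (card S) n)
        (\<lambda>\<psi>. lprod V (env_ob n \<psi>) \<otimes> FO E (card ({1..m} - S)))
        (FO Z (card S) \<otimes> FO E (card ({1..m} - S)))
        (\<lambda>\<psi>. prod_map V (\<iota> (card S) \<psi>) (Id V (FO E (card ({1..m} - S)))))" for S
      by (rule coproduct_prod_right[OF presents_coproduct[OF P]]) (rule e)
    from coproduct_Sigma[OF presents_coproduct[OF DP', of m] this]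
    have "is_coproduct V (SIGMA S:Pow {1..m}. hom Fpos_cat (card S) n) ?X (FO ?D m)
      (\<lambda>(S, \<psi>). \<kappa> m S \<cdot> prod_map V (\<iota> (card S) \<psi>) (Id V (FO E (card ({1..m} - S)))))" by simp
    then have "is_coproduct V (hom F_cat m n) (\<lambda>\<phi>. lprod V (env_ob n \<phi>) \<otimes> FO E (card (zero_fib \<phi>))) (FO ?D m)
      (\<lambda>\<phi>. (case (support \<phi>, nonzero_part \<phi>) of (S, \<psi>) \<Rightarrow>
          \<kappa> m S \<cdot> prod_map V (\<iota> (card S) \<psi>) (Id V (FO E (card ({1..m} - S))))) \<cdot>
        Id V (lprod V (env_ob n \<phi>) \<otimes> FO E (card (zero_fib \<phi>))))"
    proof (rule coproduct_reindex[OF _ bij_support_nonzero_part])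
      fix \<phi> assume p: "\<phi> \<in> hom F_cat m n"
      let ?i = "Id V (lprod V (env_ob n \<phi>) \<otimes> FO E (card (zero_fib \<phi>)))"
      have o: "lprod V (env_ob n \<phi>) \<otimes> FO E (card (zero_fib \<phi>)) \<in> Obj V" using EO e(4) by simp
      have "zero_fib \<phi> = {1..m} - support \<phi>" using p by (simp add: hom_F_iff zero_fib_eq)
      then have "?X (support \<phi>, nonzero_part \<phi>) = lprod V (env_ob n \<phi>) \<otimes> FO E (card (zero_fib \<phi>))"
        by (simp add: posob[OF p])
      moreover have "is_iso V ?i" using o by (intro is_isoI[where g = ?i]) simp_all
      ultimately show "is_iso V ?i \<and> Dom V ?i = lprod V (env_ob n \<phi>) \<otimes> FO E (card (zero_fib \<phi>)) \<and>
          Cod V ?i = ?X (support \<phi>, nonzero_part \<phi>)" using o by simp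
    qed
    moreover have "(case (support \<phi>, nonzero_part \<phi>) of (S, \<psi>) \<Rightarrow>
          \<kappa> m S \<cdot> prod_map V (\<iota> (card S) \<psi>) (Id V (FO E (card ({1..m} - S))))) \<cdot>
        Id V (lprod V (env_ob n \<phi>) \<otimes> FO E (card (zero_fib \<phi>))) = \<iota>' m \<phi>"
      if p: "\<phi> \<in> hom F_cat m n" for \<phi>
    proof -
      have zf: "zero_fib \<phi> = {1..m} - support \<phi>" using p by (simp add: hom_F_iff zero_fib_eq)
      have S: "support \<phi> \<in> Pow {1..m}" using p by (auto simp: hom_F_iff support_def)
      note i = presents_in[OF P posh[OF p]] and k = presents_in[OF DP' S]
      show ?thesis unfolding \<iota>'_def prod.case zf[symmetric]
        using i k e(4) by (simp add: posob[OF p] zf)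
    qed
    ultimately show ?thesis by (simp add: is_coproduct_def)
  qed
  have "is_split n E ?D \<iota>'"
    unfolding presents_def
  proof (intro conjI allI ballI)
    show "is_coproduct V (hom F_cat m n) (\<lambda>\<phi>. lprod V (env_ob n \<phi>) \<otimes> FO E (card (zero_fib \<phi>)))
      (FO ?D m) (\<iota>' m)" for m by (rule cp)
    fix l assume l: "l \<in> Arr Lambda_cat"
    show "FA ?D l \<in> hom V (FO ?D (tgt l)) (FO ?D (src l))" by (rule presents_arr(1)[OF DP l])
    fix \<phi> assume p: "\<phi> \<in> hom F_cat (tgt l) n"
    have \<phi>: "\<phi> \<in> F_arr" "tgt l = src \<phi>" "tgt \<phi> = n" using p by (simp_all add: hom_F_iff)
    let ?c = "\<phi> \<odot> l" and ?S = "support \<phi>"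
    show c: "?c \<in> hom F_cat (src l) n" using \<phi> l by (simp add: hom_F_iff)
    note ea = env_arr_simps[OF C \<phi>(1) l \<phi>(2), of n]
    have zc: "zero_fib ?c = preim l (zero_fib \<phi>)" and sc: "support ?c = preim l ?S" and pc: "nonzero_part ?c = nonzero_part \<phi> \<odot> restr l ?S"
      using zero_fib_comp[OF \<phi>(1) l \<phi>(2)] support_comp[OF \<phi>(1) l \<phi>(2)] nonzero_part_comp[OF \<phi>(1) l \<phi>(2)] by simp_all
    have zf: "{1..tgt l} - ?S = zero_fib \<phi>" using \<phi>(2) by (simp add: zero_fib_eq)
    have S: "?S \<in> Pow {1..tgt l}" using \<phi>(2) by (auto simp: support_def)
    have rlS: "restr l ?S \<in> Arr Lambda_cat" "src (restr l ?S) = card (support ?c)" "tgt (restr l ?S) = card ?S"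
      using l by (simp_all add: sc)
    have rlz: "restr l (zero_fib \<phi>) \<in> Arr Lambda_cat" "src (restr l (zero_fib \<phi>)) = card (zero_fib ?c)"
      "tgt (restr l (zero_fib \<phi>)) = card (zero_fib \<phi>)"
      using l by (simp_all add: zc)
    note eE = e(1-3)[OF rlz(1), unfolded rlz(2,3)]
    show "prod_map V (env_ar n l \<phi>) (FA E (restr l (zero_fib \<phi>))) \<in>
      hom V (lprod V (env_ob n \<phi>) \<otimes> FO E (card (zero_fib \<phi>))) (lprod V (env_ob n ?c) \<otimes> FO E (card (zero_fib ?c)))"
      using ea eE by (simp add: hom_iff)
    note zZ = z(1-3)[OF rlS(1), unfolded rlS(2,3)]
    note i = presents_in[OF P posh[OF p]] and k = presents_in[OF DP' S]
    have Sc: "support ?c \<in> Pow {1..src l}" unfolding sc using preim_subset by simp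
    note ic = presents_in[OF P posh[OF c]] and kc = presents_in[OF DP' Sc]
    have zfc: "{1..src l} - support ?c = zero_fib ?c" by (simp add: zero_fib_eq)
    have pt: "nonzero_part \<phi> \<in> hom Fpos_cat (tgt (restr l ?S)) n" using posh[OF p] by (simp add: rlS)
    have ear: "env_ar n (restr l ?S) (nonzero_part \<phi>) = env_ar n l \<phi>"
    proof -
      have "map (\<lambda>j. FA (operad_Lambda V C) (restr (restr l ?S) (fib (nonzero_part \<phi>) j))) [1..<Suc n] =
        map (\<lambda>j. FA (operad_Lambda V C) (restr l (fib \<phi> j))) [1..<Suc n]"
        by (rule map_cong[OF refl]) (auto simp: restr_fib_nonzero_part[OF \<phi>(1) l] simp del: upt_Suc)
      then show ?thesis unfolding env_arr_def[OF C] posob[OF p] by (simp only:)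
    qed
    have nat: "FA Z (restr l ?S) \<cdot> \<iota> (card ?S) (nonzero_part \<phi>) = \<iota> (card (support ?c)) (nonzero_part ?c) \<cdot> env_ar n l \<phi>"
      using presents_act(5)[OF P rlS(1) pt] unfolding rlS(2,3) pc[symmetric] ear .
    have kn: "FA ?D l \<cdot> \<kappa> (tgt l) ?S = \<kappa> (src l) (support ?c) \<cdot> prod_map V (FA Z (restr l ?S)) (FA E (restr l (zero_fib \<phi>)))"
      using presents_act(5)[OF DP' l S] unfolding zf sc[symmetric] .
    note k' = k[unfolded zf] and kc' = kc[unfolded zfc]
    let ?j = "prod_map V (\<iota> (card ?S) (nonzero_part \<phi>)) (Id V (FO E (card (zero_fib \<phi>))))"
    let ?jc = "prod_map V (\<iota> (card (support ?c)) (nonzero_part ?c)) (Id V (FO E (card (zero_fib ?c))))"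
    have j: "?j \<in> Arr V" "Cod V ?j = FO Z (card ?S) \<otimes> FO E (card (zero_fib \<phi>))"
      using i e(4) by simp_all
    have jc: "?jc \<in> Arr V" "Dom V ?jc = lprod V (env_ob n ?c) \<otimes> FO E (card (zero_fib ?c))"
      "Cod V ?jc = FO Z (card (support ?c)) \<otimes> FO E (card (zero_fib ?c))"
      using ic e(4) by (simp_all add: posob[OF c])
    note Dl = presents_arr(2-4)[OF DP l]
    have "FA ?D l \<cdot> \<iota>' (tgt l) \<phi> = (FA ?D l \<cdot> \<kappa> (tgt l) ?S) \<cdot> ?j"
      unfolding \<iota>'_def using Dl k' j by simp
    also have "\<dots> = \<kappa> (src l) (support ?c) \<cdot> prod_map V (FA Z (restr l ?S)) (FA E (restr l (zero_fib \<phi>))) \<cdot> ?j"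
      unfolding kn using kc' zZ eE j by (intro comp_assoc) simp_all
    also have "prod_map V (FA Z (restr l ?S)) (FA E (restr l (zero_fib \<phi>))) \<cdot> ?j
       = prod_map V (\<iota> (card (support ?c)) (nonzero_part ?c) \<cdot> env_ar n l \<phi>) (FA E (restr l (zero_fib \<phi>)))"
      using zZ eE i e(4) nat by simp
    also have "\<dots> = ?jc \<cdot> prod_map V (env_ar n l \<phi>) (FA E (restr l (zero_fib \<phi>)))"
      using ic ea eE e(4) by (simp add: posob[OF c])
    also have "\<kappa> (src l) (support ?c) \<cdot> ?jc \<cdot> prod_map V (env_ar n l \<phi>) (FA E (restr l (zero_fib \<phi>)))
      = (\<kappa> (src l) (support ?c) \<cdot> ?jc) \<cdot> prod_map V (env_ar n l \<phi>) (FA E (restr l (zero_fib \<phi>)))"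
      by (rule comp_assoc[symmetric]) (use kc' jc ea eE in simp_all)
    finally show "FA ?D l \<cdot> \<iota>' (tgt l) \<phi> = \<iota>' (src l) ?c \<cdot> prod_map V (env_ar n l \<phi>) (FA E (restr l (zero_fib \<phi>)))"
      unfolding \<iota>'_def .
  qed
  then show ?thesis by blast
qed

text \<open>Sending the zero fibre to a new largest element turns based maps to \<open>n\<close> into arrows of
  \<open>\<F>\<^sub>>\<^sub>0\<close> to \<open>n + 1\<close>.\<close>

lemma env_Suc_presents:
  assumes P: "is_env (Suc n) Z \<iota>"
  shows "\<exists>\<iota>'. is_split n (operad_Lambda V C) Z \<iota>'"
proof -
  let ?D = "operad_Lambda V C"
  have ob: "env_ob (Suc n) (top_map \<phi>) = env_ob n \<phi> @ [OpOb C (card (zero_fib \<phi>))]"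
    if "\<phi> \<in> hom F_cat m n" for \<phi> m
  proof -
    have "\<phi> \<in> F_arr" "tgt \<phi> = n" using that by (simp_all add: hom_F_iff)
    then have "map (\<lambda>j. OpOb C (card (fib (top_map \<phi>) j))) [1..<Suc n] = map (\<lambda>j. OpOb C (card (fib \<phi> j))) [1..<Suc n]"
      "fib (top_map \<phi>) (Suc n) = zero_fib \<phi>"
      using fib_top_map_top[of \<phi>] by (auto simp: fib_top_map simp del: upt_Suc)
    then show ?thesis unfolding env_obs_def upt_Suc_append[of 1 "Suc n", simplified] by (simp add: upt_Suc_append)
  qed
  have arr: "env_ar (Suc n) l (top_map \<phi>) = lmap (env_ob n \<phi> @ [OpOb C (card (zero_fib \<phi>))])
      (map (\<lambda>j. FA ?D (restr l (fib \<phi> j))) [1..<Suc n] @ [FA ?D (restr l (zero_fib \<phi>))])"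
    if p: "\<phi> \<in> hom F_cat m n" for \<phi> m l
  proof -
    have "\<phi> \<in> F_arr" "tgt \<phi> = n" using that by (simp_all add: hom_F_iff)
    then have m: "map (\<lambda>j. FA ?D (restr l (fib (top_map \<phi>) j))) [1..<Suc n] = map (\<lambda>j. FA ?D (restr l (fib \<phi> j))) [1..<Suc n]"
      and z: "fib (top_map \<phi>) (Suc n) = zero_fib \<phi>"
      using fib_top_map_top[of \<phi>] by (auto simp: fib_top_map simp del: upt_Suc)
    have "[1..<Suc (Suc n)] = [1..<Suc n] @ [Suc n]" by simp
    then show ?thesis unfolding env_arr_def[OF C] ob[OF p] by (simp only: map_append list.map m z)
  qed
  let ?a = "\<lambda>m \<phi>. snoc_arr (env_ob n \<phi>) (OpOb C (card (zero_fib \<phi>)))"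
  have "is_split n ?D Z (\<lambda>m \<phi>. \<iota> m (top_map \<phi>) \<cdot> ?a m \<phi>)"
  proof (rule presents_reindex[OF P, where b = "\<lambda>_. top_map"])
    show "bij_betw top_map (hom F_cat m n) (hom Fpos_cat m (Suc n))" for m by (rule bij_top_map)
    fix m \<phi> assume p: "\<phi> \<in> hom F_cat m n"
    let ?xs = "env_ob n \<phi>" and ?x = "OpOb C (card (zero_fib \<phi>))"
    have xs: "set ?xs \<subseteq> Obj V" "?x \<in> Obj V" using env_obs_Obj[OF C] OpOb_Obj[OF C] by simp_all
    note s = snoc_arr_simps[OF xs] and u = unsnoc_arr_simps[OF xs]
    have "is_iso V (?a m \<phi>)"
      by (rule is_isoI[where g = "unsnoc_arr ?xs ?x"])
        (use s u snoc_unsnoc[OF xs] unsnoc_snoc[OF xs] in simp_all)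
    then show "is_iso V (?a m \<phi>) \<and> Dom V (?a m \<phi>) = lprod V ?xs \<otimes> FO ?D (card (zero_fib \<phi>)) \<and>
       Cod V (?a m \<phi>) = lprod V (env_ob (Suc n) (top_map \<phi>))"
      using s by (simp add: ob[OF p] operad_Lambda_FO[OF C])
  next
    fix l \<phi> assume l: "l \<in> Arr Lambda_cat" and p: "\<phi> \<in> hom F_cat (tgt l) n"
    have \<phi>: "\<phi> \<in> F_arr" "tgt l = src \<phi>" "tgt \<phi> = n" using p by (simp_all add: hom_F_iff)
    let ?c = "\<phi> \<odot> l"
    have c: "?c \<in> hom F_cat (src l) n" using \<phi> l by (simp add: hom_F_iff)
    have t: "top_map ?c = top_map \<phi> \<odot> l" by (rule top_map_comp[OF \<phi>(1) l \<phi>(2)])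
    note ea = env_arr_simps[OF C \<phi>(1) l \<phi>(2), of n]
    have zc: "zero_fib ?c = preim l (zero_fib \<phi>)" by (rule zero_fib_comp[OF \<phi>(1) l \<phi>(2)])
    have f: "FA ?D (restr l (zero_fib \<phi>)) \<in> Arr V" "Dom V (FA ?D (restr l (zero_fib \<phi>))) = OpOb C (card (zero_fib \<phi>))"
      "Cod V (FA ?D (restr l (zero_fib \<phi>))) = OpOb C (card (zero_fib ?c))"
      using operad_Lambda_simps[OF C restr_Lambda[OF l finite_zfib[of \<phi>]]] by (simp_all add: zc)
    have "lmap (env_ob n \<phi> @ [OpOb C (card (zero_fib \<phi>))])
        (map (\<lambda>j. FA ?D (restr l (fib \<phi> j))) [1..<Suc n] @ [FA ?D (restr l (zero_fib \<phi>))]) \<cdot> ?a (tgt l) \<phi>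
      = ?a (src l) ?c \<cdot> prod_map V (env_ar n l \<phi>) (FA ?D (restr l (zero_fib \<phi>)))"
      unfolding env_arr_def[OF C]
      by (rule snoc_arr_natural[OF env_obs_Obj[OF C] env_arr_lists[OF C \<phi>(1) l \<phi>(2)] f])
    then show "?c \<in> hom F_cat (src l) n \<and> top_map ?c = top_map \<phi> \<odot> l \<and>
      prod_map V (env_ar n l \<phi>) (FA ?D (restr l (zero_fib \<phi>))) \<in>
        hom V (lprod V (env_ob n \<phi>) \<otimes> FO ?D (card (zero_fib \<phi>))) (lprod V (env_ob n ?c) \<otimes> FO ?D (card (zero_fib ?c))) \<and>
      ?a (src l) ?c \<cdot> prod_map V (env_ar n l \<phi>) (FA ?D (restr l (zero_fib \<phi>))) =
        env_ar (Suc n) l (top_map \<phi>) \<cdot> ?a (tgt l) \<phi>"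
      using c t ea f arr[OF p] by (simp add: hom_iff operad_Lambda_FO[OF C])
  qed
  then show ?thesis by blast
qed

text \<open>All values of this functor are terminal, so all equations between arrows hold.\<close>

lemma Comm_functor: "Lambda_functor (operad_Lambda V (Comm V))"
  and Comm_FO: "FO (operad_Lambda V (Comm V)) j = One V"
proof -
  let ?E = "operad_Lambda V (Comm V)"
  show FO: "FO ?E j = One V" for j by (simp add: operad_Lambda_def Comm_def)
  have FA: "FA ?E l \<in> hom V (One V) (One V)" if l: "l \<in> Arr Lambda_cat" for l
  proof -
    have pt: "inj_point (Comm V) l j = Id V (One V)" for j by (simp add: inj_point_def Comm_def)
    let ?us = "map (\<lambda>j. inj_point (Comm V) l j \<cdot> bang V (One V)) [1..<Suc (tgt l)]"
    have us: "\<forall>f\<in>set ?us. f \<in> Arr V \<and> Dom V f = One V" by (simp add: pt del: upt_Suc)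
    let ?B = "sorted_list_of_set {1..tgt l}"
    have "map (Cod V) ?us = map (\<lambda>_. One V) ?B"
      unfolding sorted_list_of_interval by (simp add: pt del: upt_Suc)
    then have T: "tuple V (One V) ?us \<in> Arr V" "Dom V (tuple V (One V) ?us) = One V"
      "Cod V (tuple V (One V) ?us) = lprod V (map (\<lambda>_. One V) ?B)"
      using tuple_simps[OF One_Obj us] by simp_all
    have O: "lprod V (map (\<lambda>_. One V) ?B) \<in> Obj V" by (rule lprod_Obj) auto
    have g: "OpGam (Comm V) (map f ?B) = bang V (One V \<otimes> lprod V (map (\<lambda>_. One V) ?B))" for f
      by (simp add: Comm_def comp_def)
    have a: "OpAct (Comm V) m \<sigma> = Id V (One V)" for m \<sigma> by (simp add: Comm_def)
    have o: "OpOb (Comm V) m = One V" for m by (simp add: Comm_def)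
    show ?thesis
      unfolding operad_Lambda_def functr.simps set_gam_def g a o Let_def
      using T O by (simp add: hom_iff del: upt_Suc bang_comp)
  qed
  show "Lambda_functor ?E"
  proof (rule Lambda_functorI)
    show "FA ?E (Id F_cat n) = Id V (FO ?E n)" for n
      using FA[OF Lambda_Id[of n]] unfolding FO by (intro One_ext) (simp_all add: hom_iff)
    fix k l assume kl: "k \<in> Arr Lambda_cat" "l \<in> Arr Lambda_cat" "tgt k = src l"
    show "FA ?E (l \<odot> k) = FA ?E k \<cdot> FA ?E l"
      using FA[OF kl(1)] FA[OF kl(2)] FA[OF Lambda_comp[OF kl]] by (intro One_ext) (simp_all add: hom_iff)
  qed (use FA FO in simp_all)
qed

text \<open>The zero fibre contributes the factor \<open>*\<close>, which the projection removes.\<close>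

lemma operators_presents:
  assumes P: "presents Z (\<lambda>m. hom F_cat m n) (\<lambda>m \<phi>. lprod V (env_ob n \<phi>))
     (\<lambda>l \<phi>. \<phi> \<odot> l) (env_ar n) \<iota>"
  shows "\<exists>\<iota>'. is_split n (operad_Lambda V (Comm V)) Z \<iota>'"
proof -
  let ?E = "operad_Lambda V (Comm V)"
  have EO: "lprod V (env_ob n \<phi>) \<in> Obj V" for \<phi> using env_obs_Obj[OF C] by simp
  let ?a = "\<lambda>m \<phi>. Fst V (lprod V (env_ob n \<phi>)) (One V)"
  have "is_split n ?E Z (\<lambda>m \<phi>. \<iota> m \<phi> \<cdot> ?a m \<phi>)"
  proof (rule presents_reindex[OF P, where b = "\<lambda>_ \<phi>. \<phi>"])
    show "bij_betw (\<lambda>\<phi>. \<phi>) (hom F_cat m n) (hom F_cat m n)" for m by (simp add: bij_betw_def)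
    fix m \<phi> assume "\<phi> \<in> hom F_cat m n"
    let ?P = "lprod V (env_ob n \<phi>)"
    have "pair V (Id V ?P) (bang V ?P) \<cdot> Fst V ?P (One V) = Id V (?P \<otimes> One V)"
    proof (rule pair_ext)
      show "Snd V ?P (One V) \<cdot> pair V (Id V ?P) (bang V ?P) \<cdot> Fst V ?P (One V)
          = Snd V ?P (One V) \<cdot> Id V (?P \<otimes> One V)"
        by (rule One_ext) (use EO[of \<phi>] in simp_all)
    qed (use EO[of \<phi>] in simp_all)
    then have "is_iso V (?a m \<phi>)"
      using EO[of \<phi>] by (intro is_isoI[where g = "pair V (Id V ?P) (bang V ?P)"]) simp_all
    then show "is_iso V (?a m \<phi>) \<and> Dom V (?a m \<phi>) = ?P \<otimes> FO ?E (card (zero_fib \<phi>)) \<and> Cod V (?a m \<phi>) = ?P"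
      using EO[of \<phi>] by (simp add: Comm_FO)
  next
    fix l \<phi> assume l: "l \<in> Arr Lambda_cat" and p: "\<phi> \<in> hom F_cat (tgt l) n"
    have \<phi>: "\<phi> \<in> F_arr" "tgt l = src \<phi>" "tgt \<phi> = n" using p by (simp_all add: hom_F_iff)
    let ?c = "\<phi> \<odot> l"
    have c: "?c \<in> hom F_cat (src l) n" using \<phi> l by (simp add: hom_F_iff)
    note ea = env_arr_simps[OF C \<phi>(1) l \<phi>(2), of n]
    note f = Lambda_functor_simps[OF Comm_functor restr_Lambda[OF l finite_zfib[of \<phi>]], unfolded Comm_FO]
    show "?c \<in> hom F_cat (src l) n \<and> ?c = ?c \<and>
      prod_map V (env_ar n l \<phi>) (FA ?E (restr l (zero_fib \<phi>))) \<in>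
        hom V (lprod V (env_ob n \<phi>) \<otimes> FO ?E (card (zero_fib \<phi>))) (lprod V (env_ob n ?c) \<otimes> FO ?E (card (zero_fib ?c))) \<and>
      ?a (src l) ?c \<cdot> prod_map V (env_ar n l \<phi>) (FA ?E (restr l (zero_fib \<phi>))) = env_ar n l \<phi> \<cdot> ?a (tgt l) \<phi>"
      using c ea f by (simp add: hom_iff Comm_FO)
  qed
  then show ?thesis by blast
qed

lemma perm_envelope_presents: "is_env n (perm_envelope_Lambda V C n) (\<lambda>m. op_inj V Fpos_cat C)"
  unfolding perm_envelope_Lambda_def perm_envelope_def
proof (rule Lambda_rep_presents[OF C])
  show "hom Fpos_cat m n \<subseteq> hom F_cat m n" for m n
    by (rule subsetI) (simp add: hom_Fpos_iff hom_F_iff)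
  show "l \<in> hom Fpos_cat (src l) (tgt l)" if "l \<in> Arr Lambda_cat" for l
    using Lambda_Fpos[OF that] by (simp add: hom_Fpos_iff)
qed (simp_all add: hom_Fpos_iff)

lemma operators_Lambda_presents:
  "presents (cat_of_operators_Lambda V C n) (\<lambda>m. hom F_cat m n) (\<lambda>m \<phi>. lprod V (env_ob n \<phi>))
     (\<lambda>l \<phi>. \<phi> \<odot> l) (env_ar n) (\<lambda>m. op_inj V F_cat C)"
  unfolding cat_of_operators_Lambda_def cat_of_operators_def
  by (rule Lambda_rep_presents[OF C]) (simp_all add: hom_F_iff)

text \<open>Arrows to \<open>0\<close> exist only from \<open>0\<close>, both in \<open>\<Lambda>\<close> and in \<open>\<F>\<^sub>>\<^sub>0\<close>, and an empty product is \<open>*\<close>.\<close>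

lemma day_unit_presents: "is_env 0 (day_unit V) (\<lambda>m. inj_copower V (hom Lambda_cat m 0) (One V))"
  and day_unit_functor: "Lambda_functor (day_unit V)"
proof -
  have h: "hom Fpos_cat m 0 = hom Lambda_cat m 0" for m
  proof (intro set_eqI iffI)
    fix \<phi> assume "\<phi> \<in> hom Lambda_cat m 0"
    then show "\<phi> \<in> hom Fpos_cat m 0" using Lambda_Fpos by (simp add: hom_Fpos_iff hom_Lambda_iff)
  next
    fix \<phi> assume "\<phi> \<in> hom Fpos_cat m 0"
    then have p: "\<phi> \<in> Arr Fpos_cat" "src \<phi> = m" "tgt \<phi> = 0" by (simp_all add: hom_Fpos_iff)
    \<comment> \<open>A based map to \<open>0\<close> is zero, and only the base point may go to the base point.\<close>
    have "m = 0"
    proof (rule ccontr)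
      assume "m \<noteq> 0"
      then have "1 \<le> src \<phi>" using p by simp
      then show False using Fpos_pos[OF p(1), of 1] F_arr_le[OF Fpos_F[OF p(1)], of 1] p(3) by simp
    qed
    then show "\<phi> \<in> hom Lambda_cat m 0" using p by (simp add: hom_Lambda_iff LambdaI)
  qed
  have env: "env_ob 0 \<phi> = []" for \<phi> by (simp add: env_obs_def)
  have ear: "env_ar 0 l \<phi> = Id V (One V)" for l \<phi> by (simp add: env_arr_def[OF C] env lmap_def)
  have cp: "is_coproduct V (hom Lambda_cat m 0) (\<lambda>_. One V) (FO (day_unit V) m) (inj_copower V (hom Lambda_cat m 0) (One V))" for m
    using copower[OF finite_hom_Lambda One_Obj] by (simp add: day_unit_def)
  have comp: "k \<odot> l \<in> hom Lambda_cat (src l) 0" if "l \<in> Arr Lambda_cat" "k \<in> hom Lambda_cat (tgt l) 0" for k l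
    using that by (simp add: hom_Lambda_iff)
  show P: "is_env 0 (day_unit V) (\<lambda>m. inj_copower V (hom Lambda_cat m 0) (One V))"
    unfolding presents_def h env ear lprod.simps
  proof (intro conjI allI ballI)
    fix l assume l: "l \<in> Arr Lambda_cat"
    have FA: "FA (day_unit V) l = copower_map V (hom Lambda_cat (tgt l) 0) (hom Lambda_cat (src l) 0)
        (\<lambda>k. k \<odot> l) (Id V (One V))" by (simp add: day_unit_def)
    have FO: "FO (day_unit V) m = copower V (hom Lambda_cat m 0) (One V)" for m by (simp add: day_unit_def)
    note cm = copower_map_simps[of "hom Lambda_cat (tgt l) 0" "hom Lambda_cat (src l) 0" "Id V (One V)" "One V" "One V"
        "\<lambda>k. k \<odot> l", OF finite_hom_Lambda finite_hom_Lambda _ _ _ comp[OF l]]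
    note cmi = copower_map_inj[of "hom Lambda_cat (tgt l) 0" "hom Lambda_cat (src l) 0" "Id V (One V)" "One V" "One V"
        "\<lambda>k. k \<odot> l", OF finite_hom_Lambda finite_hom_Lambda _ _ _ comp[OF l]]
    show "FA (day_unit V) l \<in> hom V (FO (day_unit V) (tgt l)) (FO (day_unit V) (src l))"
      unfolding FA FO using cm by (simp add: hom_iff)
    fix k assume k: "k \<in> hom Lambda_cat (tgt l) 0"
    show "k \<odot> l \<in> hom Lambda_cat (src l) 0" by (rule comp[OF l k])
    show "FA (day_unit V) l \<cdot> inj_copower V (hom Lambda_cat (tgt l) 0) (One V) k =
        inj_copower V (hom Lambda_cat (src l) 0) (One V) (k \<odot> l) \<cdot> Id V (One V)"
      unfolding FA using cmi k by simp
  qed (use cp in \<open>simp_all add: hom_iff\<close>)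
  show "Lambda_functor (day_unit V)"
  proof (rule presents_functor[OF P])
    show "i \<odot> Id F_cat m = i \<and> env_ar 0 (Id F_cat m) i = Id V (lprod V (env_ob 0 i))"
      if "i \<in> hom Fpos_cat m 0" for m i using that by (simp add: ear env hom_Fpos_iff)
    fix k l i assume "k \<in> Arr Lambda_cat" "l \<in> Arr Lambda_cat" "tgt k = src l" "i \<in> hom Fpos_cat (tgt l) 0"
    then show "i \<odot> (l \<odot> k) = (i \<odot> l) \<odot> k \<and>
        env_ar 0 (l \<odot> k) i = env_ar 0 k (i \<odot> l) \<cdot> env_ar 0 l i"
      using F_assoc[of k l i] by (simp add: ear hom_Fpos_iff)
  qed
qed

text \<open>The isomorphism from \<open>Z'\<close> to \<open>Z\<close> transports functoriality to \<open>Z\<close>, after which it can be reversed.\<close>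

lemma presents_iso':
  assumes "presents Z I X act x \<iota>" "presents Z' I X act x \<iota>'" "Lambda_functor Z'"
  shows "Lambda_iso V Z Z'"
proof -
  have "Lambda_iso V Z' Z" by (rule presents_iso[OF assms(2,1,3)])
  then have "Lambda_functor Z" unfolding Lambda_iso_iff by blast
  then show ?thesis by (rule presents_iso[OF assms(1,2)])
qed

text \<open>Induction on \<open>n\<close>: if \<open>C\<^sup>\<boxtimes>\<^sup>n\<close> has the presentation of the envelope at \<open>n\<close>, then its Day convolution with
  \<open>C\<close> has a presentation by based maps to \<open>n\<close> whose zero fibre carries the new factor, and the envelope at
  \<open>n + 1\<close> has the same one.\<close>

lemma perm_envelope_iso: "Lambda_iso V (perm_envelope_Lambda V C n) (day_power V (operad_Lambda V C) n)"
proof (induction n)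
  case 0
  show ?case
    using presents_iso'[OF perm_envelope_presents day_unit_presents day_unit_functor] by simp
next
  case (Suc n)
  let ?D = "operad_Lambda V C" and ?W = "day_power V (operad_Lambda V C) n"
  have D: "Lambda_functor ?D" by (rule operad_Lambda_functor[OF C])
  have W: "Lambda_functor ?W" using Suc unfolding Lambda_iso_iff by blast
  obtain \<iota> where i: "is_env n ?W \<iota>" using presents_transport[OF perm_envelope_presents Suc] by blast
  obtain \<iota>1 where 1: "is_split n ?D (day V ?W ?D) \<iota>1"
    using day_env_presents[OF W D i] by blast
  obtain \<iota>2 where 2: "is_split n ?D (perm_envelope_Lambda V C (Suc n)) \<iota>2"
    using env_Suc_presents[OF perm_envelope_presents] by blast
  show ?case
    unfolding day_power.simps by (rule presents_iso'[OF 2 1 day_functor[OF W D]])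
qed

lemma operators_iso:
  assumes Z: "Lambda_functor Z" and P: "is_env n Z \<iota>"
  shows "Lambda_iso V (cat_of_operators_Lambda V C n) (day V Z (operad_Lambda V (Comm V)))"
proof -
  let ?E = "operad_Lambda V (Comm V)"
  obtain \<iota>1 where 1: "is_split n ?E (day V Z ?E) \<iota>1"
    using day_env_presents[OF Z Comm_functor P] by blast
  obtain \<iota>2 where 2: "is_split n ?E (cat_of_operators_Lambda V C n) \<iota>2"
    using operators_presents[OF operators_Lambda_presents] by blast
  show ?thesis by (rule presents_iso'[OF 2 1 day_functor[OF Z Comm_functor]])
qed

lemma day_Comm_iso:
  assumes Z: "Lambda_functor Z" "is_env n Z \<iota>" and Z': "Lambda_functor Z'" "is_env n Z' \<iota>'"
  shows "Lambda_iso V (day V Z (operad_Lambda V (Comm V))) (day V Z' (operad_Lambda V (Comm V)))"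
proof -
  let ?E = "operad_Lambda V (Comm V)"
  obtain \<iota>1 where 1: "is_split n ?E (day V Z ?E) \<iota>1"
    using day_env_presents[OF Z(1) Comm_functor Z(2)] by blast
  obtain \<iota>2 where 2: "is_split n ?E (day V Z' ?E) \<iota>2"
    using day_env_presents[OF Z'(1) Comm_functor Z'(2)] by blast
  show ?thesis by (rule presents_iso[OF 1 2 day_functor[OF Z(1) Comm_functor]])
qed

end

end

theorem proposition2p18:
  fixes V :: "('o, 'a) cmcat" and C :: "('o, 'a) based_operad" and n :: nat
  assumes "infinite (UNIV :: 's set)"
    and "is_cartesian_closed V"
    and "complete_cat TYPE('s) V"
    and "cocomplete_cat TYPE('s) V"
    and "is_based_operad V C"
  shows "Lambda_iso V (perm_envelope_Lambda V C n) (day_power V (operad_Lambda V C) n)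
    \<and> Lambda_iso V (cat_of_operators_Lambda V C n)
        (day V (perm_envelope_Lambda V C n) (operad_Lambda V (Comm V)))
    \<and> Lambda_iso V (day V (perm_envelope_Lambda V C n) (operad_Lambda V (Comm V)))
        (day V (day_power V (operad_Lambda V C) n) (operad_Lambda V (Comm V)))"
proof -
  interpret distributive V by (rule distributiveI[OF assms(1,2,4)])
  note C = assms(5)
  note iso = perm_envelope_iso[OF C, of n] and P = perm_envelope_presents[OF C, of n]
  have Z: "is_functor (op_cat Lambda_cat) V (perm_envelope_Lambda V C n)"
    and W: "is_functor (op_cat Lambda_cat) V (day_power V (operad_Lambda V C) n)"
    using iso unfolding Lambda_iso_iff by blast+
  obtain \<iota> where Q: "presents (day_power V (operad_Lambda V C) n) (\<lambda>m. hom Fpos_cat m n)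
      (\<lambda>m \<phi>. lprod V (env_obs C n \<phi>)) (\<lambda>l \<phi>. \<phi> \<odot> l) (env_arr C n) \<iota>"
    using presents_transport[OF P iso] by blast
  show ?thesis
    using iso operators_iso[OF C Z P] day_Comm_iso[OF C Z P W Q] by blast
qed

end
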